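(* Assume the setting described in the context, and assume in addition that there exists $K>0$ such that $|b(x)|\le K(1+|x|)$ and $|a(x)|\le K(1+|x|^2)$ for all $x\in\mathbb{R}^d$. Let $w=\nu/\mu$. Assume that there exists another function $\tilde w\in L^1(\mu)$ on $\mathbb{R}^d$ such that $$\frac{\partial}{\partial s}\mathbb{E}\,f(X_t)w(X_s)=\frac{\partial}{\partial s}\mathbb{E}\,f(X_t)\tilde w(X_s)\qquad\text{for all } f\in C_c^\infty(\mathbb{R}^d),\ 0\le s<t\le T.$$ Then $w-\tilde w$ is a constant almost everywhere.
   Context: Setting (homogeneous, stationary): Fix $T>0$; $X$ solves $dX_t=b(X_t)dt+\sigma(X_t)dW_t$ in $\mathbb{R}^d$, $a=\sigma\sigma^T$, generator $\mathcal{A}f=\sum_ib^i\partial_if+\frac12\sum_{i,j}a^{ij}\partial_{ij}f$; $X_0$ is distributed with the stationary density $\mu$. Regular conditions: there are $\alpha\in(0,1)$, $\lambda,C>0$, $\eta:\mathbb{R}^d\to\mathbb{R}$ with (a) $b,a\in C^{3+\alpha}_b(B_R)$ for every open ball $B_R$ of radius $R$ centred at $0$ (bounded with bounded derivatives up to order $3$ and $\alpha$-Hölder third derivatives on $B_R$); (b) $\xi^Ta(x)\xi\ge\eta(x)|\xi|^2$, $\inf\eta\ge\lambda$; (c) $b(x)^Tx\le C\eta(1+|x|^2)$, $|a(x)x|+\mathrm{tr}\,a(x)\le C\eta(1+|x|^2)$; (d) $|D^\beta b|+|D^\beta a|\le C\eta$ for $1\le|\beta|\le3$; (e) some $\phi\in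 C^2(\mathbb{R}^d)$ with $\phi\to\infty$ at infinity satisfies $\mathcal{A}\phi\le C\phi$. Perturbation: $\bar b(h,x)$, $\bar a(h,x)$ on $[-1,1]\times\mathbb{R}^d$ with $\bar b(0,\cdot)=b$, $\bar a(0,\cdot)=a$; for constant $h$, $\bar X^h$ is the homogeneous diffusion with drift $\bar b(h,\cdot)$ and diffusion coefficient $\bar a(h,\cdot)$. Assume: for $|h|$ small, $\bar X^h$ has a stationary density $\mu_h$ ($\mu_0=\mu$), and there is $\nu\in L^1(\mathbb{R}^d)$ with $h^{-1}(\mu_h-\mu)\to\nu$ in $L^1(\mathbb{R}^d)$ as $h\to0$. *)

theory Defs
  imports "HOL-Probability.Probability"
begin

definition pd :: "'d::finite \<Rightarrow> (real^'d \<Rightarrow> real) \<Rightarrow> real^'d \<Rightarrow> real" where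
  "pd i f x = frechet_derivative f (at x) (axis i 1)"

text \<open>Iterated partial derivative along a list of coordinate indices
  (a multi-index beta of order |beta| = length of the list).\<close>
fun Dl :: "'d::finite list \<Rightarrow> (real^'d \<Rightarrow> real) \<Rightarrow> real^'d \<Rightarrow> real" where
  "Dl [] f = f"
| "Dl (i # is) f = pd i (Dl is f)"

text \<open>C_c^infinity(R^d): all iterated partial derivatives exist (everywhere differentiable),
  and the support is bounded (hence compact closure).\<close>
definition smooth_cs :: "(real^'d::finite \<Rightarrow> real) \<Rightarrow> bool" where
  "smooth_cs f \<longleftrightarrow> (\<forall>is x. Dl is f differentiable (at x)) \<and> bounded {x. f x \<noteq> 0}"

definition C2 :: "(real^'d::finite \<Rightarrow> real) \<Rightarrow> bool" where
  "C2 f \<longleftrightarrow> (\<forall>is x. length is < 2 \<longrightarrow> Dl is f differentiable (at x))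
     \<and> (\<forall>is. length is = 2 \<longrightarrow> continuous_on UNIV (Dl is f))"

definition C3_holder_b :: "real \<Rightarrow> (real^'d::finite) set \<Rightarrow> (real^'d \<Rightarrow> real) \<Rightarrow> bool" where
  "C3_holder_b \<alpha> U g \<longleftrightarrow>
     (\<forall>is. length is < 3 \<longrightarrow> (\<forall>x\<in>U. Dl is g differentiable (at x)))
   \<and> (\<forall>is. length is \<le> 3 \<longrightarrow> continuous_on U (Dl is g) \<and> bounded (Dl is g ` U))
   \<and> (\<forall>is. length is = 3 \<longrightarrow> (\<exists>L. \<forall>x\<in>U. \<forall>y\<in>U. \<bar>Dl is g x - Dl is g y\<bar> \<le> L * dist x y powr \<alpha>))"

definition gen :: "(real^'d::finite \<Rightarrow> real^'d) \<Rightarrow> (real^'d \<Rightarrow> real^'d^'d)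
    \<Rightarrow> (real^'d \<Rightarrow> real) \<Rightarrow> real^'d \<Rightarrow> real" where
  "gen b a f x = (\<Sum>i\<in>UNIV. b x $ i * pd i f x)
     + 1/2 * (\<Sum>i\<in>UNIV. \<Sum>j\<in>UNIV. a x $ i $ j * pd i (pd j f) x)"

definition nat_filtration :: "'w measure \<Rightarrow> (real \<Rightarrow> 'w \<Rightarrow> real^'d::finite) \<Rightarrow> real set \<Rightarrow> real \<Rightarrow> 'w measure" where
  "nat_filtration M X I s = sigma (space M)
     (\<Union>r\<in>I \<inter> {..s}. {X r -` B \<inter> space M | B. B \<in> sets borel})"

text \<open>X (continuous paths on the time set I, on probability space M) is a weak solution of
  dX = b(X) dt + sigma(X) dW with a = sigma sigma^T, expressed via the martingale problem:
  f(X_t) - f(X_0) - int_0^t A f(X_r) dr is a martingale (natural filtration) for all f in C_c^infinity.\<close>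
definition diffusion :: "'w measure \<Rightarrow> (real \<Rightarrow> 'w \<Rightarrow> real^'d::finite) \<Rightarrow> real set
    \<Rightarrow> (real^'d \<Rightarrow> real^'d) \<Rightarrow> (real^'d \<Rightarrow> real^'d^'d) \<Rightarrow> bool" where
  "diffusion M X I b a \<longleftrightarrow> prob_space M
   \<and> (\<forall>t\<in>I. X t \<in> borel_measurable M)
   \<and> (\<forall>\<omega>\<in>space M. continuous_on I (\<lambda>t. X t \<omega>))
   \<and> (\<forall>f. smooth_cs f \<longrightarrow> (\<forall>s\<in>I. \<forall>t\<in>I. s \<le> t \<longrightarrow>
        integrable M (\<lambda>\<omega>. f (X t \<omega>) - f (X s \<omega>) - (\<integral>r\<in>{s..t}. gen b a f (X r \<omega>) \<partial>lborel))
      \<and> (\<forall>A\<in>sets (nat_filtration M X I s).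
          (\<integral>\<omega>. indicator A \<omega> * (f (X t \<omega>) - f (X s \<omega>)
               - (\<integral>r\<in>{s..t}. gen b a f (X r \<omega>) \<partial>lborel)) \<partial>M) = 0)))"

definition prob_density :: "(real^'d::finite \<Rightarrow> real) \<Rightarrow> bool" where
  "prob_density p \<longleftrightarrow> p \<in> borel_measurable borel \<and> (\<forall>x. 0 \<le> p x)
     \<and> integrable lborel p \<and> (\<integral>x. p x \<partial>lborel) = 1"

text \<open>p is a stationary density of the homogeneous diffusion with coefficients (b,a):
  a solution started from p exists, and every solution started with X_0 having density p has
  X_t with density p for all t >= 0. Solutions are taken on the canonical path space
  (coordinate process), which loses no generality since everything depends only on laws.\<close>
definition stationary_density :: "(real^'d::finite \<Rightarrow> real^'d) \<Rightarrow> (real^'d \<Rightarrow> real^'d^'d)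
    \<Rightarrow> (real^'d \<Rightarrow> real) \<Rightarrow> bool" where
  "stationary_density b a p \<longleftrightarrow> prob_density p
   \<and> (\<exists>M :: (real \<Rightarrow> real^'d) measure. diffusion M (\<lambda>t \<omega>. \<omega> t) {0..} b a
        \<and> distributed M lborel (\<lambda>\<omega>. \<omega> 0) (\<lambda>x. ennreal (p x)))
   \<and> (\<forall>M :: (real \<Rightarrow> real^'d) measure. diffusion M (\<lambda>t \<omega>. \<omega> t) {0..} b a
        \<and> distributed M lborel (\<lambda>\<omega>. \<omega> 0) (\<lambda>x. ennreal (p x))
        \<longrightarrow> (\<forall>t\<ge>0. distributed M lborel (\<lambda>\<omega>. \<omega> t) (\<lambda>x. ennreal (p x))))"

definition regular_conditions :: "(real^'d::finite \<Rightarrow> real^'d) \<Rightarrow> (real^'d \<Rightarrow> real^'d^'d)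
    \<Rightarrow> real \<Rightarrow> real \<Rightarrow> real \<Rightarrow> (real^'d \<Rightarrow> real) \<Rightarrow> bool" where
  "regular_conditions b a \<alpha> lam C \<eta> \<longleftrightarrow> 0 < \<alpha> \<and> \<alpha> < 1 \<and> 0 < lam \<and> 0 < C
   \<comment> \<open>(a)\<close>
   \<and> (\<forall>R>0. (\<forall>i. C3_holder_b \<alpha> (ball 0 R) (\<lambda>x. b x $ i))
            \<and> (\<forall>i j. C3_holder_b \<alpha> (ball 0 R) (\<lambda>x. a x $ i $ j)))
   \<comment> \<open>(b)\<close>
   \<and> (\<forall>x \<xi>. \<xi> \<bullet> (a x *v \<xi>) \<ge> \<eta> x * (norm \<xi>)\<^sup>2) \<and> (\<forall>x. lam \<le> \<eta> x)
   \<comment> \<open>(c)\<close>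
   \<and> (\<forall>x. b x \<bullet> x \<le> C * \<eta> x * (1 + (norm x)\<^sup>2))
   \<and> (\<forall>x. norm (a x *v x) + trace (a x) \<le> C * \<eta> x * (1 + (norm x)\<^sup>2))
   \<comment> \<open>(d)\<close>
   \<and> (\<forall>\<beta> x. 1 \<le> length \<beta> \<and> length \<beta> \<le> 3 \<longrightarrow>
        norm (\<chi> i. Dl \<beta> (\<lambda>y. b y $ i) x) + norm (\<chi> i j. Dl \<beta> (\<lambda>y. a y $ i $ j) x) \<le> C * \<eta> x)
   \<comment> \<open>(e)\<close>
   \<and> (\<exists>\<phi>. C2 \<phi> \<and> filterlim \<phi> at_top at_infinity \<and> (\<forall>x. gen b a \<phi> x \<le> C * \<phi> x))"

end

theory Submission imports Defs begin

text \<open>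
  Let \<open>g = w - wt\<close>. By hypothesis \<open>E f(X_t) g(X_s)\<close> does not depend on \<open>s < t\<close>, so letting \<open>t\<close>
  decrease to \<open>s\<close> gives \<open>E (g(X_0) | X_s) = g(X_s)\<close>. As \<open>X_0\<close> and \<open>X_s\<close> have the same law, the equality case of
  Jensen's inequality for \<open>sqrt (1 + y\<^sup>2)\<close> shows \<open>g(X_0) = g(X_s)\<close> almost surely. Hence \<open>X\<close> does not leave a level
  set \<open>A\<close> of \<open>g\<close>, and by Dynkin's formula the density \<open>\<mu>\<close> restricted to \<open>A\<close> is infinitesimally invariant. Such
  a density vanishes almost everywhere or is positive almost everywhere: testing it with regularised
  fundamental solutions bounds its mass on a small ball by a multiple of its convolution with the
  kernel \<open>t (|z|\<^sup>2 + t) powr (- d / 2 - 1)\<close>, and integrating over the zero set and letting \<open>t\<close> tend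
  to 0 excludes that both this set and its complement have positive measure. So every level set of \<open>g\<close>
  is null or conull.

  The equality of the laws of \<open>X_s\<close> is uniqueness for the Fokker-Planck equation. The
  resolvent equation with coefficients truncated outside a ball is solved approximately by a Gaussian parametrix;
  the solution is localised with the Lyapunov function \<open>ln (1 + |x|\<^sup>2)\<close>, which the growth bounds on
  \<open>a\<close> and \<open>b\<close> control, and inversion of the truncated Laplace transform identifies the marginals.
\<close>

section \<open>Smooth functions\<close>

text \<open>\<open>stationary_density\<close> constrains only solutions on the path space that live
  for all times, whereas \<open>X\<close> lives on an arbitrary space and stops at \<open>T\<close>.
  Stationarity of \<open>X\<close> is therefore a theorem: its marginals must be identified with
  those of a canonical solution, and the link between the two probability spaces is an equation for
  the marginals alone. As nothing is known beyond \<open>T\<close>, the discounted equation keeps a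
  terminal term of order \<open>exp (- (l * T))\<close>, and the Laplace inversion has to tolerate
  exactly this error.

  The second obstacle is roughness. The level set \<open>A\<close> is merely Borel, so
  \<open>\<mu>\<close> restricted to \<open>A\<close> is merely integrable and is accessible only
  through integrals against compactly supported smooth functions. All estimates are hence made on
  the test functions; neither regularity of the density nor a Harnack inequality is invoked.
  Likewise \<open>g\<close> is only integrable, so \<open>g (X 0)\<close> and \<open>g (X s)\<close>
  are compared through a convex function of linear growth instead of variances.\<close>

definition smooth :: "(real^'d::finite \<Rightarrow> real) \<Rightarrow> bool" where
  "smooth f \<longleftrightarrow> (\<forall>is x. Dl is f differentiable (at x))"

text \<open>\<open>D n\<close> plays the role of the \<open>n\<close>-th derivative of
  \<open>D 0\<close> on \<open>S\<close>. The whole sequence is carried so that differentiating a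
  composition stays within the same data.\<close>

definition tower :: "(nat \<Rightarrow> real \<Rightarrow> real) \<Rightarrow> real set \<Rightarrow> bool" where
  "tower D S \<longleftrightarrow> (\<forall>n. \<forall>s\<in>S. (D n has_real_derivative D (Suc n) s) (at s))"

text \<open>\<open>smooth\<close> quantifies over all iterated partial derivatives, which no finite
  computation checks. This class of expressions is closed under partial derivatives, so one
  induction gives differentiability of every order. The rule \<open>comp\<close> admits every
  \<open>D n\<close>, not only \<open>D 0\<close>, because the derivative of
  \<open>D n (f x)\<close> involves \<open>D (Suc n) (f x)\<close>.\<close>

inductive sm :: "(real^'d::finite \<Rightarrow> real) \<Rightarrow> bool" where
  const: "sm (\<lambda>x. c)"
| coord: "sm (\<lambda>x. x $ i)"
| add: "sm f \<Longrightarrow> sm g \<Longrightarrow> sm (\<lambda>x. f x + g x)"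
| mult: "sm f \<Longrightarrow> sm g \<Longrightarrow> sm (\<lambda>x. f x * g x)"
| comp: "tower D S \<Longrightarrow> (\<And>x. f x \<in> S) \<Longrightarrow> sm f \<Longrightarrow> sm (\<lambda>x. D n (f x))"

lemma pd_eqI: "(f has_derivative F) (at x) \<Longrightarrow> pd i f x = F (axis i 1)"
  unfolding pd_def by (metis frechet_derivative_at)

lemma has_derivative_pd:
  assumes "f differentiable (at x)"
  shows "(f has_derivative (\<lambda>v. \<Sum>i\<in>UNIV. v $ i * pd i f x)) (at x)"
proof -
  let ?F = "frechet_derivative f (at x)"
  have F: "(f has_derivative ?F) (at x)"
    using assms frechet_derivative_works by blast
  then have lin: "linear ?F"
    using has_derivative_linear by blast
  have "?F v = (\<Sum>i\<in>UNIV. v $ i * pd i f x)" for v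
  proof -
    have "?F v = ?F (\<Sum>i\<in>UNIV. v $ i *\<^sub>R axis i 1)"
      by (simp add: basis_expansion flip: scalar_mult_eq_scaleR)
    also have "\<dots> = (\<Sum>i\<in>UNIV. v $ i * pd i f x)"
      using lin by (simp add: linear_sum linear_scale pd_def)
    finally show ?thesis .
  qed
  then show ?thesis using F by presburger
qed

lemma sum_axis: "(\<Sum>j\<in>UNIV. axis i (1::real) $ j * c j) = c i"
proof -
  have "(\<Sum>j\<in>UNIV. axis i (1::real) $ j * c j) = (\<Sum>j\<in>UNIV. if j = i then c j else 0)"
    by (intro sum.cong) (auto simp: axis_def)
  then show ?thesis by simp
qed

lemma pd_const: "pd i (\<lambda>x. c) = (\<lambda>x. 0)"
  using pd_eqI[OF has_derivative_const] by (intro ext) blast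

lemma pd_coord: "pd i (\<lambda>x::real^'d::finite. x $ j) = (\<lambda>x. if i = j then 1 else 0)"
proof
  fix x :: "real^'d"
  have "((\<lambda>x::real^'d. x $ j) has_derivative (\<lambda>v. v $ j)) (at x)"
    by (rule bounded_linear_imp_has_derivative[OF bounded_linear_vec_nth])
  from pd_eqI[OF this] show "pd i (\<lambda>x. x $ j) x = (if i = j then 1 else 0)"
    by (simp add: axis_def)
qed

lemma pd_add:
  assumes "f differentiable (at x)" "g differentiable (at x)"
  shows "pd i (\<lambda>x. f x + g x) x = pd i f x + pd i g x"
  using pd_eqI[OF has_derivative_add[OF has_derivative_pd[OF assms(1)] has_derivative_pd[OF assms(2)]], of i]
  by (simp only: sum_axis)

lemma pd_mult:
  assumes "f differentiable (at x)" "g differentiable (at x)"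
  shows "pd i (\<lambda>x. f x * g x) x = f x * pd i g x + pd i f x * g x"
  using pd_eqI[OF has_derivative_mult[OF has_derivative_pd[OF assms(1)] has_derivative_pd[OF assms(2)]], of i]
  by (simp only: sum_axis)

lemma has_derivative_comp_real:
  assumes "(f has_derivative F) (at x)" "(h has_real_derivative h') (at (f x))"
  shows "((\<lambda>x. h (f x)) has_derivative (\<lambda>v. F v * h')) (at x)"
  using has_derivative_compose[OF assms(1), of h "(*) h'"] assms(2)
  by (simp add: has_field_derivative_def mult.commute)

lemma pd_comp:
  assumes "f differentiable (at x)" "(h has_real_derivative h') (at (f x))"
  shows "pd i (\<lambda>x. h (f x)) x = h' * pd i f x"
  using pd_eqI[OF has_derivative_comp_real[OF has_derivative_pd[OF assms(1)] assms(2)], of i]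
  by (simp only: sum_axis) (simp only: mult.commute)

lemma differentiable_comp_real:
  fixes f :: "real^'d::finite \<Rightarrow> real"
  assumes "f differentiable (at x)" "(h has_real_derivative h') (at (f x))"
  shows "(\<lambda>x. h (f x)) differentiable (at x)"
  using has_derivative_comp_real[OF has_derivative_pd[OF assms(1)] assms(2)]
  unfolding differentiable_def by blast

lemma sm_differentiable_pd:
  assumes "sm f"
  shows "(\<forall>x. f differentiable (at x)) \<and> (\<forall>i. sm (pd i f))"
  using assms
proof induction
  case (const c)
  then show ?case by (simp add: pd_const sm.const)
next
  case (coord i)
  have "(\<lambda>x::real^'a. x $ i) differentiable (at x)" for x
    using bounded_linear_imp_differentiable bounded_linear_vec_nth by blast
  then show ?case by (simp add: pd_coord sm.const)
next
  case (add f g)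
  then have "pd i (\<lambda>x. f x + g x) = (\<lambda>x. pd i f x + pd i g x)" for i
    using pd_add by fastforce
  then show ?case using add by (simp add: sm.add)
next
  case (mult f g)
  then have "pd i (\<lambda>x. f x * g x) = (\<lambda>x. f x * pd i g x + pd i f x * g x)" for i
    using pd_mult by fastforce
  then show ?case using mult by (simp add: sm.mult sm.add)
next
  case (comp D S f n)
  then have d: "(D n has_real_derivative D (Suc n) (f x)) (at (f x))" for x
    by (simp add: tower_def)
  have "pd i (\<lambda>x. D n (f x)) = (\<lambda>x. D (Suc n) (f x) * pd i f x)" for i
    using pd_comp[of f _ "D n", OF _ d] comp by blast
  moreover have "(\<lambda>x. D n (f x)) differentiable at x" for x
    using differentiable_comp_real[of f x "D n", OF _ d] comp by blast
  moreover have "sm (\<lambda>x. D (Suc n) (f x))"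
    using sm.comp comp by blast
  ultimately show ?case using comp by (simp add: sm.mult)
qed

lemma sm_differentiable: "sm f \<Longrightarrow> f differentiable (at x)"
  and sm_pd: "sm f \<Longrightarrow> sm (pd i f)"
  using sm_differentiable_pd by blast+

lemma sm_Dl: "sm f \<Longrightarrow> sm (Dl is f)"
  by (induction "is") (auto intro: sm_pd)

lemma sm_imp_smooth: "sm f \<Longrightarrow> smooth f"
  by (simp add: smooth_def sm_Dl sm_differentiable)

lemma smooth_pd: "smooth f \<Longrightarrow> smooth (pd i f)"
proof -
  have "Dl is (pd i f) = Dl (is @ [i]) f" for "is"
    by (induction "is") auto
  then show "smooth f \<Longrightarrow> smooth (pd i f)"
    by (simp add: smooth_def)
qed

lemma smooth_differentiable: "smooth f \<Longrightarrow> f differentiable (at x)"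
  unfolding smooth_def by (metis Dl.simps(1))

text \<open>Covers functions given as antiderivatives, such as the barrier: only the gradient has to
  belong to a known class.\<close>

lemma smooth_if_pd:
  assumes "\<And>x. f differentiable (at x)" "\<And>i. smooth (pd i f)"
  shows "smooth f"
proof -
  have "Dl is f differentiable (at x)" for "is" x
  proof (cases "is" rule: rev_cases)
    case Nil
    then show ?thesis using assms by simp
  next
    case (snoc js i)
    have "Dl (js @ [i]) f = Dl js (pd i f)"
      by (induction js) auto
    then show ?thesis using assms snoc by (simp add: smooth_def)
  qed
  then show ?thesis by (simp add: smooth_def)
qed

lemma smooth_continuous: "smooth f \<Longrightarrow> continuous_on S f"
  by (meson continuous_at_imp_continuous_on differentiable_imp_continuous_within smooth_differentiable)

lemma sm_cmult: "sm f \<Longrightarrow> sm (\<lambda>x. c * f x)"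
  by (rule sm.mult[OF sm.const])

lemma sm_diff: "sm f \<Longrightarrow> sm g \<Longrightarrow> sm (\<lambda>x. f x - g x)"
  using sm.add[OF _ sm_cmult[of g "-1"]] by simp

lemma sm_sum: "(\<And>i. i \<in> I \<Longrightarrow> sm (f i)) \<Longrightarrow> sm (\<lambda>x. \<Sum>i\<in>I. f i x)"
  by (induction I rule: infinite_finite_induct) (auto intro: sm.const sm.add)

lemma sm_prod: "(\<And>i. i \<in> I \<Longrightarrow> sm (f i)) \<Longrightarrow> sm (\<lambda>x. \<Prod>i\<in>I. f i x)"
  by (induction I rule: infinite_finite_induct) (auto intro: sm.const sm.mult)

lemma smooth_cs_iff: "smooth_cs f \<longleftrightarrow> smooth f \<and> bounded {x. f x \<noteq> 0}"
  by (simp add: smooth_cs_def smooth_def)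

section \<open>Exponentials, powers, logarithms and flat functions\<close>

lemma tower_exp: "tower (\<lambda>n s. exp s) UNIV"
  by (auto simp: tower_def intro!: derivative_eq_intros)

lemma sm_exp: "sm f \<Longrightarrow> sm (\<lambda>x. exp (f x))"
  using sm.comp[OF tower_exp] by simp

lemma tower_powr: "tower (\<lambda>n s. (\<Prod>k<n. \<alpha> - real k) * s powr (\<alpha> - real n)) {0<..}"
  unfolding tower_def
proof (intro allI ballI)
  fix n and s :: real assume s: "s \<in> {0<..}"
  show "((\<lambda>s. (\<Prod>k<n. \<alpha> - real k) * s powr (\<alpha> - real n)) has_real_derivative
      (\<Prod>k<Suc n. \<alpha> - real k) * s powr (\<alpha> - real (Suc n))) (at s)"
    using s by (auto intro!: derivative_eq_intros simp: field_simps)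
qed

lemma sm_powr: "sm f \<Longrightarrow> (\<And>x. f x > 0) \<Longrightarrow> sm (\<lambda>x. f x powr \<alpha>)"
  using sm.comp[OF tower_powr[of \<alpha>], of f 0] by simp

lemma tower_ln: "tower (\<lambda>n s. case n of 0 \<Rightarrow> ln s | Suc m \<Rightarrow> (\<Prod>k<m. -1 - real k) * s powr (-1 - real m)) {0<..}"
  unfolding tower_def
proof (intro allI ballI)
  fix n and s :: real assume s: "s \<in> {0<..}"
  show "((\<lambda>s. case n of 0 \<Rightarrow> ln s | Suc m \<Rightarrow> (\<Prod>k<m. -1 - real k) * s powr (-1 - real m)) has_real_derivative
      (case Suc n of 0 \<Rightarrow> ln s | Suc m \<Rightarrow> (\<Prod>k<m. -1 - real k) * s powr (-1 - real m))) (at s)"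
  proof (cases n)
    case 0
    then show ?thesis using s by (auto intro!: derivative_eq_intros simp: powr_minus_divide)
  next
    case (Suc m)
    then show ?thesis using s tower_powr[of "-1"] by (auto simp: tower_def)
  qed
qed

lemma sm_ln: "sm f \<Longrightarrow> (\<And>x. f x > 0) \<Longrightarrow> sm (\<lambda>x. ln (f x))"
  using sm.comp[OF tower_ln, of f 0] by simp

lemma sm_sqrt: "sm f \<Longrightarrow> (\<And>x. f x > 0) \<Longrightarrow> sm (\<lambda>x. sqrt (f x))"
  using sm_powr[of f "1/2"] by (simp add: powr_half_sqrt less_imp_le)

text \<open>The functions \<open>P (1 / y) * exp (- 1 / y)\<close>, extended by 0, form a class
  closed under differentiation: the derivative replaces \<open>P\<close> by
  \<open>X^2 * (P - P')\<close>, with \<open>[:0, 0, 1:]\<close> standing for \<open>X^2\<close>.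
  They supply cutoffs all of whose derivatives exist at 0.\<close>

definition flatf :: "real poly \<Rightarrow> real \<Rightarrow> real" where
  "flatf P y = (if y > 0 then poly P (1 / y) * exp (- 1 / y) else 0)"

primrec flat_poly :: "nat \<Rightarrow> real poly" where
  "flat_poly 0 = 1"
| "flat_poly (Suc n) = [:0, 0, 1:] * (flat_poly n - pderiv (flat_poly n))"

lemma poly_exp_tendsto_0: "((\<lambda>x::real. x ^ k * poly P x * exp (- x)) \<longlongrightarrow> 0) at_top"
proof (induction P arbitrary: k)
  case 0
  then show ?case by simp
next
  case (pCons c P)
  have "((\<lambda>x::real. c * (x ^ k / exp x) + x ^ Suc k * poly P x * exp (- x)) \<longlongrightarrow> c * 0 + 0) at_top"
    by (intro tendsto_intros tendsto_power_div_exp_0 pCons.IH)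
  moreover have "x ^ k * poly (pCons c P) x * exp (- x) =
      c * (x ^ k / exp x) + x ^ Suc k * poly P x * exp (- x)" for x :: real
    by (simp add: algebra_simps exp_minus divide_inverse)
  ultimately show ?case by simp
qed

lemma flatf_has_derivative:
  "(flatf P has_real_derivative flatf ([:0, 0, 1:] * (P - pderiv P)) y) (at y)"
proof -
  consider "y > 0" | "y < 0" | "y = 0" by linarith
  then show ?thesis
  proof cases
    case 1
    have d: "((\<lambda>y. poly P (1 / y) * exp (- 1 / y)) has_real_derivative
        flatf ([:0, 0, 1:] * (P - pderiv P)) y) (at y)"
      using 1 unfolding flatf_def
      by (auto intro!: derivative_eq_intros DERIV_chain2[OF poly_DERIV] simp: field_simps power2_eq_square)
    have ev: "\<forall>\<^sub>F z in nhds y. poly P (1 / z) * exp (- 1 / z) = flatf P z"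
      using eventually_nhds_in_open[of "{0<..}" y] 1 by (auto elim!: eventually_mono simp: flatf_def)
    show ?thesis by (rule iffD1[OF DERIV_cong_ev[OF refl ev refl] d])
  next
    case 2
    have d: "((\<lambda>y::real. 0::real) has_real_derivative flatf ([:0, 0, 1:] * (P - pderiv P)) y) (at y)"
      using 2 by (simp add: flatf_def)
    have ev: "\<forall>\<^sub>F z in nhds y. 0 = flatf P z"
      using eventually_nhds_in_open[of "{..<0}" y] 2 by (auto elim!: eventually_mono simp: flatf_def)
    show ?thesis by (rule iffD1[OF DERIV_cong_ev[OF refl ev refl] d])
  next
    case 3
    \<comment> \<open>To the right of 0 the difference quotient is
      \<open>(1 / x) * P (1 / x) * exp (- 1 / x)\<close>, which the exponential sends to 0.\<close>
    have "((\<lambda>x. flatf P (0 + x) / x) \<longlongrightarrow> 0) (at_right 0)"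
    proof -
      have "((\<lambda>x::real. (inverse x) ^ 1 * poly P (inverse x) * exp (- inverse x)) \<longlongrightarrow> 0) (at_right 0)"
        using filterlim_compose[OF poly_exp_tendsto_0[of 1 P] filterlim_inverse_at_top_right] .
      then show ?thesis
        by (rule Lim_transform_eventually)
          (auto simp: flatf_def eventually_at_right_field field_simps intro!: exI[of _ 1])
    qed
    moreover have "((\<lambda>x. flatf P (0 + x) / x) \<longlongrightarrow> 0) (at_left 0)"
      by (rule tendsto_eventually) (auto simp: flatf_def eventually_at_left_field intro!: exI[of _ "-1"])
    ultimately have "((\<lambda>x. flatf P (0 + x) / x) \<longlongrightarrow> 0) (at 0)"
      by (simp add: filterlim_split_at)
    then show ?thesis
      using 3 by (simp add: DERIV_def flatf_def)
  qed
qed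

lemma tower_flat: "tower (\<lambda>n. flatf (flat_poly n)) UNIV"
  by (simp add: tower_def flatf_has_derivative del: mult_pCons_left)

definition fexp :: "real \<Rightarrow> real" where
  "fexp y = (if y > 0 then exp (- 1 / y) else 0)"

definition fexp' :: "real \<Rightarrow> real" where
  "fexp' y = (if y > 0 then exp (- 1 / y) / y\<^sup>2 else 0)"

lemma fexp_flat: "fexp = flatf (flat_poly 0)"
  by (auto simp: fexp_def flatf_def)

lemma fexp'_flat: "fexp' = flatf (flat_poly 1)"
  by (auto simp: fexp'_def flatf_def power2_eq_square field_simps)

lemma fexp_has_derivative: "(fexp has_real_derivative fexp' y) (at y)"
  using tower_flat unfolding tower_def fexp_flat fexp'_flat One_nat_def by blast

lemma sm_fexp: "sm f \<Longrightarrow> sm (\<lambda>x. fexp (f x))"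
  using sm.comp[OF tower_flat, of f 0] by (simp add: fexp_flat)

lemma fexp_nonneg: "fexp y \<ge> 0" and fexp_le_1: "fexp y \<le> 1" and fexp'_nonneg: "fexp' y \<ge> 0"
  by (auto simp: fexp_def fexp'_def)

section \<open>Positive definite matrices and radial functions\<close>

lemma norm_matrix_vector_le:
  fixes M :: "real^'n::finite^'m::finite"
  shows "norm (M *v v) \<le> norm M * norm v"
proof -
  have "norm (M *v v) = L2_set (\<lambda>i. norm ((M *v v) $ i)) UNIV"
    by (simp add: norm_vec_def)
  also have "\<dots> \<le> L2_set (\<lambda>i. norm (M $ i) * norm v) UNIV"
  proof (rule L2_set_mono)
    fix i
    have "(M *v v) $ i = M $ i \<bullet> v"
      by (simp add: matrix_vector_mult_def inner_vec_def)
    then show "norm ((M *v v) $ i) \<le> norm (M $ i) * norm v"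
      using Cauchy_Schwarz_ineq2[of "M $ i" v] by simp
  qed simp
  also have "\<dots> = norm M * norm v"
    by (simp add: norm_vec_def L2_set_left_distrib)
  finally show ?thesis .
qed

lemma inner_matrix: "(A::real^'n::finite^'m::finite) \<bullet> B = (\<Sum>i\<in>UNIV. \<Sum>j\<in>UNIV. A $ i $ j * B $ i $ j)"
  by (simp add: inner_vec_def)

lemma inner_symmetric_matrix:
  fixes A :: "real^'n::finite^'n"
  assumes "transpose A = A"
  shows "x \<bullet> (A *v y) = (A *v x) \<bullet> y"
  by (metis assms dot_lmul_matrix transpose_matrix_vector)

lemma symmetric_nth:
  assumes "transpose A = A"
  shows "A $ i $ j = A $ j $ i"
  by (metis assms transpose_def vec_lambda_beta)

locale spd =
  fixes a :: "real^'d::finite^'d" and lam :: real and Lam :: real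
  assumes sym: "transpose a = a"
    and lam: "0 < lam"
    and ell: "\<And>\<xi>. lam * (norm \<xi>)\<^sup>2 \<le> \<xi> \<bullet> (a *v \<xi>)"
    and bnd: "norm a \<le> Lam"
begin

definition A where "A = matrix_inv a"

lemma inverse: "a ** A = mat 1" "A ** a = mat 1"
proof -
  have "x = 0" if "a *v x = 0" for x
    using ell[of x] lam that by (simp add: mult_le_0_iff)
  then obtain B where "B ** a = mat 1"
    using matrix_left_invertible_ker[of a] by blast
  then have inv: "invertible a"
    using invertible_left_inverse by blast
  then show "a ** A = mat 1" "A ** a = mat 1"
    unfolding A_def matrix_inv_def invertible_def by (metis (mono_tags, lifting) someI_ex)+
qed

lemma A_sym: "transpose A = A"
proof -
  have "transpose A ** a = mat 1"
    by (metis inverse(1) matrix_transpose_mul sym transpose_mat)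
  then show ?thesis
    by (metis inverse(1) matrix_mul_assoc matrix_mul_lid matrix_mul_rid)
qed

lemma aA: "a *v (A *v z) = z" and Aa: "A *v (a *v z) = z"
  by (simp_all add: matrix_vector_mul_assoc inverse)

text \<open>The trace of the inverse times the matrix. This is where the dimension enters, and it is
  what makes \<open>- d / 2\<close> the right exponent in the fundamental solution.\<close>

lemma A_inner: "A \<bullet> a = real CARD('d)"
proof -
  have "A \<bullet> a = (\<Sum>i\<in>UNIV. \<Sum>j\<in>UNIV. A $ i $ j * a $ j $ i)"
    unfolding inner_matrix using symmetric_nth[OF sym] by simp
  also have "\<dots> = (\<Sum>i\<in>UNIV. (A ** a) $ i $ i)"
    by (simp add: matrix_matrix_mult_def)
  finally show ?thesis by (simp add: inverse mat_def)
qed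

lemma norm_Az: "norm (A *v z) \<le> norm z / lam"
proof (cases "A *v z = 0")
  case True
  then show ?thesis using lam by simp
next
  case False
  have "lam * (norm (A *v z))\<^sup>2 \<le> (A *v z) \<bullet> z"
    using ell[of "A *v z"] by (simp add: aA)
  also have "\<dots> \<le> norm (A *v z) * norm z"
    by (rule norm_cauchy_schwarz)
  finally show ?thesis
    using False lam by (simp add: power2_eq_square field_simps)
qed

lemma q_le: "z \<bullet> (A *v z) \<le> (norm z)\<^sup>2 / lam"
  using norm_cauchy_schwarz[of z "A *v z"] norm_Az[of z] mult_left_mono[OF norm_Az[of z] norm_ge_zero[of z]]
  by (simp add: power2_eq_square)

lemma Lam_pos: "0 < Lam"
proof -
  obtain e :: "real^'d" where e: "norm e = 1"
    using vector_choose_size[of 1] by auto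
  have "lam \<le> e \<bullet> (a *v e)" using ell[of e] e by simp
  also have "\<dots> \<le> norm a"
    using norm_cauchy_schwarz[of e "a *v e"] norm_matrix_vector_le[of a e] e by simp
  finally show ?thesis using lam bnd by linarith
qed

text \<open>Avoids eigenvalues: \<open>z = a (A z)\<close> gives
  \<open>norm z <= Lam * norm (A z)\<close>, and ellipticity at \<open>A z\<close> gives
  \<open>lam * norm (A z)^2 <= z . A z\<close>.\<close>

lemma q_ge: "lam / Lam\<^sup>2 * (norm z)\<^sup>2 \<le> z \<bullet> (A *v z)"
proof -
  have "norm z = norm (a *v (A *v z))" by (simp add: aA)
  also have "\<dots> \<le> norm a * norm (A *v z)"
    by (rule norm_matrix_vector_le)
  also have "\<dots> \<le> Lam * norm (A *v z)"
    by (intro mult_right_mono bnd) auto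
  finally have "(norm z)\<^sup>2 \<le> Lam\<^sup>2 * (norm (A *v z))\<^sup>2"
    by (metis norm_ge_zero power_mono power_mult_distrib)
  then have "lam / Lam\<^sup>2 * (norm z)\<^sup>2 \<le> lam * (norm (A *v z))\<^sup>2"
    using lam Lam_pos by (simp add: field_simps)
  also have "\<dots> \<le> (A *v z) \<bullet> z"
    using ell[of "A *v z"] by (simp add: aA)
  finally show ?thesis by (simp add: inner_commute)
qed

lemma q_nonneg: "0 \<le> z \<bullet> (A *v z)"
proof -
  have "0 \<le> lam * (norm (A *v z))\<^sup>2" using lam by simp
  also have "\<dots> \<le> z \<bullet> (A *v z)"
    using ell[of "A *v z"] by (simp add: aA inner_commute)
  finally show ?thesis .
qed

text \<open>The norm of a matrix is the Euclidean norm of its entries, estimated row by row; by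
  symmetry the rows are the images of the unit vectors, whence the factor
  \<open>CARD('d)\<close>.\<close>

lemma norm_A: "norm A \<le> real CARD('d) / lam"
proof -
  have "norm (A $ i) \<le> 1 / lam" for i
  proof -
    have "A $ i = A *v axis i 1"
      using symmetric_nth[OF A_sym] by (simp add: vec_eq_iff matrix_vector_mul_component inner_axis)
    then show ?thesis using norm_Az[of "axis i 1"] by simp
  qed
  then have "(\<Sum>i\<in>UNIV. norm (A $ i)) \<le> real CARD('d) * (1 / lam)"
    by (intro sum_bounded_above) auto
  moreover have "norm A \<le> (\<Sum>i\<in>UNIV. norm (A $ i))"
    unfolding norm_vec_def by (rule L2_set_le_sum) auto
  ultimately show ?thesis by simp
qed

end

section \<open>Functions of a quadratic form\<close>

lemma has_derivative_quad:
  fixes A :: "real^'d::finite^'d"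
  assumes "transpose A = A"
  shows "((\<lambda>x. (x - y) \<bullet> (A *v (x - y)) + c) has_derivative (\<lambda>v. 2 * (v \<bullet> (A *v (x - y))))) (at x)"
proof -
  have d: "((\<lambda>x. A *v (x - y)) has_derivative (\<lambda>v. A *v v)) (at x)"
    by (intro has_derivative_eq_rhs[OF bounded_linear.has_derivative[OF matrix_vector_mul_bounded_linear]])
      (auto intro!: derivative_eq_intros)
  have "((\<lambda>x. (x - y) \<bullet> (A *v (x - y)) + c) has_derivative
      (\<lambda>v. (x - y) \<bullet> (A *v v) + v \<bullet> (A *v (x - y)))) (at x)"
    by (rule derivative_eq_intros d refl | simp)+
  then show ?thesis
    by (rule has_derivative_eq_rhs) (simp add: inner_symmetric_matrix[OF assms] inner_commute)
qed

lemma pd_quad: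
  fixes A :: "real^'d::finite^'d"
  assumes "transpose A = A"
  shows "pd i (\<lambda>x. (x - y) \<bullet> (A *v (x - y)) + c) x = 2 * (A *v (x - y)) $ i"
  using pd_eqI[OF has_derivative_quad[OF assms]] by (simp add: inner_axis')

lemma differentiable_quad:
  fixes A :: "real^'d::finite^'d"
  assumes "transpose A = A"
  shows "(\<lambda>x. (x - y) \<bullet> (A *v (x - y)) + c) differentiable (at x)"
  using has_derivative_quad[OF assms] unfolding differentiable_def by blast

lemma sm_linear: "sm (\<lambda>x. ((A::real^'d::finite^'m::finite) *v (x - y)) $ i)"
  unfolding matrix_vector_mult_def by (simp, intro sm_sum sm_cmult sm_diff sm.coord sm.const)

lemma sm_quad: "sm (\<lambda>x. (x - y) \<bullet> ((A::real^'d::finite^'d) *v (x - y)) + c)"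
proof -
  have "sm (\<lambda>x. (\<Sum>i\<in>UNIV. (x $ i - y $ i) * (A *v (x - y)) $ i) + c)"
    by (intro sm_sum sm.mult sm_diff sm.coord sm.const sm_linear sm.add)
  then show ?thesis by (simp add: inner_vec_def)
qed

lemma pd_linear:
  "pd i (\<lambda>x. ((A::real^'d::finite^'m::finite) *v (x - y)) $ j) x = A $ j $ i"
proof -
  have "((\<lambda>x. (A *v (x - y)) $ j) has_derivative (\<lambda>v. (A *v v) $ j)) (at x)"
    by (intro has_derivative_eq_rhs[OF bounded_linear.has_derivative[OF bounded_linear_compose[OF bounded_linear_vec_nth matrix_vector_mul_bounded_linear]]])
      (auto intro!: derivative_eq_intros)
  from pd_eqI[OF this] show ?thesis
    by (simp add: matrix_vector_mul_component inner_axis)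
qed

lemma quadratic_form: "w \<bullet> (M *v w) = (\<Sum>i\<in>UNIV. \<Sum>j\<in>UNIV. M $ i $ j * w $ i * w $ (j::'d::finite) :: real)"
  by (simp add: inner_vec_def matrix_vector_mult_def sum_distrib_left mult_ac)

text \<open>The barrier, the Gaussian and the Lyapunov function are all of the form
  \<open>h (q x)\<close>. The matrix \<open>A\<close> is a constant attached to the centre
  \<open>y\<close>, while \<open>a\<close> and \<open>b\<close> are evaluated at \<open>x\<close>;
  their mismatch is the freezing error estimated later.\<close>

lemma gen_radial:
  fixes A :: "real^'d::finite^'d" and y :: "real^'d" and c :: real
  defines "q \<equiv> \<lambda>x. (x - y) \<bullet> (A *v (x - y)) + c"
  assumes A: "transpose A = A"
    and h: "\<And>x. (h has_real_derivative h1 (q x)) (at (q x))"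
    and h1: "\<And>x. (h1 has_real_derivative h2 (q x)) (at (q x))"
  shows "gen b a (\<lambda>x. h (q x)) x =
    h1 (q x) * (2 * (b x \<bullet> (A *v (x - y))) + A \<bullet> a x)
      + 2 * h2 (q x) * ((A *v (x - y)) \<bullet> (a x *v (A *v (x - y))))"
proof -
  let ?w = "A *v (x - y)"
  have dq: "q differentiable (at x)" for x
    unfolding q_def using differentiable_quad[OF A] .
  have pdq: "pd i q x = 2 * (A *v (x - y)) $ i" for i x
    unfolding q_def using pd_quad[OF A] .
  have p1: "pd j (\<lambda>x. h (q x)) = (\<lambda>x. h1 (q x) * (2 * (A *v (x - y)) $ j))" for j
    using pd_comp[OF dq h] by (auto simp: pdq)
  have dl: "(\<lambda>x. 2 * (A *v (x - y)) $ j) differentiable (at x)" for j x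
    by (intro sm_differentiable sm_cmult sm_linear)
  have pdl: "pd i (\<lambda>x. 2 * (A *v (x - y)) $ j) x = 2 * A $ j $ i" for i j
    using pd_mult[of "\<lambda>x. 2" x "\<lambda>x. (A *v (x - y)) $ j" i] sm_differentiable[OF sm_linear[of A y j]]
    by (simp add: pd_const pd_linear)
  have dh1: "(\<lambda>x. h1 (q x)) differentiable (at x)"
    by (rule differentiable_comp_real[OF dq h1])
  have p2: "pd i (pd j (\<lambda>x. h (q x))) x =
      h1 (q x) * (2 * A $ j $ i) + h2 (q x) * (2 * ?w $ i) * (2 * ?w $ j)" for i j
    unfolding p1 by (subst pd_mult[OF dh1 dl]) (simp add: pdl pd_comp[OF dq h1] pdq)
  have "gen b a (\<lambda>x. h (q x)) x = (\<Sum>i\<in>UNIV. b x $ i * (h1 (q x) * (2 * ?w $ i)))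
     + 1/2 * (\<Sum>i\<in>UNIV. \<Sum>j\<in>UNIV. a x $ i $ j * (h1 (q x) * (2 * A $ i $ j) + h2 (q x) * (2 * ?w $ i) * (2 * ?w $ j)))"
    unfolding gen_def using p2 symmetric_nth[OF A] by (simp add: p1)
  also have "(\<Sum>i\<in>UNIV. b x $ i * (h1 (q x) * (2 * ?w $ i))) = h1 (q x) * (2 * (b x \<bullet> ?w))"
    by (simp add: inner_vec_def sum_distrib_left algebra_simps)
  also have "(\<Sum>i\<in>UNIV. \<Sum>j\<in>UNIV. a x $ i $ j * (h1 (q x) * (2 * A $ i $ j) + h2 (q x) * (2 * ?w $ i) * (2 * ?w $ j)))
    = h1 (q x) * 2 * (A \<bullet> a x) + 4 * h2 (q x) * (?w \<bullet> (a x *v ?w))"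
    unfolding quadratic_form inner_matrix
    by (simp add: sum_distrib_left sum.distrib distrib_left mult_ac)
  finally show ?thesis by (simp add: algebra_simps)
qed

section \<open>Positivity of infinitesimally invariant densities\<close>

lemma nn_integral_affine:
  fixes g :: "'a::euclidean_space \<Rightarrow> ennreal"
  assumes [measurable]: "g \<in> borel_measurable borel" and "c \<noteq> 0"
  shows "(\<integral>\<^sup>+y. g y \<partial>lborel) = ennreal (\<bar>c\<bar> ^ DIM('a)) * (\<integral>\<^sup>+z. g (x + c *\<^sub>R z) \<partial>lborel)"
  by (subst lborel_affine[OF \<open>c \<noteq> 0\<close>, of x])
    (simp add: nn_integral_density nn_integral_distr nn_integral_cmult ennreal_power)

text \<open>The shape of the error term of the barrier. The prefactor \<open>t\<close> makes the
  integral over the space independent of \<open>t\<close>, while at a fixed distance from 0 the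
  kernel is of order \<open>t\<close>. It thus concentrates at scale \<open>sqrt t\<close> like an
  approximate identity, with algebraic tails.\<close>

definition kern :: "real \<Rightarrow> real^'d::finite \<Rightarrow> real" where
  "kern t z = t * ((norm z)\<^sup>2 + t) powr (- (real CARD('d) / 2 + 1))"

lemma kern_measurable[measurable]: "kern t \<in> borel_measurable borel"
  unfolding kern_def by measurable

lemma kern_nonneg: "t \<ge> 0 \<Longrightarrow> kern t z \<ge> 0"
  by (simp add: kern_def)

lemma kern_scale:
  fixes z :: "real^'d::finite"
  assumes "t > 0"
  shows "sqrt t ^ CARD('d) * kern t (sqrt t *\<^sub>R z) = kern 1 z"
proof -
  let ?d = "real CARD('d)"
  have 1: "(norm (sqrt t *\<^sub>R z))\<^sup>2 + t = t * ((norm z)\<^sup>2 + 1)"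
    using assms by (simp add: power_mult_distrib algebra_simps)
  have 2: "sqrt t ^ CARD('d) = t powr (?d / 2)"
    using assms by (simp add: powr_half_sqrt[symmetric] powr_powr flip: powr_realpow)
  have 3: "t powr (?d / 2) * (t powr 1 * t powr (- (?d / 2 + 1))) = 1"
    using assms unfolding powr_add[symmetric] by simp
  have "sqrt t ^ CARD('d) * kern t (sqrt t *\<^sub>R z) =
    (t powr (?d / 2) * (t powr 1 * t powr (- (?d / 2 + 1)))) * ((norm z)\<^sup>2 + 1) powr (- (?d / 2 + 1))"
    unfolding kern_def 1 2 using assms by (simp add: powr_mult)
  then show ?thesis unfolding 3 by (simp add: kern_def)
qed

lemma nn_integral_kern_scale:
  fixes x :: "real^'d::finite"
  assumes t: "t > 0" and [measurable]: "h \<in> borel_measurable borel"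
  shows "(\<integral>\<^sup>+y. h ((x - y) /\<^sub>R sqrt t) \<partial>lborel) = ennreal (sqrt t ^ CARD('d)) * (\<integral>\<^sup>+z. h z \<partial>lborel)"
  using nn_integral_affine[of "\<lambda>y. h ((x - y) /\<^sub>R sqrt t)" "- sqrt t" x] t by simp

lemma ennreal_le_suminf: "(f :: nat \<Rightarrow> ennreal) j \<le> suminf f"
  using sum_le_suminf[of f "{j}"] by simp

text \<open>Dyadic decomposition: on the shell \<open>2 ^ (j - 1) \<le> norm z \<le> 2 ^ j\<close> the kernel is of order
  \<open>2 ^ (- j (d + 2))\<close>, while the shell has volume of order \<open>2 ^ (j d)\<close>.\<close>

lemma nn_integral_kern_1: "(\<integral>\<^sup>+z. ennreal (kern 1 (z::real^'d::finite)) \<partial>lborel) < \<infinity>"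
proof -
  let ?d = "CARD('d)"
  define V where "V = unit_ball_vol (real ?d)"
  have V: "V \<ge> 0" by (simp add: V_def)
  have pointwise: "ennreal (kern 1 z) \<le>
      (\<Sum>j. ennreal (2 ^ (?d + 2) * (1 / 2 ^ (?d + 2)) ^ j) * indicator (cball 0 (2 ^ j)) z)" for z :: "real^'d"
  proof -
    define j where "j = (LEAST j. norm z \<le> 2 ^ j)"
    obtain n where n: "norm z \<le> 2 ^ n"
      using real_arch_pow[of 2 "norm z"] by (auto intro: less_imp_le)
    then have j: "norm z \<le> 2 ^ j" unfolding j_def by (rule LeastI)
    have "kern 1 z \<le> 2 ^ (?d + 2) * (1 / 2 ^ (?d + 2)) ^ j"
    proof (cases j)
      case 0
      have "kern 1 z \<le> 1"
        unfolding kern_def using powr_mono2'[of "- (real ?d / 2 + 1)" 1 "(norm z)\<^sup>2 + 1"] by simp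
      also have "(1::real) \<le> 2 ^ (?d + 2)" by (rule one_le_power) simp
      finally show ?thesis using 0 by simp
    next
      case (Suc i)
      then have "2 ^ i < norm z"
        using not_less_Least[of i "\<lambda>j. norm z \<le> 2 ^ j"] unfolding j_def[symmetric] by force
      then have "(2 ^ i)\<^sup>2 \<le> (norm z)\<^sup>2 + 1"
        by (smt (verit) power_mono zero_le_power)
      then have "kern 1 z \<le> ((2 ^ i)\<^sup>2) powr (- (real ?d / 2 + 1))"
        unfolding kern_def using powr_mono2'[of "- (real ?d / 2 + 1)" "(2 ^ i)\<^sup>2" "(norm z)\<^sup>2 + 1"] by simp
      also have "\<dots> = (2 ^ i) powr (- real (?d + 2))"
      proof -
        have "((2::real) ^ i)\<^sup>2 = (2 ^ i) powr 2" by simp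
        moreover have "2 * (- (real ?d / 2 + 1)) = - real (?d + 2)" by simp
        ultimately show ?thesis by (metis powr_powr)
      qed
      also have "\<dots> = 1 / (2 ^ i) ^ (?d + 2)"
        by (simp only: powr_minus_divide powr_realpow[OF zero_less_power[OF zero_less_numeral]])
      also have "\<dots> = (1 / 2 ^ (?d + 2)) ^ i"
        by (simp only: power_one_over power_mult[symmetric] mult.commute)
      finally show ?thesis using Suc by simp
    qed
    then have "ennreal (kern 1 z) \<le> ennreal (2 ^ (?d + 2) * (1 / 2 ^ (?d + 2)) ^ j) * indicator (cball 0 (2 ^ j)) z"
      using j by (simp add: ennreal_leI)
    also have "\<dots> \<le> (\<Sum>j. ennreal (2 ^ (?d + 2) * (1 / 2 ^ (?d + 2)) ^ j) * indicator (cball 0 (2 ^ j)) z)"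
      by (rule ennreal_le_suminf)
    finally show ?thesis .
  qed
  have "(\<integral>\<^sup>+z. ennreal (kern 1 (z::real^'d)) \<partial>lborel) \<le>
    (\<integral>\<^sup>+z. (\<Sum>j. ennreal (2 ^ (?d + 2) * (1 / 2 ^ (?d + 2)) ^ j) * indicator (cball 0 (2 ^ j)) (z::real^'d)) \<partial>lborel)"
    by (intro nn_integral_mono pointwise)
  also have "\<dots> = (\<Sum>j. \<integral>\<^sup>+z. ennreal (2 ^ (?d + 2) * (1 / 2 ^ (?d + 2)) ^ j) * indicator (cball 0 (2 ^ j)) (z::real^'d) \<partial>lborel)"
    by (intro nn_integral_suminf borel_measurable_times_ennreal borel_measurable_const
        borel_measurable_indicator) simp
  also have "\<dots> = (\<Sum>j. ennreal ((2 ^ (?d + 2) * V) * (1 / 4) ^ j))"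
  proof (rule suminf_cong)
    fix j
    have "(\<integral>\<^sup>+z. ennreal (2 ^ (?d + 2) * (1 / 2 ^ (?d + 2)) ^ j) * indicator (cball 0 (2 ^ j)) (z::real^'d) \<partial>lborel)
      = ennreal (2 ^ (?d + 2) * (1 / 2 ^ (?d + 2)) ^ j) * ennreal (V * (2 ^ j) ^ ?d)"
      by (subst nn_integral_cmult_indicator) (auto simp: emeasure_cball V_def)
    also have "\<dots> = ennreal ((2 ^ (?d + 2) * (1 / 2 ^ (?d + 2)) ^ j) * (V * (2 ^ j) ^ ?d))"
      by (rule ennreal_mult[symmetric]) (use V in auto)
    also have "(2 ^ (?d + 2) * (1 / 2 ^ (?d + 2)) ^ j) * (V * (2 ^ j) ^ ?d) = (2 ^ (?d + 2) * V) * (1 / 4) ^ j"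
    proof -
      have "(1 / 2 ^ (?d + 2)) ^ j * (2 ^ j) ^ ?d = ((1 / 2 ^ (?d + 2)) * 2 ^ ?d :: real) ^ j"
        by (simp only: power_mult_distrib power_mult[symmetric] mult.commute[of j])
      also have "(1 / 2 ^ (?d + 2)) * 2 ^ ?d = (1 / 4 :: real)"
        by (simp add: power_add)
      finally have *: "(1 / 2 ^ (?d + 2)) ^ j * (2 ^ j) ^ ?d = (1 / 4 :: real) ^ j" .
      have "(2 ^ (?d + 2) * (1 / 2 ^ (?d + 2)) ^ j) * (V * (2 ^ j) ^ ?d) =
          (2 ^ (?d + 2) * V) * ((1 / 2 ^ (?d + 2)) ^ j * (2 ^ j) ^ ?d)"
        by (simp only: mult_ac)
      then show ?thesis by (simp only: *)
    qed
    finally show "(\<integral>\<^sup>+z. ennreal (2 ^ (?d + 2) * (1 / 2 ^ (?d + 2)) ^ j) * indicator (cball 0 (2 ^ j)) (z::real^'d) \<partial>lborel)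
      = ennreal ((2 ^ (?d + 2) * V) * (1 / 4) ^ j)" .
  qed
  also have "\<dots> = ennreal (\<Sum>j. (2 ^ (?d + 2) * V) * (1 / 4) ^ j)"
    by (rule suminf_ennreal2) (use V in \<open>auto intro!: summable_mult summable_geometric\<close>)
  finally show ?thesis
    using le_less_trans[OF _ ennreal_less_top] by simp
qed

lemma kern_bound:
  obtains \<kappa> where "\<kappa> > 0"
    "\<And>t x. t > 0 \<Longrightarrow> (\<integral>\<^sup>+y. ennreal (kern t (x - y :: real^'d::finite)) \<partial>lborel) \<le> ennreal \<kappa>"
proof -
  define J where "J = (\<integral>\<^sup>+z. ennreal (kern 1 (z::real^'d)) \<partial>lborel)"
  have fin: "J < \<infinity>" unfolding J_def by (rule nn_integral_kern_1)
  have "(\<integral>\<^sup>+y. ennreal (kern t (x - y)) \<partial>lborel) = J" if t: "t > 0" for t and x :: "real^'d"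
  proof -
    have "(\<integral>\<^sup>+y. ennreal (kern t (x - y)) \<partial>lborel) = ennreal (sqrt t ^ CARD('d)) * (\<integral>\<^sup>+z. ennreal (kern t (sqrt t *\<^sub>R (z::real^'d))) \<partial>lborel)"
      using nn_integral_affine[of "\<lambda>y. ennreal (kern t (x - y))" "- sqrt t" x] t by simp
    also have "\<dots> = (\<integral>\<^sup>+z. ennreal (sqrt t ^ CARD('d)) * ennreal (kern t (sqrt t *\<^sub>R (z::real^'d))) \<partial>lborel)"
      by (rule nn_integral_cmult[symmetric]) measurable
    also have "\<dots> = J"
      unfolding J_def using t by (simp add: kern_nonneg kern_scale flip: ennreal_mult)
    finally show ?thesis .
  qed
  moreover obtain r where "r \<ge> 0" "J = ennreal r"
    using fin by (cases J) auto
  ultimately show thesis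
    using that[of "r + 1"] by (simp add: ennreal_leI)
qed

text \<open>This is \<open>(1 + x / n)^n <= exp x\<close> at \<open>x = c * (1 + s)\<close>. It lets
  a Gaussian absorb polynomial weights at the cost of part of its exponent.\<close>

lemma exp_gt_power:
  fixes s :: real
  assumes "s \<ge> 0" "n > 0" "c > 0"
  shows "(1 + s) ^ n * exp (- (c * s)) \<le> (real n / c) ^ n * exp c"
proof -
  have "(c * (1 + s) / n) ^ n \<le> (1 + c * (1 + s) / n) ^ n"
    using assms by (intro power_mono) auto
  also have "\<dots> \<le> exp (c * (1 + s))"
    using assms by (intro exp_ge_one_plus_x_over_n_power_n)
      (auto intro: order_trans[of _ 0])
  finally have "(c / n) ^ n * (1 + s) ^ n \<le> exp c * exp (c * s)"
    by (simp add: exp_add[symmetric] distrib_left mult.commute flip: power_mult_distrib)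
  then have "(real n / c) ^ n * ((c / n) ^ n * (1 + s) ^ n) \<le> (real n / c) ^ n * (exp c * exp (c * s))"
    using assms by (intro mult_left_mono) auto
  then have "(1 + s) ^ n \<le> (real n / c) ^ n * exp c * exp (c * s)"
    using assms by (simp add: mult.assoc[symmetric] flip: power_mult_distrib)
  then show ?thesis by (simp add: exp_minus divide_inverse[symmetric] pos_divide_le_eq)
qed

section \<open>The barrier: a regularised and truncated fundamental solution\<close>

lemma fexp'_le: "fexp' y \<le> 2"
proof (cases "y > 0")
  case True
  have "1 + 1 / y + (1 / y)\<^sup>2 / 2 \<le> exp (1 / y)"
    using True by (intro exp_lower_Taylor_quadratic) auto
  then have "(1 / y)\<^sup>2 / 2 \<le> exp (1 / y)"
    using True by (smt (verit) zero_le_divide_1_iff)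
  then show ?thesis
    using True by (simp add: fexp'_def exp_minus field_simps)
qed (simp add: fexp'_def)

lemma fexp_eq_fexp': "fexp y = y\<^sup>2 * fexp' y"
  by (simp add: fexp_def fexp'_def)

lemma barrier_inequality:
  fixes d s q \<tau> Q K R e :: real
  assumes d: "d \<ge> 1" and s: "s = q + e" and q: "q \<ge> 0" and e: "e > 0" and R: "R \<le> 1" and sR: "sqrt s < R"
    and K: "K \<ge> 0" "K * R \<le> 1 / 2" "(d + 1) * K * R\<^sup>2 \<le> 1 / 4"
    and \<tau>: "\<bar>\<tau>\<bar> \<le> K * sqrt q" and Q: "\<bar>Q - q\<bar> \<le> K * (q * sqrt q)"
  defines "E \<equiv> fexp (R - sqrt s)" and "E' \<equiv> fexp' (R - sqrt s)"
  shows "E * (d * Q / s - d - \<tau>) + Q * E' / sqrt s \<ge> sqrt s * E' / 4 - (d + 1) * e / s"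
proof -
  define \<sigma> where "\<sigma> = sqrt s"
  have s0: "s > 0" and \<sigma>0: "\<sigma> > 0" and ss: "s = \<sigma> * \<sigma>"
    using s q e by (auto simp: \<sigma>_def)
  have q\<sigma>: "sqrt q \<le> \<sigma>" using s e by (simp add: \<sigma>_def)
  have E: "0 \<le> E" "E \<le> 1" and E': "0 \<le> E'" "E' \<le> 2"
    by (auto simp: E_def E'_def fexp_nonneg fexp_le_1 fexp'_nonneg fexp'_le)
  have \<sigma>R: "\<sigma> < R" using sR by (simp add: \<sigma>_def)
  have EE': "E \<le> R\<^sup>2 * E'"
  proof -
    have "(R - \<sigma>)\<^sup>2 \<le> R\<^sup>2" using \<sigma>R \<sigma>0 by (intro power_mono) auto
    then show ?thesis unfolding E_def E'_def fexp_eq_fexp' \<sigma>_def[symmetric]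
      by (intro mult_right_mono fexp'_nonneg)
  qed
  have Q1: "Q \<ge> q - K * q * \<sigma>"
  proof -
    have "K * (q * sqrt q) \<le> K * (q * \<sigma>)"
      using K q q\<sigma> by (intro mult_left_mono) auto
    then show ?thesis using Q by (simp add: mult.assoc)
  qed
  have Q2: "Q \<ge> q / 2"
  proof -
    have "K * \<sigma> \<le> K * R" using K \<sigma>R by (intro mult_left_mono) auto
    then have "K * \<sigma> \<le> 1 / 2" using K by linarith
    then have "q * (K * \<sigma>) \<le> q * (1 / 2)" by (rule mult_left_mono) (rule q)
    then show ?thesis using Q1 by (simp add: mult_ac)
  qed
  \<comment> \<open>\<open>Q / s\<close> falls short of 1 by at most \<open>e / s\<close>, from the
    regularisation, and \<open>K * \<sigma>\<close>, from freezing.\<close>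
  have T1: "d * Q / s - d - \<tau> \<ge> - d * e / s - (d + 1) * K * \<sigma>"
  proof -
    have "d * Q / s \<ge> d * (q - K * q * \<sigma>) / s"
      using Q1 d s0 by (intro divide_right_mono mult_left_mono) auto
    moreover have "d * (q - K * q * \<sigma>) / s - d = - d * e / s - d * (K * \<sigma>) * (q / s)"
    proof -
      have "d * (q - K * q * \<sigma>) / s = d * (q / s) - d * (K * \<sigma>) * (q / s)"
        by (simp add: diff_divide_distrib right_diff_distrib mult_ac)
      moreover have "d * (q / s) = d - d * e / s"
        using s0 s by (simp add: field_simps)
      ultimately show ?thesis by simp
    qed
    moreover have "d * (K * \<sigma>) * (q / s) \<le> d * (K * \<sigma>) * 1"
      using d K \<sigma>0 s e s0 by (intro mult_left_mono) auto
    moreover have "\<tau> \<le> K * \<sigma>"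
      using \<tau> mult_left_mono[OF q\<sigma> K(1)] by linarith
    ultimately show ?thesis by (simp add: algebra_simps)
  qed
  have "E * (d * Q / s - d - \<tau>) \<ge> E * (- d * e / s - (d + 1) * K * \<sigma>)"
    by (rule mult_left_mono[OF T1 E(1)])
  moreover have "E * (d * e / s) \<le> 1 * (d * e / s)"
    using E d e s0 by (intro mult_right_mono) auto
  moreover have "E * ((d + 1) * K * \<sigma>) \<le> \<sigma> * E' / 4"
  proof -
    have "E * ((d + 1) * K * \<sigma>) \<le> (R\<^sup>2 * E') * ((d + 1) * K * \<sigma>)"
      using EE' d K \<sigma>0 by (intro mult_right_mono) auto
    also have "\<dots> = ((d + 1) * K * R\<^sup>2) * (\<sigma> * E')" by simp
    also have "\<dots> \<le> (1 / 4) * (\<sigma> * E')"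
      using K \<sigma>0 E' by (intro mult_right_mono) auto
    finally show ?thesis by simp
  qed
  ultimately have A: "E * (d * Q / s - d - \<tau>) \<ge> - (d * e / s) - \<sigma> * E' / 4"
    by (simp add: algebra_simps)
  have "Q * E' / \<sigma> \<ge> (q / 2) * E' / \<sigma>"
    using Q2 E' \<sigma>0 by (intro divide_right_mono mult_right_mono) auto
  moreover have "(q / 2) * E' / \<sigma> = \<sigma> * E' / 2 - e / s * (\<sigma> * E' / 2)"
  proof -
    have "q = \<sigma> * \<sigma> - e" using s ss by simp
    then have "q / \<sigma> = \<sigma> - e / s * \<sigma>" unfolding ss using \<sigma>0 by (simp add: field_simps)
    then have "(q / \<sigma>) * (E' / 2) = (\<sigma> - e / s * \<sigma>) * (E' / 2)" by (rule arg_cong)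
    also have "\<dots> = \<sigma> * E' / 2 - e / s * (\<sigma> * E' / 2)" by (simp add: left_diff_distrib)
    finally show ?thesis by simp
  qed
  moreover have "e / s * (\<sigma> * E' / 2) \<le> e / s * 1"
  proof -
    have "\<sigma> * E' \<le> 1 * 2" using \<sigma>R R E' \<sigma>0 by (intro mult_mono) auto
    then show ?thesis using e s0 by (intro mult_left_mono) auto
  qed
  ultimately have B: "Q * E' / \<sigma> \<ge> \<sigma> * E' / 2 - e / s" by simp
  show ?thesis using A B unfolding \<sigma>_def[symmetric]
    by (simp add: algebra_simps add_divide_distrib)
qed

lemma antiderivative_at_right:
  fixes p :: "real \<Rightarrow> real"
  assumes "continuous_on {0<..} p" "c > 0"
  obtains H where "\<And>s. s > c \<Longrightarrow> (H has_real_derivative p s) (at s)"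
proof -
  have "((\<lambda>s. integral {c..s} p) has_real_derivative p s) (at s)" if "s > c" for s
  proof -
    have "((\<lambda>s. integral {c..s} p) has_real_derivative p s) (at s within {c..s + 1})"
      using that assms by (intro integral_has_real_derivative continuous_on_subset[OF assms(1)]) auto
    moreover have "s \<in> interior {c..s + 1}" using that by simp
    ultimately show ?thesis by (metis at_within_interior)
  qed
  then show thesis by (rule that)
qed

text \<open>With \<open>s = q + e\<close>, the function \<open>H\<close> below has derivative \<open>- s powr (- d / 2) * fexp (R - sqrt s)\<close>:
  it is the fundamental solution of the operator frozen at \<open>y\<close>, regularised at scale \<open>sqrt e\<close> and cut off
  at radius \<open>R\<close>. The decay of \<open>fexp (R - sqrt s)\<close> produces the positive term that absorbs the
  errors made by freezing the coefficients.\<close>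

lemma barrier:
  fixes a :: "real^'d::finite \<Rightarrow> real^'d^'d" and b :: "real^'d \<Rightarrow> real^'d" and y :: "real^'d"
  assumes "spd (a y) lam Lam"
  defines "A \<equiv> spd.A (a y)"
  defines "q \<equiv> \<lambda>x. (x - y) \<bullet> (A *v (x - y))"
  assumes R: "0 < R" "R \<le> 1" and e: "e > 0"
    and K: "K \<ge> 0" "K * R \<le> 1 / 2" "(real CARD('d) + 1) * K * R\<^sup>2 \<le> 1 / 4"
    and \<tau>: "\<And>x. q x < R\<^sup>2 \<Longrightarrow> \<bar>A \<bullet> (a x - a y) + 2 * (b x \<bullet> (A *v (x - y)))\<bar> \<le> K * sqrt (q x)"
    and Q: "\<And>x. q x < R\<^sup>2 \<Longrightarrow> \<bar>(A *v (x - y)) \<bullet> ((a x - a y) *v (A *v (x - y)))\<bar> \<le> K * (q x * sqrt (q x))"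
  obtains v where "smooth_cs v"
    "\<And>x. gen b a v x \<ge> (q x + e) powr (- (real CARD('d) / 2)) *
      (sqrt (q x + e) * fexp' (R - sqrt (q x + e)) / 4 - (real CARD('d) + 1) * e / (q x + e))"
proof -
  interpret S: spd "a y" lam Lam by fact
  note A_sym' = S.A_sym[folded A_def]
  let ?d = "real CARD('d)"
  define p where "p s = s powr (- (?d / 2)) * fexp (R - sqrt s)" for s
  define p1 where "p1 s = - (?d / 2) * s powr (- (?d / 2) - 1) * fexp (R - sqrt s)
     - s powr (- (?d / 2)) * (fexp' (R - sqrt s) / (2 * sqrt s))" for s
  have p: "(p has_real_derivative p1 s) (at s)" if "s > 0" for s
    unfolding p_def p1_def using that
    by (auto intro!: derivative_eq_intros DERIV_chain2[OF fexp_has_derivative] simp: field_simps)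
  then have "continuous_on {0<..} p"
    by (intro DERIV_atLeastAtMost_imp_continuous_on continuous_at_imp_continuous_on ballI)
      (auto intro: DERIV_isCont)
  \<comment> \<open>The integrand is singular at 0. The base point \<open>e / 2\<close> lies
    strictly below every value \<open>q x + e\<close>, so two-sided derivatives exist wherever they
    are taken.\<close>
  then obtain H0 where H0: "\<And>s. s > e / 2 \<Longrightarrow> (H0 has_real_derivative p s) (at s)"
    using antiderivative_at_right[of p "e / 2"] e by auto
  \<comment> \<open>\<open>p\<close> vanishes from \<open>R^2\<close> on, so subtracting the value
    there makes \<open>H\<close> vanish for large \<open>s\<close>, which gives compact support. The
    maximum with \<open>e\<close> keeps the reference point in the domain where \<open>H0\<close> is
    an antiderivative.\<close>
  define H where "H s = H0 (max (R\<^sup>2) e) - H0 s" for s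
  have H: "(H has_real_derivative - p s) (at s)" if "s > e / 2" for s
    unfolding H_def using H0[OF that] by (auto intro!: derivative_eq_intros)
  have H_zero: "H s = 0" if "s \<ge> max (R\<^sup>2) e" for s
  proof -
    have "(H0 has_real_derivative 0) (at x within {max (R\<^sup>2) e..})" if "x \<in> {max (R\<^sup>2) e..}" for x
    proof -
      have "R \<le> sqrt x" using that R by (simp add: real_le_rsqrt)
      then have "p x = 0" by (simp add: p_def fexp_def)
      then show ?thesis using H0[of x] that e by (auto intro: has_field_derivative_at_within)
    qed
    then have "\<exists>c. \<forall>x\<in>{max (R\<^sup>2) e..}. H0 x = c"
      by (intro has_field_derivative_zero_constant convex_real_interval)
    then show ?thesis using that unfolding H_def by force
  qed
  define v where "v x = H (q x + e)" for x
  have q_nonneg: "q x \<ge> 0" for x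
    unfolding q_def A_def by (rule S.q_nonneg)
  have s_pos: "q x + e > e / 2" "q x + e > 0" for x
    using q_nonneg[of x] e by auto
  have diff_s: "(\<lambda>x. q x + e) differentiable (at x)" for x
    unfolding q_def by (rule differentiable_quad[OF A_sym'])
  have sm_s: "sm (\<lambda>x. q x + e)"
    unfolding q_def by (rule sm_quad)
  have sm_p: "sm (\<lambda>x. p (q x + e))"
    unfolding p_def by (intro sm.mult sm_powr sm_fexp sm_diff sm.const sm_sqrt sm_s s_pos)
  have "smooth v"
  proof (rule smooth_if_pd)
    show "v differentiable (at x)" for x
      unfolding v_def by (rule differentiable_comp_real[OF diff_s H[OF s_pos(1)]])
    have "pd i v = (\<lambda>x. -1 * p (q x + e) * (2 * (A *v (x - y)) $ i))" for i
    proof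
      fix x
      show "pd i v x = -1 * p (q x + e) * (2 * (A *v (x - y)) $ i)"
        unfolding v_def using pd_comp[OF diff_s H[OF s_pos(1)], of i x] pd_quad[OF A_sym', of i y e x]
        by (simp add: q_def)
    qed
    then show "smooth (pd i v)" for i
      by (simp only:) (intro sm_imp_smooth sm.mult sm_p sm.const sm_linear)
  qed
  moreover have "bounded {x. v x \<noteq> 0}"
  proof -
    have "norm x \<le> norm y + sqrt (max (R\<^sup>2) e * Lam\<^sup>2 / lam)" if "v x \<noteq> 0" for x
    proof -
      have "q x < max (R\<^sup>2) e" using that H_zero[of "q x + e"] e unfolding v_def by linarith
      then have "lam / Lam\<^sup>2 * (norm (x - y))\<^sup>2 \<le> max (R\<^sup>2) e"
        using S.q_ge[of "x - y"] unfolding q_def A_def by linarith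
      then have "(norm (x - y))\<^sup>2 \<le> max (R\<^sup>2) e * Lam\<^sup>2 / lam"
        using S.lam S.Lam_pos by (simp add: field_simps)
      then have "norm (x - y) \<le> sqrt (max (R\<^sup>2) e * Lam\<^sup>2 / lam)"
        by (rule real_le_rsqrt)
      then show ?thesis using norm_triangle_sub[of x y] by linarith
    qed
    then show ?thesis unfolding bounded_iff by blast
  qed
  ultimately have "smooth_cs v" by (simp add: smooth_cs_iff)
  moreover have "gen b a v x \<ge> (q x + e) powr (- (?d / 2)) *
      (sqrt (q x + e) * fexp' (R - sqrt (q x + e)) / 4 - (?d + 1) * e / (q x + e))" for x
  proof -
    define s where "s = q x + e"
    define w where "w = A *v (x - y)"
    define QQ where "QQ = w \<bullet> (a x *v w)"
    define \<tau>' where "\<tau>' = A \<bullet> (a x - a y) + 2 * (b x \<bullet> w)"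
    have s0: "s > 0" using s_pos by (simp add: s_def)
    have "gen b a v x = - p s * (2 * (b x \<bullet> w) + A \<bullet> a x) + 2 * (- p1 s) * QQ"
    proof -
      have 1: "(H has_real_derivative - p (q x + e)) (at (q x + e))" for x
        by (rule H[OF s_pos(1)])
      have 2: "((\<lambda>s. - p s) has_real_derivative - p1 (q x + e)) (at (q x + e))" for x
        by (rule DERIV_minus[OF p[OF s_pos(2)]])
      show ?thesis
        using gen_radial[OF A_sym', of H "\<lambda>s. - p s" y e "\<lambda>s. - p1 s" b a x,
            OF 1[unfolded q_def] 2[unfolded q_def]]
        unfolding v_def s_def w_def QQ_def q_def by simp
    qed
    also have "2 * (b x \<bullet> w) + A \<bullet> a x = ?d + \<tau>'"
      using S.A_inner unfolding \<tau>'_def A_def by (simp add: inner_diff_right)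
    finally have gen_v: "gen b a v x = - p s * (?d + \<tau>') - 2 * p1 s * QQ" by simp
    show ?thesis
    proof (cases "sqrt s < R")
      case False
      then have "gen b a v x = 0" unfolding gen_v by (simp add: p_def p1_def fexp_def fexp'_def)
      moreover have "fexp' (R - sqrt s) = 0" using False by (simp add: fexp'_def)
      ultimately show ?thesis using s0 e unfolding s_def[symmetric]
        by (auto intro!: mult_nonneg_nonpos)
    next
      case True
      have "(sqrt s)\<^sup>2 < R\<^sup>2"
        using True s0 by (intro power_strict_mono) auto
      then have "s < R\<^sup>2" using s0 by simp
      then have qR: "q x < R\<^sup>2" using e by (simp add: s_def)
      have QQ: "QQ - q x = w \<bullet> ((a x - a y) *v w)"
      proof -
        have "w \<bullet> (a y *v w) = q x"
          unfolding w_def q_def A_def by (simp add: S.aA inner_commute)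
        then show ?thesis by (simp add: QQ_def matrix_vector_mult_diff_rdistrib inner_diff_right)
      qed
      have ineq: "fexp (R - sqrt s) * (?d * QQ / s - ?d - \<tau>') + QQ * fexp' (R - sqrt s) / sqrt s
          \<ge> sqrt s * fexp' (R - sqrt s) / 4 - (?d + 1) * e / s"
      proof (rule barrier_inequality[where q = "q x" and K = K])
        show "1 \<le> ?d" by (simp add: Suc_leI)
        show "\<bar>\<tau>'\<bar> \<le> K * sqrt (q x)" unfolding \<tau>'_def w_def by (rule \<tau>[OF qR])
        show "\<bar>QQ - q x\<bar> \<le> K * (q x * sqrt (q x))" unfolding QQ w_def by (rule Q[OF qR])
      qed (use True s_def q_nonneg e R K in auto)
      have "gen b a v x = s powr (- (?d / 2)) *
          (fexp (R - sqrt s) * (?d * QQ / s - ?d - \<tau>') + QQ * fexp' (R - sqrt s) / sqrt s)"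
      proof -
        have 1: "s powr (- (?d / 2) - 1) = s powr (- (?d / 2)) / s"
          using s0 by (simp only: powr_diff) simp
        define G where "G = s powr (- (?d / 2))"
        show ?thesis
          unfolding gen_v p_def p1_def 1 unfolding G_def[symmetric] using s0
          by (simp add: algebra_simps add_divide_distrib)
      qed
      also have "\<dots> \<ge> s powr (- (?d / 2)) * (sqrt s * fexp' (R - sqrt s) / 4 - (?d + 1) * e / s)"
        by (rule mult_left_mono[OF ineq]) simp
      finally show ?thesis by (simp add: s_def)
    qed
  qed
  ultimately show thesis by (rule that)
qed

lemma integrable_bounded_mult:
  fixes f g :: "'a \<Rightarrow> real"
  assumes "integrable M g" "f \<in> borel_measurable M" "\<And>x. \<bar>f x\<bar> \<le> C"
  shows "integrable M (\<lambda>x. f x * g x)"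
proof (rule Bochner_Integration.integrable_bound)
  show "integrable M (\<lambda>x. C * g x)" using assms by simp
  show "AE x in M. norm (f x * g x) \<le> norm (C * g x)"
  proof (rule AE_I2)
    fix x
    have "\<bar>f x\<bar> * \<bar>g x\<bar> \<le> \<bar>C\<bar> * \<bar>g x\<bar>"
      using assms(3)[of x] by (intro mult_right_mono) linarith+
    then show "norm (f x * g x) \<le> norm (C * g x)" by (simp add: abs_mult)
  qed
qed (use assms in auto)

lemma pd_zero:
  assumes "open U" "x \<in> U" "\<And>x. x \<in> U \<Longrightarrow> f x = 0"
  shows "pd i f x = 0"
proof -
  have "(f has_derivative (\<lambda>v. 0)) (at x)"
    by (rule has_derivative_transform_within_open[OF has_derivative_const assms(1,2)])
      (simp add: assms(3))
  from pd_eqI[OF this] show ?thesis .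
qed

lemma gen_zero:
  assumes "open U" "x \<in> U" "\<And>x. x \<in> U \<Longrightarrow> f x = 0"
  shows "gen b a f x = 0"
  using pd_zero[OF assms] pd_zero[OF assms(1,2), of "pd i f" for i] pd_zero[OF assms(1) _ assms(3)]
  by (simp add: gen_def)

lemma gen_continuous:
  assumes "continuous_on UNIV a" "continuous_on UNIV b" "smooth f"
  shows "continuous_on UNIV (gen b a f)"
  unfolding gen_def
  by (intro continuous_intros assms smooth_continuous smooth_pd)

lemma gen_bounded:
  fixes f :: "real^'d::finite \<Rightarrow> real"
  assumes "continuous_on UNIV a" "continuous_on UNIV b" "smooth_cs f"
  obtains C where "C > 0" "\<And>x. \<bar>gen b a f x\<bar> \<le> C"
proof -
  let ?S = "closure {x. f x \<noteq> 0}"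
  have f: "smooth f" "bounded {x. f x \<noteq> 0}" using assms by (auto simp: smooth_cs_iff)
  then have "compact ?S" by (simp add: compact_closure)
  moreover have "continuous_on ?S (gen b a f)"
    using gen_continuous[OF assms(1,2) f(1)] continuous_on_subset by blast
  ultimately have "bounded (gen b a f ` ?S)"
    using compact_continuous_image compact_imp_bounded by blast
  then obtain C where C: "C > 0" "\<And>x. x \<in> ?S \<Longrightarrow> \<bar>gen b a f x\<bar> \<le> C"
    unfolding bounded_pos by (metis imageI real_norm_def)
  have "gen b a f x = 0" if "x \<notin> ?S" for x
    by (rule gen_zero[of "- ?S"])
      (use that closure_subset[of "{x. f x \<noteq> 0}"] in \<open>auto simp: closed_Compl\<close>)
  then have "\<bar>gen b a f x\<bar> \<le> C" for x
    using C by (cases "x \<in> ?S") (auto simp: less_imp_le)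
  then show thesis using C(1) that by blast
qed

lemma smooth_cs_bounded:
  fixes f :: "real^'d::finite \<Rightarrow> real"
  assumes "smooth_cs f"
  obtains C where "C > 0" "\<And>x. \<bar>f x\<bar> \<le> C"
proof -
  let ?S = "closure {x. f x \<noteq> 0}"
  have f: "smooth f" "bounded {x. f x \<noteq> 0}" using assms by (auto simp: smooth_cs_iff)
  then have "compact ?S" by (simp add: compact_closure)
  then have "bounded (f ` ?S)"
    using compact_continuous_image compact_imp_bounded smooth_continuous[OF f(1)] by blast
  then obtain C where C: "C > 0" "\<And>x. x \<in> ?S \<Longrightarrow> \<bar>f x\<bar> \<le> C"
    unfolding bounded_pos by (metis imageI real_norm_def)
  have "\<bar>f x\<bar> \<le> C" for x
  proof (cases "f x = 0")
    case False
    then have "x \<in> {x. f x \<noteq> 0}" by simp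
    then have "x \<in> ?S" by (rule subsetD[OF closure_subset])
    then show ?thesis by (rule C(2))
  qed (use C in simp)
  then show thesis using C(1) that by blast
qed

section \<open>Local lower bounds for infinitesimally invariant densities\<close>

lemma abs_kern_le:
  fixes z :: "real^'d::finite"
  assumes "t > 0"
  shows "\<bar>kern t z\<bar> \<le> t * t powr (- (real CARD('d) / 2 + 1))"
proof -
  have "kern t z \<le> t * t powr (- (real CARD('d) / 2 + 1))"
    unfolding kern_def using assms by (intro mult_left_mono powr_mono2') auto
  then show ?thesis using kern_nonneg[of t z] assms by simp
qed

locale local_elliptic =
  fixes a :: "real^'d::finite \<Rightarrow> real^'d^'d" and b :: "real^'d \<Rightarrow> real^'d"
    and x0 :: "real^'d" and lam Lam B L :: real
  assumes spd: "\<And>y. y \<in> ball x0 2 \<Longrightarrow> spd (a y) lam Lam"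
    and B: "\<And>x. x \<in> ball x0 2 \<Longrightarrow> norm (b x) \<le> B"
    and L: "\<And>x y. x \<in> ball x0 2 \<Longrightarrow> y \<in> ball x0 2 \<Longrightarrow> norm (a x - a y) \<le> L * norm (x - y)"
    and cont: "continuous_on UNIV a" "continuous_on UNIV b"
begin

lemma pos: "0 < lam" "0 < Lam" "0 \<le> B" "0 \<le> L"
proof -
  have x0: "x0 \<in> ball x0 2" by simp
  show "0 < lam" "0 < Lam" using spd.lam[OF spd[OF x0]] spd.Lam_pos[OF spd[OF x0]] .
  show "0 \<le> B" using B[OF x0] norm_ge_zero order_trans by blast
  obtain e :: "real^'d" where e: "norm e = 1"
    using vector_choose_size[of 1] by auto
  have "norm (a (x0 + e) - a x0) \<le> L"
    using L[of "x0 + e" x0] e by (simp add: dist_norm)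
  then show "0 \<le> L" by (rule order_trans[OF norm_ge_zero])
qed

definition c1 where "c1 = lam / Lam\<^sup>2"

text \<open>The two quotients are the constants of the first- and second-order freezing errors. The
  summand 1 makes \<open>KK\<close> at least 1, so that dividing by it is safe in the choice of the
  cutoff radius.\<close>

definition KK where "KK = 1 + (real CARD('d) / lam * L + 2 * B / lam) / sqrt c1 + L / (lam\<^sup>2 * c1 * sqrt c1)"

lemma c1_pos: "c1 > 0" unfolding c1_def using pos by simp

lemma KK_ge_1: "KK \<ge> 1"
  unfolding KK_def using pos c1_pos by simp

text \<open>The bound \<open>q <= c1\<close> forces \<open>norm (x - y) <= 1\<close>, so the
  Lipschitz estimate applies at \<open>x\<close>; each factor \<open>norm (x - y)\<close> is then at
  most \<open>sqrt q / sqrt c1\<close>.\<close>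

lemma freezing:
  fixes x y :: "real^'d"
  defines "A \<equiv> spd.A (a y)"
  defines "q \<equiv> (x - y) \<bullet> (A *v (x - y))"
  assumes y: "y \<in> ball x0 1" and q: "q \<le> c1"
  shows "\<bar>A \<bullet> (a x - a y) + 2 * (b x \<bullet> (A *v (x - y)))\<bar> \<le> KK * sqrt q"
    "\<bar>(A *v (x - y)) \<bullet> ((a x - a y) *v (A *v (x - y)))\<bar> \<le> KK * (q * sqrt q)"
proof -
  have y2: "y \<in> ball x0 2" using y by simp
  interpret S: spd "a y" lam Lam by (rule spd[OF y2])
  let ?z = "x - y" and ?d = "real CARD('d)"
  have q0: "q \<ge> 0" unfolding q_def A_def by (rule S.q_nonneg)
  have zq: "c1 * (norm ?z)\<^sup>2 \<le> q" unfolding q_def A_def c1_def by (rule S.q_ge)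
  then have "(norm ?z)\<^sup>2 \<le> q / c1" using c1_pos by (simp add: field_simps)
  then have zs: "norm ?z \<le> sqrt q / sqrt c1"
    by (metis real_sqrt_divide real_le_rsqrt)
  have "c1 * (norm ?z)\<^sup>2 \<le> c1 * 1" using zq q by simp
  then have "(norm ?z)\<^sup>2 \<le> 1\<^sup>2" using c1_pos by simp
  then have "norm ?z \<le> 1" by (rule power2_le_imp_le) simp
  then have x2: "x \<in> ball x0 2"
    using y norm_triangle_ineq[of "x - y" "y - x0"] by (simp add: dist_norm norm_minus_commute)
  have da: "norm (a x - a y) \<le> L * norm ?z" by (rule L[OF x2 y2])
  have Az: "norm (A *v ?z) \<le> norm ?z / lam" unfolding A_def by (rule S.norm_Az)
  have "\<bar>A \<bullet> (a x - a y)\<bar> \<le> norm A * norm (a x - a y)"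
    by (rule Cauchy_Schwarz_ineq2)
  also have "\<dots> \<le> (?d / lam) * (L * norm ?z)"
    by (intro mult_mono S.norm_A[folded A_def] da) (use pos in auto)
  finally have 1: "\<bar>A \<bullet> (a x - a y)\<bar> \<le> ?d / lam * L * norm ?z" by simp
  have "\<bar>b x \<bullet> (A *v ?z)\<bar> \<le> norm (b x) * norm (A *v ?z)"
    by (rule Cauchy_Schwarz_ineq2)
  also have "\<dots> \<le> B * (norm ?z / lam)"
    by (intro mult_mono B x2 Az) (use pos in auto)
  finally have 2: "\<bar>2 * (b x \<bullet> (A *v ?z))\<bar> \<le> 2 * B / lam * norm ?z" by simp
  have "\<bar>A \<bullet> (a x - a y) + 2 * (b x \<bullet> (A *v ?z))\<bar> \<le> (?d / lam * L + 2 * B / lam) * norm ?z"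
    using 1 2 by (simp add: distrib_right)
  also have "\<dots> \<le> (?d / lam * L + 2 * B / lam) * (sqrt q / sqrt c1)"
    by (intro mult_left_mono zs) (use pos in auto)
  also have "\<dots> = ((?d / lam * L + 2 * B / lam) / sqrt c1) * sqrt q" by simp
  also have "\<dots> \<le> KK * sqrt q"
    unfolding KK_def using pos c1_pos q0 by (intro mult_right_mono) auto
  finally show "\<bar>A \<bullet> (a x - a y) + 2 * (b x \<bullet> (A *v ?z))\<bar> \<le> KK * sqrt q" .
  have "\<bar>(A *v ?z) \<bullet> ((a x - a y) *v (A *v ?z))\<bar> \<le> norm (A *v ?z) * norm ((a x - a y) *v (A *v ?z))"
    by (rule Cauchy_Schwarz_ineq2)
  also have "\<dots> \<le> norm (A *v ?z) * (norm (a x - a y) * norm (A *v ?z))"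
    by (intro mult_left_mono norm_matrix_vector_le) auto
  also have "\<dots> \<le> (norm ?z / lam) * ((L * norm ?z) * (norm ?z / lam))"
    by (intro mult_mono Az da) (use pos in auto)
  also have "\<dots> = L / lam\<^sup>2 * (norm ?z)\<^sup>2 * norm ?z"
    by (simp add: power2_eq_square)
  also have "\<dots> \<le> L / lam\<^sup>2 * (q / c1) * (sqrt q / sqrt c1)"
    by (intro mult_mono zs \<open>(norm ?z)\<^sup>2 \<le> q / c1\<close>) (use pos c1_pos q0 in auto)
  also have "\<dots> = (L / (lam\<^sup>2 * c1 * sqrt c1)) * (q * sqrt q)" by simp
  also have "\<dots> \<le> KK * (q * sqrt q)"
    unfolding KK_def using pos c1_pos q0 by (intro mult_right_mono) auto
  finally show "\<bar>(A *v ?z) \<bullet> ((a x - a y) *v (A *v ?z))\<bar> \<le> KK * (q * sqrt q)" .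
qed

lemma lower_bound:
  assumes \<rho>: "integrable lborel \<rho>" "\<And>x. 0 \<le> \<rho> x"
    and inv: "\<And>v. smooth_cs v \<Longrightarrow> (\<integral>x. gen b a v x * \<rho> x \<partial>lborel) = 0"
  obtains C r0 where "C > 0" "r0 > 0" "r0 \<le> 1"
    "\<And>y t. y \<in> ball x0 1 \<Longrightarrow> 0 < t \<Longrightarrow> t < r0 \<Longrightarrow>
      (\<integral>\<^sup>+x. indicator (ball y r0) x * ennreal (\<rho> x) \<partial>lborel) \<le>
        ennreal C * (\<integral>\<^sup>+x. ennreal (kern t (x - y)) * ennreal (\<rho> x) \<partial>lborel)"
proof -
  let ?d = "real CARD('d)"
  have d1: "?d \<ge> 1" by (simp add: Suc_leI)
  \<comment> \<open>\<open>sqrt c1\<close> keeps the region \<open>q < R^2\<close> within the range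
    of \<open>freezing\<close>; the last bound yields the two smallness conditions of the
    barrier.\<close>
  define R where "R = min (min 1 (sqrt c1)) (1 / (4 * KK * (1 + ?d)))"
  have R: "0 < R" "R \<le> 1" "R \<le> sqrt c1" "R \<le> 1 / (4 * KK * (1 + ?d))"
    unfolding R_def using c1_pos KK_ge_1 by auto
  have KR: "KK * R * (1 + ?d) \<le> 1 / 4"
  proof -
    have "4 * KK * (1 + ?d) > 0" using KK_ge_1 by (intro mult_pos_pos) auto
    then have "R * (4 * KK * (1 + ?d)) \<le> 1" using R(4) by (simp only: pos_le_divide_eq)
    then show ?thesis by (simp add: mult_ac)
  qed
  have "KK * R * 1 \<le> KK * R * (1 + ?d)"
    using KK_ge_1 R by (intro mult_left_mono) auto
  then have KR1: "KK * R \<le> 1 / 2" using KR by linarith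
  have KR2: "(?d + 1) * KK * R\<^sup>2 \<le> 1 / 4"
  proof -
    have "(KK * R * (1 + ?d)) * R \<le> (1 / 4) * 1"
      using KR R KK_ge_1 by (intro mult_mono) auto
    then show ?thesis by (simp add: power2_eq_square mult_ac add.commute)
  qed
  \<comment> \<open>Below both \<open>c1\<close> and 1, so that
    \<open>q >= c1 * norm (x - y)^2\<close> and \<open>t\<close> can be bounded below with one
    common factor.\<close>
  define c2 where "c2 = min c1 1"
  have c2: "0 < c2" "c2 \<le> c1" "c2 \<le> 1" unfolding c2_def using c1_pos by auto
  \<comment> \<open>On the ball of radius \<open>r0\<close> this gives \<open>q <= R^2 / 9\<close>
    and \<open>t < R^2 / 8\<close>, hence \<open>sqrt s <= R / 2\<close>: the cutoff derivative is
    taken at an argument between \<open>R / 2\<close> and 1, where it is at least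
    \<open>exp (- (2 / R))\<close>. The constant \<open>c0\<close> is a quarter of that
    value.\<close>
  define r0 where "r0 = min (R\<^sup>2 / 8) (R * sqrt lam / 3)"
  have r0: "r0 > 0" "r0 \<le> 1" "r0 \<le> R\<^sup>2 / 8" "r0 \<le> R * sqrt lam / 3"
    unfolding r0_def using R pos power_le_one[of R 2] by auto
  define c0 where "c0 = exp (- (2 / R)) / 4"
  have c0: "c0 > 0" unfolding c0_def by simp
  define C2 where "C2 = (?d + 1) * c2 powr (- (?d / 2 + 1))"
  have C2: "C2 > 0" unfolding C2_def using c2 by simp
  have main: "c0 * (\<integral>x. indicator (ball y r0) x * \<rho> x \<partial>lborel) \<le> C2 * (\<integral>x. kern t (x - y) * \<rho> x \<partial>lborel)"
    if y: "y \<in> ball x0 1" and t: "0 < t" "t < r0" for y t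
  proof -
    have "y \<in> ball x0 2" using y by simp
    then interpret spd "a y" lam Lam by (rule spd)
    define q where "q x = (x - y) \<bullet> (A *v (x - y))" for x
    have qc: "q x \<le> c1" if "q x < R\<^sup>2" for x
    proof -
      have "R\<^sup>2 \<le> (sqrt c1)\<^sup>2" using R by (intro power_mono) auto
      then show ?thesis using that c1_pos by simp
    qed
    obtain v where v: "smooth_cs v"
      and gv: "\<And>x. gen b a v x \<ge> (q x + t) powr (- (?d / 2)) *
        (sqrt (q x + t) * fexp' (R - sqrt (q x + t)) / 4 - (?d + 1) * t / (q x + t))"
    proof (rule barrier[where a = a and b = b and y = y and lam = lam and Lam = Lam and R = R and e = t and K = KK])
      show "\<bar>A \<bullet> (a x - a y) + 2 * (b x \<bullet> (A *v (x - y)))\<bar> \<le> KK * sqrt ((x - y) \<bullet> (A *v (x - y)))"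
        "\<bar>(A *v (x - y)) \<bullet> ((a x - a y) *v (A *v (x - y)))\<bar>
          \<le> KK * ((x - y) \<bullet> (A *v (x - y)) * sqrt ((x - y) \<bullet> (A *v (x - y))))"
        if "(x - y) \<bullet> (A *v (x - y)) < R\<^sup>2" for x
        using freezing[OF y, of x] qc[of x] that unfolding q_def by auto
    qed (use KK_ge_1 spd[OF \<open>y \<in> ball x0 2\<close>] R t KR1 KR2 in \<open>auto simp: q_def\<close>)
    have bound: "c0 * indicator (ball y r0) x - C2 * kern t (x - y) \<le> gen b a v x" for x
    proof -
      define s where "s = q x + t"
      have q0: "q x \<ge> 0" unfolding q_def by (rule q_nonneg)
      have s0: "s > 0" using q0 t by (simp add: s_def)
      have "s powr (- (?d / 2)) * ((?d + 1) * t / s) \<le> C2 * kern t (x - y)"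
      proof -
        have "c2 * (norm (x - y))\<^sup>2 \<le> c1 * (norm (x - y))\<^sup>2"
          using c2 by (intro mult_right_mono) auto
        also have "\<dots> \<le> q x" unfolding q_def c1_def by (rule q_ge)
        finally have "c2 * (norm (x - y))\<^sup>2 \<le> q x" .
        moreover have "c2 * t \<le> 1 * t" using c2 t by (intro mult_right_mono) auto
        ultimately have "c2 * ((norm (x - y))\<^sup>2 + t) \<le> s"
          by (simp add: s_def distrib_left)
        then have "s powr (- (?d / 2 + 1)) \<le> (c2 * ((norm (x - y))\<^sup>2 + t)) powr (- (?d / 2 + 1))"
          using c2 t by (intro powr_mono2') (auto intro!: mult_pos_pos add_nonneg_pos)
        also have "\<dots> = c2 powr (- (?d / 2 + 1)) * ((norm (x - y))\<^sup>2 + t) powr (- (?d / 2 + 1))"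
          using c2 t by (simp add: powr_mult)
        finally have "(?d + 1) * t * s powr (- (?d / 2 + 1)) \<le>
            (?d + 1) * t * (c2 powr (- (?d / 2 + 1)) * ((norm (x - y))\<^sup>2 + t) powr (- (?d / 2 + 1)))"
          using t by (intro mult_left_mono) auto
        moreover have "s powr (- (?d / 2)) * ((?d + 1) * t / s) = (?d + 1) * t * s powr (- (?d / 2 + 1))"
          using s0 by (simp add: powr_diff)
        ultimately show ?thesis by (simp add: C2_def kern_def mult_ac)
      qed
      moreover have "c0 * indicator (ball y r0) x \<le> s powr (- (?d / 2)) * (sqrt s * fexp' (R - sqrt s) / 4)"
      proof (cases "x \<in> ball y r0")
        case True
        then have "norm (x - y) \<le> R * sqrt lam / 3"
          using r0 by (simp add: dist_norm norm_minus_commute)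
        then have "(norm (x - y))\<^sup>2 \<le> (R * sqrt lam / 3)\<^sup>2"
          by (intro power_mono) auto
        also have "\<dots> = R\<^sup>2 * lam / 9" using pos by (simp add: power_mult_distrib power_divide)
        finally have "(norm (x - y))\<^sup>2 / lam \<le> R\<^sup>2 / 9" using pos by (simp add: field_simps)
        then have "q x \<le> R\<^sup>2 / 9" using q_le[of "x - y"] unfolding q_def by linarith
        then have "s \<le> (R / 2)\<^sup>2" using t r0 by (simp add: s_def power_divide)
        then have sR: "sqrt s \<le> R / 2" using R by (intro real_le_lsqrt) auto
        have s1: "s \<le> 1" using \<open>s \<le> (R / 2)\<^sup>2\<close> power_le_one[of "R / 2" 2] R by simp
        define u where "u = R - sqrt s"
        have u: "R / 2 \<le> u" "u \<le> 1" "0 < u" using sR R s0 by (auto simp: u_def intro: order_trans[of _ R])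
        have "1 / u \<le> 2 / R" using u R by (simp add: field_simps)
        then have "exp (- (2 / R)) \<le> exp (- (1 / u))" by simp
        also have "\<dots> \<le> exp (- (1 / u)) / u\<^sup>2"
          using u power_le_one[of u 2] by (simp add: field_simps)
        finally have f: "exp (- (2 / R)) \<le> fexp' (R - sqrt s)"
          using u unfolding u_def[symmetric] by (simp add: fexp'_def)
        have "1 \<le> s powr (1 / 2 - ?d / 2)"
          using powr_mono2'[of "1 / 2 - ?d / 2" s 1] s0 s1 d1 by simp
        also have "\<dots> = s powr (- (?d / 2)) * sqrt s"
          using s0 by (simp add: powr_half_sqrt[symmetric] powr_add[symmetric])
        finally have "1 * (exp (- (2 / R)) / 4) \<le> (s powr (- (?d / 2)) * sqrt s) * (fexp' (R - sqrt s) / 4)"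
          using f by (intro mult_mono) auto
        then show ?thesis using True by (simp add: c0_def)
      next
        case False
        then show ?thesis using s0 by (simp add: fexp'_nonneg)
      qed
      ultimately show ?thesis
        using gv[of x] unfolding s_def[symmetric] by (simp add: right_diff_distrib)
    qed
    have i1: "integrable lborel (\<lambda>x. indicator (ball y r0) x * \<rho> x)"
      by (rule integrable_bounded_mult[OF \<rho>(1), where C = 1]) (auto simp: indicator_def)
    have i2: "integrable lborel (\<lambda>x. kern t (x - y) * \<rho> x)"
      by (rule integrable_bounded_mult[OF \<rho>(1) _ abs_kern_le[OF t(1)]]) auto
    obtain Cv where Cv: "\<And>x. \<bar>gen b a v x\<bar> \<le> Cv"
      using gen_bounded[OF cont v] by metis
    have i3: "integrable lborel (\<lambda>x. gen b a v x * \<rho> x)"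
      by (rule integrable_bounded_mult[OF \<rho>(1) _ Cv])
        (use gen_continuous[OF cont] v in \<open>auto simp: smooth_cs_iff intro: borel_measurable_continuous_onI\<close>)
    have "c0 * (\<integral>x. indicator (ball y r0) x * \<rho> x \<partial>lborel) - C2 * (\<integral>x. kern t (x - y) * \<rho> x \<partial>lborel)
      = (\<integral>x. c0 * (indicator (ball y r0) x * \<rho> x) - C2 * (kern t (x - y) * \<rho> x) \<partial>lborel)"
      using i1 i2 by simp
    also have "\<dots> \<le> (\<integral>x. gen b a v x * \<rho> x \<partial>lborel)"
    proof (rule integral_mono)
      show "c0 * (indicator (ball y r0) x * \<rho> x) - C2 * (kern t (x - y) * \<rho> x) \<le> gen b a v x * \<rho> x" for x
        using mult_right_mono[OF bound[of x] \<rho>(2)[of x]] by (simp add: left_diff_distrib mult.assoc)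
    qed (use i1 i2 i3 in auto)
    also have "\<dots> = 0" by (rule inv[OF v])
    finally show ?thesis by simp
  qed
  show thesis
  proof (rule that[of "C2 / c0" r0])
    show "0 < C2 / c0" using C2 c0 by simp
    fix y t assume y: "y \<in> ball x0 1" and t: "0 < t" "t < r0"
    have i1: "integrable lborel (\<lambda>x. indicator (ball y r0) x * \<rho> x)"
      by (rule integrable_bounded_mult[OF \<rho>(1), where C = 1]) (auto simp: indicator_def)
    have i2: "integrable lborel (\<lambda>x. kern t (x - y) * \<rho> x)"
      by (rule integrable_bounded_mult[OF \<rho>(1) _ abs_kern_le[OF t(1)]]) auto
    have "(\<integral>x. indicator (ball y r0) x * \<rho> x \<partial>lborel) \<le> C2 / c0 * (\<integral>x. kern t (x - y) * \<rho> x \<partial>lborel)"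
      using main[OF y t] c0 by (simp add: field_simps)
    moreover have "(\<integral>\<^sup>+x. indicator (ball y r0) x * ennreal (\<rho> x) \<partial>lborel) = ennreal (\<integral>x. indicator (ball y r0) x * \<rho> x \<partial>lborel)"
      by (subst nn_integral_eq_integral[symmetric, OF i1])
        (auto simp: \<rho> ennreal_mult' intro!: nn_integral_cong split: split_indicator)
    moreover have "(\<integral>\<^sup>+x. ennreal (kern t (x - y)) * ennreal (\<rho> x) \<partial>lborel) = ennreal (\<integral>x. kern t (x - y) * \<rho> x \<partial>lborel)"
      by (subst nn_integral_eq_integral[symmetric, OF i2])
        (use t in \<open>auto simp: \<rho> ennreal_mult' kern_nonneg intro!: nn_integral_cong\<close>)
    ultimately show "(\<integral>\<^sup>+x. indicator (ball y r0) x * ennreal (\<rho> x) \<partial>lborel) \<le>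
        ennreal (C2 / c0) * (\<integral>\<^sup>+x. ennreal (kern t (x - y)) * ennreal (\<rho> x) \<partial>lborel)"
      using C2 c0 by (simp add: ennreal_mult'[symmetric] ennreal_leI)
  qed (use r0 in auto)
qed

end

text \<open>A compact part of the zero set has positive distance from every point outside it. There
  the kernel convolved with its indicator tends to 0 at every point, and no differentiation theorem
  is called for.\<close>

lemma compact_subset_pos:
  fixes N :: "(real^'d::finite) set"
  assumes "N \<in> sets borel" "emeasure lborel N > 0" "bounded N"
  obtains T where "compact T" "T \<subseteq> N" "emeasure lborel T > 0"
proof -
  have fin: "emeasure lborel N < \<infinity>" using emeasure_bounded_finite[OF assms(3)] .
  then obtain m where m: "m > 0" "emeasure lborel N = ennreal m"
    using assms(2) by (cases "emeasure lborel N") auto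
  have leb: "N \<in> sets lebesgue" using assms(1) by simp
  obtain T where T: "closed T" "T \<subseteq> N" "emeasure lebesgue (N - T) < ennreal m"
    using sets_lebesgue_inner_closed[OF leb m(1)] by metis
  have Tb: "T \<in> sets borel" using T(1) by simp
  have "emeasure lborel T > 0"
  proof (rule ccontr)
    assume "\<not> emeasure lborel T > 0"
    then have 0: "emeasure lborel T = 0" by simp
    have "emeasure lborel N \<le> emeasure lborel (N - T) + emeasure lborel T"
      using emeasure_subadditive[of "N - T" lborel T] assms(1) Tb T(2)
      by (simp add: Un_absorb2)
    also have "\<dots> < ennreal m" using T(3) 0 assms(1) Tb by simp
    finally show False using m by simp
  qed
  moreover have "compact T"
    using T assms(3) bounded_subset compact_eq_bounded_closed by blast
  ultimately show thesis using T(2) that by blast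
qed

context local_elliptic
begin

text \<open>Let \<open>T\<close> be a compact part of the zero set of positive measure, and
  \<open>k t\<close> the convolution of the kernel with the indicator of \<open>T\<close>.
  Integrating the lower bound over \<open>y\<close> in \<open>T\<close> and exchanging the integrals
  bounds \<open>I\<close> times the measure of \<open>T\<close> by a multiple of the integral of
  \<open>k t * \<rho>\<close>. On \<open>T\<close> the density is 0, off \<open>T\<close> the
  function \<open>k t\<close> tends to 0, and it is bounded uniformly in \<open>t\<close>; dominated
  convergence then yields \<open>I = 0\<close>.\<close>

lemma dichotomy:
  assumes \<rho>: "integrable lborel \<rho>" "\<And>x. 0 \<le> \<rho> x"
    and inv: "\<And>v. smooth_cs v \<Longrightarrow> (\<integral>x. gen b a v x * \<rho> x \<partial>lborel) = 0"
  obtains r where "r > 0"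
    "(AE x in lborel. x \<in> ball x0 r \<longrightarrow> \<rho> x = 0) \<or> (AE x in lborel. x \<in> ball x0 r \<longrightarrow> \<rho> x > 0)"
proof -
  have [measurable]: "\<rho> \<in> borel_measurable borel" using \<rho>(1) by auto
  obtain C r0 where C: "C > 0" and r0: "r0 > 0" "r0 \<le> 1" and
    lower: "\<And>y t. y \<in> ball x0 1 \<Longrightarrow> 0 < t \<Longrightarrow> t < r0 \<Longrightarrow>
      (\<integral>\<^sup>+x. indicator (ball y r0) x * ennreal (\<rho> x) \<partial>lborel) \<le>
        ennreal C * (\<integral>\<^sup>+x. ennreal (kern t (x - y)) * ennreal (\<rho> x) \<partial>lborel)"
    using lower_bound[OF assms] by blast
  \<comment> \<open>Half the radius, so that \<open>ball y r0\<close> contains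
    \<open>ball x0 r\<close> whenever \<open>y\<close> lies in \<open>ball x0 r\<close>.\<close>
  define r where "r = r0 / 2"
  have r: "r > 0" "2 * r = r0" "r \<le> 1" using r0 by (auto simp: r_def)
  define N where "N = {x \<in> ball x0 r. \<rho> x = 0}"
  have N: "N \<in> sets borel" unfolding N_def by measurable
  have Nb: "bounded N" by (rule bounded_subset[OF bounded_ball[of x0 r]]) (auto simp: N_def)
  show thesis
  proof (cases "emeasure lborel N > 0")
    case False
    then have "N \<in> null_sets lborel" using N by (simp add: null_sets_def)
    then have "AE x in lborel. x \<notin> N" by (rule AE_not_in)
    then have "AE x in lborel. x \<in> ball x0 r \<longrightarrow> \<rho> x > 0"
      by eventually_elim (use \<rho>(2) in \<open>auto simp: N_def order_less_le\<close>)
    then show thesis using that r by blast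
  next
    case True
    obtain T where T: "compact T" "T \<subseteq> N" "emeasure lborel T > 0"
      using compact_subset_pos[OF N True Nb] by blast
    have [measurable]: "T \<in> sets borel" by (intro borel_closed compact_imp_closed T)
    have Tfin: "emeasure lborel T < \<infinity>"
      by (rule emeasure_compact_finite[OF T(1)])
    define I where "I = (\<integral>\<^sup>+x. indicator (ball x0 r) x * ennreal (\<rho> x) \<partial>lborel)"
    define k where "k t x = (\<integral>\<^sup>+y. ennreal (kern t (x - y)) * indicator T y \<partial>lborel)" for t x
    \<comment> \<open>The shift by 2 keeps \<open>t n\<close> strictly below \<open>r0\<close>
      already for \<open>n = 0\<close>.\<close>
    define t where "t n = r0 / (real n + 2)" for n :: nat
    have t: "0 < t n" "t n < r0" for n
    proof -
      show "0 < t n" using r0 by (simp add: t_def add_nonneg_pos)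
      have "t n \<le> r0 / 2" unfolding t_def using r0 by (intro divide_left_mono) auto
      then show "t n < r0" using r0 by simp
    qed
    have t_lim: "t \<longlonglongrightarrow> 0" 
      unfolding t_def using LIMSEQ_ignore_initial_segment[OF lim_const_over_n[of r0], of 2] by (simp add: add.commute)
    have meas_k[measurable]: "k s \<in> borel_measurable borel" for s
      unfolding k_def kern_def by measurable
    have step: "I * emeasure lborel T \<le> ennreal C * (\<integral>\<^sup>+x. k (t n) x * ennreal (\<rho> x) \<partial>lborel)" for n
    proof -
      have "I * emeasure lborel T = (\<integral>\<^sup>+y. I * indicator T y \<partial>lborel)"
        by (rule nn_integral_cmult_indicator[symmetric]) simp
      also have "\<dots> \<le> (\<integral>\<^sup>+y. ennreal C * (\<integral>\<^sup>+x. ennreal (kern (t n) (x - y)) * ennreal (\<rho> x) \<partial>lborel) * indicator T y \<partial>lborel)"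
      proof (intro nn_integral_mono)
        fix y
        show "I * indicator T y \<le> ennreal C * (\<integral>\<^sup>+x. ennreal (kern (t n) (x - y)) * ennreal (\<rho> x) \<partial>lborel) * indicator T y"
        proof (cases "y \<in> T")
          case True
          then have y: "y \<in> ball x0 r" using T(2) unfolding N_def by auto
          have "I \<le> (\<integral>\<^sup>+x. indicator (ball y r0) x * ennreal (\<rho> x) \<partial>lborel)"
            unfolding I_def
          proof (intro nn_integral_mono mult_right_mono)
            fix x
            have "x \<in> ball y r0" if "x \<in> ball x0 r"
              using that y r(2) dist_triangle_less_add[of x x0 r y r] by (simp add: dist_commute)
            then show "(indicator (ball x0 r) x :: ennreal) \<le> indicator (ball y r0) x"
              by (auto simp: indicator_def)
          qed simp
          also have "\<dots> \<le> ennreal C * (\<integral>\<^sup>+x. ennreal (kern (t n) (x - y)) * ennreal (\<rho> x) \<partial>lborel)"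
            using y r t by (intro lower) auto
          finally show ?thesis using True by simp
        qed simp
      qed
      also have "\<dots> = (\<integral>\<^sup>+y. \<integral>\<^sup>+x. ennreal C * (ennreal (kern (t n) (x - y)) * indicator T y * ennreal (\<rho> x)) \<partial>lborel \<partial>lborel)"
        unfolding kern_def
        by (intro nn_integral_cong) (simp add: nn_integral_cmult[symmetric] nn_integral_multc[symmetric] mult_ac)
      also have "\<dots> = (\<integral>\<^sup>+x. \<integral>\<^sup>+y. ennreal C * (ennreal (kern (t n) (x - y)) * indicator T y * ennreal (\<rho> x)) \<partial>lborel \<partial>lborel)"
        unfolding kern_def by (rule lborel_pair.Fubini') measurable
      also have "\<dots> = ennreal C * (\<integral>\<^sup>+x. k (t n) x * ennreal (\<rho> x) \<partial>lborel)"
        unfolding k_def kern_def by (simp add: nn_integral_cmult nn_integral_multc)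
      finally show ?thesis .
    qed
    obtain \<kappa> where \<kappa>: "\<kappa> > 0"
      "\<And>t x. t > 0 \<Longrightarrow> (\<integral>\<^sup>+y. ennreal (kern t (x - y :: real^'d)) \<partial>lborel) \<le> ennreal \<kappa>"
      using kern_bound by blast
    have k_le: "k (t n) x \<le> ennreal \<kappa>" for n x
    proof -
      have "k (t n) x \<le> (\<integral>\<^sup>+y. ennreal (kern (t n) (x - y)) \<partial>lborel)"
        unfolding k_def by (intro nn_integral_mono) (auto simp: indicator_def)
      also have "\<dots> \<le> ennreal \<kappa>" by (rule \<kappa>(2)[OF t(1)])
      finally show ?thesis .
    qed
    have k_lim: "(\<lambda>n. k (t n) x * ennreal (\<rho> x)) \<longlonglongrightarrow> 0" for x
    proof (cases "x \<in> T")
      case True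
      then have "\<rho> x = 0" using T(2) by (auto simp: N_def)
      then show ?thesis by simp
    next
      case False
      obtain \<delta> where \<delta>: "\<delta> > 0" "\<And>y. y \<in> T \<Longrightarrow> \<delta> \<le> dist x y"
        using separate_point_closed[OF compact_imp_closed[OF T(1)] False] by blast
      define c where "c = (\<delta>\<^sup>2) powr (- (real CARD('d) / 2 + 1))"
      have "k (t n) x \<le> ennreal (t n * c) * emeasure lborel T" for n
      proof -
        have "k (t n) x \<le> (\<integral>\<^sup>+y. ennreal (t n * c) * indicator T y \<partial>lborel)"
          unfolding k_def
        proof (intro nn_integral_mono)
          fix y
          have "kern (t n) (x - y) \<le> t n * c" if "y \<in> T"
          proof -
            have "\<delta>\<^sup>2 \<le> (norm (x - y))\<^sup>2"
              using \<delta>(1) \<delta>(2)[OF that] by (intro power_mono) (auto simp: dist_norm)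
            then have "\<delta>\<^sup>2 \<le> (norm (x - y))\<^sup>2 + t n" using t(1)[of n] by linarith
            then show ?thesis
              unfolding kern_def c_def using t[of n] \<delta>(1)
              by (intro mult_left_mono powr_mono2') auto
          qed
          then show "ennreal (kern (t n) (x - y)) * indicator T y \<le> ennreal (t n * c) * indicator T y"
            by (auto simp: indicator_def intro!: ennreal_leI)
        qed
        also have "\<dots> = ennreal (t n * c) * emeasure lborel T"
          by (rule nn_integral_cmult_indicator) simp
        finally show ?thesis .
      qed
      then have le: "k (t n) x * ennreal (\<rho> x) \<le> ennreal (t n * c) * emeasure lborel T * ennreal (\<rho> x)" for n
        by (rule mult_right_mono) simp
      obtain m where m: "m \<ge> 0" "emeasure lborel T = ennreal m"
        using Tfin by (cases "emeasure lborel T") auto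
      have c: "c \<ge> 0" by (simp add: c_def)
      have "(\<lambda>n. ennreal (t n * c * m * \<rho> x)) \<longlonglongrightarrow> ennreal (0 * c * m * \<rho> x)"
        by (intro tendsto_intros t_lim)
      then have "(\<lambda>n. ennreal (t n * c) * emeasure lborel T * ennreal (\<rho> x)) \<longlonglongrightarrow> 0"
        using t(1) c m(1) \<rho>(2) unfolding m(2) by (simp add: ennreal_mult'[symmetric] less_imp_le)
      then show ?thesis
        by (rule tendsto_sandwich[OF _ _ tendsto_const, rotated -1]) (use le in auto)
    qed
    have "(\<lambda>n. \<integral>\<^sup>+x. k (t n) x * ennreal (\<rho> x) \<partial>lborel) \<longlonglongrightarrow> (\<integral>\<^sup>+(x::real^'d). 0 \<partial>lborel)"
    proof (rule nn_integral_dominated_convergence[where w = "\<lambda>x. ennreal \<kappa> * ennreal (\<rho> x)"])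
      have "(\<integral>\<^sup>+x. ennreal \<kappa> * ennreal (\<rho> x) \<partial>lborel) = ennreal \<kappa> * ennreal (\<integral>x. \<rho> x \<partial>lborel)"
        using \<rho> by (simp add: nn_integral_cmult nn_integral_eq_integral)
      then show "(\<integral>\<^sup>+x. ennreal \<kappa> * ennreal (\<rho> x) \<partial>lborel) < \<infinity>"
        by (simp add: ennreal_mult_less_top)
    qed (use k_le k_lim in \<open>auto intro!: mult_right_mono\<close>)
    then have "(\<lambda>n. ennreal C * (\<integral>\<^sup>+x. k (t n) x * ennreal (\<rho> x) \<partial>lborel)) \<longlonglongrightarrow> ennreal C * 0"
      by (intro ennreal_tendsto_cmult) auto
    then have "I * emeasure lborel T \<le> 0"
      using LIMSEQ_le_const[of _ "0::ennreal" "I * emeasure lborel T"] step by auto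
    then have "I = 0" using T(3) by (simp add: less_le)
    moreover have "(\<lambda>x. indicator (ball x0 r) x * ennreal (\<rho> x)) \<in> borel_measurable lborel"
      by (intro borel_measurable_times_ennreal borel_measurable_indicator) auto
    ultimately have "AE x in lborel. indicator (ball x0 r) x * ennreal (\<rho> x) = 0"
      unfolding I_def using nn_integral_0_iff_AE by blast
    then have "AE x in lborel. x \<in> ball x0 r \<longrightarrow> \<rho> x = 0"
      by eventually_elim (use \<rho>(2) in \<open>auto simp: indicator_def ennreal_eq_0_iff antisym\<close>)
    then show thesis using that r by blast
  qed
qed

end

lemma AE_locally:
  fixes P :: "real^'d::finite \<Rightarrow> bool"
  assumes "\<And>x. \<exists>r>0. AE y in lborel. y \<in> ball x r \<longrightarrow> P y"
  shows "AE y in lborel. P y"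
proof -
  obtain r where r: "\<And>x. r x > 0" "\<And>x. AE y in lborel. y \<in> ball x (r x) \<longrightarrow> P y"
    using assms by metis
  let ?F = "range (\<lambda>x. ball x (r x))"
  obtain F where F: "F \<subseteq> ?F" "countable F" "\<Union>F = \<Union>?F"
    using Lindelof[of ?F] by auto
  have "x \<in> \<Union>?F" for x
  proof (rule UnionI)
    show "ball x (r x) \<in> ?F" by simp
    show "x \<in> ball x (r x)" using r(1) by simp
  qed
  then have cover: "\<Union>F = UNIV" using F(3) by blast
  have "AE y in lborel. \<forall>S\<in>F. y \<in> S \<longrightarrow> P y"
  proof (rule AE_ball_countable[OF F(2), THEN iffD2], intro ballI)
    fix S assume "S \<in> F"
    then show "AE y in lborel. y \<in> S \<longrightarrow> P y" using F(1) r(2) by blast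
  qed
  then show ?thesis
    by eventually_elim (use cover in blast)
qed

text \<open>The points near which \<open>\<rho>\<close> is almost everywhere 0 and those near which
  it is almost everywhere positive form two open sets. They are disjoint because balls have positive
  measure, and they cover the space by the local alternative; connectedness leaves only one of
  them.\<close>

lemma global_dichotomy:
  fixes a :: "real^'d::finite \<Rightarrow> real^'d^'d" and b :: "real^'d \<Rightarrow> real^'d"
  assumes ell: "\<And>x0. \<exists>lam Lam B L. local_elliptic a b x0 lam Lam B L"
    and \<rho>: "integrable lborel \<rho>" "\<And>x. 0 \<le> \<rho> x"
    and inv: "\<And>v. smooth_cs v \<Longrightarrow> (\<integral>x. gen b a v x * \<rho> x \<partial>lborel) = 0"
  shows "(AE x in lborel. \<rho> x = 0) \<or> (AE x in lborel. \<rho> x > 0)"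
proof -
  define U where "U P = {x. \<exists>r>0. AE y in lborel. y \<in> ball x r \<longrightarrow> P (\<rho> y)}" for P :: "real \<Rightarrow> bool"
  have op: "open (U P)" for P
  proof (rule openI)
    fix x assume "x \<in> U P"
    then obtain r where r: "r > 0" "AE y in lborel. y \<in> ball x r \<longrightarrow> P (\<rho> y)"
      unfolding U_def by blast
    have "ball x (r / 2) \<subseteq> U P"
    proof
      fix z assume z: "z \<in> ball x (r / 2)"
      have "AE y in lborel. y \<in> ball z (r / 2) \<longrightarrow> P (\<rho> y)"
        using r(2)
      proof eventually_elim
        case (elim y)
        have "y \<in> ball x r" if "y \<in> ball z (r / 2)"
          using that z dist_triangle_half_r[of z x r y] by (simp add: dist_commute)
        then show ?case using elim by blast
      qed
      then show "z \<in> U P" unfolding U_def using r(1) by (intro CollectI exI[of _ "r / 2"]) auto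
    qed
    then show "\<exists>e>0. ball x e \<subseteq> U P" using r(1) by (intro exI[of _ "r / 2"]) auto
  qed
  let ?Z = "U (\<lambda>s. s = 0)" and ?P = "U (\<lambda>s. s > 0)"
  have "x0 \<in> ?Z \<union> ?P" for x0
  proof -
    obtain lam Lam B L where "local_elliptic a b x0 lam Lam B L" using ell by blast
    then interpret local_elliptic a b x0 lam Lam B L .
    show ?thesis using dichotomy[OF \<rho> inv] unfolding U_def by blast
  qed
  then have cover: "UNIV \<subseteq> ?Z \<union> ?P" by blast
  have disj: "?Z \<inter> ?P \<inter> UNIV = {}"
  proof (rule ccontr)
    assume "?Z \<inter> ?P \<inter> UNIV \<noteq> {}"
    then obtain x r1 r2 where r: "r1 > 0" "r2 > 0"
      and ae: "AE y in lborel. y \<in> ball x r1 \<longrightarrow> \<rho> y = 0" "AE y in lborel. y \<in> ball x r2 \<longrightarrow> \<rho> y > 0"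
      unfolding U_def by blast
    from ae have "AE y in lborel. y \<notin> ball x (min r1 r2)"
      by eventually_elim auto
    then have "ball x (min r1 r2) \<in> null_sets lborel"
      by (subst (asm) AE_iff_null_sets[symmetric]) auto
    moreover have "emeasure lborel (ball x (min r1 r2)) > 0"
      using r by (subst emeasure_ball) (auto intro!: mult_pos_pos simp: unit_ball_vol_def)
    ultimately show False by (auto simp: null_sets_def)
  qed
  have "?Z = {} \<or> ?P = {}"
    using connectedD[OF connected_UNIV op op disj cover] by blast
  then have "?P = UNIV \<or> ?Z = UNIV" using cover by blast
  then show ?thesis
  proof
    assume "?P = UNIV"
    then have "AE y in lborel. 0 < \<rho> y" by (intro AE_locally) (auto simp: U_def)
    then show ?thesis ..
  next
    assume "?Z = UNIV"
    then have "AE y in lborel. \<rho> y = 0" by (intro AE_locally) (auto simp: U_def)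
    then show ?thesis ..
  qed
qed

section \<open>Diffusion processes and the Fokker--Planck equation\<close>

definition box_bump :: "real^'d::finite \<Rightarrow> real^'d \<Rightarrow> nat \<Rightarrow> real^'d \<Rightarrow> real" where
  "box_bump l u n x = (\<Prod>i\<in>UNIV. fexp (real n * (x $ i - l $ i)) * fexp (real n * (u $ i - x $ i)))"

lemma smooth_cs_box_bump: "smooth_cs (box_bump l u n)"
proof -
  have "sm (box_bump l u n)"
    unfolding box_bump_def
    by (intro sm_prod sm.mult sm_fexp sm_cmult sm_diff sm.coord sm.const)
  moreover have "x \<in> box l u" if "box_bump l u n x \<noteq> 0" for x
  proof -
    have "fexp (real n * (x $ i - l $ i)) \<noteq> 0 \<and> fexp (real n * (u $ i - x $ i)) \<noteq> 0" for i
      using that unfolding box_bump_def by (simp add: prod_zero_iff)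
    then have "real n * (x $ i - l $ i) > 0 \<and> real n * (u $ i - x $ i) > 0" for i
      unfolding fexp_def by (metis)
    then show ?thesis by (auto simp: mem_box_cart zero_less_mult_iff)
  qed
  then have "bounded {x. box_bump l u n x \<noteq> 0}"
    by (intro bounded_subset[OF bounded_box]) auto
  ultimately show ?thesis by (simp add: smooth_cs_iff sm_imp_smooth)
qed

lemma box_bump_nonneg: "0 \<le> box_bump l u n x"
  unfolding box_bump_def by (intro prod_nonneg) (simp add: fexp_nonneg)

lemma box_bump_le_1: "box_bump l u n x \<le> 1"
  unfolding box_bump_def by (intro prod_le_1) (simp add: fexp_nonneg fexp_le_1 mult_le_one)

lemma fexp_tendsto: "(\<lambda>n. fexp (real n * c)) \<longlonglongrightarrow> (if c > 0 then 1 else 0)"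
proof (cases "c > 0")
  case True
  have "(\<lambda>n. exp (- ((1 / c) / real n))) \<longlonglongrightarrow> exp (- 0)"
    by (intro tendsto_intros lim_const_over_n)
  moreover have "\<forall>\<^sub>F n in sequentially. exp (- ((1 / c) / real n)) = fexp (real n * c)"
    using eventually_gt_at_top[of 0] by eventually_elim (use True in \<open>simp add: fexp_def field_simps\<close>)
  ultimately show ?thesis using True by (auto intro: Lim_transform_eventually)
next
  case False
  then have "fexp (real n * c) = 0" for n by (simp add: fexp_def zero_less_mult_iff)
  then show ?thesis using False by simp
qed

lemma box_bump_tendsto: "(\<lambda>n. box_bump l u n x) \<longlonglongrightarrow> indicator (box l u) x"
proof -
  have "(\<lambda>n. box_bump l u n x) \<longlonglongrightarrow>
    (\<Prod>i\<in>UNIV. (if x $ i - l $ i > 0 then 1 else 0) * (if u $ i - x $ i > 0 then 1 else 0))"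
    unfolding box_bump_def by (intro tendsto_prod tendsto_mult fexp_tendsto)
  moreover have "(\<Prod>i\<in>UNIV. (if x $ i - l $ i > 0 then 1 else 0) * (if u $ i - x $ i > 0 then 1 else 0))
      = (indicator (box l u) x :: real)"
    by (auto simp: indicator_def mem_box_cart prod_zero_iff)
  ultimately show ?thesis by simp
qed

text \<open>Open boxes form an intersection-stable generator of the Borel sets, and their indicators
  are bounded pointwise limits of smooth bumps.\<close>

lemma measure_eqI_smooth_cs:
  fixes M N :: "(real^'d::finite) measure"
  assumes fin: "finite_measure M" "finite_measure N" and sets: "sets M = sets borel" "sets N = sets borel"
    and eq: "\<And>f. smooth_cs f \<Longrightarrow> (\<And>x. 0 \<le> f x) \<Longrightarrow> (\<And>x. f x \<le> 1) \<Longrightarrow> (\<integral>x. f x \<partial>M) = (\<integral>x. f x \<partial>N)"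
  shows "M = N"
proof -
  interpret M: finite_measure M by fact
  interpret N: finite_measure N by fact
  have [measurable]: "box_bump l u n \<in> borel_measurable borel" for l u :: "real^'d" and n
    using smooth_cs_box_bump[of l u n]
    by (auto simp: smooth_cs_iff intro!: borel_measurable_continuous_onI smooth_continuous)
  have lim: "(\<lambda>n. \<integral>x. box_bump l u n x \<partial>Q) \<longlonglongrightarrow> measure Q (box l u)"
    if "finite_measure Q" "sets Q = sets borel" for Q and l u :: "real^'d"
  proof -
    interpret finite_measure Q by fact
    have [measurable_cong]: "sets Q = sets borel" by fact
    have "(\<lambda>n. \<integral>x. box_bump l u n x \<partial>Q) \<longlonglongrightarrow> (\<integral>x. indicator (box l u) x \<partial>Q)"
    proof (rule integral_dominated_convergence[where w = "\<lambda>_. 1"])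
      show "AE x in Q. (\<lambda>n. box_bump l u n x) \<longlonglongrightarrow> indicator (box l u) x"
        by (intro AE_I2 box_bump_tendsto)
      show "AE x in Q. norm (box_bump l u n x) \<le> 1" for n
        by (intro AE_I2) (simp add: box_bump_nonneg box_bump_le_1)
    qed auto
    then show ?thesis using that(2) by (simp add: sets_eq_imp_space_eq)
  qed
  have box: "emeasure M (box l u) = emeasure N (box l u)" for l u
  proof -
    have "(\<lambda>n. \<integral>x. box_bump l u n x \<partial>M) = (\<lambda>n. \<integral>x. box_bump l u n x \<partial>N)"
      by (intro ext eq smooth_cs_box_bump box_bump_nonneg box_bump_le_1)
    then have "measure M (box l u) = measure N (box l u)"
      using LIMSEQ_unique lim[OF fin(1) sets(1)] lim[OF fin(2) sets(2)] by metis
    then show ?thesis by (simp add: M.emeasure_eq_measure N.emeasure_eq_measure)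
  qed
  let ?E = "range (\<lambda>(l, u). box l u :: (real^'d) set)"
  show ?thesis
  proof (rule measure_eqI_generator_eq[where E = ?E and \<Omega> = UNIV and A = "\<lambda>n. box (- (real n *\<^sub>R One)) (real n *\<^sub>R One)"])
    show "Int_stable ?E"
      by (auto simp: Int_stable_def box_Int_box)
    show "(\<Union>i. box (- (real i *\<^sub>R One)) (real i *\<^sub>R One)) = (UNIV :: (real^'d) set)"
      by (rule UN_box_eq_UNIV)
    show "emeasure M (box (- (real i *\<^sub>R One)) (real i *\<^sub>R One)) \<noteq> \<infinity>" for i
      by simp
  qed (use box sets in \<open>auto simp: borel_eq_box\<close>)
qed

text \<open>Keeps from the martingale problem the increments from time 0, tested against events of
  \<open>X 0\<close>. It serves as a common interface for the given solution on
  \<open>{0..T}\<close> and the canonical one on \<open>{0..}\<close>.\<close>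

locale diffusion_process = prob_space M
  for M :: "'w measure" +
  fixes X :: "real \<Rightarrow> 'w \<Rightarrow> real^'d::finite" and T :: real
    and b :: "real^'d \<Rightarrow> real^'d" and a :: "real^'d \<Rightarrow> real^'d^'d"
  assumes T: "T > 0"
    and cont_a: "continuous_on UNIV a" and cont_b: "continuous_on UNIV b"
    and X_measurable: "\<And>t. t \<in> {0..T} \<Longrightarrow> X t \<in> borel_measurable M"
    and paths: "\<And>\<omega>. \<omega> \<in> space M \<Longrightarrow> continuous_on {0..T} (\<lambda>t. X t \<omega>)"
    and mart: "\<And>f t B. smooth_cs f \<Longrightarrow> t \<in> {0..T} \<Longrightarrow> B \<in> sets borel \<Longrightarrow>
      (\<integral>\<omega>. indicator B (X 0 \<omega>) * (f (X t \<omega>) - f (X 0 \<omega>)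
               - (\<integral>r\<in>{0..t}. gen b a f (X r \<omega>) \<partial>lborel)) \<partial>M) = 0"

lemma diffusion_processI:
  fixes X :: "real \<Rightarrow> 'w \<Rightarrow> real^'d::finite"
  assumes D: "diffusion M X I b a" and I: "{0..T} \<subseteq> I" and T: "T > 0"
    and cont: "continuous_on UNIV a" "continuous_on UNIV b"
  shows "diffusion_process M X T b a"
proof -
  interpret prob_space M using D by (simp add: diffusion_def)
  show ?thesis
  proof
    show "X t \<in> borel_measurable M" if "t \<in> {0..T}" for t
      using D I that unfolding diffusion_def by blast
    show "continuous_on {0..T} (\<lambda>t. X t \<omega>)" if "\<omega> \<in> space M" for \<omega>
      using D I that unfolding diffusion_def by (meson continuous_on_subset)
    fix f :: "real^'d \<Rightarrow> real" and t :: real and B :: "(real^'d) set"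
    assume f: "smooth_cs f" and t: "t \<in> {0..T}" and B: "B \<in> sets borel"
    have "0 \<in> I" using I T by auto
    then have "X 0 -` B \<inter> space M \<in> (\<Union>r\<in>I \<inter> {..0}. {X r -` B \<inter> space M | B. B \<in> sets borel})"
      using B by auto
    then have "X 0 -` B \<inter> space M \<in> sets (nat_filtration M X I 0)"
      unfolding nat_filtration_def by (subst sets_measure_of) (auto intro: sigma_sets.Basic)
    then have "(\<integral>\<omega>. indicator (X 0 -` B \<inter> space M) \<omega> * (f (X t \<omega>) - f (X 0 \<omega>)
               - (\<integral>r\<in>{0..t}. gen b a f (X r \<omega>) \<partial>lborel)) \<partial>M) = 0"
      using D f t I \<open>0 \<in> I\<close> unfolding diffusion_def by auto
    moreover have "(\<integral>\<omega>. indicator B (X 0 \<omega>) * (f (X t \<omega>) - f (X 0 \<omega>)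
               - (\<integral>r\<in>{0..t}. gen b a f (X r \<omega>) \<partial>lborel)) \<partial>M) =
        (\<integral>\<omega>. indicator (X 0 -` B \<inter> space M) \<omega> * (f (X t \<omega>) - f (X 0 \<omega>)
               - (\<integral>r\<in>{0..t}. gen b a f (X r \<omega>) \<partial>lborel)) \<partial>M)"
      by (intro Bochner_Integration.integral_cong) (auto simp: indicator_def)
    ultimately show "(\<integral>\<omega>. indicator B (X 0 \<omega>) * (f (X t \<omega>) - f (X 0 \<omega>)
               - (\<integral>r\<in>{0..t}. gen b a f (X r \<omega>) \<partial>lborel)) \<partial>M) = 0" by simp
  qed (use T cont in auto)
qed

context diffusion_process
begin

text \<open>\<open>X t\<close> is known to be measurable only for \<open>t\<close> in
  \<open>{0..T}\<close>; clamping gives a process indexed by all reals, as the product with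
  \<open>lborel\<close> demands.\<close>

definition clamp_time where "clamp_time r = max 0 (min T r)"

lemma clamp_time: "clamp_time r \<in> {0..T}" "r \<in> {0..T} \<Longrightarrow> clamp_time r = r"
  using T by (auto simp: clamp_time_def)

text \<open>The time-discretised process visits countably many times and is therefore measurable;
  continuity of the paths gives pointwise convergence. For \<open>n = 0\<close> the division by 0
  selects time 0, which does not affect the limit.\<close>

lemma joint_measurable:
  "(\<lambda>(r, \<omega>). X (clamp_time r) \<omega>) \<in> borel_measurable (lborel \<Otimes>\<^sub>M M)"
proof (rule borel_measurable_LIMSEQ_metric)
  fix n :: nat
  have "(\<lambda>p. X (clamp_time (real_of_int \<lfloor>real n * fst p\<rfloor> / real n)) (snd p)) \<in> borel_measurable (lborel \<Otimes>\<^sub>M M)"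
    by (rule measurable_compose_countable'[where I = UNIV and g = "\<lambda>p. \<lfloor>real n * fst p\<rfloor>" and
        f = "\<lambda>i p. X (clamp_time (real_of_int i / real n)) (snd p)"])
      (auto intro!: measurable_compose[OF measurable_snd X_measurable] clamp_time)
  then show "(\<lambda>(r, \<omega>). X (clamp_time (real_of_int \<lfloor>real n * r\<rfloor> / real n)) \<omega>) \<in> borel_measurable (lborel \<Otimes>\<^sub>M M)"
    by (simp add: case_prod_beta')
next
  fix p :: "real \<times> 'w" assume "p \<in> space (lborel \<Otimes>\<^sub>M M)"
  then obtain r \<omega> where p: "p = (r, \<omega>)" "\<omega> \<in> space M"
    by (auto simp: space_pair_measure)
  have "(\<lambda>n. real_of_int \<lfloor>real n * r\<rfloor> / real n) \<longlonglongrightarrow> r"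
  proof (rule tendsto_sandwich)
    show "(\<lambda>n. r - 1 / real n) \<longlonglongrightarrow> r"
      using tendsto_diff[OF tendsto_const lim_const_over_n[of 1], of r] by simp
    show "\<forall>\<^sub>F n in sequentially. r - 1 / real n \<le> real_of_int \<lfloor>real n * r\<rfloor> / real n"
      using eventually_gt_at_top[of 0]
    proof eventually_elim
      case (elim n)
      have "real n * r - 1 \<le> real_of_int \<lfloor>real n * r\<rfloor>" by linarith
      then have "(real n * r - 1) / real n \<le> real_of_int \<lfloor>real n * r\<rfloor> / real n"
        by (rule divide_right_mono) simp
      then show ?case using elim by (simp add: diff_divide_distrib)
    qed
    show "\<forall>\<^sub>F n in sequentially. real_of_int \<lfloor>real n * r\<rfloor> / real n \<le> r"
      using eventually_gt_at_top[of 0]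
      by eventually_elim (simp add: field_simps)
  qed auto
  then have "(\<lambda>n. clamp_time (real_of_int \<lfloor>real n * r\<rfloor> / real n)) \<longlonglongrightarrow> clamp_time r"
    unfolding clamp_time_def by (intro tendsto_intros)
  then have "(\<lambda>n. X (clamp_time (real_of_int \<lfloor>real n * r\<rfloor> / real n)) \<omega>) \<longlonglongrightarrow> X (clamp_time r) \<omega>"
    by (intro continuous_on_tendsto_compose[OF paths[OF p(2)]]) (use clamp_time in auto)
  then show "(\<lambda>n. case p of (r, \<omega>) \<Rightarrow> X (clamp_time (real_of_int \<lfloor>real n * r\<rfloor> / real n)) \<omega>)
      \<longlonglongrightarrow> (case p of (r, \<omega>) \<Rightarrow> X (clamp_time r) \<omega>)" by (simp add: p)
qed

lemma continuous_expectation: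
  assumes \<phi>: "continuous_on UNIV \<phi>" "\<And>x. \<bar>\<phi> x\<bar> \<le> C" and B: "B \<in> sets borel"
  shows "continuous_on {0..T} (\<lambda>r. \<integral>\<omega>. indicator B (X 0 \<omega>) * (\<phi> (X r \<omega>) :: real) \<partial>M)"
  unfolding continuous_on_sequentially comp_def
proof (intro allI ballI impI)
  fix u r assume r: "r \<in> {0..T}" and u: "(\<forall>n. u n \<in> {0..T}) \<and> u \<longlonglongrightarrow> r"
  have [measurable]: "X 0 \<in> borel_measurable M" "X r \<in> borel_measurable M" "X (u n) \<in> borel_measurable M" for n
    using X_measurable r u T by auto
  have [measurable]: "\<phi> \<in> borel_measurable borel" "B \<in> sets borel"
    using \<phi>(1) B by (auto intro: borel_measurable_continuous_onI)
  show "(\<lambda>n. \<integral>\<omega>. indicator B (X 0 \<omega>) * \<phi> (X (u n) \<omega>) \<partial>M) \<longlonglongrightarrow> (\<integral>\<omega>. indicator B (X 0 \<omega>) * \<phi> (X r \<omega>) \<partial>M)"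
  proof (rule integral_dominated_convergence[where w = "\<lambda>_. C"])
    show "AE \<omega> in M. (\<lambda>n. indicator B (X 0 \<omega>) * \<phi> (X (u n) \<omega>)) \<longlonglongrightarrow> indicator B (X 0 \<omega>) * \<phi> (X r \<omega>)"
    proof (rule AE_I2)
      fix \<omega> assume "\<omega> \<in> space M"
      then have "(\<lambda>n. X (u n) \<omega>) \<longlonglongrightarrow> X r \<omega>"
        using continuous_on_tendsto_compose[OF paths, of \<omega> u r] u r by auto
      then have "(\<lambda>n. \<phi> (X (u n) \<omega>)) \<longlonglongrightarrow> \<phi> (X r \<omega>)"
        using continuous_on_tendsto_compose[OF \<phi>(1)] by auto
      then show "(\<lambda>n. indicator B (X 0 \<omega>) * \<phi> (X (u n) \<omega>)) \<longlonglongrightarrow> indicator B (X 0 \<omega>) * \<phi> (X r \<omega>)"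
        by (intro tendsto_intros)
    qed
    have "0 \<le> C" using \<phi>(2)[of 0] by linarith
    then show "AE \<omega> in M. norm (indicator B (X 0 \<omega>) * \<phi> (X (u n) \<omega>)) \<le> C" for n
      using \<phi>(2) by (intro AE_I2) (auto simp: indicator_def)
  qed auto
qed

text \<open>Exchanging expectation and time integral in the martingale identity.
  \<open>B = UNIV\<close> leads to the Fokker-Planck equation; a level set \<open>B\<close> leads to
  infinitesimal invariance.\<close>

lemma dynkin:
  assumes f: "smooth_cs f" and t: "t \<in> {0..T}" and B: "B \<in> sets borel"
  shows "(\<integral>\<omega>. indicator B (X 0 \<omega>) * (f (X t \<omega>) - f (X 0 \<omega>)) \<partial>M) =
    integral {0..t} (\<lambda>r. \<integral>\<omega>. indicator B (X 0 \<omega>) * gen b a f (X r \<omega>) \<partial>M)"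
proof -
  let ?\<phi> = "gen b a f"
  obtain C where C: "C > 0" "\<And>x. \<bar>?\<phi> x\<bar> \<le> C"
    using gen_bounded[OF cont_a cont_b f] by blast
  obtain Cf where Cf: "Cf > 0" "\<And>x. \<bar>f x\<bar> \<le> Cf"
    using smooth_cs_bounded[OF f] by blast
  have cont: "continuous_on UNIV ?\<phi>"
    using f cont_a cont_b by (intro gen_continuous) (auto simp: smooth_cs_iff)
  have [measurable]: "?\<phi> \<in> borel_measurable borel" "B \<in> sets borel" "f \<in> borel_measurable borel"
    using cont B f by (auto intro: borel_measurable_continuous_onI simp: smooth_cs_iff smooth_continuous)
  have [measurable]: "X 0 \<in> borel_measurable M" "X t \<in> borel_measurable M"
    using X_measurable t T by auto
  note joint_measurable[measurable]
  have Y[measurable]: "(\<lambda>p. X (clamp_time (fst p)) (snd p)) \<in> borel_measurable (lborel \<Otimes>\<^sub>M M)"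
    using joint_measurable by (simp add: case_prod_beta')
  interpret P: pair_sigma_finite lborel M ..
  define g where "g r \<omega> = indicator {0..t} r * (indicator B (X 0 \<omega>) * ?\<phi> (X (clamp_time r) \<omega>))" for r \<omega>
  have int_g: "integrable (lborel \<Otimes>\<^sub>M M) (case_prod g)"
  proof (rule Bochner_Integration.integrable_bound)
    show "integrable (lborel \<Otimes>\<^sub>M M) (\<lambda>p. C * indicator ({0..t} \<times> space M) p)"
    proof -
      have "emeasure (lborel \<Otimes>\<^sub>M M) ({0..t} \<times> space M) = ennreal t"
        using t by (subst emeasure_pair_measure_Times) (auto simp: emeasure_space_1)
      then show ?thesis by (intro integrable_mult_right integrable_real_indicator) auto
    qed
    show "case_prod g \<in> borel_measurable (lborel \<Otimes>\<^sub>M M)"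
      unfolding g_def case_prod_beta' by measurable
    show "AE p in lborel \<Otimes>\<^sub>M M. norm (case_prod g p) \<le> norm (C * indicator ({0..t} \<times> space M) p)"
      using C by (intro AE_I2) (auto simp: g_def indicator_def space_pair_measure)
  qed
  have eq: "(\<integral>r\<in>{0..t}. ?\<phi> (X r \<omega>) \<partial>lborel) * indicator B (X 0 \<omega>) = (\<integral>r. g r \<omega> \<partial>lborel)" for \<omega>
    unfolding set_lebesgue_integral_def g_def using t
    by (subst integral_mult_left_zero[symmetric])
      (auto simp: indicator_def clamp_time intro!: Bochner_Integration.integral_cong)
  have i1: "integrable M (\<lambda>\<omega>. \<integral>r. g r \<omega> \<partial>lborel)"
    using P.integrable_snd[OF int_g] .
  have i2: "integrable M (\<lambda>\<omega>. indicator B (X 0 \<omega>) * (f (X t \<omega>) - f (X 0 \<omega>)))"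
  proof (rule integrable_const_bound[where B = "2 * Cf"])
    show "AE \<omega> in M. norm (indicator B (X 0 \<omega>) * (f (X t \<omega>) - f (X 0 \<omega>))) \<le> 2 * Cf"
    proof (rule AE_I2)
      fix \<omega>
      have "\<bar>f (X t \<omega>) - f (X 0 \<omega>)\<bar> \<le> 2 * Cf" using Cf(2)[of "X t \<omega>"] Cf(2)[of "X 0 \<omega>"] by linarith
      then show "norm (indicator B (X 0 \<omega>) * (f (X t \<omega>) - f (X 0 \<omega>))) \<le> 2 * Cf"
        using Cf(1) by (auto simp: indicator_def)
    qed
  qed measurable
  have "0 = (\<integral>\<omega>. indicator B (X 0 \<omega>) * (f (X t \<omega>) - f (X 0 \<omega>)) - (\<integral>r. g r \<omega> \<partial>lborel) \<partial>M)"
    using mart[OF f t B] by (simp add: right_diff_distrib eq[symmetric] mult.commute)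
  also have "\<dots> = (\<integral>\<omega>. indicator B (X 0 \<omega>) * (f (X t \<omega>) - f (X 0 \<omega>)) \<partial>M) - (\<integral>\<omega>. \<integral>r. g r \<omega> \<partial>lborel \<partial>M)"
    by (rule Bochner_Integration.integral_diff[OF i2 i1])
  also have "(\<integral>\<omega>. \<integral>r. g r \<omega> \<partial>lborel \<partial>M) = (\<integral>r. \<integral>\<omega>. g r \<omega> \<partial>M \<partial>lborel)"
    by (rule P.Fubini_integral[OF int_g])
  also have "\<dots> = (\<integral>r\<in>{0..t}. (\<integral>\<omega>. indicator B (X 0 \<omega>) * ?\<phi> (X r \<omega>) \<partial>M) \<partial>lborel)"
    unfolding set_lebesgue_integral_def g_def using t
    by (intro Bochner_Integration.integral_cong) (auto simp: indicator_def clamp_time)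
  also have "\<dots> = integral {0..t} (\<lambda>r. \<integral>\<omega>. indicator B (X 0 \<omega>) * ?\<phi> (X r \<omega>) \<partial>M)"
  proof (rule set_borel_integral_eq_integral)
    have "continuous_on {0..t} (\<lambda>r. \<integral>\<omega>. indicator B (X 0 \<omega>) * ?\<phi> (X r \<omega>) \<partial>M)"
      by (rule continuous_on_subset[OF continuous_expectation[OF cont C(2) B]]) (use t in auto)
    then show "set_integrable lborel {0..t} (\<lambda>r. \<integral>\<omega>. indicator B (X 0 \<omega>) * ?\<phi> (X r \<omega>) \<partial>M)"
      unfolding set_integrable_def by (intro borel_integrable_compact) auto
  qed
  finally show ?thesis by simp
qed

end

text \<open>Speaks of the family of marginals only, so that processes on different probability
  spaces become comparable. The derivative is one-sided at 0 and at \<open>T\<close>.\<close>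

definition fokker_planck :: "real \<Rightarrow> (real^'d::finite \<Rightarrow> real^'d) \<Rightarrow> (real^'d \<Rightarrow> real^'d^'d) \<Rightarrow>
    (real \<Rightarrow> (real^'d) measure) \<Rightarrow> bool" where
  "fokker_planck T b a m \<longleftrightarrow> (\<forall>s\<in>{0..T}. prob_space (m s) \<and> sets (m s) = sets borel) \<and>
    (\<forall>f. smooth_cs f \<longrightarrow> (\<forall>s\<in>{0..T}.
      ((\<lambda>s. \<integral>x. f x \<partial>m s) has_real_derivative (\<integral>x. gen b a f x \<partial>m s)) (at s within {0..T})))"

lemma (in diffusion_process) fokker_planck_distr:
  "fokker_planck T b a (\<lambda>s. distr M borel (X s))"
  unfolding fokker_planck_def
proof (intro conjI ballI allI impI)
  fix s assume s: "s \<in> {0..T}"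
  note [measurable] = X_measurable[OF s]
  show "prob_space (distr M borel (X s))" by (rule prob_space_distr) simp
  show "sets (distr M borel (X s)) = sets borel" by simp
next
  fix f :: "real^'d \<Rightarrow> real" and s assume f: "smooth_cs f" and s: "s \<in> {0..T}"
  let ?\<phi> = "gen b a f"
  obtain C where C: "C > 0" "\<And>x. \<bar>?\<phi> x\<bar> \<le> C"
    using gen_bounded[OF cont_a cont_b f] by blast
  obtain Cf where Cf: "Cf > 0" "\<And>x. \<bar>f x\<bar> \<le> Cf"
    using smooth_cs_bounded[OF f] by blast
  have cont: "continuous_on UNIV ?\<phi>"
    using f cont_a cont_b by (intro gen_continuous) (auto simp: smooth_cs_iff)
  have meas[measurable]: "?\<phi> \<in> borel_measurable borel" "f \<in> borel_measurable borel"
    using cont f by (auto intro: borel_measurable_continuous_onI simp: smooth_cs_iff smooth_continuous)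
  have int: "integrable M (\<lambda>\<omega>. f (X r \<omega>))" if "r \<in> {0..T}" for r
    by (rule integrable_const_bound[where B = Cf])
      (use Cf(2) X_measurable[OF that] in \<open>auto intro: measurable_compose[OF _ meas(2)]\<close>)
  have 0: "0 \<in> {0..T}" using T by simp
  have "((\<lambda>t. integral {0..t} (\<lambda>r. \<integral>\<omega>. indicator UNIV (X 0 \<omega>) * ?\<phi> (X r \<omega>) \<partial>M)) has_real_derivative
      (\<integral>\<omega>. indicator UNIV (X 0 \<omega>) * ?\<phi> (X s \<omega>) \<partial>M)) (at s within {0..T})"
    by (rule integral_has_real_derivative[OF continuous_expectation[OF cont C(2)] s]) simp
  then have "((\<lambda>t. (\<integral>\<omega>. f (X 0 \<omega>) \<partial>M) + integral {0..t} (\<lambda>r. \<integral>\<omega>. indicator UNIV (X 0 \<omega>) * ?\<phi> (X r \<omega>) \<partial>M)) has_real_derivative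
      (\<integral>x. ?\<phi> x \<partial>distr M borel (X s))) (at s within {0..T})"
    using X_measurable[OF s] by (auto intro!: derivative_eq_intros simp: integral_distr)
  moreover have "(\<integral>\<omega>. f (X 0 \<omega>) \<partial>M) + integral {0..t} (\<lambda>r. \<integral>\<omega>. indicator UNIV (X 0 \<omega>) * ?\<phi> (X r \<omega>) \<partial>M)
      = (\<integral>x. f x \<partial>distr M borel (X t))" if t: "t \<in> {0..T}" for t
  proof -
    have "(\<integral>\<omega>. f (X t \<omega>) - f (X 0 \<omega>) \<partial>M) = integral {0..t} (\<lambda>r. \<integral>\<omega>. indicator UNIV (X 0 \<omega>) * ?\<phi> (X r \<omega>) \<partial>M)"
      using dynkin[OF f t, of UNIV] by simp
    then show ?thesis
      using int[OF t] int[OF 0] X_measurable[OF t] by (simp add: integral_distr)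
  qed
  ultimately show "((\<lambda>s. \<integral>x. f x \<partial>distr M borel (X s)) has_real_derivative
      (\<integral>x. ?\<phi> x \<partial>distr M borel (X s))) (at s within {0..T})"
    by (rule has_field_derivative_transform_within[OF _ zero_less_one s]) auto
qed

section \<open>The maximum principle and the resolvent equation\<close>

text \<open>The space \<open>C_0\<close>. Its members attain a positive supremum, which the maximum
  principle needs, and it contains the Gaussians of the parametrix, whose support is not
  compact.\<close>

definition vanishes :: "(real^'d::finite \<Rightarrow> real) \<Rightarrow> bool" where
  "vanishes f \<longleftrightarrow> continuous_on UNIV f \<and> (\<forall>e>0. \<exists>R. \<forall>x. norm x \<ge> R \<longrightarrow> \<bar>f x\<bar> \<le> e)"

lemma vanishesD: "vanishes f \<Longrightarrow> e > 0 \<Longrightarrow> \<exists>R. \<forall>x. norm x \<ge> R \<longrightarrow> \<bar>f x\<bar> \<le> e"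
  by (simp add: vanishes_def)

lemma vanishes_continuous: "vanishes f \<Longrightarrow> continuous_on UNIV f"
  by (simp add: vanishes_def)

lemma vanishes_zero: "vanishes (\<lambda>x. 0)"
  by (simp add: vanishes_def)

lemma vanishes_add:
  assumes "vanishes f" "vanishes g"
  shows "vanishes (\<lambda>x. f x + g x)"
  unfolding vanishes_def
proof (intro conjI allI impI)
  show "continuous_on UNIV (\<lambda>x. f x + g x)"
    using assms by (intro continuous_intros vanishes_continuous)
  fix e :: real assume e: "e > 0"
  obtain R1 where R1: "\<And>x. norm x \<ge> R1 \<Longrightarrow> \<bar>f x\<bar> \<le> e / 2"
    using vanishesD[OF assms(1), of "e / 2"] e by auto
  obtain R2 where R2: "\<And>x. norm x \<ge> R2 \<Longrightarrow> \<bar>g x\<bar> \<le> e / 2"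
    using vanishesD[OF assms(2), of "e / 2"] e by auto
  have "\<bar>f x + g x\<bar> \<le> e" if "norm x \<ge> max R1 R2" for x
    using R1[of x] R2[of x] that by linarith
  then show "\<exists>R. \<forall>x. norm x \<ge> R \<longrightarrow> \<bar>f x + g x\<bar> \<le> e" by blast
qed

lemma vanishes_cmult:
  assumes "vanishes f"
  shows "vanishes (\<lambda>x. c * f x)"
  unfolding vanishes_def
proof (intro conjI allI impI)
  show "continuous_on UNIV (\<lambda>x. c * f x)"
    using assms by (intro continuous_intros vanishes_continuous)
  fix e :: real assume e: "e > 0"
  obtain R where R: "\<And>x. norm x \<ge> R \<Longrightarrow> \<bar>f x\<bar> \<le> e / (\<bar>c\<bar> + 1)"
    using vanishesD[OF assms, of "e / (\<bar>c\<bar> + 1)"] e by (auto simp: divide_pos_pos)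
  have "\<bar>c * f x\<bar> \<le> e" if "norm x \<ge> R" for x
  proof -
    have "\<bar>c * f x\<bar> \<le> (\<bar>c\<bar> + 1) * (e / (\<bar>c\<bar> + 1))"
      unfolding abs_mult using R[OF that] by (intro mult_mono) auto
    then show ?thesis by simp
  qed
  then show "\<exists>R. \<forall>x. norm x \<ge> R \<longrightarrow> \<bar>c * f x\<bar> \<le> e" by blast
qed

lemma vanishes_diff: "vanishes f \<Longrightarrow> vanishes g \<Longrightarrow> vanishes (\<lambda>x. f x - g x)"
  using vanishes_add[OF _ vanishes_cmult[of g "-1"]] by simp

lemma bounded_support_vanishes:
  assumes "continuous_on UNIV f" "bounded {x. f x \<noteq> 0}"
  shows "vanishes f"
  unfolding vanishes_def
proof (intro conjI allI impI)
  obtain R where R: "\<And>x. f x \<noteq> 0 \<Longrightarrow> norm x \<le> R"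
    using assms(2) unfolding bounded_iff by blast
  fix e :: real assume "e > 0"
  then have "\<forall>x. norm x \<ge> R + 1 \<longrightarrow> \<bar>f x\<bar> \<le> e"
    using R by (metis abs_zero add_le_same_cancel1 dual_order.trans less_imp_le not_one_le_zero)
  then show "\<exists>R. \<forall>x. norm x \<ge> R \<longrightarrow> \<bar>f x\<bar> \<le> e" by blast
qed (fact assms(1))

lemma vanishes_bounded:
  assumes "vanishes f"
  obtains C where "C > 0" "\<And>x. \<bar>f x\<bar> \<le> C"
proof -
  obtain R where R: "\<And>x. norm x \<ge> R \<Longrightarrow> \<bar>f x\<bar> \<le> 1"
    using vanishesD[OF assms, of 1] by auto
  have "bounded (f ` cball 0 R)"
    using compact_continuous_image[OF continuous_on_subset[OF vanishes_continuous[OF assms]] compact_cball]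
    by (auto intro: compact_imp_bounded)
  then obtain C where C: "\<forall>y\<in>f ` cball 0 R. norm y \<le> C"
    unfolding bounded_iff by blast
  have "\<bar>f x\<bar> \<le> C" if "norm x \<le> R" for x
    using C that by auto
  then have "\<bar>f x\<bar> \<le> max C 1" for x
    using R[of x] by (cases "norm x \<le> R") (auto intro: max.coboundedI1 max.coboundedI2)
  then show thesis using that[of "max C 1"] by auto
qed

lemma vanishes_attains_sup:
  assumes "vanishes f" "f x1 > 0"
  obtains x0 where "\<And>x. f x \<le> f x0"
proof -
  obtain R where R: "\<And>x. norm x \<ge> R \<Longrightarrow> \<bar>f x\<bar> \<le> f x1 / 2"
    using vanishesD[OF assms(1), of "f x1 / 2"] assms(2) by auto
  have x1: "x1 \<in> cball 0 R" using R[of x1] assms(2) by (force simp: not_le)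
  obtain x0 where x0: "x0 \<in> cball 0 R" "\<And>x. x \<in> cball 0 R \<Longrightarrow> f x \<le> f x0"
    using continuous_attains_sup[OF compact_cball, of "0 :: real^'a" R f] x1
      continuous_on_subset[OF vanishes_continuous[OF assms(1)]] by blast
  have "f x \<le> f x0" for x
  proof (cases "x \<in> cball 0 R")
    case False
    then have "f x \<le> f x1 / 2" using R[of x] by (simp add: abs_le_iff)
    also have "\<dots> \<le> f x0" using x0(2)[OF x1] assms(2) by simp
    finally show ?thesis .
  qed (rule x0(2))
  then show thesis by (rule that)
qed

lemma vanishes_approx:
  assumes "vanishes f" "e > 0"
  obtains g where "continuous_on UNIV g" "bounded {x. g x \<noteq> 0}"
    "\<And>x. \<bar>g x\<bar> \<le> \<bar>f x\<bar>" "\<And>x. \<bar>f x - g x\<bar> \<le> e"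
proof -
  obtain R where R: "\<And>x. norm x \<ge> R \<Longrightarrow> \<bar>f x\<bar> \<le> e"
    using vanishesD[OF assms] by auto
  define k :: "real^'a \<Rightarrow> real" where "k x = max 0 (min 1 (R + 1 - norm x))" for x
  have k: "0 \<le> k x" "k x \<le> 1" for x by (auto simp: k_def)
  show thesis
  proof
    show "continuous_on UNIV (\<lambda>x. k x * f x)"
      unfolding k_def by (intro continuous_intros vanishes_continuous assms)
    show "bounded {x. k x * f x \<noteq> 0}"
      unfolding bounded_iff by (intro exI[of _ "R + 1"]) (auto simp: k_def max_def split: if_splits)
    show "\<bar>k x * f x\<bar> \<le> \<bar>f x\<bar>" for x
      using mult_right_mono[OF k(2) abs_ge_zero[of "f x"], of x] k(1)[of x] by (simp add: abs_mult)
    show "\<bar>f x - k x * f x\<bar> \<le> e" for x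
    proof (cases "norm x \<le> R")
      case True
      then have "k x = 1" by (simp add: k_def)
      then show ?thesis using assms(2) by simp
    next
      case False
      have "\<bar>f x - k x * f x\<bar> = (1 - k x) * \<bar>f x\<bar>"
      proof -
        have "f x - k x * f x = (1 - k x) * f x" by (simp add: left_diff_distrib)
        then show ?thesis using k(2)[of x] by (simp add: abs_mult)
      qed
      also have "\<dots> \<le> 1 * e"
        using R[of x] False k[of x] by (intro mult_mono) auto
      finally show ?thesis by simp
    qed
  qed
qed

section \<open>The maximum principle\<close>

lemma directional_derivative:
  fixes u :: "real^'d::finite \<Rightarrow> real"
  assumes "\<And>x. u differentiable (at x)"
  shows "((\<lambda>s. u (x + s *\<^sub>R v)) has_real_derivative (\<Sum>i\<in>UNIV. v $ i * pd i u (x + s *\<^sub>R v))) (at s)"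
proof -
  have "((\<lambda>s. x + s *\<^sub>R v) has_derivative (\<lambda>h. h *\<^sub>R v)) (at s)"
    by (auto intro!: derivative_eq_intros)
  from has_derivative_compose[OF this has_derivative_pd[OF assms]]
  show ?thesis unfolding has_field_derivative_def
    by (rule has_derivative_eq_rhs) (simp add: fun_eq_iff sum_distrib_left mult_ac)
qed

text \<open>Otherwise the derivative along \<open>v\<close>, which is 0 at the maximum, would be
  positive just after it, and \<open>u\<close> would exceed its maximum.\<close>

lemma second_derivative_at_max:
  fixes u :: "real^'d::finite \<Rightarrow> real"
  assumes u: "smooth u" and max: "\<And>x. u x \<le> u x0"
  shows "(\<Sum>i\<in>UNIV. \<Sum>j\<in>UNIV. v $ i * v $ j * pd i (pd j u) x0) \<le> 0"
proof (rule ccontr)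
  define \<phi>' where "\<phi>' s = (\<Sum>j\<in>UNIV. v $ j * pd j u (x0 + s *\<^sub>R v))" for s
  have 1: "((\<lambda>s. u (x0 + s *\<^sub>R v)) has_real_derivative \<phi>' s) (at s)" for s
    unfolding \<phi>'_def by (rule directional_derivative[OF smooth_differentiable[OF u]])
  have 2: "(\<phi>' has_real_derivative (\<Sum>j\<in>UNIV. v $ j * (\<Sum>i\<in>UNIV. v $ i * pd i (pd j u) (x0 + s *\<^sub>R v)))) (at s)" for s
    unfolding \<phi>'_def
    by (intro DERIV_sum DERIV_cmult directional_derivative smooth_differentiable smooth_pd u)
  have swap: "(\<Sum>j\<in>UNIV. v $ j * (\<Sum>i\<in>UNIV. v $ i * pd i (pd j u) (x0 + 0 *\<^sub>R v)))
      = (\<Sum>i\<in>UNIV. \<Sum>j\<in>UNIV. v $ i * v $ j * pd i (pd j u) x0)"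
  proof -
    have "(\<Sum>j\<in>UNIV. v $ j * (\<Sum>i\<in>UNIV. v $ i * pd i (pd j u) (x0 + 0 *\<^sub>R v)))
        = (\<Sum>j\<in>UNIV. \<Sum>i\<in>UNIV. v $ i * v $ j * pd i (pd j u) x0)"
      by (simp add: sum_distrib_left mult_ac)
    also have "\<dots> = (\<Sum>i\<in>UNIV. \<Sum>j\<in>UNIV. v $ i * v $ j * pd i (pd j u) x0)"
      by (rule sum.swap)
    finally show ?thesis .
  qed
  assume "\<not> ?thesis"
  then have pos: "0 < (\<Sum>j\<in>UNIV. v $ j * (\<Sum>i\<in>UNIV. v $ i * pd i (pd j u) (x0 + 0 *\<^sub>R v)))"
    unfolding swap by simp
  have "\<phi>' 0 = 0"
    by (rule DERIV_local_max[OF 1 zero_less_one]) (simp add: max)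
  then obtain d where d: "d > 0" "\<And>h. 0 < h \<Longrightarrow> h < d \<Longrightarrow> 0 < \<phi>' h"
    using DERIV_pos_inc_right[OF 2 pos] by auto
  have "u (x0 + 0 *\<^sub>R v) < u (x0 + (d / 2) *\<^sub>R v)"
  proof (rule DERIV_pos_imp_increasing_open[of 0 "d / 2" "\<lambda>s. u (x0 + s *\<^sub>R v)"])
    show "continuous_on {0..d / 2} (\<lambda>s. u (x0 + s *\<^sub>R v))"
      using 1 DERIV_isCont by (intro continuous_at_imp_continuous_on) blast
    show "\<exists>y. ((\<lambda>s. u (x0 + s *\<^sub>R v)) has_real_derivative y) (at s) \<and> y > 0" if "0 < s" "s < d / 2" for s
      using 1[of s] d that by (intro exI[of _ "\<phi>' s"]) auto
  qed (use d in auto)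
  then show False using max[of "x0 + (d / 2) *\<^sub>R v"] by simp
qed

text \<open>The factorisation of the matrix splits the second-order part into second derivatives
  along the columns of \<open>S\<close>, each of which is nonpositive at a maximum; the gradient is
  0 there.\<close>

lemma gen_at_max:
  fixes u :: "real^'d::finite \<Rightarrow> real" and S :: "real^'m::finite^'d"
  assumes u: "smooth u" and max: "\<And>x. u x \<le> u x0" and a: "a x0 = S ** transpose S"
  shows "gen b a u x0 \<le> 0"
proof -
  have grad: "pd i u x0 = 0" for i
  proof -
    have "((\<lambda>s. u (x0 + s *\<^sub>R axis i 1)) has_real_derivative
        (\<Sum>j\<in>UNIV. axis i 1 $ j * pd j u (x0 + 0 *\<^sub>R axis i 1))) (at 0)"
      by (rule directional_derivative[OF smooth_differentiable[OF u]])
    then have "(\<Sum>j\<in>UNIV. axis i 1 $ j * pd j u (x0 + 0 *\<^sub>R axis i 1)) = 0"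
      by (rule DERIV_local_max[OF _ zero_less_one]) (simp add: max)
    then show ?thesis by (simp add: sum_axis)
  qed
  have "(\<Sum>i\<in>UNIV. \<Sum>j\<in>UNIV. a x0 $ i $ j * pd i (pd j u) x0) =
      (\<Sum>i\<in>UNIV. \<Sum>j\<in>UNIV. \<Sum>k\<in>UNIV. column k S $ i * column k S $ j * pd i (pd j u) x0)"
    by (simp add: a matrix_matrix_mult_def transpose_def column_def sum_distrib_right)
  also have "\<dots> = (\<Sum>i\<in>UNIV. \<Sum>k\<in>UNIV. \<Sum>j\<in>UNIV. column k S $ i * column k S $ j * pd i (pd j u) x0)"
    by (intro sum.cong refl sum.swap)
  also have "\<dots> = (\<Sum>k\<in>UNIV. \<Sum>i\<in>UNIV. \<Sum>j\<in>UNIV. column k S $ i * column k S $ j * pd i (pd j u) x0)"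
    by (rule sum.swap)
  also have "\<dots> \<le> 0"
    by (intro sum_nonpos second_derivative_at_max u max)
  finally show ?thesis by (simp add: gen_def grad)
qed

section \<open>Approximate solutions of the resolvent equation: soft arguments\<close>

lemma gen_add:
  assumes "smooth u" "smooth v"
  shows "gen b a (\<lambda>x. u x + v x) x = gen b a u x + gen b a v x"
proof -
  have p: "pd i (\<lambda>x. u x + v x) = (\<lambda>x. pd i u x + pd i v x)" for i
    using assms smooth_differentiable pd_add by blast
  have "pd i (\<lambda>x. pd j u x + pd j v x) x = pd i (pd j u) x + pd i (pd j v) x" for i j
    by (intro pd_add smooth_differentiable smooth_pd assms)
  then show ?thesis
    by (simp add: gen_def p distrib_left sum.distrib)
qed

lemma gen_cmult:
  assumes "smooth u"
  shows "gen b a (\<lambda>x. c * u x) x = c * gen b a u x"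
proof -
  have p: "pd i (\<lambda>x. c * v x) = (\<lambda>x. c * pd i v x)" if "smooth v" for i and v :: "real^'a \<Rightarrow> real"
    using pd_mult[of "\<lambda>_. c" _ v] smooth_differentiable[OF that] by (auto simp: pd_const)
  show ?thesis
    by (simp add: gen_def p assms smooth_pd sum_distrib_left distrib_left mult_ac)
qed

lemma gen_add_fun: "smooth u \<Longrightarrow> smooth v \<Longrightarrow> gen b a (\<lambda>x. u x + v x) = (\<lambda>x. gen b a u x + gen b a v x)"
  and gen_cmult_fun: "smooth u \<Longrightarrow> gen b a (\<lambda>x. c * u x) = (\<lambda>x. c * gen b a u x)"
  by (intro ext gen_add gen_cmult; assumption)+

text \<open>Smooth functions that stay in \<open>C_0\<close> together with their image under the
  generator. The resolvent equation is solved in this set up to an arbitrarily small uniform error,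
  which is the range condition of Hille and Yosida.\<close>

definition dom0 :: "(real^'d::finite \<Rightarrow> real^'d) \<Rightarrow> (real^'d \<Rightarrow> real^'d^'d) \<Rightarrow> (real^'d \<Rightarrow> real) set" where
  "dom0 b a = {u. sm u \<and> vanishes u \<and> vanishes (gen b a u)}"

lemma dom0_add: "u \<in> dom0 b a \<Longrightarrow> v \<in> dom0 b a \<Longrightarrow> (\<lambda>x. u x + v x) \<in> dom0 b a"
  unfolding dom0_def by (simp add: sm.add vanishes_add gen_add_fun sm_imp_smooth)

lemma dom0_cmult: "u \<in> dom0 b a \<Longrightarrow> (\<lambda>x. c * u x) \<in> dom0 b a"
  unfolding dom0_def by (simp add: sm_cmult vanishes_cmult gen_cmult_fun sm_imp_smooth)

lemma dom0_zero: "(\<lambda>x. 0) \<in> dom0 b a"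
proof -
  have "gen b a (\<lambda>x. 0) = (\<lambda>x. 0)" by (rule ext) (simp add: gen_def pd_const)
  then show ?thesis by (simp add: dom0_def sm.const vanishes_zero)
qed

lemma dom0_sum: "finite I \<Longrightarrow> (\<And>i. i \<in> I \<Longrightarrow> u i \<in> dom0 b a) \<Longrightarrow>
    (\<lambda>x. \<Sum>i\<in>I. c i * u i x) \<in> dom0 b a \<and> (\<forall>x. gen b a (\<lambda>x. \<Sum>i\<in>I. c i * u i x) x = (\<Sum>i\<in>I. c i * gen b a (u i) x))"
proof (induction I rule: finite_induct)
  case empty
  then show ?case by (simp add: dom0_zero gen_def pd_const)
next
  case (insert i I)
  then have IH: "(\<lambda>x. \<Sum>i\<in>I. c i * u i x) \<in> dom0 b a"
      "\<And>x. gen b a (\<lambda>x. \<Sum>i\<in>I. c i * u i x) x = (\<Sum>i\<in>I. c i * gen b a (u i) x)" and i: "u i \<in> dom0 b a" by auto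
  have "smooth (\<lambda>x. c i * u i x)" "smooth (u i)" "smooth (\<lambda>x. \<Sum>i\<in>I. c i * u i x)"
    using dom0_cmult[OF i, of "c i"] IH(1) i by (auto simp: dom0_def sm_imp_smooth)
  then show ?case
    using insert.hyps IH dom0_add[OF dom0_cmult[OF i, of "c i"] IH(1)]
    by (simp add: gen_add gen_cmult)
qed

text \<open>At a maximum \<open>x0\<close> of \<open>u\<close> the generator is nonpositive, hence
  \<open>l * u x0 <= l * u x0 - gen b a u x0 <= N\<close>. The other sign is the same argument for
  \<open>- u\<close>.\<close>

lemma resolvent_contraction:
  fixes \<sigma> :: "real^'d::finite \<Rightarrow> real^'m::finite^'d"
  assumes a: "\<And>x. a x = \<sigma> x ** transpose (\<sigma> x)"
    and u: "u \<in> dom0 b a" and l: "l > 0"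
    and le: "\<And>x. \<bar>l * u x - gen b a u x\<bar> \<le> N"
  shows "l * \<bar>u x\<bar> \<le> N"
proof -
  have upper: "l * v x \<le> N" if v: "v \<in> dom0 b a" and le: "\<And>x. \<bar>l * v x - gen b a v x\<bar> \<le> N" for v x
  proof (cases "v x > 0")
    case True
    obtain x0 where x0: "\<And>x. v x \<le> v x0"
      using vanishes_attains_sup[of v x] v True by (auto simp: dom0_def sm_imp_smooth)
    have "gen b a v x0 \<le> 0"
      by (rule gen_at_max[where S = "\<sigma> x0"]) (use v x0 a in \<open>auto simp: dom0_def sm_imp_smooth\<close>)
    then have "l * v x0 \<le> N" using le[of x0] by linarith
    then show ?thesis using mult_left_mono[OF x0[of x], of l] l by linarith
  next
    case False
    have "0 \<le> N" using le[of x] by linarith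
    moreover have "l * v x \<le> 0" using False l by (simp add: mult_nonneg_nonpos)
    ultimately show ?thesis by linarith
  qed
  have "\<bar>l * (-1 * u x) - gen b a (\<lambda>x. -1 * u x) x\<bar> \<le> N" for x
    using le[of x] u by (subst gen_cmult) (auto simp: dom0_def sm_imp_smooth)
  from upper[OF dom0_cmult[OF u] this, of x] upper[OF u le, of x]
  show ?thesis using l by (simp add: abs_if)
qed

text \<open>The residual again vanishes at infinity, so the step applies to it and the errors
  decrease geometrically. Gaining one fixed factor is thus enough for density of the range.\<close>

lemma residual_iteration:
  assumes step: "\<And>f M. vanishes f \<Longrightarrow> M > 0 \<Longrightarrow> (\<And>x. \<bar>f x\<bar> \<le> M) \<Longrightarrow>
      \<exists>u\<in>dom0 b a. \<forall>x. \<bar>f x - (l * u x - gen b a u x)\<bar> \<le> \<theta> * M"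
    and \<theta>: "0 < \<theta>" "\<theta> < 1" and f: "vanishes f" and e: "e > 0"
  shows "\<exists>u\<in>dom0 b a. \<forall>x. \<bar>f x - (l * u x - gen b a u x)\<bar> \<le> e"
proof -
  obtain M where M: "M > 0" "\<And>x. \<bar>f x\<bar> \<le> M" using vanishes_bounded[OF f] by blast
  have iter: "\<exists>u\<in>dom0 b a. \<forall>x. \<bar>f x - (l * u x - gen b a u x)\<bar> \<le> \<theta> ^ n * M" for n
  proof (induction n)
    case 0
    show ?case
      by (rule bexI[OF _ dom0_zero]) (simp add: gen_def pd_const M)
  next
    case (Suc n)
    then obtain u where u: "u \<in> dom0 b a" "\<And>x. \<bar>f x - (l * u x - gen b a u x)\<bar> \<le> \<theta> ^ n * M" by blast
    have "vanishes (\<lambda>x. f x - (l * u x - gen b a u x))"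
      using u(1) f by (intro vanishes_diff vanishes_cmult) (auto simp: dom0_def sm_imp_smooth)
    moreover have "\<theta> ^ n * M > 0" using \<theta> M by simp
    ultimately obtain v where v: "v \<in> dom0 b a"
      "\<And>x. \<bar>(f x - (l * u x - gen b a u x)) - (l * v x - gen b a v x)\<bar> \<le> \<theta> * (\<theta> ^ n * M)"
      using step u(2) by blast
    have "gen b a (\<lambda>x. u x + v x) x = gen b a u x + gen b a v x" for x
      using u(1) v(1) by (intro gen_add) (auto simp: dom0_def sm_imp_smooth)
    then have "\<bar>f x - (l * (u x + v x) - gen b a (\<lambda>x. u x + v x) x)\<bar> \<le> \<theta> ^ Suc n * M" for x
      using v(2)[of x] by (simp add: algebra_simps)
    then show ?case by (intro bexI[OF _ dom0_add[OF u(1) v(1)]]) simp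
  qed
  obtain n where "\<theta> ^ n < e / M"
    using real_arch_pow_inv[of "e / M" \<theta>] \<theta> e M by auto
  then have "\<theta> ^ n * M \<le> e" using M by (simp add: pos_less_divide_eq)
  then show ?thesis using iter[of n] order_trans by meson
qed

text \<open>The parametrix works for large \<open>l\<close>, but the Laplace transform is evaluated
  at every positive integer. Solving at \<open>l0\<close> instead of \<open>l\<close> leaves the
  residual \<open>(l0 - l) * u\<close>, which the contraction bounds by nearly
  \<open>1 - l / l0\<close> times the data; this is a factor below 1.\<close>

lemma resolvent_extend:
  fixes \<sigma> :: "real^'d::finite \<Rightarrow> real^'m::finite^'d"
  assumes a: "\<And>x. a x = \<sigma> x ** transpose (\<sigma> x)"
    and dense: "\<And>f e. vanishes f \<Longrightarrow> e > 0 \<Longrightarrow> \<exists>u\<in>dom0 b a. \<forall>x. \<bar>f x - (l0 * u x - gen b a u x)\<bar> \<le> e"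
    and l: "0 < l" "l < l0" and f: "vanishes f" and e: "e > 0"
  shows "\<exists>u\<in>dom0 b a. \<forall>x. \<bar>f x - (l * u x - gen b a u x)\<bar> \<le> e"
proof (rule residual_iteration[OF _ _ _ f e, where \<theta> = "1 - l / (2 * l0)"])
  show "0 < 1 - l / (2 * l0)" "1 - l / (2 * l0) < 1" using l by (simp_all add: field_simps)
  fix f :: "real^'d \<Rightarrow> real" and M :: real assume f: "vanishes f" and M: "M > 0" "\<And>x. \<bar>f x\<bar> \<le> M"
  \<comment> \<open>Small enough that the approximation errors, at most \<open>2 * \<eta>\<close> in
    all, use up only half of the gain \<open>l / l0\<close>.\<close>
  define \<eta> where "\<eta> = l / (4 * l0)"
  have \<eta>: "\<eta> > 0" using l by (simp add: \<eta>_def)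
  obtain u where u: "u \<in> dom0 b a" "\<And>x. \<bar>f x - (l0 * u x - gen b a u x)\<bar> \<le> \<eta> * M"
    using dense[OF f, of "\<eta> * M"] \<eta> M by auto
  have "\<bar>l0 * u x - gen b a u x\<bar> \<le> (1 + \<eta>) * M" for x
    using u(2)[of x] M(2)[of x] by (simp add: distrib_right)
  then have ub: "l0 * \<bar>u x\<bar> \<le> (1 + \<eta>) * M" for x
    using resolvent_contraction[OF a u(1)] l by simp
  have "\<bar>f x - (l * u x - gen b a u x)\<bar> \<le> (1 - l / (2 * l0)) * M" for x
  proof -
    have "\<bar>(l0 - l) * u x\<bar> = (1 - l / l0) * (l0 * \<bar>u x\<bar>)"
    proof -
      have "\<bar>(l0 - l) * u x\<bar> = (l0 - l) * \<bar>u x\<bar>" using l by (simp add: abs_mult)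
      also have "\<dots> = (1 - l / l0) * (l0 * \<bar>u x\<bar>)" using l by (simp add: field_simps)
      finally show ?thesis .
    qed
    also have "\<dots> \<le> (1 - l / l0) * ((1 + \<eta>) * M)"
      using ub l by (intro mult_left_mono) auto
    finally have *: "\<bar>(l0 - l) * u x\<bar> \<le> (1 - l / l0) * ((1 + \<eta>) * M)" .
    have "\<bar>f x - (l * u x - gen b a u x)\<bar> \<le> \<eta> * M + (1 - l / l0) * ((1 + \<eta>) * M)"
    proof -
      have "f x - (l * u x - gen b a u x) = (f x - (l0 * u x - gen b a u x)) + (l0 - l) * u x"
        by (simp add: algebra_simps)
      then have "\<bar>f x - (l * u x - gen b a u x)\<bar> \<le> \<bar>f x - (l0 * u x - gen b a u x)\<bar> + \<bar>(l0 - l) * u x\<bar>"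
        by (simp only: abs_triangle_ineq)
      then show ?thesis using u(2)[of x] * by linarith
    qed
    also have "\<dots> = (1 - l / (2 * l0)) * M - (l / l0) * (\<eta> * M)"
      using l unfolding \<eta>_def by (simp add: field_simps)
    also have "\<dots> \<le> (1 - l / (2 * l0)) * M"
      using l \<eta> M by simp
    finally show ?thesis .
  qed
  then show "\<exists>u\<in>dom0 b a. \<forall>x. \<bar>f x - (l * u x - gen b a u x)\<bar> \<le> (1 - l / (2 * l0)) * M"
    using u(1) by blast
qed

text \<open>The parametrix is an integral of Gaussians over time and space and is not itself an
  element of \<open>sm\<close>; its Riemann sums are finite combinations of Gaussians. The error
  must be uniform in \<open>x\<close>, because it is fed into the maximum principle. The uniform
  decay reduces this to uniform continuity on a compact set.\<close>

lemma uniform_riemann_sum: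
  fixes h :: "'a::euclidean_space \<Rightarrow> real^'d::finite \<Rightarrow> real"
  assumes cont: "continuous_on (cbox l u \<times> UNIV) (\<lambda>(p, x). h p x)"
    and decay: "\<And>e. e > 0 \<Longrightarrow> \<exists>R. \<forall>p\<in>cbox l u. \<forall>x. norm x \<ge> R \<longrightarrow> \<bar>h p x\<bar> \<le> e"
    and e: "e > 0"
  obtains D :: "('a \<times> 'a set) set" where "finite D" "\<And>p K. (p, K) \<in> D \<Longrightarrow> p \<in> cbox l u"
    "\<And>x. \<bar>integral (cbox l u) (\<lambda>p. h p x) - (\<Sum>(p, K)\<in>D. measure lborel K * h p x)\<bar> \<le> e"
proof -
  \<comment> \<open>The summand 1 avoids a division by 0 for a degenerate box.\<close>
  define e' where "e' = e / (measure lborel (cbox l u) + 1)"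
  have c0: "measure lborel (cbox l u) \<ge> 0" by simp
  have e': "e' > 0" "e' * measure lborel (cbox l u) \<le> e"
  proof -
    define c where "c = measure lborel (cbox l u)"
    have c: "c \<ge> 0" using c0 by (simp add: c_def)
    then show "e' > 0" using e unfolding e'_def c_def[symmetric] by simp
    have "e * c / (c + 1) \<le> e * (c + 1) / (c + 1)"
      using e c by (intro divide_right_mono mult_left_mono) auto
    then show "e' * measure lborel (cbox l u) \<le> e"
      using c unfolding e'_def c_def[symmetric] by simp
  qed
  obtain R where R: "\<And>p x. p \<in> cbox l u \<Longrightarrow> norm x \<ge> R \<Longrightarrow> \<bar>h p x\<bar> \<le> e' / 2"
    using decay[of "e' / 2"] e' by auto
  have "uniformly_continuous_on (cbox l u \<times> cball 0 R) (\<lambda>(p, x). h p x)"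
    by (intro compact_uniformly_continuous continuous_on_subset[OF cont] compact_Times compact_cbox compact_cball) auto
  then obtain \<delta> where \<delta>: "\<delta> > 0"
    "\<And>p x p' x'. p \<in> cbox l u \<Longrightarrow> x \<in> cball 0 R \<Longrightarrow> p' \<in> cbox l u \<Longrightarrow> x' \<in> cball 0 R \<Longrightarrow>
      dist (p', x') (p, x) < \<delta> \<Longrightarrow> dist (h p' x') (h p x) < e'"
    unfolding uniformly_continuous_on_def using e'(1) by fast
  have unif: "\<bar>h p' x - h p x\<bar> \<le> e'" if "p \<in> cbox l u" "p' \<in> cbox l u" "dist p' p < \<delta>" for p p' x
  proof (cases "norm x \<le> R")
    case True
    then show ?thesis
      using \<delta>(2)[of p x p' x] that by (simp add: dist_Pair_Pair dist_real_def)
  next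
    case False
    then show ?thesis using R[of p x] R[of p' x] that by linarith
  qed
  obtain D where D: "D tagged_division_of (cbox l u)" "(\<lambda>p. ball p \<delta>) fine D"
    using fine_division_exists[of "\<lambda>p. ball p \<delta>"] \<delta>(1) by (metis gauge_ball)
  have int: "(\<lambda>p. h p x) integrable_on (cbox l u)" for x
  proof (rule integrable_continuous)
    show "continuous_on (cbox l u) (\<lambda>p. h p x)"
    proof -
      have "continuous_on (cbox l u) (\<lambda>p. (p, x))" by (intro continuous_intros)
      from continuous_on_compose2[OF cont this] show "continuous_on (cbox l u) (\<lambda>p. h p x)" by auto
    qed
  qed
  show thesis
  proof (rule that[of D])
    show "finite D" using D(1) by blast
    show "p \<in> cbox l u" if "(p, K) \<in> D" for p K
      using D(1) that tag_in_interval by blast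
    fix x
    have "integral (cbox l u) (\<lambda>p. h p x) - (\<Sum>(p, K)\<in>D. measure lborel K * h p x) =
        (\<Sum>(p, K)\<in>D. integral K (\<lambda>p'. h p' x) - measure lborel K * h p x)"
      by (subst integral_combine_tagged_division_topdown[OF int D(1)])
        (simp add: case_prod_beta' sum_subtractf)
    also have "\<bar>\<dots>\<bar> \<le> (\<Sum>(p, K)\<in>D. e' * measure lborel K)"
    proof (rule order_trans[OF sum_abs], rule sum_mono, clarify)
      fix p K assume pK: "(p, K) \<in> D"
      obtain l' u' where K: "K = cbox l' u'" using D(1) pK by blast
      have sub: "K \<subseteq> cbox l u" "K \<subseteq> ball p \<delta>" "p \<in> cbox l u"
        using D pK tag_in_interval by (blast, auto simp: fine_def)
      have intK: "(\<lambda>p. h p x) integrable_on K"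
        using integrable_on_subcbox[OF int] sub(1) K by blast
      have "((\<lambda>p'. h p' x - h p x) has_integral (integral K (\<lambda>p'. h p' x) - measure lborel K * h p x)) K"
        using has_integral_diff[OF integrable_integral[OF intK] has_integral_const[of "h p x" l' u', folded K]] by simp
      then have "norm (integral K (\<lambda>p'. h p' x) - measure lborel K * h p x) \<le> e' * measure lborel K"
        unfolding K
        by (rule has_integral_bound[OF less_imp_le[OF e'(1)]])
          (use sub K unif in \<open>auto simp: dist_commute subset_iff\<close>)
      then show "\<bar>integral K (\<lambda>p'. h p' x) - measure lborel K * h p x\<bar> \<le> e' * measure lborel K" by simp
    qed
    also have "\<dots> = e' * measure lborel (cbox l u)"
      using additive_content_tagged_division[OF D(1)]
      by (simp add: case_prod_beta' sum_distrib_left[symmetric])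
    also have "\<dots> \<le> e" by (rule e')
    finally show "\<bar>integral (cbox l u) (\<lambda>p. h p x) - (\<Sum>(p, K)\<in>D. measure lborel K * h p x)\<bar> \<le> e" .
  qed
qed

section \<open>A parametrix for bounded Lipschitz coefficients\<close>

lemma bounded_bilinear_matrix_vector: "bounded_bilinear ((*v) :: real^'n::finite^'m::finite \<Rightarrow> real^'n \<Rightarrow> real^'m)"
proof
  show "\<exists>K. \<forall>(M :: real^'n^'m) v. norm (M *v v) \<le> norm M * norm v * K"
    using norm_matrix_vector_le by (intro exI[of _ 1]) auto
qed (auto simp: matrix_vector_mult_add_rdistrib matrix_vector_right_distrib scaleR_matrix_vector_assoc
      matrix_vector_mult_scaleR)

lemmas continuous_on_matrix_vector[continuous_intros] = bounded_bilinear.continuous_on[OF bounded_bilinear_matrix_vector]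

lemma exp_quadratic_integrable:
  assumes c: "c > 0"
  shows "integrable lborel (\<lambda>z::real^'d::finite. exp (- (c * (norm z)\<^sup>2)))"
proof -
  let ?n = "CARD('d) + 1"
  define C where "C = (real ?n / c) ^ ?n * exp c"
  have C: "C \<ge> 0" using c by (simp add: C_def)
  have le: "exp (- (c * (norm z)\<^sup>2)) \<le> C * kern 1 z" for z :: "real^'d"
  proof -
    let ?s = "1 + (norm z)\<^sup>2"
    have s: "?s \<ge> 1" by simp
    have "?s powr (real CARD('d) / 2 + 1) \<le> ?s powr (real ?n)"
      by (rule powr_mono[OF _ s]) simp
    also have "\<dots> = ?s ^ ?n"
      using s by (intro powr_realpow) (simp add: add_pos_nonneg)
    finally have "?s powr (real CARD('d) / 2 + 1) * exp (- (c * (norm z)\<^sup>2)) \<le> ?s ^ ?n * exp (- (c * (norm z)\<^sup>2))"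
      by (rule mult_right_mono) simp
    also have "\<dots> \<le> C" unfolding C_def by (rule exp_gt_power) (use c in auto)
    finally have "?s powr (real CARD('d) / 2 + 1) * exp (- (c * (norm z)\<^sup>2)) \<le> C" .
    moreover have "?s powr (real CARD('d) / 2 + 1) > 0" using s by (smt (verit) powr_gt_zero)
    ultimately have "exp (- (c * (norm z)\<^sup>2)) \<le> C / ?s powr (real CARD('d) / 2 + 1)"
      by (simp add: field_simps)
    then show ?thesis
      by (simp only: kern_def powr_minus_divide) (simp add: add.commute)
  qed
  have fin: "(\<integral>\<^sup>+z. ennreal (exp (- (c * (norm (z::real^'d))\<^sup>2))) \<partial>lborel) < \<infinity>"
  proof -
    have "(\<integral>\<^sup>+z. ennreal (exp (- (c * (norm (z::real^'d))\<^sup>2))) \<partial>lborel) \<le> (\<integral>\<^sup>+z. ennreal C * ennreal (kern 1 (z::real^'d)) \<partial>lborel)"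
      using le C by (intro nn_integral_mono) (simp add: ennreal_mult'[symmetric] ennreal_leI)
    also have "\<dots> = ennreal C * (\<integral>\<^sup>+z. ennreal (kern 1 (z::real^'d)) \<partial>lborel)"
      by (rule nn_integral_cmult) measurable
    also have "\<dots> < \<infinity>" using nn_integral_kern_1[where 'd = 'd] by (simp add: ennreal_mult_less_top)
    finally show ?thesis .
  qed
  show ?thesis
    by (rule integrableI_nonneg) (use fin in auto)
qed

lemma integral_scale:
  fixes h :: "real^'d::finite \<Rightarrow> real" and x :: "real^'d"
  assumes h: "integrable lborel h" "\<And>z. 0 \<le> h z" and t: "t > 0"
  shows "integrable lborel (\<lambda>y. t powr (- (real CARD('d) / 2)) * h ((x - y) /\<^sub>R sqrt t))" (is "integrable _ ?f")
    "(\<integral>y. t powr (- (real CARD('d) / 2)) * h ((x - y) /\<^sub>R sqrt t) \<partial>lborel) = (\<integral>z. h z \<partial>lborel)"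
proof -
  have [measurable]: "h \<in> borel_measurable borel" using h(1) by auto
  have pw: "t powr (- (real CARD('d) / 2)) * sqrt t ^ CARD('d) = 1"
    using t by (simp add: powr_half_sqrt[symmetric] powr_powr powr_add[symmetric] flip: powr_realpow)
  have "(\<integral>\<^sup>+y. ennreal (?f y) \<partial>lborel) = (\<integral>\<^sup>+y. ennreal (t powr (- (real CARD('d) / 2))) * ennreal (h ((x - y) /\<^sub>R sqrt t)) \<partial>lborel)"
    by (simp add: ennreal_mult')
  also have "\<dots> = ennreal (t powr (- (real CARD('d) / 2))) * (\<integral>\<^sup>+y. ennreal (h ((x - y) /\<^sub>R sqrt t)) \<partial>lborel)"
    by (rule nn_integral_cmult) measurable
  also have "\<dots> = ennreal (t powr (- (real CARD('d) / 2)) * sqrt t ^ CARD('d)) * (\<integral>\<^sup>+z. ennreal (h z) \<partial>lborel)"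
    using nn_integral_kern_scale[OF t, of "\<lambda>z. ennreal (h z)" x] t by (simp add: ennreal_mult' mult.assoc)
  also have "\<dots> = ennreal (\<integral>z. h z \<partial>lborel)"
    unfolding pw using nn_integral_eq_integral[OF h(1)] h(2) by simp
  finally have eq: "(\<integral>\<^sup>+y. ennreal (?f y) \<partial>lborel) = ennreal (\<integral>z. h z \<partial>lborel)" .
  show int: "integrable lborel ?f"
    by (rule integrableI_nonneg) (use eq h(2) in auto)
  show "(\<integral>y. ?f y \<partial>lborel) = (\<integral>z. h z \<partial>lborel)"
    using integral_eq_nn_integral[of ?f lborel] eq h by (simp add: Bochner_Integration.integral_nonneg)
qed

locale global_elliptic =
  fixes a :: "real^'d::finite \<Rightarrow> real^'d^'d" and b :: "real^'d \<Rightarrow> real^'d" and lam Lam B L :: real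
  assumes spd: "\<And>y. spd (a y) lam Lam"
    and B: "\<And>x. norm (b x) \<le> B"
    and L: "\<And>x y. norm (a x - a y) \<le> L * norm (x - y)"
    and cont_b: "continuous_on UNIV b"
begin

lemma pos: "0 < lam" "0 < Lam" "0 \<le> B" "0 \<le> L"
proof -
  show "0 < lam" "0 < Lam" using spd.lam[OF spd[of 0]] spd.Lam_pos[OF spd[of 0]] .
  show "0 \<le> B" using B[of 0] norm_ge_zero order_trans by blast
  obtain e :: "real^'d" where e: "norm e = 1"
    using vector_choose_size[of 1] by auto
  have "norm (a e - a 0) \<le> L" using L[of e 0] e by simp
  then show "0 \<le> L" by (rule order_trans[OF norm_ge_zero])
qed

lemma cont_a: "continuous_on UNIV a"
proof -
  have "L-lipschitz_on UNIV a" using L pos by (auto simp: lipschitz_on_def dist_norm)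
  then show ?thesis by (rule lipschitz_on_continuous_on)
qed

definition Ai where "Ai y = spd.A (a y)"
definition Q where "Q y z = z \<bullet> (Ai y *v z)"
definition c1 where "c1 = lam / Lam\<^sup>2"
definition LA where "LA = real CARD('d) * L / lam\<^sup>2"

lemma c1_pos: "c1 > 0" and LA_nonneg: "LA \<ge> 0" using pos by (simp_all add: c1_def LA_def)

lemma Ai_sym: "transpose (Ai y) = Ai y" unfolding Ai_def by (rule spd.A_sym[OF spd])
lemma Ai_norm: "norm (Ai y *v z) \<le> norm z / lam" unfolding Ai_def by (rule spd.norm_Az[OF spd])
lemma norm_Ai: "norm (Ai y) \<le> real CARD('d) / lam" unfolding Ai_def by (rule spd.norm_A[OF spd])
lemma Ai_inner: "Ai y \<bullet> a y = real CARD('d)" unfolding Ai_def by (rule spd.A_inner[OF spd])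
lemma aAi: "a y *v (Ai y *v z) = z" unfolding Ai_def by (rule spd.aA[OF spd])
lemma Aia: "Ai y *v (a y *v z) = z" unfolding Ai_def by (rule spd.Aa[OF spd])
lemma Q_ge: "c1 * (norm z)\<^sup>2 \<le> Q y z" unfolding Q_def Ai_def c1_def by (rule spd.q_ge[OF spd])
lemma Q_le: "Q y z \<le> (norm z)\<^sup>2 / lam" unfolding Q_def Ai_def by (rule spd.q_le[OF spd])
lemma Q_nonneg: "0 \<le> Q y z" unfolding Q_def Ai_def by (rule spd.q_nonneg[OF spd])

text \<open>By the identity \<open>Ai x - Ai y = Ai x (a y - a x) Ai y\<close>, each inverse
  contributing a factor \<open>1 / lam\<close>.\<close>

lemma Ai_lipschitz: "norm (Ai x - Ai y) \<le> LA * norm (x - y)"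
proof -
  have app: "norm ((Ai x - Ai y) *v v) \<le> L / lam\<^sup>2 * norm (x - y) * norm v" for v
  proof -
    have "(Ai x - Ai y) *v v = Ai x *v ((a y - a x) *v (Ai y *v v))"
      by (simp add: matrix_vector_mult_diff_rdistrib matrix_vector_mult_diff_distrib aAi Aia)
    also have "norm \<dots> \<le> norm ((a y - a x) *v (Ai y *v v)) / lam" by (rule Ai_norm)
    also have "\<dots> \<le> (norm (a y - a x) * norm (Ai y *v v)) / lam"
      using pos by (intro divide_right_mono norm_matrix_vector_le) auto
    also have "\<dots> \<le> ((L * norm (y - x)) * (norm v / lam)) / lam"
      using pos by (intro divide_right_mono mult_mono L Ai_norm) auto
    also have "\<dots> = L / lam\<^sup>2 * norm (x - y) * norm v"
      by (simp add: power2_eq_square norm_minus_commute)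
    finally show ?thesis .
  qed
  have "norm ((Ai x - Ai y) $ i) \<le> L / lam\<^sup>2 * norm (x - y)" for i
  proof -
    have "(Ai x - Ai y) $ i = (Ai x - Ai y) *v axis i 1"
      using symmetric_nth[OF Ai_sym, of x] symmetric_nth[OF Ai_sym, of y]
      by (simp add: vec_eq_iff matrix_vector_mul_component inner_axis)
    then show ?thesis using app[of "axis i 1"] by simp
  qed
  then have "(\<Sum>i\<in>UNIV. norm ((Ai x - Ai y) $ i)) \<le> real CARD('d) * (L / lam\<^sup>2 * norm (x - y))"
    by (intro sum_bounded_above) auto
  moreover have "norm (Ai x - Ai y) \<le> (\<Sum>i\<in>UNIV. norm ((Ai x - Ai y) $ i))"
    unfolding norm_vec_def by (rule L2_set_le_sum) auto
  ultimately show ?thesis by (simp add: LA_def)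
qed

lemma cont_Ai: "continuous_on UNIV Ai"
proof -
  have "LA-lipschitz_on UNIV Ai" using Ai_lipschitz LA_nonneg by (auto simp: lipschitz_on_def dist_norm)
  then show ?thesis by (rule lipschitz_on_continuous_on)
qed

lemma Q_diff: "\<bar>Q x z - Q y z\<bar> \<le> LA * norm (x - y) * (norm z)\<^sup>2"
proof -
  have "Q x z - Q y z = z \<bullet> ((Ai x - Ai y) *v z)"
    by (simp add: Q_def matrix_vector_mult_diff_rdistrib inner_diff_right)
  then have "\<bar>Q x z - Q y z\<bar> \<le> norm z * norm ((Ai x - Ai y) *v z)"
    using Cauchy_Schwarz_ineq2 by metis
  also have "\<dots> \<le> norm z * (norm (Ai x - Ai y) * norm z)"
    by (intro mult_left_mono norm_matrix_vector_le) auto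
  also have "\<dots> \<le> norm z * ((LA * norm (x - y)) * norm z)"
    by (intro mult_left_mono mult_right_mono Ai_lipschitz) auto
  finally show ?thesis by (simp add: power2_eq_square mult_ac)
qed

definition g0 :: "real^'d \<Rightarrow> real" where "g0 z = exp (- (c1 / 4 * (norm z)\<^sup>2))"
definition gam where "gam t z = t powr (- (real CARD('d) / 2)) * g0 (z /\<^sub>R sqrt t)"
definition \<Gamma> where "\<Gamma> = (\<integral>z. g0 z \<partial>lborel)"

lemma g0_integrable: "integrable lborel g0"
  unfolding g0_def using c1_pos by (intro exp_quadratic_integrable) simp

lemma g0_nonneg: "0 \<le> g0 z" by (simp add: g0_def)

lemma gam_integral:
  assumes "t > 0"
  shows "integrable lborel (\<lambda>y. gam t (x - y))" "(\<integral>y. gam t (x - y) \<partial>lborel) = \<Gamma>"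
  unfolding gam_def \<Gamma>_def by (rule integral_scale[OF g0_integrable g0_nonneg assms])+

lemma gam_nonneg: "gam t z \<ge> 0" by (simp add: gam_def g0_def)

lemma \<Gamma>_nonneg: "\<Gamma> \<ge> 0" unfolding \<Gamma>_def g0_def by (intro Bochner_Integration.integral_nonneg) auto

definition CE where "CE = (real 2 / (c1 / 4)) ^ 2 * exp (c1 / 4)"

lemma CE_pos: "CE > 0" using c1_pos by (simp add: CE_def)

lemma CE:
  assumes t: "t > 0"
  shows "(1 + (norm z)\<^sup>2 / t)\<^sup>2 * exp (- (c1 * (norm z)\<^sup>2 / (2 * t))) \<le> CE * g0 (z /\<^sub>R sqrt t)"
proof -
  let ?s = "(norm z)\<^sup>2 / t"
  have "(1 + ?s)\<^sup>2 * exp (- (c1 / 4 * ?s)) \<le> CE"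
    unfolding CE_def by (rule exp_gt_power) (use t c1_pos in auto)
  then have "((1 + ?s)\<^sup>2 * exp (- (c1 / 4 * ?s))) * exp (- (c1 / 4 * ?s)) \<le> CE * exp (- (c1 / 4 * ?s))"
    by (rule mult_right_mono) simp
  moreover have "exp (- (c1 * (norm z)\<^sup>2 / (2 * t))) = exp (- (c1 / 4 * ?s)) * exp (- (c1 / 4 * ?s))"
    by (simp add: exp_add[symmetric])
  moreover have "g0 (z /\<^sub>R sqrt t) = exp (- (c1 / 4 * ?s))"
  proof -
    have "(norm (z /\<^sub>R sqrt t))\<^sup>2 = ?s"
      using t by (simp add: power_mult_distrib power_inverse divide_inverse mult.commute)
    then show ?thesis by (simp only: g0_def)
  qed
  ultimately show ?thesis by (simp only: mult.assoc)
qed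

text \<open>Equals \<open>(2 * pi) powr (d / 2) * sqrt (det (a y))\<close>. In the form of an
  integral its lower bound \<open>j0\<close> and its Lipschitz bound follow from those of
  \<open>Q\<close>, without determinants.\<close>

definition J where "J y = (\<integral>z. exp (- (Q y z / 2)) \<partial>lborel)"

lemma Q_measurable[measurable]: "Q y \<in> borel_measurable borel"
  unfolding Q_def by (intro borel_measurable_continuous_onI continuous_intros)

lemma exp_Q_le: "exp (- (Q y z / 2)) \<le> exp (- (c1 / 2 * (norm z)\<^sup>2))"
  using Q_ge[of z y] by simp

lemma exp_Q_integrable: "integrable lborel (\<lambda>z. exp (- (Q y z / 2)))"
  by (rule Bochner_Integration.integrable_bound[OF exp_quadratic_integrable[of "c1 / 2"]])
    (use c1_pos exp_Q_le in auto)

definition j0 where "j0 = exp (- (1 / (2 * lam))) * measure lborel (ball (0::real^'d) 1)"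

lemma j0_pos: "j0 > 0"
proof -
  have "emeasure lborel (ball (0::real^'d) 1) > 0"
    by (subst emeasure_ball) (auto intro!: mult_pos_pos simp: unit_ball_vol_def)
  then have "measure lborel (ball (0::real^'d) 1) > 0"
    using emeasure_bounded_finite[of "ball (0::real^'d) 1"] by (simp add: measure_def enn2real_positive_iff)
  then show ?thesis by (simp add: j0_def)
qed

lemma J_ge: "J y \<ge> j0"
proof -
  have "j0 = (\<integral>z. exp (- (1 / (2 * lam))) * indicator (ball (0::real^'d) 1) z \<partial>lborel)"
    by (simp add: j0_def)
  also have "\<dots> \<le> J y"
    unfolding J_def
  proof (rule integral_mono[OF _ exp_Q_integrable])
    show "integrable lborel (\<lambda>z. exp (- (1 / (2 * lam))) * indicator (ball (0::real^'d) 1) z)"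
      using emeasure_bounded_finite[of "ball (0::real^'d) 1"] by (intro integrable_mult_right integrable_real_indicator) auto
    show "exp (- (1 / (2 * lam))) * indicator (ball 0 1) z \<le> exp (- (Q y z / 2))" for z
    proof (cases "z \<in> ball 0 1")
      case True
      then have "(norm z)\<^sup>2 \<le> 1" by (simp add: power_le_one)
      then have "Q y z \<le> 1 / lam" using Q_le[of y z] pos divide_right_mono[of "(norm z)\<^sup>2" 1 lam] by simp
      then show ?thesis using True by simp
    qed simp
  qed
  finally show ?thesis .
qed

lemma exp_diff_le:
  fixes u v m :: real
  assumes "m \<le> u" "m \<le> v"
  shows "\<bar>exp (- u) - exp (- v)\<bar> \<le> \<bar>u - v\<bar> * exp (- m)"
proof -
  have *: "exp (- u) - exp (- v) \<le> (v - u) * exp (- m)" if "u \<le> v" "m \<le> u" for u v :: real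
  proof -
    have "exp (- u) - exp (- v) = exp (- u) * (1 - exp (- (v - u)))"
      by (simp add: exp_diff right_diff_distrib exp_minus field_simps exp_add[symmetric])
    also have "\<dots> \<le> exp (- m) * (v - u)"
    proof (rule mult_mono)
      show "1 - exp (- (v - u)) \<le> v - u"
        using exp_ge_add_one_self[of "- (v - u)"] by linarith
    qed (use that in auto)
    finally show ?thesis by (simp add: mult.commute)
  qed
  show ?thesis
    using *[of u v] *[of v u] assms by (cases "u \<le> v") auto
qed

lemma J_lipschitz: "\<bar>J x - J y\<bar> \<le> LA / 2 * CE * \<Gamma> * norm (x - y)"
proof -
  have "\<bar>J x - J y\<bar> = \<bar>\<integral>z. exp (- (Q x z / 2)) - exp (- (Q y z / 2)) \<partial>lborel\<bar>"
    unfolding J_def by (simp add: exp_Q_integrable)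
  also have "\<dots> \<le> (\<integral>z. (LA / 2 * CE * norm (x - y)) * gam 1 (0 - z) \<partial>lborel)"
  proof (rule integral_abs_bound_integral)
    show "integrable lborel (\<lambda>z. exp (- (Q x z / 2)) - exp (- (Q y z / 2)))"
      by (simp add: exp_Q_integrable)
    show "integrable lborel (\<lambda>z. (LA / 2 * CE * norm (x - y)) * gam 1 (0 - z))"
      using gam_integral(1)[of 1 0] by (intro integrable_mult_right) simp
    fix z
    have "\<bar>exp (- (Q x z / 2)) - exp (- (Q y z / 2))\<bar> \<le> \<bar>Q x z / 2 - Q y z / 2\<bar> * exp (- (c1 / 2 * (norm z)\<^sup>2))"
      using Q_ge[of z] by (intro exp_diff_le) auto
    also have "\<dots> \<le> (LA / 2 * norm (x - y) * (norm z)\<^sup>2) * exp (- (c1 / 2 * (norm z)\<^sup>2))"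
    proof (rule mult_right_mono)
      have "\<bar>Q x z / 2 - Q y z / 2\<bar> = \<bar>Q x z - Q y z\<bar> / 2"
        by (simp only: diff_divide_distrib[symmetric] abs_divide)
      then show "\<bar>Q x z / 2 - Q y z / 2\<bar> \<le> LA / 2 * norm (x - y) * (norm z)\<^sup>2"
        using Q_diff[of x z y] by simp
    qed simp
    also have "\<dots> = (LA / 2 * norm (x - y)) * ((norm z)\<^sup>2 * exp (- (c1 / 2 * (norm z)\<^sup>2)))" by simp
    also have "\<dots> \<le> (LA / 2 * norm (x - y)) * (CE * gam 1 (0 - z))"
    proof (intro mult_left_mono)
      have "(norm z)\<^sup>2 \<le> (1 + (norm z)\<^sup>2)\<^sup>2" by (simp add: power2_sum)
      then have "(norm z)\<^sup>2 * exp (- (c1 / 2 * (norm z)\<^sup>2)) \<le> (1 + (norm z)\<^sup>2)\<^sup>2 * exp (- (c1 / 2 * (norm z)\<^sup>2))"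
        by (intro mult_right_mono) auto
      also have "\<dots> \<le> CE * gam 1 (0 - z)" using CE[of 1 z] by (simp add: gam_def g0_def)
      finally show "(norm z)\<^sup>2 * exp (- (c1 / 2 * (norm z)\<^sup>2)) \<le> CE * gam 1 (0 - z)" .
    qed (use LA_nonneg in auto)
    finally show "\<bar>exp (- (Q x z / 2)) - exp (- (Q y z / 2))\<bar> \<le> (LA / 2 * CE * norm (x - y)) * gam 1 (0 - z)"
      by (simp add: mult_ac)
  qed
  also have "\<dots> = LA / 2 * CE * \<Gamma> * norm (x - y)"
    using gam_integral(2)[of 1 0] by simp
  finally show ?thesis .
qed

definition cn where "cn y = 1 / J y"
definition Lc where "Lc = LA / 2 * CE * \<Gamma> / j0\<^sup>2"

lemma cn_bounds: "0 < cn y" "cn y \<le> 1 / j0"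
  using J_ge[of y] j0_pos by (auto simp: cn_def intro!: divide_left_mono)

lemma Lc_nonneg: "Lc \<ge> 0"
  unfolding Lc_def using LA_nonneg CE_pos \<Gamma>_nonneg by (intro divide_nonneg_nonneg mult_nonneg_nonneg) auto

lemma cn_lipschitz: "\<bar>cn x - cn y\<bar> \<le> Lc * norm (x - y)"
proof -
  have J: "J x > 0" "J y > 0" using J_ge j0_pos less_le_trans by blast+
  have "\<bar>cn x - cn y\<bar> = \<bar>J x - J y\<bar> / (J x * J y)"
    using J by (simp add: cn_def abs_mult field_simps abs_minus_commute)
  also have "\<dots> \<le> (LA / 2 * CE * \<Gamma> * norm (x - y)) / (j0 * j0)"
    using J_lipschitz[of x y] J_ge j0_pos J LA_nonneg CE_pos \<Gamma>_nonneg
    by (intro frac_le mult_mono mult_nonneg_nonneg) auto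
  finally show ?thesis by (simp add: Lc_def power2_eq_square)
qed

lemma cont_cn: "continuous_on UNIV cn"
proof -
  have "Lc-lipschitz_on UNIV cn" using cn_lipschitz Lc_nonneg by (auto simp: lipschitz_on_def dist_norm)
  then show ?thesis by (rule lipschitz_on_continuous_on)
qed

end

context global_elliptic
begin

text \<open>The driftless Gaussian transition density from \<open>x\<close> to \<open>y\<close> with
  the matrix frozen at the target \<open>y\<close>. Freezing at the target makes it an exact
  Gaussian in \<open>x\<close>, the variable in which \<open>gen\<close> differentiates.\<close>

definition G where "G t y x = cn y * t powr (- (real CARD('d) / 2)) * exp (- (Q y (x - y) / (2 * t)))"

text \<open>At once the time derivative of \<open>G\<close> and its image under the second-order
  operator frozen at \<open>y\<close>. What freezing leaves over, including the drift, is collected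
  in \<open>rem\<close>.\<close>

definition T where "T t y x = G t y x * (Q y (x - y) / (2 * t\<^sup>2) - real CARD('d) / (2 * t))"

definition rem where "rem t y x = G t y x * (
    ((Ai y *v (x - y)) \<bullet> ((a x - a y) *v (Ai y *v (x - y)))) / (2 * t\<^sup>2)
    - (Ai y \<bullet> (a x - a y)) / (2 * t) - (b x \<bullet> (Ai y *v (x - y))) / t)"

lemma sm_G: "sm (G t y)"
proof -
  have "sm (\<lambda>x. (cn y * t powr (- (real CARD('d) / 2))) * exp ((- (1 / (2 * t))) * (Q y (x - y) + 0)))"
    unfolding Q_def by (intro sm_cmult sm_exp sm_quad)
  moreover have "G t y = (\<lambda>x. (cn y * t powr (- (real CARD('d) / 2))) * exp ((- (1 / (2 * t))) * (Q y (x - y) + 0)))"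
    by (simp add: G_def fun_eq_iff)
  ultimately show ?thesis by simp
qed

lemma gen_G:
  assumes t: "t > 0"
  shows "gen b a (G t y) x = T t y x + rem t y x"
proof -
  define k where "k = cn y * t powr (- (real CARD('d) / 2))"
  let ?w = "Ai y *v (x - y)"
  have G: "G t y = (\<lambda>x. k * exp (- (((x - y) \<bullet> (Ai y *v (x - y)) + 0) / (2 * t))))"
    by (simp add: G_def fun_eq_iff k_def Q_def)
  have "gen b a (G t y) x = (- G t y x / (2 * t)) * (2 * (b x \<bullet> ?w) + Ai y \<bullet> a x)
      + 2 * (G t y x / (4 * t\<^sup>2)) * (?w \<bullet> (a x *v ?w))"
    unfolding G
    by (rule gen_radial[OF Ai_sym[of y], of "\<lambda>s. k * exp (- (s / (2 * t)))" "\<lambda>s. - (k * exp (- (s / (2 * t)))) / (2 * t)" y 0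
          "\<lambda>s. (k * exp (- (s / (2 * t)))) / (4 * t\<^sup>2)"])
      (use t in \<open>auto intro!: derivative_eq_intros simp: field_simps power2_eq_square\<close>)
  moreover have "Ai y \<bullet> a x = real CARD('d) + Ai y \<bullet> (a x - a y)"
    using Ai_inner[of y] by (simp add: inner_diff_right)
  moreover have "?w \<bullet> (a x *v ?w) = Q y (x - y) + ?w \<bullet> ((a x - a y) *v ?w)"
    by (simp add: Q_def aAi matrix_vector_mult_diff_rdistrib inner_diff_right inner_commute)
  ultimately show ?thesis
    using t by (simp add: T_def rem_def) (simp add: field_simps power2_eq_square)
qed

definition CG where "CG = CE / j0"

lemma CG_pos: "CG > 0" using CE_pos j0_pos by (simp add: CG_def)

lemma G_nonneg: "G t y x \<ge> 0"
  unfolding G_def using cn_bounds(1)[of y] by (intro mult_nonneg_nonneg) auto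

text \<open>The weight is of fourth order in \<open>norm (x - y) / sqrt t\<close>, so it dominates
  all the powers up to the third that occur in \<open>T\<close> and \<open>rem\<close>.\<close>

lemma weighted_G:
  assumes t: "t > 0"
  shows "(1 + (norm (x - y))\<^sup>2 / t)\<^sup>2 * G t y x \<le> CG * gam t (x - y)"
proof -
  let ?z = "x - y"
  have "G t y x \<le> (1 / j0) * t powr (- (real CARD('d) / 2)) * exp (- (c1 * (norm ?z)\<^sup>2 / (2 * t)))"
    unfolding G_def using cn_bounds[of y] Q_ge[of ?z y] t j0_pos
    by (intro mult_mono) (auto intro!: divide_right_mono)
  then have "(1 + (norm ?z)\<^sup>2 / t)\<^sup>2 * G t y x \<le>
      (1 + (norm ?z)\<^sup>2 / t)\<^sup>2 * ((1 / j0) * t powr (- (real CARD('d) / 2)) * exp (- (c1 * (norm ?z)\<^sup>2 / (2 * t))))"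
    by (rule mult_left_mono) simp
  also have "\<dots> = ((1 / j0) * t powr (- (real CARD('d) / 2))) * ((1 + (norm ?z)\<^sup>2 / t)\<^sup>2 * exp (- (c1 * (norm ?z)\<^sup>2 / (2 * t))))"
    by (simp only: mult_ac)
  also have "\<dots> \<le> ((1 / j0) * t powr (- (real CARD('d) / 2))) * (CE * g0 (?z /\<^sub>R sqrt t))"
    by (rule mult_left_mono[OF CE[OF t]]) (use j0_pos in simp)
  finally show ?thesis by (simp add: CG_def gam_def mult_ac)
qed

lemma G_le: "t > 0 \<Longrightarrow> G t y x \<le> CG * gam t (x - y)"
proof -
  assume t: "t > 0"
  have "1\<^sup>2 \<le> (1 + (norm (x - y))\<^sup>2 / t)\<^sup>2" using t by (intro power_mono) auto
  then have "1 * G t y x \<le> (1 + (norm (x - y))\<^sup>2 / t)\<^sup>2 * G t y x"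
    by (intro mult_right_mono G_nonneg) simp
  then show ?thesis using weighted_G[OF t, of x y] by simp
qed

lemma rescaled_powers:
  fixes z :: "real^'d"
  assumes t: "t > 0"
  defines "s \<equiv> (norm z)\<^sup>2 / t"
  shows "norm z \<le> sqrt t * (1 + s)\<^sup>2" "(norm z)\<^sup>2 \<le> t * (1 + s)\<^sup>2" "(norm z) ^ 3 \<le> (t * sqrt t) * (1 + s)\<^sup>2"
proof -
  have s: "s \<ge> 0" using t by (simp add: s_def)
  have z2: "(norm z)\<^sup>2 = t * s" using t by (simp add: s_def)
  then have z1: "norm z = sqrt t * sqrt s"
    by (metis norm_ge_zero real_sqrt_mult real_sqrt_unique)
  have "sqrt s \<le> sqrt ((1 + s)\<^sup>2)"
    by (rule real_sqrt_le_mono) (use s in \<open>simp add: power2_sum\<close>)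
  then have sq: "sqrt s \<le> 1 + s" using s by simp
  have one: "1 + s \<le> (1 + s)\<^sup>2" using s by (simp add: power2_sum)
  show "norm z \<le> sqrt t * (1 + s)\<^sup>2"
    unfolding z1 using sq one t by (intro mult_left_mono) auto
  show "(norm z)\<^sup>2 \<le> t * (1 + s)\<^sup>2"
    unfolding z2 using s one t by (intro mult_left_mono) auto
  have "(norm z) ^ 3 = (t * s) * (sqrt t * sqrt s)"
    using z1 z2 by (simp add: power3_eq_cube power2_eq_square)
  also have "\<dots> = (t * sqrt t) * (s * sqrt s)" by simp
  also have "\<dots> \<le> (t * sqrt t) * ((1 + s) * (1 + s))"
    using s sq t by (intro mult_left_mono mult_mono) auto
  finally show "(norm z) ^ 3 \<le> (t * sqrt t) * (1 + s)\<^sup>2" by (simp add: power2_eq_square)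
qed

definition Crem where "Crem = (L / (2 * lam\<^sup>2) + real CARD('d) * L / (2 * lam) + B / lam) * CG"

lemma Crem_nonneg: "Crem \<ge> 0" unfolding Crem_def using pos CG_pos by simp

text \<open>Under the Gaussian a Lipschitz factor \<open>norm (x - y)\<close> counts as
  \<open>sqrt t\<close>, which improves the natural singularity \<open>1 / t\<close> of a second
  derivative to \<open>1 / sqrt t\<close>. That is integrable at 0. For \<open>T\<close> the bound
  is only \<open>1 / t\<close>, which is why \<open>T\<close> is integrated exactly, as a time
  derivative.\<close>

lemma rem_le:
  assumes t: "t > 0"
  shows "\<bar>rem t y x\<bar> \<le> Crem / sqrt t * gam t (x - y)"
proof -
  let ?z = "x - y" and ?d = "real CARD('d)"
  let ?w = "Ai y *v ?z"
  define s where "s = (norm ?z)\<^sup>2 / t"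
  note rp = rescaled_powers[OF t, of ?z, folded s_def]
  have t2: "t / sqrt t = sqrt t" "sqrt t * sqrt t = t" using t by (auto simp: real_div_sqrt)
  have "\<bar>?w \<bullet> ((a x - a y) *v ?w)\<bar> \<le> norm ?w * (norm (a x - a y) * norm ?w)"
    by (rule order_trans[OF Cauchy_Schwarz_ineq2 mult_left_mono[OF norm_matrix_vector_le]]) simp
  also have "\<dots> \<le> (norm ?z / lam) * ((L * norm ?z) * (norm ?z / lam))"
    by (intro mult_mono Ai_norm L) (use pos in auto)
  also have "\<dots> = L / lam\<^sup>2 * norm ?z ^ 3" by (simp add: power2_eq_square power3_eq_cube)
  also have "\<dots> \<le> L / lam\<^sup>2 * ((t * sqrt t) * (1 + s)\<^sup>2)"
    using pos by (intro mult_left_mono rp) auto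
  finally have "\<bar>?w \<bullet> ((a x - a y) *v ?w)\<bar> / (2 * t\<^sup>2) \<le> L / lam\<^sup>2 * ((t * sqrt t) * (1 + s)\<^sup>2) / (2 * t\<^sup>2)"
    using t by (intro divide_right_mono) auto
  also have "\<dots> = L / (2 * lam\<^sup>2) * ((1 + s)\<^sup>2 / sqrt t)"
  proof -
    have "t\<^sup>2 = (t * sqrt t) * sqrt t" using t by (simp add: power2_eq_square)
    then have "(t * sqrt t) / t\<^sup>2 = 1 / sqrt t" using t by simp
    moreover have "L / lam\<^sup>2 * ((t * sqrt t) * (1 + s)\<^sup>2) / (2 * t\<^sup>2) = L / (2 * lam\<^sup>2) * ((1 + s)\<^sup>2 * ((t * sqrt t) / t\<^sup>2))"
      by (simp add: mult_ac)
    ultimately show ?thesis by (simp only:) simp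
  qed
  finally have 1: "\<bar>?w \<bullet> ((a x - a y) *v ?w)\<bar> / (2 * t\<^sup>2) \<le> L / (2 * lam\<^sup>2) * ((1 + s)\<^sup>2 / sqrt t)" .
  have zt: "norm ?z / t \<le> (1 + s)\<^sup>2 / sqrt t"
  proof -
    have "norm ?z / t \<le> (sqrt t * (1 + s)\<^sup>2) / t" using t by (intro divide_right_mono rp) auto
    also have "\<dots> = (1 + s)\<^sup>2 / sqrt t" using t t2 by (simp add: field_simps)
    finally show ?thesis .
  qed
  have "\<bar>Ai y \<bullet> (a x - a y)\<bar> \<le> (?d / lam) * (L * norm ?z)"
    by (rule order_trans[OF Cauchy_Schwarz_ineq2 mult_mono[OF norm_Ai L]]) (use pos in auto)
  then have "\<bar>Ai y \<bullet> (a x - a y)\<bar> / (2 * t) \<le> (?d / lam) * (L * norm ?z) / (2 * t)"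
    using t by (intro divide_right_mono) auto
  also have "\<dots> = ?d * L / (2 * lam) * (norm ?z / t)" by simp
  also have "\<dots> \<le> ?d * L / (2 * lam) * ((1 + s)\<^sup>2 / sqrt t)"
    using pos by (intro mult_left_mono zt) auto
  finally have 2: "\<bar>Ai y \<bullet> (a x - a y)\<bar> / (2 * t) \<le> ?d * L / (2 * lam) * ((1 + s)\<^sup>2 / sqrt t)" .
  have "\<bar>b x \<bullet> ?w\<bar> \<le> B * (norm ?z / lam)"
    by (rule order_trans[OF Cauchy_Schwarz_ineq2 mult_mono[OF B Ai_norm]]) (use pos in auto)
  then have "\<bar>b x \<bullet> ?w\<bar> / t \<le> B * (norm ?z / lam) / t"
    using t by (intro divide_right_mono) auto
  also have "\<dots> = B / lam * (norm ?z / t)" by simp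
  also have "\<dots> \<le> B / lam * ((1 + s)\<^sup>2 / sqrt t)"
    using pos by (intro mult_left_mono zt) auto
  finally have 3: "\<bar>b x \<bullet> ?w\<bar> / t \<le> B / lam * ((1 + s)\<^sup>2 / sqrt t)" .
  have "\<bar>(?w \<bullet> ((a x - a y) *v ?w)) / (2 * t\<^sup>2) - (Ai y \<bullet> (a x - a y)) / (2 * t) - (b x \<bullet> ?w) / t\<bar>
      \<le> \<bar>?w \<bullet> ((a x - a y) *v ?w)\<bar> / (2 * t\<^sup>2) + \<bar>Ai y \<bullet> (a x - a y)\<bar> / (2 * t) + \<bar>b x \<bullet> ?w\<bar> / t"
  proof -
    have "\<bar>p - q - r\<bar> \<le> \<bar>p\<bar> + \<bar>q\<bar> + \<bar>r\<bar>" for p q r :: real by linarith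
    from this[of "(?w \<bullet> ((a x - a y) *v ?w)) / (2 * t\<^sup>2)" "(Ai y \<bullet> (a x - a y)) / (2 * t)" "(b x \<bullet> ?w) / t"]
    show ?thesis using t by (simp add: abs_divide)
  qed
  also have "\<dots> \<le> (L / (2 * lam\<^sup>2) + ?d * L / (2 * lam) + B / lam) * ((1 + s)\<^sup>2 / sqrt t)"
    using 1 2 3 unfolding distrib_right by linarith
  finally have "G t y x * \<bar>(?w \<bullet> ((a x - a y) *v ?w)) / (2 * t\<^sup>2) - (Ai y \<bullet> (a x - a y)) / (2 * t) - (b x \<bullet> ?w) / t\<bar>
      \<le> G t y x * ((L / (2 * lam\<^sup>2) + ?d * L / (2 * lam) + B / lam) * ((1 + s)\<^sup>2 / sqrt t))"
    by (rule mult_left_mono) (rule G_nonneg)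
  then have "\<bar>rem t y x\<bar> \<le> (L / (2 * lam\<^sup>2) + ?d * L / (2 * lam) + B / lam) / sqrt t * ((1 + s)\<^sup>2 * G t y x)"
    using G_nonneg[of t y x] by (simp add: rem_def abs_mult mult_ac)
  also have "\<dots> \<le> (L / (2 * lam\<^sup>2) + ?d * L / (2 * lam) + B / lam) / sqrt t * (CG * gam t ?z)"
    unfolding s_def using pos t by (intro mult_left_mono weighted_G) auto
  finally show ?thesis by (simp add: Crem_def)
qed

definition CT where "CT = (1 / (2 * lam) + real CARD('d) / 2) * CG"

lemma CT_nonneg: "CT \<ge> 0" unfolding CT_def using pos CG_pos by simp

lemma T_le:
  assumes t: "t > 0"
  shows "\<bar>T t y x\<bar> \<le> CT / t * gam t (x - y)"
proof -
  let ?z = "x - y" and ?d = "real CARD('d)"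
  define s where "s = (norm ?z)\<^sup>2 / t"
  have s: "s \<ge> 0" using t by (simp add: s_def)
  have one: "1 \<le> (1 + s)\<^sup>2" "s \<le> (1 + s)\<^sup>2" using s by (auto simp: power2_sum)
  have "\<bar>Q y ?z / (2 * t\<^sup>2) - ?d / (2 * t)\<bar> \<le> Q y ?z / (2 * t\<^sup>2) + ?d / (2 * t)"
    using Q_nonneg[of y ?z] t by (simp add: abs_le_iff)
  also have "\<dots> \<le> ((norm ?z)\<^sup>2 / lam) / (2 * t\<^sup>2) + ?d / (2 * t)"
    using Q_le[of y ?z] by (intro add_right_mono divide_right_mono) auto
  also have "\<dots> = (1 / (2 * lam) * s + ?d / 2) / t"
    using t pos by (simp add: s_def field_simps power2_eq_square)
  also have "\<dots> \<le> (1 / (2 * lam) * (1 + s)\<^sup>2 + ?d / 2 * (1 + s)\<^sup>2) / t"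
    using t pos one by (intro divide_right_mono add_mono mult_left_mono) auto
  finally have "G t y x * \<bar>Q y ?z / (2 * t\<^sup>2) - ?d / (2 * t)\<bar> \<le>
      G t y x * ((1 / (2 * lam) * (1 + s)\<^sup>2 + ?d / 2 * (1 + s)\<^sup>2) / t)"
    by (rule mult_left_mono) (rule G_nonneg)
  note * = this
  have "\<bar>T t y x\<bar> \<le> (1 / (2 * lam) + ?d / 2) / t * ((1 + s)\<^sup>2 * G t y x)"
  proof -
    have "G t y x * ((1 / (2 * lam) * (1 + s)\<^sup>2 + ?d / 2 * (1 + s)\<^sup>2) / t) =
        (1 / (2 * lam) + ?d / 2) / t * ((1 + s)\<^sup>2 * G t y x)"
    proof -
      have "g * ((p * E + q * E) / t) = (p + q) / t * (E * g)" for g p q E :: real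
        by (simp add: distrib_left distrib_right add_divide_distrib mult_ac)
      then show ?thesis .
    qed
    then show ?thesis using * by (simp only: T_def abs_mult abs_of_nonneg[OF G_nonneg])
  qed
  also have "\<dots> \<le> (1 / (2 * lam) + ?d / 2) / t * (CG * gam t ?z)"
    unfolding s_def using pos t by (intro mult_left_mono weighted_G) auto
  finally show ?thesis by (simp add: CT_def)
qed

definition H where "H t x y = cn x * t powr (- (real CARD('d) / 2)) * exp (- (Q x (x - y) / (2 * t)))"

lemma Q_scale: "t > 0 \<Longrightarrow> Q x (z /\<^sub>R sqrt t) = Q x z / t"
  by (simp add: Q_def matrix_vector_mult_scaleR divide_inverse inverse_mult_distrib[symmetric] mult.assoc[symmetric] mult.commute
      del: inverse_mult_distrib)

lemma H_integral:
  assumes t: "t > 0"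
  shows "integrable lborel (H t x)" "(\<integral>y. H t x y \<partial>lborel) = 1"
proof -
  have eq: "H t x = (\<lambda>y. cn x * (t powr (- (real CARD('d) / 2)) * exp (- (Q x ((x - y) /\<^sub>R sqrt t) / 2))))"
    using t by (simp add: H_def fun_eq_iff Q_scale)
  note i = integral_scale[OF exp_Q_integrable _ t, of x x]
  show "integrable lborel (H t x)" unfolding eq by (intro integrable_mult_right i) simp
  have "J x > 0" using J_ge[of x] j0_pos by simp
  then show "(\<integral>y. H t x y \<partial>lborel) = 1"
    unfolding eq using i by (simp add: cn_def J_def)
qed

lemma weighted_exp:
  assumes t: "t > 0"
  shows "(1 + (norm z)\<^sup>2 / t)\<^sup>2 * (t powr (- (real CARD('d) / 2)) * exp (- (c1 * (norm z)\<^sup>2 / (2 * t)))) \<le> CE * gam t z"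
proof -
  have "t powr (- (real CARD('d) / 2)) * ((1 + (norm z)\<^sup>2 / t)\<^sup>2 * exp (- (c1 * (norm z)\<^sup>2 / (2 * t))))
     \<le> t powr (- (real CARD('d) / 2)) * (CE * g0 (z /\<^sub>R sqrt t))"
    by (rule mult_left_mono[OF CE[OF t]]) simp
  then show ?thesis by (simp add: gam_def mult_ac)
qed

lemma norm_H_le:
  assumes t: "t > 0"
  shows "norm (x - y) * H t x y \<le> CG * sqrt t * gam t (x - y)"
proof -
  let ?z = "x - y"
  define s where "s = (norm ?z)\<^sup>2 / t"
  have "H t x y \<le> (1 / j0) * t powr (- (real CARD('d) / 2)) * exp (- (c1 * (norm ?z)\<^sup>2 / (2 * t)))"
    unfolding H_def using cn_bounds[of x] Q_ge[of ?z x] t j0_pos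
    by (intro mult_mono) (auto intro!: divide_right_mono)
  then have "norm ?z * H t x y \<le> (sqrt t * (1 + s)\<^sup>2) * ((1 / j0) * t powr (- (real CARD('d) / 2)) * exp (- (c1 * (norm ?z)\<^sup>2 / (2 * t))))"
    using rescaled_powers(1)[OF t, of ?z, folded s_def] t cn_bounds(1)[of x]
    by (intro mult_mono) (auto simp: H_def)
  also have "\<dots> = (sqrt t / j0) * ((1 + s)\<^sup>2 * (t powr (- (real CARD('d) / 2)) * exp (- (c1 * (norm ?z)\<^sup>2 / (2 * t)))))"
    by simp
  also have "\<dots> \<le> (sqrt t / j0) * (CE * gam t ?z)"
    unfolding s_def using t j0_pos by (intro mult_left_mono weighted_exp) auto
  finally show ?thesis by (simp add: CG_def mult_ac)
qed

definition CH where "CH = (Lc + LA / (2 * j0)) * CE"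

lemma CH_nonneg: "CH \<ge> 0" unfolding CH_def using Lc_nonneg LA_nonneg j0_pos CE_pos by simp

lemma G_H_diff:
  assumes t: "t > 0"
  shows "\<bar>G t y x - H t x y\<bar> \<le> CH * sqrt t * gam t (x - y)"
proof -
  let ?z = "x - y" and ?tp = "t powr (- (real CARD('d) / 2))"
  define s where "s = (norm ?z)\<^sup>2 / t"
  define u where "u = Q y ?z / (2 * t)"
  define v where "v = Q x ?z / (2 * t)"
  define m where "m = c1 * (norm ?z)\<^sup>2 / (2 * t)"
  have m: "m \<le> u" "m \<le> v"
    unfolding m_def u_def v_def using Q_ge t by (auto intro!: divide_right_mono)
  have uv: "\<bar>u - v\<bar> \<le> LA / 2 * sqrt t * (1 + s)\<^sup>2"
  proof -
    have "\<bar>u - v\<bar> = \<bar>Q y ?z - Q x ?z\<bar> / (2 * t)"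
      using t by (simp add: u_def v_def diff_divide_distrib[symmetric])
    also have "\<dots> \<le> (LA * norm (y - x) * (norm ?z)\<^sup>2) / (2 * t)"
      using t by (intro divide_right_mono Q_diff) auto
    also have "\<dots> = LA / (2 * t) * norm ?z ^ 3"
      by (simp add: norm_minus_commute power3_eq_cube power2_eq_square)
    also have "\<dots> \<le> LA / (2 * t) * ((t * sqrt t) * (1 + s)\<^sup>2)"
      unfolding s_def using t LA_nonneg by (intro mult_left_mono rescaled_powers) auto
    finally show ?thesis using t by simp
  qed
  have "\<bar>cn y * exp (- u) - cn x * exp (- v)\<bar> = \<bar>(cn y - cn x) * exp (- u) + cn x * (exp (- u) - exp (- v))\<bar>"
    by (simp add: algebra_simps)
  also have "\<dots> \<le> \<bar>cn y - cn x\<bar> * exp (- u) + cn x * \<bar>exp (- u) - exp (- v)\<bar>"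
    using abs_triangle_ineq[of "(cn y - cn x) * exp (- u)" "cn x * (exp (- u) - exp (- v))"] cn_bounds(1)[of x]
    by (simp add: abs_mult)
  also have "\<dots> \<le> (Lc * (sqrt t * (1 + s)\<^sup>2)) * exp (- m) + (1 / j0) * ((LA / 2 * sqrt t * (1 + s)\<^sup>2) * exp (- m))"
  proof (intro add_mono mult_mono)
    show "\<bar>cn y - cn x\<bar> \<le> Lc * (sqrt t * (1 + s)\<^sup>2)"
      using cn_lipschitz[of y x] mult_left_mono[OF rescaled_powers(1)[OF t, of ?z, folded s_def] Lc_nonneg]
      by (simp add: norm_minus_commute)
    show "\<bar>exp (- u) - exp (- v)\<bar> \<le> (LA / 2 * sqrt t * (1 + s)\<^sup>2) * exp (- m)"
      by (rule order_trans[OF exp_diff_le[OF m] mult_right_mono[OF uv]]) simp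
  qed (use m cn_bounds[of x] Lc_nonneg t j0_pos in auto)
  also have "\<dots> = (Lc + LA / (2 * j0)) * sqrt t * ((1 + s)\<^sup>2 * exp (- m))"
    by (simp add: algebra_simps)
  finally have "?tp * \<bar>cn y * exp (- u) - cn x * exp (- v)\<bar> \<le> ?tp * ((Lc + LA / (2 * j0)) * sqrt t * ((1 + s)\<^sup>2 * exp (- m)))"
    by (rule mult_left_mono) simp
  moreover have "\<bar>G t y x - H t x y\<bar> = ?tp * \<bar>cn y * exp (- u) - cn x * exp (- v)\<bar>"
  proof -
    have "G t y x - H t x y = ?tp * (cn y * exp (- u) - cn x * exp (- v))"
      by (simp add: G_def H_def u_def v_def algebra_simps)
    then show ?thesis by (simp add: abs_mult)
  qed
  ultimately have "\<bar>G t y x - H t x y\<bar> \<le> (Lc + LA / (2 * j0)) * sqrt t * ((1 + s)\<^sup>2 * (?tp * exp (- m)))"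
    by (simp only: mult_ac)
  also have "\<dots> \<le> (Lc + LA / (2 * j0)) * sqrt t * (CE * gam t ?z)"
    unfolding s_def m_def using Lc_nonneg LA_nonneg j0_pos t by (intro mult_left_mono weighted_exp) auto
  finally show ?thesis by (simp add: CH_def mult_ac)
qed

lemma gam_decay:
  assumes \<epsilon>: "0 < \<epsilon>" and e: "e > 0"
  obtains R where "R \<ge> 0" "\<And>t z. \<epsilon> \<le> t \<Longrightarrow> t \<le> 1 \<Longrightarrow> norm z \<ge> R \<Longrightarrow> gam t z \<le> e"
proof -
  define k where "k = \<epsilon> powr (- (real CARD('d) / 2))"
  have k: "k > 0" using \<epsilon> by (simp add: k_def)
  define R where "R = sqrt (k / (e * (c1 / 4)))"
  have R: "R \<ge> 0" using k e c1_pos by (simp add: R_def)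
  have "gam t z \<le> e" if t: "\<epsilon> \<le> t" "t \<le> 1" and z: "norm z \<ge> R" for t and z :: "real^'d"
  proof -
    have t0: "t > 0" using t \<epsilon> by linarith
    have "k / (e * (c1 / 4)) = R\<^sup>2" using k e c1_pos by (simp add: R_def)
    also have "\<dots> \<le> (norm z)\<^sup>2" using z R by (intro power_mono) auto
    also have "\<dots> \<le> (norm z)\<^sup>2 / t" using t t0 by (simp add: field_simps mult_left_le_one_le)
    finally have "(k / e) / (c1 / 4) \<le> (norm z)\<^sup>2 / t" by simp
    then have "k / e \<le> (norm z)\<^sup>2 / t * (c1 / 4)" using c1_pos by (subst (asm) pos_divide_le_eq) auto
    then have "k / e \<le> c1 / 4 * ((norm z)\<^sup>2 / t)" by (simp only: mult.commute)
    also have "\<dots> \<le> exp (c1 / 4 * ((norm z)\<^sup>2 / t))"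
      using exp_ge_add_one_self[of "c1 / 4 * ((norm z)\<^sup>2 / t)"] by linarith
    finally have "k * exp (- (c1 / 4 * ((norm z)\<^sup>2 / t))) \<le> e"
      using e by (simp add: exp_minus field_simps)
    moreover have "gam t z \<le> k * exp (- (c1 / 4 * ((norm z)\<^sup>2 / t)))"
    proof -
      have "(norm (z /\<^sub>R sqrt t))\<^sup>2 = (norm z)\<^sup>2 / t"
        using t0 by (simp add: power_mult_distrib power_inverse divide_inverse mult.commute)
      moreover have "t powr (- (real CARD('d) / 2)) \<le> k"
        unfolding k_def using \<epsilon> t by (intro powr_mono2') auto
      ultimately show ?thesis by (simp add: gam_def g0_def)
    qed
    ultimately show ?thesis by linarith
  qed
  then show thesis using R that by blast
qed

end

section \<open>The parametrix as an approximate resolvent\<close>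

lemma integral_lborel_cbox:
  fixes g :: "real^'d::finite \<Rightarrow> real"
  assumes "continuous_on UNIV g" "\<And>y. y \<notin> cbox c e \<Longrightarrow> g y = 0"
  shows "integrable lborel g" "integral (cbox c e) g = (\<integral>y. g y \<partial>lborel)"
proof -
  have eq: "(\<lambda>y. indicator (cbox c e) y *\<^sub>R g y) = g"
    using assms(2) by (auto simp: indicator_def fun_eq_iff)
  have si: "set_integrable lborel (cbox c e) g"
    unfolding set_integrable_def
    by (rule borel_integrable_compact[OF compact_cbox continuous_on_subset[OF assms(1)]]) simp
  show "integrable lborel g" using si unfolding set_integrable_def eq .
  show "integral (cbox c e) g = (\<integral>y. g y \<partial>lborel)"
    using set_borel_integral_eq_integral(2)[OF si] unfolding set_lebesgue_integral_def eq by simp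
qed

lemma uniformly_continuous_bounded_support:
  fixes f :: "real^'d::finite \<Rightarrow> real"
  assumes f: "continuous_on UNIV f" "\<And>x. norm x > R \<Longrightarrow> f x = 0" and e: "e > 0"
  obtains \<delta> where "\<delta> > 0" "\<And>x y. norm (x - y) < \<delta> \<Longrightarrow> \<bar>f x - f y\<bar> \<le> e"
proof -
  have "uniformly_continuous_on (cball 0 (R + 1)) f"
    by (intro compact_uniformly_continuous continuous_on_subset[OF f(1)]) auto
  then obtain \<delta> where \<delta>: "\<delta> > 0"
    "\<And>x y. x \<in> cball 0 (R + 1) \<Longrightarrow> y \<in> cball 0 (R + 1) \<Longrightarrow> dist y x < \<delta> \<Longrightarrow> dist (f y) (f x) < e"
    unfolding uniformly_continuous_on_def using e by metis
  have "\<bar>f x - f y\<bar> \<le> e" if "norm (x - y) < min \<delta> 1" for x y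
  proof (cases "norm x \<le> R \<or> norm y \<le> R")
    case True
    have "norm x \<le> norm y + norm (x - y)" "norm y \<le> norm x + norm (x - y)"
      using norm_triangle_sub[of x y] norm_triangle_sub[of y x] by (auto simp: norm_minus_commute)
    then have "norm x \<le> R + 1" "norm y \<le> R + 1" using True that by linarith+
    then show ?thesis using \<delta>(2)[of y x] that by (auto simp: dist_norm dist_real_def less_imp_le)
  next
    case False
    then show ?thesis using f(2) e by simp
  qed
  then show thesis using that[of "min \<delta> 1"] \<delta>(1) by auto
qed

context global_elliptic
begin

lemma cont_Q:
  assumes "continuous_on S y'" "continuous_on S z'"
  shows "continuous_on S (\<lambda>p. Q (y' p) (z' p))"
  unfolding Q_def
  by (intro continuous_intros assms continuous_on_compose2[OF cont_Ai assms(1)]) auto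

lemma cont_G:
  assumes c: "continuous_on S t'" "continuous_on S y'" "continuous_on S x'" and pos: "\<And>p. p \<in> S \<Longrightarrow> 0 < t' p"
  shows "continuous_on S (\<lambda>p. G (t' p) (y' p) (x' p))"
  unfolding G_def
  by (intro continuous_intros cont_Q c continuous_on_compose2[OF cont_cn c(2)])
    (auto dest: pos)

lemma cont_T:
  assumes c: "continuous_on S t'" "continuous_on S y'" "continuous_on S x'" and pos: "\<And>p. p \<in> S \<Longrightarrow> 0 < t' p"
  shows "continuous_on S (\<lambda>p. T (t' p) (y' p) (x' p))"
  unfolding T_def
  by (intro continuous_intros cont_Q cont_G c pos) (auto dest: pos)

lemma cont_rem:
  assumes c: "continuous_on S t'" "continuous_on S y'" "continuous_on S x'" and pos: "\<And>p. p \<in> S \<Longrightarrow> 0 < t' p"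
  shows "continuous_on S (\<lambda>p. rem (t' p) (y' p) (x' p))"
  unfolding rem_def
  by (intro continuous_intros cont_G c pos continuous_on_compose2[OF cont_Ai c(2)]
      continuous_on_compose2[OF cont_a c(2)] continuous_on_compose2[OF cont_a c(3)]
      continuous_on_compose2[OF cont_b c(3)]) (auto dest: pos)

lemma gam_vanishes:
  assumes t: "0 < t" "t \<le> 1" and h: "continuous_on UNIV h" "\<And>x. \<bar>h x\<bar> \<le> C * gam t (x - y)"
  shows "vanishes h"
  unfolding vanishes_def
proof (intro conjI allI impI)
  fix e :: real assume e: "e > 0"
  define C' where "C' = \<bar>C\<bar> + 1"
  have C': "C' > 0" "C \<le> C'" by (auto simp: C'_def)
  obtain R where R: "\<And>t' z. t \<le> t' \<Longrightarrow> t' \<le> 1 \<Longrightarrow> norm z \<ge> R \<Longrightarrow> gam t' z \<le> e / C'"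
    using gam_decay[OF t(1), of "e / C'"] e C' by (metis divide_pos_pos)
  have "\<bar>h x\<bar> \<le> e" if x: "norm x \<ge> R + norm y" for x
  proof -
    have "norm (x - y) \<ge> R" using x norm_triangle_ineq2[of x y] by linarith
    then have "gam t (x - y) \<le> e / C'" using R t by blast
    then have "C' * gam t (x - y) \<le> e" using C' by (simp add: field_simps)
    moreover have "C * gam t (x - y) \<le> C' * gam t (x - y)"
      using C' gam_nonneg by (intro mult_right_mono) auto
    ultimately show ?thesis using h(2)[of x] by linarith
  qed
  then show "\<exists>R. \<forall>x. norm x \<ge> R \<longrightarrow> \<bar>h x\<bar> \<le> e" by blast
qed (rule h)

lemma G_dom0:
  assumes t: "0 < t" "t \<le> 1"
  shows "G t y \<in> dom0 b a"
proof -
  have "vanishes (G t y)"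
    by (rule gam_vanishes[OF t, where C = CG and y = y])
      (use G_le[OF t(1)] G_nonneg t in \<open>auto intro!: cont_G continuous_intros\<close>)
  moreover have "vanishes (\<lambda>x. T t y x + rem t y x)"
  proof (rule gam_vanishes[OF t, where C = "CT / t + Crem / sqrt t" and y = y])
    show "continuous_on UNIV (\<lambda>x. T t y x + rem t y x)"
      using t by (intro continuous_intros cont_T cont_rem) auto
    show "\<bar>T t y x + rem t y x\<bar> \<le> (CT / t + Crem / sqrt t) * gam t (x - y)" for x
      using T_le[OF t(1), of y x] rem_le[OF t(1), of y x] unfolding distrib_right by linarith
  qed
  moreover have "gen b a (G t y) = (\<lambda>x. T t y x + rem t y x)"
    by (rule ext) (rule gen_G[OF t(1)])
  ultimately show ?thesis by (simp add: dom0_def sm_G)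
qed

lemma gam_bound_integral:
  assumes "integrable lborel h" "\<And>y. \<bar>h y\<bar> \<le> C * gam t (x - y)" "t > 0"
  shows "\<bar>\<integral>y. h y \<partial>lborel\<bar> \<le> C * \<Gamma>"
proof -
  have "\<bar>\<integral>y. h y \<partial>lborel\<bar> \<le> (\<integral>y. C * gam t (x - y) \<partial>lborel)"
    using assms gam_integral(1)[OF assms(3)] by (intro integral_abs_bound_integral) auto
  then show ?thesis using gam_integral(2)[OF assms(3)] by simp
qed

lemma DERIV_G:
  assumes t: "t > 0"
  shows "((\<lambda>t. G t y x) has_real_derivative T t y x) (at t)"
proof -
  have "((\<lambda>t. G t y x) has_real_derivative
     cn y * ((- (real CARD('d) / 2)) * t powr (- (real CARD('d) / 2) - 1)) * exp (- (Q y (x - y) / (2 * t)))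
     + cn y * t powr (- (real CARD('d) / 2)) * (exp (- (Q y (x - y) / (2 * t))) * (Q y (x - y) / (2 * t\<^sup>2)))) (at t)"
    unfolding G_def using t
    by (auto intro!: derivative_eq_intros simp: power2_eq_square field_simps)
  moreover have "t powr (- (real CARD('d) / 2) - 1) = t powr (- (real CARD('d) / 2)) / t"
    using t by (simp only: powr_diff) simp
  ultimately show ?thesis
    using t by (simp add: T_def G_def algebra_simps)
qed

text \<open>The integrand is minus the time derivative of
  \<open>exp (- (l * t)) * G t y x\<close>.\<close>

lemma integral_time:
  assumes \<epsilon>: "0 < \<epsilon>" "\<epsilon> \<le> 1"
  shows "integral {\<epsilon>..1} (\<lambda>t. exp (- (l * t)) * (l * G t y x - T t y x)) =
    exp (- (l * \<epsilon>)) * G \<epsilon> y x - exp (- l) * G 1 y x"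
proof -
  have "((\<lambda>t. exp (- (l * t)) * (l * G t y x - T t y x)) has_integral
      (- (exp (- (l * 1)) * G 1 y x)) - (- (exp (- (l * \<epsilon>)) * G \<epsilon> y x))) {\<epsilon>..1}"
  proof (rule fundamental_theorem_of_calculus[OF \<epsilon>(2)])
    fix t assume t: "t \<in> {\<epsilon>..1}"
    then have "((\<lambda>t. - (exp (- (l * t)) * G t y x)) has_real_derivative exp (- (l * t)) * (l * G t y x - T t y x)) (at t)"
      using \<epsilon> by (auto intro!: derivative_eq_intros DERIV_G simp: algebra_simps)
    then show "((\<lambda>t. - (exp (- (l * t)) * G t y x)) has_vector_derivative exp (- (l * t)) * (l * G t y x - T t y x)) (at t within {\<epsilon>..1})"
      by (simp add: has_real_derivative_iff_has_vector_derivative has_vector_derivative_at_within)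
  qed
  then show ?thesis by (simp add: integral_unique)
qed

text \<open>\<open>H t x\<close> is \<open>G t y x\<close> with the coefficients frozen at \<open>x\<close> instead of \<open>y\<close>; it has mass 1.\<close>

lemma approximate_identity:
  fixes f :: "real^'d \<Rightarrow> real"
  assumes f: "continuous_on UNIV f" "\<And>y. y \<notin> cbox c e \<Longrightarrow> f y = 0"
    and M: "M > 0" "\<And>x. \<bar>f x\<bar> \<le> M" and l: "l \<ge> 0"
  obtains \<epsilon> where "0 < \<epsilon>" "\<epsilon> \<le> 1"
    "\<And>x. \<bar>exp (- (l * \<epsilon>)) * (\<integral>y. f y * G \<epsilon> y x \<partial>lborel) - f x\<bar> \<le> M / 8"
proof -
  obtain R where R: "\<And>x. x \<in> cbox c e \<Longrightarrow> norm x \<le> R"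
    using bounded_cbox[of c e] unfolding bounded_iff by blast
  have f0: "f x = 0" if "norm x > R" for x
  proof -
    have "x \<notin> cbox c e" using R[of x] that by linarith
    then show ?thesis by (rule f(2))
  qed
  define e1 where "e1 = M / 32"
  have e1: "e1 > 0" using M by (simp add: e1_def)
  obtain \<delta> where \<delta>: "\<delta> > 0" "\<And>x y. norm (x - y) < \<delta> \<Longrightarrow> \<bar>f x - f y\<bar> \<le> e1"
    using uniformly_continuous_bounded_support[OF f(1) f0 e1] by blast
  \<comment> \<open>Collects the errors proportional to \<open>sqrt \<epsilon>\<close>: exchanging
    \<open>G\<close> for \<open>H\<close>, the mass of \<open>H\<close> at distance
    \<open>\<delta>\<close> from \<open>x\<close>, and the discount factor.\<close>
  define Ke where "Ke = CH * \<Gamma> + 2 * (CG / \<delta>) * \<Gamma> + l"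
  have Ke: "Ke \<ge> 0"
    unfolding Ke_def using CH_nonneg \<Gamma>_nonneg CG_pos \<delta> l by simp
  \<comment> \<open>Makes \<open>sqrt \<epsilon> * Ke\<close> at most \<open>1 / 16\<close>;
    together with the oscillation \<open>M / 32\<close> the total stays below
    \<open>M / 8\<close>.\<close>
  define \<epsilon> where "\<epsilon> = (1 / (16 * (Ke + 1)))\<^sup>2"
  have se: "sqrt \<epsilon> = 1 / (16 * (Ke + 1))" using Ke by (simp add: \<epsilon>_def)
  have \<epsilon>: "0 < \<epsilon>" using Ke by (simp add: \<epsilon>_def)
  have se1: "sqrt \<epsilon> \<le> 1" unfolding se using Ke by simp
  have \<epsilon>1: "\<epsilon> \<le> 1" using se1 \<epsilon> by simp
  have \<epsilon>se: "\<epsilon> \<le> sqrt \<epsilon>"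
    using mult_left_mono[OF se1, of "sqrt \<epsilon>"] \<epsilon> by simp
  have Kse: "sqrt \<epsilon> * Ke \<le> 1 / 16" unfolding se using Ke by (simp add: field_simps)
  have "\<bar>exp (- (l * \<epsilon>)) * (\<integral>y. f y * G \<epsilon> y x \<partial>lborel) - f x\<bar> \<le> M / 8" for x
  proof -
    have contG: "continuous_on UNIV (\<lambda>y. f y * G \<epsilon> y x)"
      using \<epsilon> by (intro continuous_intros f cont_G) auto
    have iG: "integrable lborel (\<lambda>y. f y * G \<epsilon> y x)"
      by (rule integral_lborel_cbox(1)[OF contG, of c e]) (simp add: f(2))
    have [measurable]: "f \<in> borel_measurable borel" by (rule borel_measurable_continuous_onI[OF f(1)])
    have iH: "integrable lborel (\<lambda>y. f y * H \<epsilon> x y)"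
      by (rule integrable_bounded_mult[OF H_integral(1)[OF \<epsilon>] _ M(2)]) simp
    have iH': "integrable lborel (\<lambda>y. f x * H \<epsilon> x y)"
      using H_integral(1)[OF \<epsilon>] by simp
    have A: "\<bar>\<integral>y. f y * G \<epsilon> y x - f y * H \<epsilon> x y \<partial>lborel\<bar> \<le> (M * (CH * sqrt \<epsilon>)) * \<Gamma>"
    proof (rule gam_bound_integral[OF _ _ \<epsilon>, where x = x])
      fix y
      have "\<bar>f y * G \<epsilon> y x - f y * H \<epsilon> x y\<bar> = \<bar>f y\<bar> * \<bar>G \<epsilon> y x - H \<epsilon> x y\<bar>"
        by (simp add: abs_mult[symmetric] right_diff_distrib)
      also have "\<dots> \<le> M * (CH * sqrt \<epsilon> * gam \<epsilon> (x - y))"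
        using M by (intro mult_mono G_H_diff \<epsilon>) auto
      finally show "\<bar>f y * G \<epsilon> y x - f y * H \<epsilon> x y\<bar> \<le> M * (CH * sqrt \<epsilon>) * gam \<epsilon> (x - y)" by (simp add: mult_ac)
    qed (use iG iH in simp)
    have Bd: "\<bar>\<integral>y. f y * H \<epsilon> x y - f x * H \<epsilon> x y \<partial>lborel\<bar> \<le> e1 + (2 * M / \<delta>) * (CG * sqrt \<epsilon> * \<Gamma>)"
    proof -
      have "\<bar>\<integral>y. f y * H \<epsilon> x y - f x * H \<epsilon> x y \<partial>lborel\<bar> \<le> (\<integral>y. e1 * H \<epsilon> x y + (2 * M / \<delta>) * (CG * sqrt \<epsilon>) * gam \<epsilon> (x - y) \<partial>lborel)"
      proof (rule integral_abs_bound_integral)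
        show "integrable lborel (\<lambda>y. f y * H \<epsilon> x y - f x * H \<epsilon> x y)" using iH iH' by simp
        show "integrable lborel (\<lambda>y. e1 * H \<epsilon> x y + (2 * M / \<delta>) * (CG * sqrt \<epsilon>) * gam \<epsilon> (x - y))"
          using H_integral(1)[OF \<epsilon>] gam_integral(1)[OF \<epsilon>] by simp
        fix y
        have H0: "H \<epsilon> x y \<ge> 0" unfolding H_def using cn_bounds(1)[of x] by simp
        \<comment> \<open>Uniform continuity near \<open>x\<close> and the trivial bound
          \<open>2 * M\<close> far from it, merged into one bound that is affine in the distance, so
          that \<open>norm_H_le\<close> applies.\<close>
        have "\<bar>f y - f x\<bar> \<le> e1 + (2 * M / \<delta>) * norm (x - y)"
        proof (cases "norm (x - y) < \<delta>")
          case True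
          have "0 \<le> (2 * M / \<delta>) * norm (x - y)" using M \<delta> by simp
          then show ?thesis using \<delta>(2)[of y x] True by (simp add: norm_minus_commute)
        next
          case False
          then have "2 * M * 1 \<le> 2 * M * (norm (x - y) / \<delta>)" using M \<delta> by (intro mult_left_mono) auto
          moreover have "\<bar>f y - f x\<bar> \<le> 2 * M" using M(2)[of x] M(2)[of y] by linarith
          moreover have "e1 \<ge> 0" using M by (simp add: e1_def)
          ultimately show ?thesis by simp
        qed
        then have "\<bar>f y - f x\<bar> * H \<epsilon> x y \<le> (e1 + (2 * M / \<delta>) * norm (x - y)) * H \<epsilon> x y"
          by (rule mult_right_mono[OF _ H0])
        also have "\<dots> = e1 * H \<epsilon> x y + (2 * M / \<delta>) * (norm (x - y) * H \<epsilon> x y)" by (simp add: distrib_right)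
        also have "\<dots> \<le> e1 * H \<epsilon> x y + (2 * M / \<delta>) * (CG * sqrt \<epsilon> * gam \<epsilon> (x - y))"
          using M \<delta> by (intro add_left_mono mult_left_mono norm_H_le \<epsilon>) auto
        finally show "\<bar>f y * H \<epsilon> x y - f x * H \<epsilon> x y\<bar> \<le> e1 * H \<epsilon> x y + (2 * M / \<delta>) * (CG * sqrt \<epsilon>) * gam \<epsilon> (x - y)"
          using H0 by (simp add: left_diff_distrib[symmetric] abs_mult mult.assoc)
      qed
      also have "\<dots> = e1 + (2 * M / \<delta>) * (CG * sqrt \<epsilon> * \<Gamma>)"
        using H_integral[OF \<epsilon>, of x] gam_integral[OF \<epsilon>, of x] by simp
      finally show ?thesis .
    qed
    define IG where "IG = (\<integral>y. f y * G \<epsilon> y x \<partial>lborel)"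
    define IH where "IH = (\<integral>y. f y * H \<epsilon> x y \<partial>lborel)"
    have A': "\<bar>IG - IH\<bar> \<le> (M * (CH * sqrt \<epsilon>)) * \<Gamma>"
      using A iG iH by (simp add: IG_def IH_def)
    have B': "\<bar>IH - f x\<bar> \<le> e1 + (2 * M / \<delta>) * (CG * sqrt \<epsilon> * \<Gamma>)"
      using Bd iH iH' H_integral(2)[OF \<epsilon>, of x] by (simp add: IH_def)
    define E where "E = exp (- (l * \<epsilon>))"
    have E: "0 \<le> E" "E \<le> 1" "1 - E \<le> l * \<epsilon>"
      using l \<epsilon> exp_ge_add_one_self[of "- (l * \<epsilon>)"] by (auto simp: E_def)
    have "\<bar>E * IG - f x\<bar> \<le> E * \<bar>IG - f x\<bar> + (1 - E) * \<bar>f x\<bar>"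
    proof -
      have "E * IG - f x = E * (IG - f x) + (- (1 - E)) * f x" by (simp add: algebra_simps)
      then show ?thesis using abs_triangle_ineq[of "E * (IG - f x)" "(- (1 - E)) * f x"] E by (simp add: abs_mult)
    qed
    also have "\<dots> \<le> 1 * \<bar>IG - f x\<bar> + (l * \<epsilon>) * M"
      using E M by (intro add_mono mult_mono) auto
    also have "\<dots> \<le> (M * (CH * sqrt \<epsilon>)) * \<Gamma> + (e1 + (2 * M / \<delta>) * (CG * sqrt \<epsilon> * \<Gamma>)) + (l * sqrt \<epsilon>) * M"
      using A' B' mult_right_mono[OF mult_left_mono[OF \<epsilon>se l], of M] M by simp
    also have "\<dots> = e1 + M * (sqrt \<epsilon> * Ke)"
      by (simp add: Ke_def algebra_simps)
    also have "\<dots> \<le> M / 32 + M * (1 / 16)"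
      unfolding e1_def using M by (intro add_left_mono mult_left_mono Kse) auto
    also have "\<dots> \<le> M / 8" using M by simp
    finally show ?thesis by (simp add: E_def IG_def)
  qed
  then show thesis by (rule that[OF \<epsilon> \<epsilon>1])
qed

text \<open>The inequality \<open>exp (- x) <= x powr (- (1 / 4))\<close>, a consequence of
  \<open>ln x <= x\<close>, trades part of the discount for a power of \<open>l\<close>. The time
  integrand becomes a multiple of \<open>l powr (- (1 / 4)) * t powr (- (3 / 4))\<close>, whose time
  factor integrates to at most 4, whatever \<open>\<epsilon>\<close> is.\<close>

lemma remainder_integral:
  fixes f :: "real^'d \<Rightarrow> real"
  assumes f: "continuous_on UNIV f" "\<And>y. y \<notin> cbox c e \<Longrightarrow> f y = 0"
    and M: "M > 0" "\<And>x. \<bar>f x\<bar> \<le> M" and l: "l > 0" and \<epsilon>: "0 < \<epsilon>" "\<epsilon> \<le> 1"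
  shows "\<bar>integral {\<epsilon>..1} (\<lambda>t. integral (cbox c e) (\<lambda>y. exp (- (l * t)) * (f y * rem t y x)))\<bar>
    \<le> 4 * M * Crem * \<Gamma> * l powr (- (1 / 4))"
proof -
  define \<phi> where "\<phi> t = integral (cbox c e) (\<lambda>y. exp (- (l * t)) * (f y * rem t y x))" for t
  have contF: "continuous_on ({\<epsilon>..1} \<times> cbox c e) (\<lambda>(t, y). exp (- (l * t)) * (f y * rem t y x))"
    unfolding case_prod_beta' using \<epsilon>
    by (intro continuous_intros cont_rem continuous_on_compose2[OF f(1)]) auto
  have cont: "continuous_on {\<epsilon>..1} \<phi>"
    unfolding \<phi>_def by (rule integral_continuous_on_param[OF contF])
  have bound: "\<bar>\<phi> t\<bar> \<le> M * Crem * \<Gamma> * l powr (- (1 / 4)) * t powr (- (3 / 4))" if t: "t \<in> {\<epsilon>..1}" for t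
  proof -
    have t0: "t > 0" using t \<epsilon> by simp
    have c: "continuous_on UNIV (\<lambda>y. exp (- (l * t)) * (f y * rem t y x))"
      using t0 by (intro continuous_intros f cont_rem) auto
    have z: "exp (- (l * t)) * (f y * rem t y x) = 0" if "y \<notin> cbox c e" for y
      using f(2)[OF that] by simp
    have \<phi>_eq: "\<phi> t = (\<integral>y. exp (- (l * t)) * (f y * rem t y x) \<partial>lborel)"
      unfolding \<phi>_def by (rule integral_lborel_cbox(2)[OF c z])
    have "\<bar>\<integral>y. exp (- (l * t)) * (f y * rem t y x) \<partial>lborel\<bar> \<le> (exp (- (l * t)) * (M * (Crem / sqrt t))) * \<Gamma>"
    proof (rule gam_bound_integral[OF integral_lborel_cbox(1)[OF c z] _ t0, where x = x])
      fix y
      have "\<bar>exp (- (l * t)) * (f y * rem t y x)\<bar> = exp (- (l * t)) * (\<bar>f y\<bar> * \<bar>rem t y x\<bar>)"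
        by (simp add: abs_mult)
      also have "\<dots> \<le> exp (- (l * t)) * (M * (Crem / sqrt t * gam t (x - y)))"
        using M by (intro mult_left_mono mult_mono rem_le t0) auto
      finally show "\<bar>exp (- (l * t)) * (f y * rem t y x)\<bar> \<le> exp (- (l * t)) * (M * (Crem / sqrt t)) * gam t (x - y)"
        by (simp add: mult_ac)
    qed
    moreover have "exp (- (l * t)) \<le> (l * t) powr (- (1 / 4))"
    proof -
      have "ln (l * t) \<le> l * t" using ln_bound[of "l * t"] l t0 by simp
      moreover have "0 < l * t" using l t0 by simp
      ultimately have "- (l * t) \<le> - (1 / 4) * ln (l * t)" by linarith
      then show ?thesis using l t0 by (simp add: powr_def)
    qed
    then have "exp (- (l * t)) * (1 / sqrt t) \<le> (l * t) powr (- (1 / 4)) * (1 / sqrt t)"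
      using t0 by (intro mult_right_mono) auto
    moreover have "(l * t) powr (- (1 / 4)) * (1 / sqrt t) = l powr (- (1 / 4)) * t powr (- (3 / 4))"
    proof -
      have "1 / sqrt t = t powr (- (1 / 2))" using t0 by (simp add: powr_minus_divide powr_half_sqrt)
      then have "(l * t) powr (- (1 / 4)) * (1 / sqrt t) = l powr (- (1 / 4)) * (t powr (- (1 / 4)) * t powr (- (1 / 2)))"
        using l t0 by (simp add: powr_mult)
      also have "t powr (- (1 / 4)) * t powr (- (1 / 2)) = t powr (- (3 / 4))"
        by (simp add: powr_add[symmetric])
      finally show ?thesis .
    qed
    ultimately have "\<bar>\<phi> t\<bar> \<le> (M * Crem * \<Gamma>) * (exp (- (l * t)) * (1 / sqrt t))"
      "exp (- (l * t)) * (1 / sqrt t) \<le> l powr (- (1 / 4)) * t powr (- (3 / 4))"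
      unfolding \<phi>_eq by (simp_all add: mult_ac)
    then have "\<bar>\<phi> t\<bar> \<le> (M * Crem * \<Gamma>) * (l powr (- (1 / 4)) * t powr (- (3 / 4)))"
      using M Crem_nonneg \<Gamma>_nonneg by (meson mult_left_mono mult_nonneg_nonneg less_imp_le order_trans)
    then show ?thesis by (simp add: mult_ac)
  qed
  have pw: "((\<lambda>t. t powr (- (3 / 4))) has_integral (4 * 1 powr (1 / 4) - 4 * \<epsilon> powr (1 / 4))) {\<epsilon>..1}"
  proof (rule fundamental_theorem_of_calculus[OF \<epsilon>(2)])
    fix t assume "t \<in> {\<epsilon>..1}"
    then have "((\<lambda>t. 4 * t powr (1 / 4)) has_real_derivative t powr (- (3 / 4))) (at t)"
      using \<epsilon> by (auto intro!: derivative_eq_intros)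
    then show "((\<lambda>t. 4 * t powr (1 / 4)) has_vector_derivative t powr (- (3 / 4))) (at t within {\<epsilon>..1})"
      by (simp add: has_real_derivative_iff_has_vector_derivative has_vector_derivative_at_within)
  qed
  have "norm (integral {\<epsilon>..1} \<phi>) \<le> integral {\<epsilon>..1} (\<lambda>t. M * Crem * \<Gamma> * l powr (- (1 / 4)) * t powr (- (3 / 4)))"
    by (rule integral_norm_bound_integral[OF integrable_continuous_interval[OF cont]])
      (use bound pw in \<open>auto intro!: integrable_on_mult_right\<close>)
  also have "\<dots> = M * Crem * \<Gamma> * l powr (- (1 / 4)) * (4 * 1 powr (1 / 4) - 4 * \<epsilon> powr (1 / 4))"
    using pw by (simp add: integral_unique)
  also have "\<dots> \<le> M * Crem * \<Gamma> * l powr (- (1 / 4)) * 4"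
    using M Crem_nonneg \<Gamma>_nonneg by (intro mult_left_mono) auto
  finally have "\<bar>integral {\<epsilon>..1} \<phi>\<bar> \<le> 4 * M * Crem * \<Gamma> * l powr (- (1 / 4))"
    by (simp add: mult_ac)
  then show ?thesis unfolding \<phi>_def .
qed

end

context global_elliptic
begin

text \<open>The left side is \<open>l * u - gen b a u\<close>, with the generator taken under the
  integral, for the superposition \<open>u\<close> of the Gaussians with weight
  \<open>exp (- (l * t)) * f y\<close>. Integrating over time first turns the part with
  \<open>T\<close> into boundary terms: the one at \<open>\<epsilon>\<close> is nearly
  \<open>f\<close>, the one at 1 is small for large \<open>l\<close>.\<close>

lemma kernel_integral:
  fixes f :: "real^'d \<Rightarrow> real"
  assumes f: "continuous_on UNIV f" "\<And>y. y \<notin> cbox c e \<Longrightarrow> f y = 0" and \<epsilon>: "0 < \<epsilon>" "\<epsilon> \<le> 1"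
  shows "integral (cbox (\<epsilon>, c) (1, e)) (\<lambda>p. exp (- (l * fst p)) * (f (snd p) * (l * G (fst p) (snd p) x - (T (fst p) (snd p) x + rem (fst p) (snd p) x))))
    = exp (- (l * \<epsilon>)) * (\<integral>y. f y * G \<epsilon> y x \<partial>lborel) - exp (- l) * (\<integral>y. f y * G 1 y x \<partial>lborel)
      - integral {\<epsilon>..1} (\<lambda>t. integral (cbox c e) (\<lambda>y. exp (- (l * t)) * (f y * rem t y x)))"
proof -
  let ?P = "cbox (\<epsilon>, c) (1, e)"
  have pos: "0 < fst p" if "p \<in> ?P" for p using that \<epsilon> by (auto simp: cbox_Pair_eq)
  define h1 where "h1 t y = exp (- (l * t)) * (f y * (l * G t y x - T t y x))" for t y
  define h2 where "h2 t y = exp (- (l * t)) * (f y * rem t y x)" for t y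
  have c1: "continuous_on ?P (\<lambda>p. h1 (fst p) (snd p))"
    unfolding h1_def
    by (intro continuous_intros cont_G cont_T continuous_on_compose2[OF f(1)] pos) auto
  have c2: "continuous_on ?P (\<lambda>p. h2 (fst p) (snd p))"
    unfolding h2_def
    by (intro continuous_intros cont_rem continuous_on_compose2[OF f(1)] pos) auto
  have "integral ?P (\<lambda>p. exp (- (l * fst p)) * (f (snd p) * (l * G (fst p) (snd p) x - (T (fst p) (snd p) x + rem (fst p) (snd p) x))))
      = integral ?P (\<lambda>p. h1 (fst p) (snd p) - h2 (fst p) (snd p))"
    by (intro integral_cong) (simp add: h1_def h2_def algebra_simps)
  also have "\<dots> = integral ?P (\<lambda>p. h1 (fst p) (snd p)) - integral ?P (\<lambda>p. h2 (fst p) (snd p))"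
    by (intro integral_diff integrable_continuous c1 c2)
  also have "integral ?P (\<lambda>p. h2 (fst p) (snd p)) = integral {\<epsilon>..1} (\<lambda>t. integral (cbox c e) (\<lambda>y. h2 t y))"
    using integral_prod_continuous[OF c2] by simp
  also have "integral ?P (\<lambda>p. h1 (fst p) (snd p)) = integral (cbox \<epsilon> 1) (\<lambda>t. integral (cbox c e) (\<lambda>y. h1 t y))"
    using integral_prod_continuous[OF c1] by simp
  also have "\<dots> = integral (cbox c e) (\<lambda>y. integral (cbox \<epsilon> 1) (\<lambda>t. h1 t y))"
    by (rule integral_swap_continuous) (use c1 in \<open>simp add: case_prod_beta'\<close>)
  also have "\<dots> = integral (cbox c e) (\<lambda>y. f y * (exp (- (l * \<epsilon>)) * G \<epsilon> y x - exp (- l) * G 1 y x))"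
  proof (rule integral_cong)
    fix y
    have "integral {\<epsilon>..1} (\<lambda>t. h1 t y) = integral {\<epsilon>..1} (\<lambda>t. f y * (exp (- (l * t)) * (l * G t y x - T t y x)))"
      by (intro integral_cong) (simp add: h1_def)
    then show "integral (cbox \<epsilon> 1) (\<lambda>t. h1 t y) = f y * (exp (- (l * \<epsilon>)) * G \<epsilon> y x - exp (- l) * G 1 y x)"
      using integral_time[OF \<epsilon>, of l y x] by simp
  qed
  also have "\<dots> = exp (- (l * \<epsilon>)) * (\<integral>y. f y * G \<epsilon> y x \<partial>lborel) - exp (- l) * (\<integral>y. f y * G 1 y x \<partial>lborel)"
  proof -
    have cG: "continuous_on UNIV (\<lambda>y. f y * G t y x)" if "t > 0" for t
      using that by (intro continuous_intros f cont_G) auto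
    have iG: "integrable lborel (\<lambda>y. f y * G t y x)" if "t > 0" for t
      by (rule integral_lborel_cbox(1)[OF cG[OF that], of c e]) (simp add: f(2))
    have "integral (cbox c e) (\<lambda>y. f y * (exp (- (l * \<epsilon>)) * G \<epsilon> y x - exp (- l) * G 1 y x))
        = (\<integral>y. f y * (exp (- (l * \<epsilon>)) * G \<epsilon> y x - exp (- l) * G 1 y x) \<partial>lborel)"
      by (rule integral_lborel_cbox(2)) (use f \<epsilon> in \<open>auto intro!: continuous_intros cont_G\<close>)
    also have "\<dots> = (\<integral>y. exp (- (l * \<epsilon>)) * (f y * G \<epsilon> y x) - exp (- l) * (f y * G 1 y x) \<partial>lborel)"
      by (intro Bochner_Integration.integral_cong) (auto simp: algebra_simps)
    also have "\<dots> = exp (- (l * \<epsilon>)) * (\<integral>y. f y * G \<epsilon> y x \<partial>lborel) - exp (- l) * (\<integral>y. f y * G 1 y x \<partial>lborel)"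
      using iG[OF \<epsilon>(1)] iG[of 1] by simp
    finally show ?thesis .
  qed
  finally show ?thesis by (simp add: h2_def)
qed

text \<open>The error \<open>M / 2\<close> consists of four parts of size \<open>M / 8\<close>: the
  Riemann sum, the approximate identity at time \<open>\<epsilon>\<close>, the boundary term at time
  1 and the freezing remainder. Starting at \<open>\<epsilon> > 0\<close> keeps the integrand
  continuous, as the Riemann sum demands.\<close>

lemma approximate_resolvent:
  obtains l0 where "l0 > 0"
    "\<And>l f M. l \<ge> l0 \<Longrightarrow> continuous_on UNIV f \<Longrightarrow> bounded {x. f x \<noteq> 0} \<Longrightarrow> M > 0 \<Longrightarrow> (\<And>x. \<bar>f x\<bar> \<le> M) \<Longrightarrow>
      \<exists>u\<in>dom0 b a. \<forall>x. \<bar>f x - (l * u x - gen b a u x)\<bar> \<le> M / 2"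
proof -
  define X where "X = 32 * Crem * \<Gamma> + 1"
  have X: "X > 0" unfolding X_def using Crem_nonneg \<Gamma>_nonneg by (simp add: add_nonneg_pos)
  \<comment> \<open>\<open>8 * CG * \<Gamma>\<close> controls the boundary term through
    \<open>exp (- l) <= 1 / l\<close>; \<open>X ^ 4\<close> controls the remainder, since then
    \<open>l powr (- (1 / 4)) <= 1 / X\<close>.\<close>
  define l0 where "l0 = max 1 (max (8 * CG * \<Gamma>) (X ^ 4))"
  have step: "\<exists>u\<in>dom0 b a. \<forall>x. \<bar>f x - (l * u x - gen b a u x)\<bar> \<le> M / 2"
    if l: "l \<ge> l0" and f: "continuous_on UNIV f" "bounded {x. f x \<noteq> 0}" and M: "M > 0" "\<And>x. \<bar>f x\<bar> \<le> M"
    for l f M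
  proof -
    have l1: "l \<ge> 1" "l \<ge> 8 * CG * \<Gamma>" "l \<ge> X ^ 4" using l by (auto simp: l0_def)
    have l_nonneg: "0 \<le> l" using l1 by linarith
    obtain r where r: "{x. f x \<noteq> 0} \<subseteq> cbox (- r) r"
      using bounded_subset_cbox_symmetric[OF f(2)] by blast
    define c where "c = - r"
    have f0: "f y = 0" if "y \<notin> cbox c r" for y using r that unfolding c_def by blast
    obtain \<epsilon> where \<epsilon>: "0 < \<epsilon>" "\<epsilon> \<le> 1"
      and ai: "\<And>x. \<bar>exp (- (l * \<epsilon>)) * (\<integral>y. f y * G \<epsilon> y x \<partial>lborel) - f x\<bar> \<le> M / 8"
      using approximate_identity[OF f(1) f0 M l_nonneg] by blast
    define h where "h p x = exp (- (l * fst p)) * (f (snd p) * (l * G (fst p) (snd p) x - (T (fst p) (snd p) x + rem (fst p) (snd p) x)))"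
      for p x
    let ?P = "cbox (\<epsilon>, c) (1, r)"
    have P: "\<epsilon> \<le> fst p" "fst p \<le> 1" "0 < fst p" "snd p \<in> cbox c r" if "p \<in> ?P" for p
      using that \<epsilon> by (auto simp: cbox_Pair_eq)
    have cont: "continuous_on (?P \<times> UNIV) (\<lambda>(p, x). h p x)"
      unfolding h_def case_prod_beta'
      by (intro continuous_intros cont_G cont_T cont_rem continuous_on_compose2[OF f(1)] P) auto
    define C where "C = M * (l * CG + (CT / \<epsilon> + Crem / sqrt \<epsilon>)) + 1"
    have C: "C > 0" unfolding C_def using M l1 CG_pos CT_nonneg Crem_nonneg \<epsilon>
      by (intro add_nonneg_pos mult_nonneg_nonneg add_nonneg_nonneg) auto
    have h_le: "\<bar>h p x\<bar> \<le> C * gam (fst p) (x - snd p)" if p: "p \<in> ?P" for p x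
    proof -
      let ?t = "fst p" and ?y = "snd p"
      let ?g = "gam ?t (x - ?y)"
      note P = P[OF p]
      have g: "0 \<le> ?g" by (rule gam_nonneg)
      have "\<bar>T ?t ?y x\<bar> \<le> CT / ?t * ?g" by (rule T_le[OF P(3)])
      also have "\<dots> \<le> CT / \<epsilon> * ?g"
        using CT_nonneg P \<epsilon> g by (intro mult_right_mono divide_left_mono) auto
      finally have 1: "\<bar>T ?t ?y x\<bar> \<le> CT / \<epsilon> * ?g" .
      have "\<bar>rem ?t ?y x\<bar> \<le> Crem / sqrt ?t * ?g" by (rule rem_le[OF P(3)])
      also have "\<dots> \<le> Crem / sqrt \<epsilon> * ?g"
        using Crem_nonneg P \<epsilon> g by (intro mult_right_mono divide_left_mono) auto
      finally have 2: "\<bar>rem ?t ?y x\<bar> \<le> Crem / sqrt \<epsilon> * ?g" .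
      have 3: "\<bar>l * G ?t ?y x\<bar> \<le> l * CG * ?g"
        using mult_left_mono[OF G_le[OF P(3), of ?y x], of l] G_nonneg[of ?t ?y x] l1 by (simp add: abs_mult mult.assoc)
      have "\<bar>l * G ?t ?y x - (T ?t ?y x + rem ?t ?y x)\<bar> \<le> (l * CG + (CT / \<epsilon> + Crem / sqrt \<epsilon>)) * ?g"
        using 1 2 3 unfolding distrib_right by linarith
      then have "\<bar>f ?y\<bar> * \<bar>l * G ?t ?y x - (T ?t ?y x + rem ?t ?y x)\<bar> \<le> M * ((l * CG + (CT / \<epsilon> + Crem / sqrt \<epsilon>)) * ?g)"
        using M by (intro mult_mono) auto
      also have "\<dots> \<le> C * ?g" unfolding C_def using g by (simp add: distrib_right mult.assoc)
      finally have "exp (- (l * ?t)) * (\<bar>f ?y\<bar> * \<bar>l * G ?t ?y x - (T ?t ?y x + rem ?t ?y x)\<bar>) \<le> 1 * (C * ?g)"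
        by (rule mult_mono[rotated]) (use l1 P in auto)
      then show ?thesis by (simp add: h_def abs_mult)
    qed
    obtain Rc where Rc: "\<And>y. y \<in> cbox c r \<Longrightarrow> norm y \<le> Rc"
      using bounded_cbox[of c r] unfolding bounded_iff by blast
    have decay: "\<exists>R. \<forall>p\<in>?P. \<forall>x. norm x \<ge> R \<longrightarrow> \<bar>h p x\<bar> \<le> e" if e: "e > 0" for e
    proof -
      have eC: "e / C > 0" using e C by simp
      obtain R where "R \<ge> 0" and R: "\<And>t' z. \<epsilon> \<le> t' \<Longrightarrow> t' \<le> 1 \<Longrightarrow> norm (z::real^'d) \<ge> R \<Longrightarrow> gam t' z \<le> e / C"
        by (rule gam_decay[OF \<epsilon>(1) eC], rule that)
      have "\<bar>h p x\<bar> \<le> e" if p: "p \<in> ?P" and x: "norm x \<ge> R + Rc" for p x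
      proof -
        have "norm (x - snd p) \<ge> R"
          using x norm_triangle_ineq2[of x "snd p"] Rc[OF P(4)[OF p]] by linarith
        then have "C * gam (fst p) (x - snd p) \<le> e"
          using R P[OF p] C by (simp add: pos_le_divide_eq mult.commute)
        then show ?thesis using h_le[OF p, of x] by linarith
      qed
      then show ?thesis by blast
    qed
    obtain D :: "((real \<times> (real^'d)) \<times> (real \<times> (real^'d)) set) set" where D: "finite D" "\<And>p K. (p, K) \<in> D \<Longrightarrow> p \<in> ?P"
      "\<And>x. \<bar>integral ?P (\<lambda>p. h p x) - (\<Sum>(p, K)\<in>D. measure lborel K * h p x)\<bar> \<le> M / 8"
      using uniform_riemann_sum[OF cont decay, of "M / 8"] M by auto
    define u where "u x = (\<Sum>i\<in>D. (measure lborel (snd i) * exp (- (l * fst (fst i))) * f (snd (fst i))) * G (fst (fst i)) (snd (fst i)) x)" for x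
    have Gd: "G (fst (fst i)) (snd (fst i)) \<in> dom0 b a" "0 < fst (fst i)" if "i \<in> D" for i
    proof -
      have "fst i \<in> ?P" using D(2)[of "fst i" "snd i"] that by simp
      from P(2,3)[OF this] show "0 < fst (fst i)" "G (fst (fst i)) (snd (fst i)) \<in> dom0 b a"
        by (auto intro: G_dom0)
    qed
    have u: "u \<in> dom0 b a" and gu: "\<And>x. gen b a u x = (\<Sum>i\<in>D. (measure lborel (snd i) * exp (- (l * fst (fst i))) * f (snd (fst i))) * gen b a (G (fst (fst i)) (snd (fst i))) x)"
      using dom0_sum[OF D(1), of "\<lambda>i. G (fst (fst i)) (snd (fst i))" b a
          "\<lambda>i. measure lborel (snd i) * exp (- (l * fst (fst i))) * f (snd (fst i))"] Gd(1)
      unfolding u_def[abs_def] by auto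
    have lu: "l * u x - gen b a u x = (\<Sum>(p, K)\<in>D. measure lborel K * h p x)" for x
    proof -
      have "gen b a (G (fst (fst i)) (snd (fst i))) x = T (fst (fst i)) (snd (fst i)) x + rem (fst (fst i)) (snd (fst i)) x" if "i \<in> D" for i
        by (rule gen_G[OF Gd(2)[OF that]])
      then show ?thesis
        unfolding gu u_def sum_distrib_left sum_subtractf[symmetric]
        by (intro sum.cong refl) (simp add: h_def case_prod_beta' algebra_simps)
    qed
    have "\<bar>f x - (l * u x - gen b a u x)\<bar> \<le> M / 2" for x
    proof -
      let ?I1 = "exp (- (l * \<epsilon>)) * (\<integral>y. f y * G \<epsilon> y x \<partial>lborel)"
      let ?I2 = "exp (- l) * (\<integral>y. f y * G 1 y x \<partial>lborel)"
      let ?I3 = "integral {\<epsilon>..1} (\<lambda>t. integral (cbox c r) (\<lambda>y. exp (- (l * t)) * (f y * rem t y x)))"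
      have I: "integral ?P (\<lambda>p. h p x) = ?I1 - ?I2 - ?I3"
        unfolding h_def by (rule kernel_integral[OF f(1) f0 \<epsilon>])
      have i2: "\<bar>?I2\<bar> \<le> M / 8"
      proof -
        have "\<bar>\<integral>y. f y * G 1 y x \<partial>lborel\<bar> \<le> (M * CG) * \<Gamma>"
        proof (rule gam_bound_integral[OF integral_lborel_cbox(1)[of _ c r] _ zero_less_one, where x = x])
          show "continuous_on UNIV (\<lambda>y. f y * G 1 y x)"
            by (intro continuous_intros f cont_G) auto
          show "\<bar>f y * G 1 y x\<bar> \<le> (M * CG) * gam 1 (x - y)" for y
          proof -
            have "\<bar>f y\<bar> * G 1 y x \<le> M * (CG * gam 1 (x - y))"
              using M G_le[of 1 y x] G_nonneg by (intro mult_mono) auto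
            then show ?thesis using G_nonneg[of 1 y x] by (simp add: abs_mult mult.assoc)
          qed
        qed (simp add: f0)
        moreover have "exp (- l) \<le> 1 / l"
        proof -
          have "l \<le> exp l" using exp_ge_add_one_self[of l] by linarith
          then have "1 / exp l \<le> 1 / l" using l1 by (intro divide_left_mono) auto
          then show ?thesis by (simp add: exp_minus divide_inverse)
        qed
        ultimately have "exp (- l) * \<bar>\<integral>y. f y * G 1 y x \<partial>lborel\<bar> \<le> (1 / l) * ((M * CG) * \<Gamma>)"
          using l1 by (intro mult_mono) auto
        also have "\<dots> = M * (CG * \<Gamma> / l)" by simp
        also have "\<dots> \<le> M * (1 / 8)"
          using l1 M by (intro mult_left_mono) (auto simp: field_simps)
        finally show ?thesis by (simp add: abs_mult)
      qed
      have i3: "\<bar>?I3\<bar> \<le> M / 8"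
      proof -
        have "\<bar>?I3\<bar> \<le> 4 * M * Crem * \<Gamma> * l powr (- (1 / 4))"
          by (rule remainder_integral[OF f(1) f0 M _ \<epsilon>]) (use l1 in auto)
        also have "\<dots> \<le> 4 * M * Crem * \<Gamma> * (1 / X)"
        proof (intro mult_left_mono)
          have "l powr (- (1 / 4)) \<le> (X ^ 4) powr (- (1 / 4))"
            using l1 X by (intro powr_mono2') auto
          also have "(X ^ 4) powr (- (1 / 4)) = X powr (- 1)"
            using X by (simp add: powr_powr flip: powr_numeral)
          also have "\<dots> = 1 / X" using X by (simp add: powr_minus_divide)
          finally show "l powr (- (1 / 4)) \<le> 1 / X" .
        qed (use M Crem_nonneg \<Gamma>_nonneg in auto)
        also have "\<dots> = M * (4 * Crem * \<Gamma> / X)" by simp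
        also have "\<dots> \<le> M * (1 / 8)"
          using X M by (intro mult_left_mono) (auto simp: X_def field_simps)
        finally show ?thesis by simp
      qed
      show ?thesis using D(3)[of x] ai[of x] i2 i3 M(1) unfolding I lu by linarith
    qed
    then show ?thesis using u by blast
  qed
  moreover have "l0 > 0" by (simp add: l0_def)
  ultimately show thesis using that by blast
qed

lemma resolvent_dense:
  fixes \<sigma> :: "real^'d \<Rightarrow> real^'m::finite^'d"
  assumes a: "\<And>x. a x = \<sigma> x ** transpose (\<sigma> x)" and l: "l > 0" and f: "vanishes f" and e: "e > 0"
  shows "\<exists>u\<in>dom0 b a. \<forall>x. \<bar>f x - (l * u x - gen b a u x)\<bar> \<le> e"
proof -
  obtain l0 where l0: "l0 > 0"
    "\<And>l f M. l \<ge> l0 \<Longrightarrow> continuous_on UNIV f \<Longrightarrow> bounded {x. f x \<noteq> 0} \<Longrightarrow> M > 0 \<Longrightarrow> (\<And>x. \<bar>f x\<bar> \<le> M) \<Longrightarrow>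
      \<exists>u\<in>dom0 b a. \<forall>x. \<bar>f x - (l * u x - gen b a u x)\<bar> \<le> M / 2"
    using approximate_resolvent by metis
  have dense: "\<exists>u\<in>dom0 b a. \<forall>x. \<bar>f x - (l * u x - gen b a u x)\<bar> \<le> e"
    if l: "l \<ge> l0" and f: "vanishes f" and e: "e > 0" for l f e
  \<comment> \<open>Cutting \<open>f\<close> off to bounded support costs \<open>M / 4\<close>, the
    parametrix \<open>M / 2\<close>.\<close>
  proof (rule residual_iteration[OF _ _ _ f e, where \<theta> = "3 / 4"])
    fix f :: "real^'d \<Rightarrow> real" and M :: real
    assume f: "vanishes f" and M: "M > 0" "\<And>x. \<bar>f x\<bar> \<le> M"
    obtain g where g: "continuous_on UNIV g" "bounded {x. g x \<noteq> 0}"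
      "\<And>x. \<bar>g x\<bar> \<le> \<bar>f x\<bar>" "\<And>x. \<bar>f x - g x\<bar> \<le> M / 4"
      using vanishes_approx[OF f, of "M / 4"] M by auto
    have gM: "\<bar>g x\<bar> \<le> M" for x using g(3)[of x] M(2)[of x] by linarith
    obtain u where u: "u \<in> dom0 b a" "\<And>x. \<bar>g x - (l * u x - gen b a u x)\<bar> \<le> M / 2"
      using l0(2)[OF l g(1,2) M(1) gM] by blast
    have "\<bar>f x - (l * u x - gen b a u x)\<bar> \<le> 3 / 4 * M" for x
      using u(2)[of x] g(4)[of x] by linarith
    then show "\<exists>u\<in>dom0 b a. \<forall>x. \<bar>f x - (l * u x - gen b a u x)\<bar> \<le> 3 / 4 * M"
      using u(1) by blast
  qed auto
  show ?thesis
  proof (cases "l \<ge> l0")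
    case True
    then show ?thesis by (rule dense[OF _ f e])
  next
    case False
    show ?thesis
      by (rule resolvent_extend[OF a dense[OF order_refl] l _ f e]) (use False in auto)
  qed
qed

end

section \<open>Uniqueness for the Fokker--Planck equation\<close>

lemma exp_neg_tendsto_0:
  assumes "c > 0"
  shows "(\<lambda>n. exp (- (real n * c))) \<longlonglongrightarrow> 0"
proof -
  have "(\<lambda>n. exp (- c) ^ n) \<longlonglongrightarrow> 0" using assms by (intro LIMSEQ_realpow_zero) auto
  moreover have "exp (- c) ^ n = exp (- (real n * c))" for n
    by (simp add: exp_of_nat_mult[symmetric])
  ultimately show ?thesis by simp
qed

text \<open>Expanding \<open>1 - exp (- exp (n (t - s)))\<close> into exponentials expresses its integral against \<open>\<phi>\<close>
  by values of the Laplace transform, while the function itself tends to the indicator of \<open>s < t\<close>.\<close>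

lemma truncated_laplace_unique:
  fixes \<phi> :: "real \<Rightarrow> real"
  assumes T: "T > 0" and cont: "continuous_on {0..T} \<phi>"
    and bound: "\<And>n::nat. n \<ge> 1 \<Longrightarrow> \<bar>integral {0..T} (\<lambda>s. exp (- (real n * s)) * \<phi> s)\<bar> \<le> C * exp (- (real n * T))"
    and s: "s \<in> {0..T}"
  shows "\<phi> s = 0"
proof -
  obtain Bd where Bd: "Bd > 0" "\<And>s. s \<in> {0..T} \<Longrightarrow> \<bar>\<phi> s\<bar> \<le> Bd"
  proof -
    have "bounded (\<phi> ` {0..T})"
      using compact_continuous_image[OF cont compact_Icc] compact_imp_bounded by blast
    then show thesis using that unfolding bounded_pos by (auto simp: image_iff)
  qed
  have C0: "C \<ge> 0"
  proof -
    have "0 \<le> C * exp (- (real 1 * T))" using bound[of 1] by linarith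
    then show ?thesis by (simp add: zero_le_mult_iff)
  qed
  have zero: "integral {0..t} \<phi> = 0" if t: "0 < t" "t < T" for t
  proof -
    define g where "g n s = (1 - exp (- exp (real n * (t - s)))) * \<phi> s" for n s
    \<comment> \<open>The term of index \<open>k\<close> is a multiple of the transform at
      \<open>Suc k * n\<close>. Its factor \<open>exp (Suc k * n * t)\<close> meets the bound
      \<open>exp (- (Suc k * n * T))\<close>, so the sum is dominated by an exponential series in
      \<open>exp (- (n * (T - t)))\<close>, which is small because \<open>t < T\<close>.\<close>
    have gle: "\<bar>integral {0..T} (g n)\<bar> \<le> C * (exp (exp (- (real n * (T - t)))) - 1)" if n: "n \<ge> 1" for n :: nat
    proof -
      define x where "x s = exp (real n * (t - s))" for s
      define f where "f k s = (- 1) ^ k / fact (Suc k) * x s ^ Suc k * \<phi> s" for k :: nat and s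
      define y where "y = exp (- (real n * (T - t)))"
      have x0: "0 \<le> x s" "s \<in> {0..T} \<Longrightarrow> x s \<le> exp (real n * t)" for s
        unfolding x_def using n by (auto intro!: mult_left_mono)
      have sums: "(\<lambda>k. f k s) sums g n s" for s
      proof -
        have "(\<lambda>k. (- x s) ^ Suc k /\<^sub>R fact (Suc k)) sums (exp (- x s) - (- x s) ^ 0 /\<^sub>R fact 0)"
          using exp_converges[of "- x s"] by (subst sums_Suc_iff) simp
        from sums_mult2[OF sums_minus[OF this], of "\<phi> s"]
        have "(\<lambda>k. - ((- x s) ^ Suc k /\<^sub>R fact (Suc k)) * \<phi> s) sums (- (exp (- x s) - 1) * \<phi> s)" by simp
        moreover have "- ((- x s) ^ Suc k /\<^sub>R fact (Suc k)) * \<phi> s = f k s" for k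
          unfolding f_def power_minus[of "x s"] by (simp add: field_simps)
        ultimately show ?thesis by (simp add: g_def x_def)
      qed
      define M where "M k = exp (real n * t) ^ Suc k / fact (Suc k) * Bd" for k
      have summ: "summable M"
      proof -
        have "summable (\<lambda>k. exp (real n * t) ^ Suc k /\<^sub>R fact (Suc k))"
          using summable_exp_generic[of "exp (real n * t)"] by (subst summable_Suc_iff)
        from summable_mult2[OF this, of Bd] show ?thesis
          unfolding M_def by (simp add: divide_inverse mult_ac)
      qed
      have "uniform_limit {0..T} (\<lambda>N s. \<Sum>k<N. f k s) (\<lambda>s. \<Sum>k. f k s) sequentially"
      proof (rule Weierstrass_m_test[OF _ summ])
        fix k s assume s: "s \<in> {0..T}"
        have "\<bar>f k s\<bar> = x s ^ Suc k / fact (Suc k) * \<bar>\<phi> s\<bar>"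
          using x0(1)[of s] by (simp add: f_def abs_mult power_abs)
        also have "\<dots> \<le> M k"
          unfolding M_def using x0 s Bd by (intro mult_mono divide_right_mono power_mono) auto
        finally show "norm (f k s) \<le> M k" by simp
      qed
      moreover have "(\<lambda>s. \<Sum>k. f k s) = g n"
        by (rule ext) (rule sums_unique[OF sums, symmetric])
      ultimately have ul: "uniform_limit (cbox 0 T) (\<lambda>N s. \<Sum>k<N. f k s) (g n) sequentially"
        by simp
      have cf: "continuous_on {0..T} (f k)" for k
        unfolding f_def x_def by (intro continuous_intros cont)
      have cN: "continuous_on (cbox 0 T) (\<lambda>s. \<Sum>k<N. f k s)" for N
        using cf by (auto intro!: continuous_intros)
      obtain I J where IJ: "\<And>N. ((\<lambda>s. \<Sum>k<N. f k s) has_integral I N) (cbox 0 T)"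
        "(g n has_integral J) (cbox 0 T)" "(I \<longlongrightarrow> J) sequentially"
        using uniform_limit_integral_cbox[OF ul cN] by auto
      have IN: "\<bar>I N\<bar> \<le> C * (exp y - 1)" for N
      proof -
        have fk: "integral {0..T} (f k) = (- 1) ^ k / fact (Suc k) * exp (real (Suc k * n) * t) *
            integral {0..T} (\<lambda>s. exp (- (real (Suc k * n) * s)) * \<phi> s)" for k
        proof -
          have "f k s = ((- 1) ^ k / fact (Suc k) * exp (real (Suc k * n) * t)) * (exp (- (real (Suc k * n) * s)) * \<phi> s)" for s
          proof -
            have "x s ^ Suc k = exp (real (Suc k) * (real n * (t - s)))"
              unfolding x_def by (rule exp_of_nat_mult[symmetric])
            also have "\<dots> = exp (real (Suc k * n) * t) * exp (- (real (Suc k * n) * s))"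
              by (simp only: exp_add[symmetric]) (simp add: algebra_simps)
            finally show ?thesis unfolding f_def by (simp only: mult.assoc)
          qed
          then have "f k = (\<lambda>s. ((- 1) ^ k / fact (Suc k) * exp (real (Suc k * n) * t)) * (exp (- (real (Suc k * n) * s)) * \<phi> s))"
            by (rule ext)
          then show ?thesis by (simp only: integral_mult_right)
        qed
        have "I N = (\<Sum>k<N. integral {0..T} (f k))"
        proof (rule has_integral_unique)
          show "((\<lambda>s. \<Sum>k<N. f k s) has_integral I N) {0..T}" using IJ(1)[of N] by simp
          show "((\<lambda>s. \<Sum>k<N. f k s) has_integral (\<Sum>k<N. integral {0..T} (f k))) {0..T}"
            by (intro has_integral_sum integrable_integral integrable_continuous_interval cf) simp
        qed
        also have "\<bar>\<dots>\<bar> \<le> (\<Sum>k<N. C * (y ^ Suc k / fact (Suc k)))"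
        proof (rule order_trans[OF sum_abs], rule sum_mono)
          fix k
          have "Suc k * n \<ge> 1" using n by simp
          note bd = bound[OF this]
          have "\<bar>integral {0..T} (f k)\<bar> = exp (real (Suc k * n) * t) / fact (Suc k) *
              \<bar>integral {0..T} (\<lambda>s. exp (- (real (Suc k * n) * s)) * \<phi> s)\<bar>"
            unfolding fk by (simp add: abs_mult power_abs)
          also have "\<dots> \<le> exp (real (Suc k * n) * t) / fact (Suc k) * (C * exp (- (real (Suc k * n) * T)))"
            by (rule mult_left_mono[OF bd]) simp
          also have "\<dots> = C * ((exp (real (Suc k * n) * t) * exp (- (real (Suc k * n) * T))) / fact (Suc k))"
            by simp
          also have "exp (real (Suc k * n) * t) * exp (- (real (Suc k * n) * T)) = exp (real (Suc k) * (- (real n * (T - t))))"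
            by (simp only: exp_add[symmetric]) (simp add: algebra_simps)
          also have "\<dots> = y ^ Suc k" unfolding y_def by (rule exp_of_nat_mult)
          finally show "\<bar>integral {0..T} (f k)\<bar> \<le> C * (y ^ Suc k / fact (Suc k))" .
        qed
        also have "\<dots> = C * (\<Sum>k<N. y ^ Suc k / fact (Suc k))" by (rule sum_distrib_left[symmetric])
        also have "\<dots> \<le> C * (exp y - 1)"
        proof (rule mult_left_mono[OF _ C0])
          have s: "(\<lambda>k. y ^ Suc k /\<^sub>R fact (Suc k)) sums (exp y - y ^ 0 /\<^sub>R fact 0)"
            using exp_converges[of y] by (subst sums_Suc_iff) simp
          have "(\<Sum>k<N. y ^ Suc k /\<^sub>R fact (Suc k)) \<le> exp y - y ^ 0 /\<^sub>R fact 0"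
            unfolding sums_unique[OF s]
            by (rule sum_le_suminf[OF sums_summable[OF s]]) (auto simp: y_def)
          then show "(\<Sum>k<N. y ^ Suc k / fact (Suc k)) \<le> exp y - 1" by (simp add: divide_inverse mult.commute)
        qed
        finally show ?thesis .
      qed
      have "\<bar>J\<bar> \<le> C * (exp y - 1)"
        by (rule LIMSEQ_le_const2[OF tendsto_rabs[OF IJ(3)]]) (use IN in auto)
      then show ?thesis using IJ(2) by (simp add: integral_unique y_def)
    qed
    \<comment> \<open>The pointwise limit of \<open>g n\<close>; the odd value at
      \<open>s = t\<close> is confined to one point and does not affect the integral.\<close>
    define h where "h s = (if s < t then \<phi> s else if s = t then (1 - exp (- 1)) * \<phi> t else 0)" for s
    have lim: "(\<lambda>n. integral {0..T} (g n)) \<longlonglongrightarrow> integral {0..T} h"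
    proof (rule dominated_convergence(2)[where h = "\<lambda>_. Bd"])
      show "g n integrable_on {0..T}" for n
        unfolding g_def by (intro integrable_continuous_interval continuous_intros cont)
      show "norm (g n s) \<le> Bd" if "s \<in> {0..T}" for n s
      proof -
        have "\<bar>1 - exp (- exp (real n * (t - s)))\<bar> * \<bar>\<phi> s\<bar> \<le> 1 * Bd"
          using Bd that by (intro mult_mono) auto
        then show ?thesis by (simp add: g_def abs_mult)
      qed
      show "(\<lambda>n. g n s) \<longlonglongrightarrow> h s" if "s \<in> {0..T}" for s
      proof -
        consider "s < t" | "s = t" | "s > t" by linarith
        then show ?thesis
        proof cases
          case 1
          have "real n * (t - s) \<le> exp (real n * (t - s))" for n
            using exp_ge_add_one_self[of "real n * (t - s)"] by linarith
          then have "exp (- exp (real n * (t - s))) \<le> exp (- (real n * (t - s)))" for n by simp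
          then have "(\<lambda>n. exp (- exp (real n * (t - s)))) \<longlonglongrightarrow> 0"
            using 1 by (intro tendsto_sandwich[OF _ _ tendsto_const exp_neg_tendsto_0[of "t - s"]]) auto
          then have "(\<lambda>n. g n s) \<longlonglongrightarrow> (1 - 0) * \<phi> s" unfolding g_def by (intro tendsto_intros)
          then show ?thesis using 1 by (simp add: h_def)
        next
          case 2
          then show ?thesis by (simp add: h_def g_def)
        next
          case 3
          have "real n * (t - s) = - (real n * (s - t))" for n by (simp add: algebra_simps)
          then have "(\<lambda>n. exp (real n * (t - s))) \<longlonglongrightarrow> 0"
            using exp_neg_tendsto_0[of "s - t"] 3 by (simp only: diff_gt_0_iff_gt)
          then have "(\<lambda>n. g n s) \<longlonglongrightarrow> (1 - exp (- 0)) * \<phi> s" unfolding g_def by (intro tendsto_intros)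
          then show ?thesis using 3 by (simp add: h_def)
        qed
      qed
    qed auto
    moreover have "(\<lambda>n. integral {0..T} (g n)) \<longlonglongrightarrow> 0"
    proof (rule Lim_null_comparison)
      show "\<forall>\<^sub>F n in sequentially. norm (integral {0..T} (g n)) \<le> C * (exp (exp (- (real n * (T - t)))) - 1)"
        using eventually_ge_at_top[of 1] by eventually_elim (simp add: gle)
      have "(\<lambda>n. exp (- (real n * (T - t)))) \<longlonglongrightarrow> 0"
        by (rule exp_neg_tendsto_0) (use t in simp)
      then have "(\<lambda>n. C * (exp (exp (- (real n * (T - t)))) - 1)) \<longlonglongrightarrow> C * (exp 0 - 1)"
        by (intro tendsto_intros)
      then show "(\<lambda>n. C * (exp (exp (- (real n * (T - t)))) - 1)) \<longlonglongrightarrow> 0" by simp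
    qed
    ultimately have h0: "integral {0..T} h = 0" using LIMSEQ_unique by blast
    have "integral {0..T} h = integral {0..T} (\<lambda>s. if s \<in> {0..t} then \<phi> s else 0)"
      by (rule integral_spike[of "{t}"]) (auto simp: h_def)
    also have "\<dots> = integral ({0..t} \<inter> {0..T}) \<phi>" by (rule integral_restrict_Int)
    also have "{0..t} \<inter> {0..T} = {0..t}" using t by auto
    finally show ?thesis using h0 by simp
  qed
  have interior: "\<phi> t = 0" if t: "0 < t" "t < T" for t
  proof -
    have "((\<lambda>x. integral {0..x} \<phi>) has_real_derivative \<phi> t) (at t within {0..T})"
      by (rule integral_has_real_derivative[OF cont]) (use t in auto)
    moreover have "t \<in> interior {0..T}" using t by simp
    then have "at t within {0..T} = at t" by (rule at_within_interior)
    ultimately have "((\<lambda>x. integral {0..x} \<phi>) has_real_derivative \<phi> t) (at t)" by (simp only:)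
    moreover have "((\<lambda>x. integral {0..x} \<phi>) has_real_derivative 0) (at t)"
    proof (rule has_field_derivative_transform_within_open[of "\<lambda>_. 0" _ _ "{0<..<T}"])
      show "0 = integral {0..x} \<phi>" if "x \<in> {0<..<T}" for x using zero that by simp
    qed (use t in auto)
    ultimately show ?thesis by (rule DERIV_unique)
  qed
  have "closure {0<..<T} = {0..T}" using T by simp
  moreover have "\<phi> x = 0" if "x \<in> closure {0<..<T}" for x
    by (rule continuous_constant_on_closure[of "{0<..<T}" \<phi> 0]) (use cont T interior that in auto)
  ultimately show ?thesis using s by simp
qed

section \<open>Convex truncation and the Lyapunov function\<close>

lemma gen_comp:
  fixes v :: "real^'d::finite \<Rightarrow> real"
  assumes v: "smooth v" and \<Phi>: "\<And>y. (\<Phi> has_real_derivative \<Phi>1 y) (at y)" "\<And>y. (\<Phi>1 has_real_derivative \<Phi>2 y) (at y)"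
  shows "gen b a (\<lambda>x. \<Phi> (v x)) x = \<Phi>1 (v x) * gen b a v x
    + 1/2 * \<Phi>2 (v x) * ((\<chi> i. pd i v x) \<bullet> (a x *v (\<chi> i. pd i v x)))"
proof -
  note dv = smooth_differentiable[OF v]
  have p1: "pd j (\<lambda>x. \<Phi> (v x)) = (\<lambda>x. \<Phi>1 (v x) * pd j v x)" for j
    using pd_comp[OF dv \<Phi>(1)] by blast
  have p2: "pd i (\<lambda>x. \<Phi>1 (v x) * pd j v x) x = \<Phi>1 (v x) * pd i (pd j v) x + \<Phi>2 (v x) * pd i v x * pd j v x" for i j
    using pd_mult[OF differentiable_comp_real[OF dv \<Phi>(2)] smooth_differentiable[OF smooth_pd[OF v]]]
      pd_comp[OF dv \<Phi>(2)] by (simp add: mult_ac)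
  show ?thesis
    unfolding gen_def p1 p2 quadratic_form
    by (simp add: sum_distrib_left distrib_left sum.distrib mult_ac)
qed

text \<open>A smooth convex substitute for the positive part, with error at most
  \<open>\<kappa>\<close>: for \<open>y > 0\<close> it is \<open>y * exp (- \<kappa> / y)\<close>.
  Its derivative \<open>(1 + \<kappa> / y) * exp (- \<kappa> / y)\<close> lies between 0 and 1, and
  its second derivative is nonnegative.\<close>

definition ramp :: "real \<Rightarrow> real \<Rightarrow> real" where
  "ramp \<kappa> y = y * fexp (y / \<kappa>)"

definition ramp1 :: "real \<Rightarrow> real \<Rightarrow> real" where
  "ramp1 \<kappa> y = flatf [:1, 1:] (y / \<kappa>)"

lemma ramp_derivs:
  assumes "\<kappa> > 0"
  shows "(ramp \<kappa> has_real_derivative ramp1 \<kappa> y) (at y)"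
    "(ramp1 \<kappa> has_real_derivative flatf [:0, 0, 0, 1:] (y / \<kappa>) / \<kappa>) (at y)"
proof -
  have div: "((\<lambda>y. y / \<kappa>) has_real_derivative 1 / \<kappa>) (at y)"
    using assms by (auto intro!: derivative_eq_intros)
  have "(ramp \<kappa> has_real_derivative (1 * fexp (y / \<kappa>) + fexp' (y / \<kappa>) * (1 / \<kappa>) * y)) (at y)"
    unfolding ramp_def
    by (rule DERIV_mult[OF DERIV_ident DERIV_chain2[OF fexp_has_derivative div]])
  moreover have "1 * fexp (y / \<kappa>) + fexp' (y / \<kappa>) * (1 / \<kappa>) * y = ramp1 \<kappa> y"
    using assms by (auto simp: ramp1_def flatf_def fexp_def fexp'_def power2_eq_square field_simps)
  ultimately show "(ramp \<kappa> has_real_derivative ramp1 \<kappa> y) (at y)" by simp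
  have "[:0, 0, 1:] * ([:1, 1:] - pderiv [:1, 1:]) = ([:0, 0, 0, 1:] :: real poly)"
    by (simp add: pderiv_pCons)
  then have "(flatf [:1, 1:] has_real_derivative flatf [:0, 0, 0, 1:] z) (at z)" for z
    using flatf_has_derivative[of "[:1, 1:]" z] by (simp only:)
  from DERIV_chain2[OF this div]
  show "(ramp1 \<kappa> has_real_derivative flatf [:0, 0, 0, 1:] (y / \<kappa>) / \<kappa>) (at y)"
    unfolding ramp1_def by simp
qed

lemma ramp_props:
  assumes \<kappa>: "\<kappa> > 0"
  shows "y \<le> 0 \<Longrightarrow> ramp \<kappa> y = 0" "y \<le> 0 \<Longrightarrow> ramp1 \<kappa> y = 0"
    "0 \<le> ramp1 \<kappa> y" "ramp1 \<kappa> y \<le> 1" "0 \<le> ramp \<kappa> y" "ramp \<kappa> y \<le> y * ramp1 \<kappa> y" "y - \<kappa> \<le> ramp \<kappa> y"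
    "0 \<le> flatf [:0, 0, 0, 1:] (y / \<kappa>) / \<kappa>" "0 \<le> y \<Longrightarrow> ramp \<kappa> y \<le> y"
proof -
  have f1: "flatf [:1, 1:] z \<le> 1" for z
  proof (cases "z > 0")
    case True
    have "(1 + 1 / z) * exp (- (1 / z)) \<le> exp (1 / z) * exp (- (1 / z))"
      by (intro mult_right_mono exp_ge_add_one_self) auto
    then show ?thesis using True by (simp add: flatf_def exp_add[symmetric])
  qed (simp add: flatf_def)
  show "y \<le> 0 \<Longrightarrow> ramp \<kappa> y = 0" "y \<le> 0 \<Longrightarrow> ramp1 \<kappa> y = 0"
    using \<kappa> by (auto simp: ramp_def ramp1_def fexp_def flatf_def zero_less_divide_iff)
  show "0 \<le> ramp1 \<kappa> y" using \<kappa> unfolding ramp1_def flatf_def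
    by (auto intro!: mult_nonneg_nonneg add_nonneg_nonneg simp: zero_less_divide_iff)
  show "ramp1 \<kappa> y \<le> 1" unfolding ramp1_def by (rule f1)
  show "0 \<le> ramp \<kappa> y" using \<kappa> by (auto simp: ramp_def fexp_def zero_less_divide_iff)
  show "ramp \<kappa> y \<le> y * ramp1 \<kappa> y"
    using \<kappa> by (auto simp: ramp_def ramp1_def fexp_def flatf_def zero_less_divide_iff intro!: mult_left_mono)
  show "y - \<kappa> \<le> ramp \<kappa> y"
  proof (cases "y > 0")
    case True
    have "y * (1 - \<kappa> / y) \<le> y * exp (- (\<kappa> / y))"
      using True exp_ge_add_one_self[of "- (\<kappa> / y)"] by (intro mult_left_mono) auto
    then show ?thesis using True \<kappa> by (simp add: ramp_def fexp_def right_diff_distrib)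
  next
    case False
    then show ?thesis using \<kappa> by (auto simp: ramp_def fexp_def zero_less_divide_iff)
  qed
  show "0 \<le> flatf [:0, 0, 0, 1:] (y / \<kappa>) / \<kappa>"
    using \<kappa> by (auto simp: flatf_def zero_less_divide_iff intro!: divide_nonneg_nonneg mult_nonneg_nonneg)
  show "0 \<le> y \<Longrightarrow> ramp \<kappa> y \<le> y" unfolding ramp_def using mult_left_mono[OF fexp_le_1, of y] by simp
qed

lemma sm_ramp: "sm v \<Longrightarrow> sm (\<lambda>x. ramp \<kappa> (v x))"
  unfolding ramp_def using sm.mult[OF _ sm_fexp[OF sm_cmult[of v "1 / \<kappa>"]]] by simp

definition lyap :: "real^'d::finite \<Rightarrow> real" where "lyap x = ln (1 + (norm x)\<^sup>2)"

lemma lyap_eq: "lyap x = ln ((x - 0) \<bullet> (mat 1 *v (x - 0)) + 1)"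
  by (simp add: lyap_def power2_norm_eq_inner add.commute)

lemma sm_lyap: "sm lyap"
proof -
  have "sm (\<lambda>x::real^'a. ln ((x - 0) \<bullet> (mat 1 *v (x - 0)) + 1))"
    by (intro sm_ln sm_quad) (simp add: add_nonneg_pos)
  then show ?thesis unfolding lyap_eq[symmetric] .
qed

lemma lyap_nonneg: "lyap x \<ge> 0" by (simp add: lyap_def)

text \<open>The logarithm is concave, so the term with its second derivative is nonpositive and is
  dropped. The other terms grow at most like \<open>1 + norm x^2\<close>, the quantity by which the
  first derivative of the logarithm divides.\<close>

lemma gen_lyap_le:
  fixes a :: "real^'d::finite \<Rightarrow> real^'d^'d"
  assumes K: "K > 0" and b: "norm (b x) \<le> K * (1 + norm x)" and a: "norm (a x) \<le> K * (1 + (norm x)\<^sup>2)"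
    and psd: "\<And>w. 0 \<le> w \<bullet> (a x *v w)"
  shows "gen b a lyap x \<le> K * (4 + norm (mat 1 :: real^'d^'d))"
proof -
  define s where "s = (norm x)\<^sup>2 + 1"
  have s: "s \<ge> 1" by (simp add: s_def)
  have q: "(x - 0) \<bullet> (mat 1 *v (x - 0)) + 1 = s" by (simp add: s_def power2_norm_eq_inner)
  have pos: "(x - 0) \<bullet> (mat 1 *v (x - 0)) + 1 > 0" for x :: "real^'d" by (simp add: add_nonneg_pos)
  have ne: "1 + x \<bullet> x \<noteq> 0" for x :: "real^'d" using inner_ge_zero[of x] by linarith
  have "gen b a lyap x = (1 / s) * (2 * (b x \<bullet> (mat 1 *v (x - 0))) + mat 1 \<bullet> a x)
      + 2 * (- (1 / s\<^sup>2)) * ((mat 1 *v (x - 0)) \<bullet> (a x *v (mat 1 *v (x - 0))))"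
    unfolding lyap_eq[abs_def] q[symmetric]
    by (rule gen_radial[OF transpose_mat[of 1], of ln "\<lambda>s. 1 / s" 0 1 "\<lambda>s. - (1 / s\<^sup>2)"])
      (use pos ne in \<open>auto intro!: derivative_eq_intros simp: power2_eq_square field_simps\<close>)
  also have "\<dots> = (1 / s) * (2 * (b x \<bullet> x) + mat 1 \<bullet> a x) - 2 / s\<^sup>2 * (x \<bullet> (a x *v x))" by simp
  also have "\<dots> \<le> (1 / s) * (2 * (b x \<bullet> x) + mat 1 \<bullet> a x)"
    using psd[of x] by simp
  also have "\<dots> \<le> (1 / s) * (2 * (2 * K * s) + norm (mat 1 :: real^'d^'d) * (K * s))"
  proof (intro mult_left_mono add_mono)
    have "b x \<bullet> x \<le> norm (b x) * norm x" by (rule norm_cauchy_schwarz)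
    also have "\<dots> \<le> K * (1 + norm x) * norm x" by (intro mult_right_mono b) auto
    also have "\<dots> = K * ((1 + norm x) * norm x)" by simp
    also have "\<dots> \<le> K * (2 * s)"
    proof (rule mult_left_mono)
      have "0 \<le> (norm x - 1 / 2)\<^sup>2" by simp
      then show "(1 + norm x) * norm x \<le> 2 * s" by (simp add: s_def power2_eq_square algebra_simps)
    qed (use K in simp)
    finally show "b x \<bullet> x \<le> 2 * K * s" by simp
    have "mat 1 \<bullet> a x \<le> norm (mat 1 :: real^'d^'d) * norm (a x)" by (rule norm_cauchy_schwarz)
    also have "\<dots> \<le> norm (mat 1 :: real^'d^'d) * (K * s)"
      using a by (intro mult_left_mono) (auto simp: s_def add.commute)
    finally show "mat 1 \<bullet> a x \<le> norm (mat 1 :: real^'d^'d) * (K * s)" .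
  qed (use s in auto)
  also have "\<dots> = K * (4 + norm (mat 1 :: real^'d^'d))" using s by (simp add: field_simps)
  finally show ?thesis .
qed

lemma lyap_large:
  obtains R where "R > 0" "\<And>x::real^'d::finite. norm x \<ge> R \<Longrightarrow> lyap x > c"
proof -
  have "lyap x > c" if "norm x \<ge> exp \<bar>c\<bar>" for x :: "real^'d"
  proof -
    have "exp \<bar>c\<bar> * 1 \<le> norm x * norm x" using that by (intro mult_mono) (auto intro: order_trans[OF _ that])
    then have "exp \<bar>c\<bar> < 1 + (norm x)\<^sup>2" by (simp add: power2_eq_square)
    then have "\<bar>c\<bar> < ln (1 + (norm x)\<^sup>2)" by (subst exp_less_cancel_iff[symmetric]) (simp add: add_pos_nonneg)
    then show ?thesis by (simp add: lyap_def)
  qed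
  then show thesis using that[of "exp \<bar>c\<bar>"] by simp
qed

text \<open>The radius \<open>R + 1\<close> places the closed ball of radius \<open>R\<close> inside
  an open convex set on which the first derivatives are bounded.\<close>

lemma C3_holder_lipschitz:
  fixes g :: "real^'d::finite \<Rightarrow> real"
  assumes "C3_holder_b \<alpha> (ball 0 (R + 1)) g"
  obtains C where "C \<ge> 0" "\<And>x y. norm x \<le> R \<Longrightarrow> norm y \<le> R \<Longrightarrow> \<bar>g x - g y\<bar> \<le> C * norm (x - y)"
proof -
  let ?U = "ball (0::real^'d) (R + 1)"
  have diff: "g differentiable (at x)" if "x \<in> ?U" for x
    using assms that unfolding C3_holder_b_def by (elim conjE allE[of _ "[]"]) simp
  have "\<exists>C. \<forall>x\<in>?U. \<bar>pd i g x\<bar> \<le> C" for i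
  proof -
    have "bounded (Dl [i] g ` ?U)"
      using assms unfolding C3_holder_b_def by (elim conjE allE[of _ "[i]"]) simp
    then show ?thesis unfolding bounded_iff by auto
  qed
  then obtain C where C: "\<And>i x. x \<in> ?U \<Longrightarrow> \<bar>pd i g x\<bar> \<le> C i" by metis
  define S where "S = (\<Sum>i\<in>UNIV. \<bar>C i\<bar>)"
  have "\<bar>g x - g y\<bar> \<le> S * norm (x - y)" if "norm x \<le> R" "norm y \<le> R" for x y
  proof -
    have "norm (g x - g y) \<le> S * norm (x - y)"
    proof (rule differentiable_bound[of ?U])
      show "(g has_derivative (\<lambda>v. \<Sum>i\<in>UNIV. v $ i * pd i g z)) (at z within ?U)" if "z \<in> ?U" for z
        by (rule has_derivative_at_withinI[OF has_derivative_pd[OF diff[OF that]]])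
      show "onorm (\<lambda>v. \<Sum>i\<in>UNIV. v $ i * pd i g z) \<le> S" if z: "z \<in> ?U" for z
      proof (rule onorm_le)
        fix v :: "real^'d"
        have "\<bar>\<Sum>i\<in>UNIV. v $ i * pd i g z\<bar> \<le> (\<Sum>i\<in>UNIV. \<bar>v $ i * pd i g z\<bar>)" by (rule sum_abs)
        also have "\<dots> \<le> (\<Sum>i\<in>UNIV. norm v * \<bar>C i\<bar>)"
        proof (rule sum_mono)
          fix i
          have "\<bar>v $ i\<bar> * \<bar>pd i g z\<bar> \<le> norm v * \<bar>C i\<bar>"
            using C[OF z, of i] component_le_norm_cart[of v i] by (intro mult_mono) auto
          then show "\<bar>v $ i * pd i g z\<bar> \<le> norm v * \<bar>C i\<bar>" by (simp add: abs_mult)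
        qed
        also have "\<dots> = S * norm v" by (simp add: S_def sum_distrib_left mult.commute)
        finally show "norm (\<Sum>i\<in>UNIV. v $ i * pd i g z) \<le> S * norm v" by simp
      qed
    qed (use that in auto)
    then show ?thesis by simp
  qed
  moreover have "S \<ge> 0" by (simp add: S_def sum_nonneg)
  ultimately show thesis using that by blast
qed

section \<open>Truncated coefficients and the discounted comparison\<close>

locale regular_diffusion =
  fixes b :: "real^'d::finite \<Rightarrow> real^'d" and \<sigma> :: "real^'d \<Rightarrow> real^'m::finite^'d"
    and a :: "real^'d \<Rightarrow> real^'d^'d" and \<alpha> lam C :: real and \<eta> :: "real^'d \<Rightarrow> real" and K :: real
  assumes a_def: "\<And>x. a x = \<sigma> x ** transpose (\<sigma> x)"
    and reg: "regular_conditions b a \<alpha> lam C \<eta>"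
    and K: "K > 0"
    and b_lin: "\<And>x. norm (b x) \<le> K * (1 + norm x)"
    and a_quad: "\<And>x. norm (a x) \<le> K * (1 + (norm x)\<^sup>2)"
begin

lemma C3: "R > 0 \<Longrightarrow> C3_holder_b \<alpha> (ball 0 R) (\<lambda>x. b x $ i)"
  "R > 0 \<Longrightarrow> C3_holder_b \<alpha> (ball 0 R) (\<lambda>x. a x $ i $ j)"
  using reg unfolding regular_conditions_def by blast+

lemma ellipticity: "lam > 0" "lam * (norm \<xi>)\<^sup>2 \<le> \<xi> \<bullet> (a x *v \<xi>)"
proof -
  show "lam > 0" using reg unfolding regular_conditions_def by blast
  have "lam * (norm \<xi>)\<^sup>2 \<le> \<eta> x * (norm \<xi>)\<^sup>2"
    using reg unfolding regular_conditions_def by (intro mult_right_mono) auto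
  also have "\<dots> \<le> \<xi> \<bullet> (a x *v \<xi>)"
    using reg unfolding regular_conditions_def by blast
  finally show "lam * (norm \<xi>)\<^sup>2 \<le> \<xi> \<bullet> (a x *v \<xi>)" .
qed

lemma psd: "0 \<le> \<xi> \<bullet> (a x *v \<xi>)"
  by (rule order_trans[OF _ ellipticity(2)]) (simp add: ellipticity(1) less_imp_le)

lemma sym_a: "transpose (a x) = a x"
  by (simp add: a_def matrix_transpose_mul)

lemma C3_continuous:
  assumes "\<And>R. R > 0 \<Longrightarrow> C3_holder_b \<alpha> (ball 0 R) g"
  shows "continuous_on UNIV (g :: real^'d \<Rightarrow> real)"
proof (rule continuous_at_imp_continuous_on, rule ballI)
  fix x :: "real^'d"
  have "C3_holder_b \<alpha> (ball 0 (norm x + 1)) g" by (rule assms) (simp add: add_nonneg_pos)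
  then have "g differentiable (at x)"
    unfolding C3_holder_b_def by (elim conjE allE[of _ "[]"]) simp
  then show "isCont g x" by (rule differentiable_imp_continuous_within)
qed

lemma cont_b: "continuous_on UNIV b"
proof -
  have "continuous_on UNIV (\<lambda>x. \<chi> i. b x $ i)"
    by (intro continuous_on_vec_lambda C3_continuous C3)
  then show ?thesis by simp
qed

lemma cont_a: "continuous_on UNIV a"
proof -
  have "continuous_on UNIV (\<lambda>x. \<chi> i. \<chi> j. a x $ i $ j)"
    by (intro continuous_on_vec_lambda C3_continuous C3)
  then show ?thesis by simp
qed

lemma a_lipschitz:
  assumes R: "R > 0"
  obtains L where "L \<ge> 0" "\<And>x y. norm x \<le> R \<Longrightarrow> norm y \<le> R \<Longrightarrow> norm (a x - a y) \<le> L * norm (x - y)"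
proof -
  have "\<exists>L. L \<ge> 0 \<and> (\<forall>x y. norm x \<le> R \<longrightarrow> norm y \<le> R \<longrightarrow> \<bar>a x $ i $ j - a y $ i $ j\<bar> \<le> L * norm (x - y))" for i j
    using C3_holder_lipschitz[OF C3(2)[of "R + 1" i j]] R by (metis add_pos_pos zero_less_one)
  then obtain L where L: "\<And>i j. L i j \<ge> 0"
    "\<And>i j x y. norm x \<le> R \<Longrightarrow> norm y \<le> R \<Longrightarrow> \<bar>a x $ i $ j - a y $ i $ j\<bar> \<le> L i j * norm (x - y)" by metis
  define S where "S = (\<Sum>i\<in>UNIV. \<Sum>j\<in>UNIV. L i j)"
  have "norm (a x - a y) \<le> S * norm (x - y)" if xy: "norm x \<le> R" "norm y \<le> R" for x y
  proof -
    have "norm (a x - a y) \<le> (\<Sum>i\<in>UNIV. norm ((a x - a y) $ i))"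
      unfolding norm_vec_def by (rule L2_set_le_sum) auto
    also have "\<dots> \<le> (\<Sum>i\<in>UNIV. \<Sum>j\<in>UNIV. L i j * norm (x - y))"
    proof (rule sum_mono)
      fix i
      have "norm ((a x - a y) $ i) \<le> (\<Sum>j\<in>UNIV. \<bar>(a x - a y) $ i $ j\<bar>)" by (rule norm_le_l1_cart)
      also have "\<dots> \<le> (\<Sum>j\<in>UNIV. L i j * norm (x - y))"
        using L(2)[OF xy] by (intro sum_mono) simp
      finally show "norm ((a x - a y) $ i) \<le> (\<Sum>j\<in>UNIV. L i j * norm (x - y))" .
    qed
    also have "\<dots> = S * norm (x - y)" by (simp add: S_def sum_distrib_right)
    finally show ?thesis .
  qed
  moreover have "S \<ge> 0" unfolding S_def by (intro sum_nonneg L)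
  ultimately show thesis using that by blast
qed

lemma local_constants:
  assumes R: "R > 0"
  obtains Lam B L where
    "\<And>y. norm y \<le> R \<Longrightarrow> spd (a y) lam Lam" "\<And>y. norm y \<le> R \<Longrightarrow> norm (b y) \<le> B"
    "\<And>x y. norm x \<le> R \<Longrightarrow> norm y \<le> R \<Longrightarrow> norm (a x - a y) \<le> L * norm (x - y)"
proof -
  obtain L where L: "L \<ge> 0" "\<And>x y. norm x \<le> R \<Longrightarrow> norm y \<le> R \<Longrightarrow> norm (a x - a y) \<le> L * norm (x - y)"
    using a_lipschitz[OF R] by blast
  show thesis
  proof (rule that[of "K * (1 + R\<^sup>2)" "K * (1 + R)" L])
    fix y :: "real^'d" assume y: "norm y \<le> R"
    have "norm (a y) \<le> K * (1 + (norm y)\<^sup>2)" by (rule a_quad)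
    also have "\<dots> \<le> K * (1 + R\<^sup>2)" using K y by (intro mult_left_mono add_left_mono power_mono) auto
    finally show "spd (a y) lam (K * (1 + R\<^sup>2))"
      by unfold_locales (auto simp: ellipticity sym_a)
    have "norm (b y) \<le> K * (1 + norm y)" by (rule b_lin)
    also have "\<dots> \<le> K * (1 + R)" using K y by (intro mult_left_mono add_left_mono) auto
    finally show "norm (b y) \<le> K * (1 + R)" .
  qed (rule L)
qed

lemma local_elliptic: "\<exists>lam Lam B L. local_elliptic a b x0 lam Lam B L"
proof -
  have x0: "norm x0 + 2 > 0" by (simp add: add_nonneg_pos)
  obtain Lam B L where l:
    "\<And>y. norm y \<le> norm x0 + 2 \<Longrightarrow> spd (a y) lam Lam" "\<And>y. norm y \<le> norm x0 + 2 \<Longrightarrow> norm (b y) \<le> B"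
    "\<And>x y. norm x \<le> norm x0 + 2 \<Longrightarrow> norm y \<le> norm x0 + 2 \<Longrightarrow> norm (a x - a y) \<le> L * norm (x - y)"
    by (rule local_constants[OF x0], rule that)
  have "norm y \<le> norm x0 + 2" if "y \<in> ball x0 2" for y
    using that norm_triangle_sub[of y x0] by (simp add: dist_norm norm_minus_commute)
  then have "local_elliptic a b x0 lam Lam B L"
    using l by unfold_locales (auto simp: cont_a cont_b spd_def)
  then show ?thesis by blast
qed

text \<open>The coefficients are composed with the projection onto the ball. It is 1-Lipschitz and
  maps into the ball, so they become globally bounded and elliptic with a Lipschitz matrix, and they
  are unchanged on the ball. The equation for \<open>b\<close> and \<open>a\<close> thus holds there
  only, while the bound on \<open>u\<close>, coming from the contraction for the truncated operator,
  holds everywhere.\<close>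

lemma global_resolvent:
  assumes R: "R > 0" and l: "l > 0" and f: "vanishes f" and e: "e > 0"
  obtains u where "sm u" "\<And>x. norm x \<le> R \<Longrightarrow> \<bar>f x - (l * u x - gen b a u x)\<bar> \<le> e"
    "\<And>N x. (\<And>x. \<bar>f x\<bar> \<le> N) \<Longrightarrow> l * \<bar>u x\<bar> \<le> N + e"
proof -
  obtain Lam B L where lc:
    "\<And>y. norm y \<le> R \<Longrightarrow> spd (a y) lam Lam" "\<And>y. norm y \<le> R \<Longrightarrow> norm (b y) \<le> B"
    "\<And>x y. norm x \<le> R \<Longrightarrow> norm y \<le> R \<Longrightarrow> norm (a x - a y) \<le> L * norm (x - y)"
    by (rule local_constants[OF R], rule that)
  define \<pi> where "\<pi> = closest_point (cball (0::real^'d) R)"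
  have ne: "cball (0::real^'d) R \<noteq> {}" using R by simp
  have \<pi>: "norm (\<pi> x) \<le> R" for x
    using closest_point_in_set[of "cball 0 R" x] ne unfolding \<pi>_def by simp
  have \<pi>_id: "\<pi> x = x" if "norm x \<le> R" for x
    using that unfolding \<pi>_def by (simp add: closest_point_self)
  have \<pi>_lip: "norm (\<pi> x - \<pi> y) \<le> norm (x - y)" for x y
    using closest_point_lipschitz[of "cball 0 R" x y] ne unfolding \<pi>_def by (simp add: dist_norm)
  have L: "L \<ge> 0"
  proof -
    obtain v :: "real^'d" where v: "norm v = R" using vector_choose_size[of R] R by auto
    have "0 \<le> norm (a v - a 0)" by simp
    also have "\<dots> \<le> L * R" using lc(3)[of v 0] v R by simp
    finally show ?thesis using R by (simp add: zero_le_mult_iff)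
  qed
  define A where "A = (\<lambda>x. a (\<pi> x))"
  define Bb where "Bb = (\<lambda>x. b (\<pi> x))"
  interpret global_elliptic A Bb lam Lam B L
  proof (rule global_elliptic.intro)
    show "norm (A x - A y) \<le> L * norm (x - y)" for x y
      using lc(3)[OF \<pi> \<pi>, of x y] mult_left_mono[OF \<pi>_lip L, of x y] unfolding A_def by linarith
    show "continuous_on UNIV Bb"
      unfolding Bb_def \<pi>_def
      by (intro continuous_on_compose2[OF cont_b] continuous_on_closest_point) (use ne in auto)
  qed (use lc \<pi> in \<open>auto simp: A_def Bb_def\<close>)
  have A\<sigma>: "A x = \<sigma> (\<pi> x) ** transpose (\<sigma> (\<pi> x))" for x by (simp add: A_def a_def)
  obtain u where u: "u \<in> dom0 Bb A" "\<And>x. \<bar>f x - (l * u x - gen Bb A u x)\<bar> \<le> e"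
    using resolvent_dense[OF A\<sigma> l f e] by blast
  show thesis
  proof (rule that[of u])
    show "sm u" using u(1) by (simp add: dom0_def)
    show "\<bar>f x - (l * u x - gen b a u x)\<bar> \<le> e" if "norm x \<le> R" for x
      using u(2)[of x] \<pi>_id[OF that] by (simp add: gen_def A_def Bb_def)
    show "l * \<bar>u x\<bar> \<le> N + e" if N: "\<And>x. \<bar>f x\<bar> \<le> N" for N x
    proof (rule resolvent_contraction[OF A\<sigma> u(1) l])
      show "\<bar>l * u x - gen Bb A u x\<bar> \<le> N + e" for x
        using u(2)[of x] N[of x] by linarith
    qed
  qed
qed

definition Cl where "Cl = K * (4 + norm (mat 1 :: real^'d^'d))"

lemma Cl_pos: "Cl > 0" unfolding Cl_def using K by (simp add: add_pos_nonneg)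

text \<open>The test function \<open>ramp \<kappa> (U - \<delta> lyap)\<close> has compact support although \<open>U\<close> has not; convexity of
  \<open>ramp\<close> makes it a subsolution up to small errors. Only the values of the equation for \<open>U\<close> on
  \<open>norm x \<le> R\<close> enter.\<close>

lemma laplace_lower_bound:
  assumes T: "T > 0" and fp: "fokker_planck T b a m" and l: "l > 0"
    and g: "continuous_on UNIV g" "\<And>x. 0 \<le> g x" "\<And>x. g x \<le> F"
    and gm: "continuous_on {0..T} (\<lambda>s. \<integral>x. g x \<partial>m s)"
    and U: "sm U" "\<And>x. \<bar>U x\<bar> \<le> Um" and Um: "Um > 0"
    and \<delta>: "\<delta> > 0" and \<kappa>: "\<kappa> > 0" and e: "e \<ge> 0"
    and R: "\<And>x::real^'d. norm x \<ge> R \<Longrightarrow> lyap x > Um / \<delta>"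
    and eq: "\<And>x. norm x \<le> R \<Longrightarrow> \<bar>g x - (l * U x - gen b a U x)\<bar> \<le> e"
  shows "integral {0..T} (\<lambda>s. exp (- (l * s)) * (\<integral>x. g x \<partial>m s)) \<ge>
    (\<integral>x. U x \<partial>m 0) - (\<integral>x. min (\<delta> * lyap x) Um \<partial>m 0) - \<kappa> - exp (- (l * T)) * Um - (e + \<delta> * Cl) / l"
proof -
  have m: "prob_space (m s)" "sets (m s) = sets borel" if "s \<in> {0..T}" for s
    using fp that by (auto simp: fokker_planck_def)
  define v where "v x = U x - \<delta> * lyap x" for x
  define w where "w x = ramp \<kappa> (v x)" for x
  have sm_v: "sm v" unfolding v_def by (intro sm_diff sm_cmult sm_lyap U)
  have sm_w: "sm w" unfolding w_def by (rule sm_ramp[OF sm_v])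
  have v_le: "v x \<le> Um" for x
    using U(2)[of x] mult_nonneg_nonneg[OF less_imp_le[OF \<delta>] lyap_nonneg[of x]] unfolding v_def by linarith
  have v_neg: "v x \<le> 0" if "norm x \<ge> R" for x
  proof -
    have "Um < \<delta> * lyap x" using R[OF that] \<delta> by (simp add: pos_divide_less_eq mult.commute)
    then show ?thesis using U(2)[of x] unfolding v_def by linarith
  qed
  have "bounded {x. w x \<noteq> 0}"
    unfolding bounded_iff
  proof (intro exI ballI)
    fix x assume "x \<in> {x. w x \<noteq> 0}"
    then show "norm x \<le> R" using v_neg[of x] ramp_props(1)[OF \<kappa>, of "v x"] by (force simp: w_def)
  qed
  then have w: "smooth_cs w" by (simp add: smooth_cs_iff sm_imp_smooth sm_w)
  have pointwise: "gen b a w x - l * w x \<ge> - (g x + (e + \<delta> * Cl))" for x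
  proof -
    let ?\<Phi>1 = "ramp1 \<kappa> (v x)"
    have err: "0 \<le> e + \<delta> * Cl" using e \<delta> Cl_pos by simp
    have gw: "gen b a w x = ?\<Phi>1 * gen b a v x + 1/2 * (flatf [:0, 0, 0, 1:] (v x / \<kappa>) / \<kappa>) * ((\<chi> i. pd i v x) \<bullet> (a x *v (\<chi> i. pd i v x)))"
      unfolding w_def by (rule gen_comp[OF sm_imp_smooth[OF sm_v] ramp_derivs[OF \<kappa>]])
    have "0 \<le> 1/2 * (flatf [:0, 0, 0, 1:] (v x / \<kappa>) / \<kappa>) * ((\<chi> i. pd i v x) \<bullet> (a x *v (\<chi> i. pd i v x)))"
      by (intro mult_nonneg_nonneg psd ramp_props(8)[OF \<kappa>]) simp
    then have gw_ge: "gen b a w x \<ge> ?\<Phi>1 * gen b a v x" unfolding gw by linarith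
    show ?thesis
    proof (cases "v x \<le> 0")
      case True
      then have "w x = 0" "?\<Phi>1 = 0" unfolding w_def using ramp_props(1,2)[OF \<kappa>] by auto
      then show ?thesis using gw_ge g(2)[of x] err by simp
    next
      case False
      then have xR: "norm x \<le> R" using v_neg[of x] by linarith
      have sU: "smooth U" "smooth lyap" using U(1) sm_lyap sm_imp_smooth by blast+
      have sl: "smooth (\<lambda>x. - \<delta> * lyap x)" by (intro sm_imp_smooth sm_cmult sm_lyap)
      have "v = (\<lambda>x. U x + - \<delta> * lyap x)" by (simp add: v_def fun_eq_iff)
      then have "gen b a v x = gen b a U x + gen b a (\<lambda>x. - \<delta> * lyap x) x"
        by (simp only: gen_add[OF sU(1) sl])
      also have "\<dots> = gen b a U x - \<delta> * gen b a lyap x"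
        by (simp only: gen_cmult[OF sU(2)])
      finally have "gen b a v x = gen b a U x - \<delta> * gen b a lyap x" .
      moreover have "\<delta> * gen b a lyap x \<le> \<delta> * Cl"
        unfolding Cl_def by (intro mult_left_mono gen_lyap_le K b_lin a_quad psd) (use \<delta> in simp)
      ultimately have gv: "gen b a v x \<ge> gen b a U x - \<delta> * Cl" by linarith
      \<comment> \<open>Convexity together with \<open>ramp \<kappa> 0 = 0\<close> gives
        \<open>ramp \<kappa> y <= y * ramp1 \<kappa> y\<close>. The zeroth-order term then carries
        the same factor \<open>ramp1\<close> as the generator term, so the equation for
        \<open>U\<close> can be inserted.\<close>
      have "l * w x \<le> l * (v x * ?\<Phi>1)"
        unfolding w_def using l by (intro mult_left_mono ramp_props(6)[OF \<kappa>]) simp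
      also have "\<dots> \<le> l * (U x * ?\<Phi>1)"
      proof -
        have "v x \<le> U x" using \<delta> lyap_nonneg[of x] by (simp add: v_def)
        then show ?thesis using l ramp_props(3)[OF \<kappa>, of "v x"] by (intro mult_left_mono mult_right_mono) auto
      qed
      finally have "gen b a w x - l * w x \<ge> ?\<Phi>1 * (gen b a U x - \<delta> * Cl) - l * (U x * ?\<Phi>1)"
        using gw_ge mult_left_mono[OF gv ramp_props(3)[OF \<kappa>, of "v x"]] by linarith
      also have "?\<Phi>1 * (gen b a U x - \<delta> * Cl) - l * (U x * ?\<Phi>1) = ?\<Phi>1 * (gen b a U x - l * U x - \<delta> * Cl)"
        by (simp add: algebra_simps)
      also have "\<dots> \<ge> ?\<Phi>1 * (- (g x + (e + \<delta> * Cl)))"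
        using eq[OF xR] ramp_props(3)[OF \<kappa>, of "v x"] by (intro mult_left_mono) linarith+
      finally have 1: "gen b a w x - l * w x \<ge> ?\<Phi>1 * (- (g x + (e + \<delta> * Cl)))" .
      have "?\<Phi>1 * (g x + (e + \<delta> * Cl)) \<le> 1 * (g x + (e + \<delta> * Cl))"
        using ramp_props(4)[OF \<kappa>, of "v x"] g(2)[of x] err by (intro mult_right_mono) auto
      then show ?thesis using 1 unfolding mult_minus_right mult_1_left by linarith
    qed
  qed
  obtain Cg where Cg: "\<And>x. \<bar>gen b a w x\<bar> \<le> Cg" using gen_bounded[OF cont_a cont_b w] by blast
  have wb: "0 \<le> w x" "w x \<le> Um" for x
  proof -
    show "0 \<le> w x" unfolding w_def by (rule ramp_props(5)[OF \<kappa>])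
    show "w x \<le> Um"
    proof (cases "v x \<le> 0")
      case True
      then show ?thesis using ramp_props(1)[OF \<kappa>, of "v x"] Um by (simp add: w_def)
    next
      case False
      then show ?thesis using ramp_props(9)[OF \<kappa>, of "v x"] v_le[of x] by (simp add: w_def)
    qed
  qed
  have int: "integrable (m s) h" if s: "s \<in> {0..T}" and h: "continuous_on UNIV h" "\<And>x. \<bar>h x\<bar> \<le> c" for s c and h :: "real^'d \<Rightarrow> real"
  proof -
    interpret prob_space "m s" by (rule m[OF s])
    have "h \<in> borel_measurable (m s)"
      using borel_measurable_continuous_onI[OF h(1)] measurable_cong_sets[OF m(2)[OF s] refl] by blast
    then show ?thesis by (intro integrable_const_bound[where B = c]) (use h in auto)
  qed
  have cont_w: "continuous_on UNIV w" by (rule smooth_continuous[OF sm_imp_smooth[OF sm_w]])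
  have cont_gw: "continuous_on UNIV (gen b a w)"
    by (rule gen_continuous[OF cont_a cont_b sm_imp_smooth[OF sm_w]])
  \<comment> \<open>The discounted expectation of the subsolution; integrating its derivative over
    \<open>{0..T}\<close> relates the transform of \<open>g\<close> to the values at both
    ends.\<close>
  define y where "y s = exp (- (l * s)) * (\<integral>x. w x \<partial>m s)" for s
  define y' where "y' s = exp (- (l * s)) * ((\<integral>x. gen b a w x \<partial>m s) - l * (\<integral>x. w x \<partial>m s))" for s
  have y: "(y has_real_derivative y' s) (at s within {0..T})" if "s \<in> {0..T}" for s
  proof -
    have "((\<lambda>s. \<integral>x. w x \<partial>m s) has_real_derivative (\<integral>x. gen b a w x \<partial>m s)) (at s within {0..T})"
      using fp w that by (simp add: fokker_planck_def)
    then show ?thesis unfolding y_def y'_def by (auto intro!: derivative_eq_intros simp: algebra_simps)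
  qed
  have "(y' has_integral (y T - y 0)) {0..T}"
    by (rule fundamental_theorem_of_calculus)
      (use T y in \<open>auto simp: has_real_derivative_iff_has_vector_derivative[symmetric]\<close>)
  moreover define I where "I = integral {0..T} (\<lambda>s. exp (- (l * s)) * (\<integral>x. g x \<partial>m s))"
  have "((\<lambda>s. - (exp (- (l * s)) * (\<integral>x. g x \<partial>m s)) - (e + \<delta> * Cl) * exp (- (l * s))) has_integral
      (- I - (e + \<delta> * Cl) * ((1 - exp (- (l * T))) / l))) {0..T}"
  proof (intro has_integral_diff has_integral_neg has_integral_mult_right)
    show "((\<lambda>s. exp (- (l * s)) * (\<integral>x. g x \<partial>m s)) has_integral I) {0..T}"
      unfolding I_def by (intro integrable_integral integrable_continuous_interval continuous_intros gm)
    have "((\<lambda>s. exp (- (l * s))) has_integral (- exp (- (l * T)) / l) - (- exp (- (l * 0)) / l)) {0..T}"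
      by (rule fundamental_theorem_of_calculus)
        (use T l in \<open>auto intro!: derivative_eq_intros simp: has_real_derivative_iff_has_vector_derivative[symmetric]\<close>)
    then show "((\<lambda>s. exp (- (l * s))) has_integral (1 - exp (- (l * T))) / l) {0..T}"
      by (simp add: diff_divide_distrib)
  qed
  moreover have "- (exp (- (l * s)) * (\<integral>x. g x \<partial>m s)) - (e + \<delta> * Cl) * exp (- (l * s)) \<le> y' s" if s: "s \<in> {0..T}" for s
  proof -
    interpret prob_space "m s" by (rule m[OF s])
    have ig: "integrable (m s) g" by (rule int[OF s g(1), of F]) (simp add: g abs_of_nonneg)
    have iw: "integrable (m s) w" by (rule int[OF s cont_w, of Um]) (use wb in \<open>simp add: abs_of_nonneg\<close>)
    have igw: "integrable (m s) (gen b a w)" by (rule int[OF s cont_gw Cg])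
    have "(\<integral>x. - (g x + (e + \<delta> * Cl)) \<partial>m s) \<le> (\<integral>x. gen b a w x - l * w x \<partial>m s)"
      using ig iw igw pointwise by (intro integral_mono) auto
    then have "- ((\<integral>x. g x \<partial>m s) + (e + \<delta> * Cl)) \<le> (\<integral>x. gen b a w x \<partial>m s) - l * (\<integral>x. w x \<partial>m s)"
      using ig iw igw by (simp add: prob_space)
    from mult_left_mono[OF this, of "exp (- (l * s))"]
    show ?thesis by (simp add: y'_def algebra_simps)
  qed
  ultimately have "- I - (e + \<delta> * Cl) * ((1 - exp (- (l * T))) / l) \<le> y T - y 0"
    using has_integral_le by blast
  moreover have "(e + \<delta> * Cl) * ((1 - exp (- (l * T))) / l) \<le> (e + \<delta> * Cl) / l"
  proof -
    have "(e + \<delta> * Cl) * ((1 - exp (- (l * T))) / l) \<le> (e + \<delta> * Cl) * (1 / l)"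
      using l e \<delta> Cl_pos by (intro mult_left_mono divide_right_mono) auto
    then show ?thesis by simp
  qed
  moreover have "y T \<le> exp (- (l * T)) * Um"
  proof -
    have sT: "T \<in> {0..T}" using T by simp
    interpret prob_space "m T" by (rule m[OF sT])
    have "(\<integral>x. w x \<partial>m T) \<le> (\<integral>x. Um \<partial>m T)"
      by (intro integral_mono int[OF sT cont_w, of Um]) (use wb in \<open>auto simp: abs_of_nonneg\<close>)
    then show ?thesis by (simp add: y_def prob_space)
  qed
  \<comment> \<open>If \<open>\<delta> * lyap x\<close> exceeds \<open>Um\<close>, the left side of
    the pointwise bound is negative and \<open>w >= 0\<close> suffices. The cap \<open>Um\<close>
    makes the Lyapunov function integrable whatever the tails of the initial law.\<close>
  moreover have "y 0 \<ge> (\<integral>x. U x \<partial>m 0) - (\<integral>x. min (\<delta> * lyap x) Um \<partial>m 0) - \<kappa>"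
  proof -
    have s0: "0 \<in> {0..T}" using T by simp
    interpret prob_space "m 0" by (rule m[OF s0])
    have iU: "integrable (m 0) U"
      by (rule int[OF s0 smooth_continuous[OF sm_imp_smooth[OF U(1)]] U(2)])
    have iM: "integrable (m 0) (\<lambda>x. min (\<delta> * lyap x) Um)"
    proof (rule int[OF s0, of _ Um])
      show "continuous_on UNIV (\<lambda>x. min (\<delta> * lyap x) Um)"
        by (intro continuous_intros smooth_continuous[OF sm_imp_smooth[OF sm_lyap]])
      show "\<bar>min (\<delta> * lyap x) Um\<bar> \<le> Um" for x
        using mult_nonneg_nonneg[OF less_imp_le[OF \<delta>] lyap_nonneg[of x]] Um by (simp add: min_def)
    qed
    have iw: "integrable (m 0) w" by (rule int[OF s0 cont_w, of Um]) (use wb in \<open>simp add: abs_of_nonneg\<close>)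
    have "(\<integral>x. U x - min (\<delta> * lyap x) Um - \<kappa> \<partial>m 0) \<le> (\<integral>x. w x \<partial>m 0)"
    proof (rule integral_mono)
      show "U x - min (\<delta> * lyap x) Um - \<kappa> \<le> w x" for x
        using ramp_props(7)[OF \<kappa>, of "v x"] wb(1)[of x] U(2)[of x] \<kappa> unfolding w_def v_def
        by (simp add: min_def abs_le_iff)
    qed (use iU iM iw in auto)
    then show ?thesis using iU iM by (simp add: y_def prob_space)
  qed
  ultimately show ?thesis unfolding I_def by linarith
qed

end

section \<open>Comparison of two solutions with the same initial law\<close>

context regular_diffusion
begin

text \<open>The lower bound, applied to \<open>f\<close> with the approximate solution
  \<open>u\<close> and to \<open>1 - f\<close> with \<open>1 / l - u\<close>, encloses the transform
  of every solution around the integral of \<open>u\<close> against the initial law. Two solutions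
  thus have transforms that differ by at most \<open>6 * exp (- (l * T))\<close>, which the
  truncated inversion turns into equality.\<close>

lemma fokker_planck_unique:
  assumes T: "T > 0" and fp: "fokker_planck T b a m" "fokker_planck T b a m'" and init: "m 0 = m' 0"
    and t: "t \<in> {0..T}"
  shows "m t = m' t"
proof -
  have m: "prob_space (m s)" "sets (m s) = sets borel" "prob_space (m' s)" "sets (m' s) = sets borel"
    if "s \<in> {0..T}" for s
    using fp that by (auto simp: fokker_planck_def)
  have s0: "0 \<in> {0..T}" using T by simp
  show ?thesis
  proof (rule measure_eqI_smooth_cs)
    show "finite_measure (m t)" "finite_measure (m' t)"
      using m[OF t] by (auto intro: prob_space.finite_measure)
    show "sets (m t) = sets borel" "sets (m' t) = sets borel" using m[OF t] by auto
    fix f :: "real^'d \<Rightarrow> real" assume f: "smooth_cs f" "\<And>x. 0 \<le> f x" "\<And>x. f x \<le> 1"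
    have contf: "continuous_on UNIV f" using f by (simp add: smooth_cs_iff smooth_continuous)
    have vf: "vanishes f" using f contf by (intro bounded_support_vanishes) (auto simp: smooth_cs_iff)
    have cont: "continuous_on {0..T} (\<lambda>s. \<integral>x. f x \<partial>q s)" if "fokker_planck T b a q" for q
    proof (rule DERIV_continuous_on)
      show "((\<lambda>s. \<integral>x. f x \<partial>q s) has_real_derivative (\<integral>x. gen b a f x \<partial>q s)) (at s within {0..T})"
        if "s \<in> {0..T}" for s
        using \<open>fokker_planck T b a q\<close> that f(1) by (simp add: fokker_planck_def)
    qed
    define \<phi> where "\<phi> s = (\<integral>x. f x \<partial>m s) - (\<integral>x. f x \<partial>m' s)" for s
    have "\<phi> t = 0"
    proof (rule truncated_laplace_unique[OF T _ _ t])
      show "continuous_on {0..T} \<phi>" unfolding \<phi>_def by (intro continuous_intros cont fp)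
      fix n :: nat assume n: "n \<ge> 1"
      define l where "l = real n"
      have l: "l \<ge> 1" using n by (simp add: l_def)
      define I where "I q = integral {0..T} (\<lambda>s. exp (- (l * s)) * (\<integral>x. f x \<partial>q s))" for q :: "real \<Rightarrow> (real^'d) measure"
      have I_diff: "integral {0..T} (\<lambda>s. exp (- (l * s)) * \<phi> s) = I m - I m'"
        unfolding I_def \<phi>_def right_diff_distrib
        by (intro integral_diff integrable_continuous_interval continuous_intros cont fp)
      \<comment> \<open>Bounds both test functions: \<open>u\<close> by \<open>2 / l\<close>, and
        \<open>1 / l - u\<close> by \<open>1 / l + 2 / l\<close>.\<close>
      define Um where "Um = 3 / l"
      have Um: "Um > 0" "Um \<le> 3" using l by (auto simp: Um_def field_simps)
      have main: "\<bar>I m - I m'\<bar> \<le> 6 * exp (- (l * T)) + e" if e: "e > 0" for e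
      proof -
        \<comment> \<open>Each one-sided estimate loses \<open>4 * e'\<close>: one for the Lyapunov
          integral, one for \<open>\<kappa>\<close>, two for the residuals. Both sides together lose
          \<open>8 * e'\<close>.\<close>
        define e' where "e' = min 1 (e / 10)"
        have e': "e' > 0" "e' \<le> 1" "10 * e' \<le> e" using e by (auto simp: e'_def)
        \<comment> \<open>The capped functions are dominated by \<open>Um\<close> and tend to 0
          pointwise along \<open>\<delta> = 1 / k\<close>.\<close>
        obtain \<delta> where \<delta>: "\<delta> > 0" "\<delta> * Cl \<le> e'" "(\<integral>x. min (\<delta> * lyap x) Um \<partial>m 0) \<le> e'"
        proof -
          interpret prob_space "m 0" by (rule m[OF s0])
          have [measurable]: "(lyap :: real^'d \<Rightarrow> real) \<in> borel_measurable (m 0)"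
            using borel_measurable_continuous_onI[OF smooth_continuous[OF sm_imp_smooth[OF sm_lyap]]]
              measurable_cong_sets[OF m(2)[OF s0] refl] by blast
          have "(\<lambda>k. \<integral>x. min (1 / real k * lyap x) Um \<partial>m 0) \<longlonglongrightarrow> (\<integral>x. 0 \<partial>m 0)"
          proof (rule integral_dominated_convergence[where w = "\<lambda>_. Um"])
            show "AE x in m 0. norm (min (1 / real k * lyap x) Um) \<le> Um" for k
              using Um by (intro AE_I2) (auto simp: min_def lyap_nonneg)
            show "AE x in m 0. (\<lambda>k. min (1 / real k * lyap x) Um) \<longlonglongrightarrow> 0"
            proof (rule AE_I2)
              fix x
              have "(\<lambda>k. min (1 / real k * lyap x) Um) \<longlonglongrightarrow> min (0 * lyap x) Um"
                by (intro tendsto_intros lim_const_over_n)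
              then show "(\<lambda>k. min (1 / real k * lyap x) Um) \<longlonglongrightarrow> 0" using Um by simp
            qed
          qed auto
          then have "(\<lambda>k. \<integral>x. min (1 / real k * lyap x) Um \<partial>m 0) \<longlonglongrightarrow> 0" by simp
          from order_tendstoD(2)[OF this e'(1)]
          have ev1: "\<forall>\<^sub>F k in sequentially. (\<integral>x. min (1 / real k * lyap x) Um \<partial>m 0) < e'" .
          have "(\<lambda>k. Cl / real k) \<longlonglongrightarrow> 0" by (rule lim_const_over_n)
          from order_tendstoD(2)[OF this e'(1)]
          have ev2: "\<forall>\<^sub>F k in sequentially. Cl / real k < e'" .
          obtain k :: nat where "k > 0" "(\<integral>x. min (1 / real k * lyap x) Um \<partial>m 0) < e'" "Cl / real k < e'"
            using eventually_happens[OF eventually_conj[OF eventually_gt_at_top[of 0] eventually_conj[OF ev1 ev2]]] by auto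
          then show thesis using that[of "1 / real k"] by simp
        qed
        obtain R where R: "R > 0" "\<And>x::real^'d. norm x \<ge> R \<Longrightarrow> lyap x > Um / \<delta>"
          by (rule lyap_large, rule that)
        obtain u where u: "sm u" "\<And>x. norm x \<le> R \<Longrightarrow> \<bar>f x - (l * u x - gen b a u x)\<bar> \<le> e'"
          "\<And>N x. (\<And>x. \<bar>f x\<bar> \<le> N) \<Longrightarrow> l * \<bar>u x\<bar> \<le> N + e'"
          using global_resolvent[OF R(1) _ vf e'(1), of l] l by auto
        have ub: "\<bar>u x\<bar> \<le> 2 / l" for x
        proof -
          have "l * \<bar>u x\<bar> \<le> 1 + e'" by (rule u(3)) (use f in \<open>simp add: abs_of_nonneg\<close>)
          then have "l * \<bar>u x\<bar> \<le> 2" using e' by linarith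
          then show ?thesis using l by (simp add: field_simps)
        qed
        define J where "J = (\<integral>x. u x \<partial>m 0)"
        have err: "(e' + \<delta> * Cl) / l \<le> 2 * e'"
        proof -
          have "(e' + \<delta> * Cl) / l \<le> (2 * e') / 1" using \<delta> e' l Cl_pos by (intro frac_le) auto
          then show ?thesis by simp
        qed
        have expUm: "exp (- (l * T)) * Um \<le> 3 * exp (- (l * T))" using Um by simp
        have two_sided: "I q \<ge> J - 4 * e' - 3 * exp (- (l * T))" "I q \<le> J + 4 * e' + 3 * exp (- (l * T))"
          if q: "fokker_planck T b a q" and q0: "q 0 = m 0" for q
        proof -
          have "I q \<ge> (\<integral>x. u x \<partial>q 0) - (\<integral>x. min (\<delta> * lyap x) Um \<partial>q 0) - e' - exp (- (l * T)) * Um - (e' + \<delta> * Cl) / l"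
            unfolding I_def
          proof (rule laplace_lower_bound[OF T q _ contf f(2,3) cont[OF q] u(1) _ Um(1) \<delta>(1) e'(1) _ R(2) u(2)])
            show "\<bar>u x\<bar> \<le> Um" for x by (rule order_trans[OF ub]) (use l in \<open>simp add: Um_def divide_right_mono\<close>)
          qed (use l e' in auto)
          then show "I q \<ge> J - 4 * e' - 3 * exp (- (l * T))"
            using \<delta>(3) err expUm unfolding q0 J_def[symmetric] by linarith
          have qs: "prob_space (q s)" "sets (q s) = sets borel" if "s \<in> {0..T}" for s
            using q that by (auto simp: fokker_planck_def)
          have intf: "integrable (q s) h" if s: "s \<in> {0..T}" and h: "continuous_on UNIV h" "\<And>x. \<bar>h x\<bar> \<le> c" for s c and h :: "real^'d \<Rightarrow> real"
          proof -
            interpret prob_space "q s" by (rule qs[OF s])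
            have "h \<in> borel_measurable (q s)"
              using borel_measurable_continuous_onI[OF h(1)] measurable_cong_sets[OF qs(2)[OF s] refl] by blast
            then show ?thesis by (intro integrable_const_bound[where B = c]) (use h in auto)
          qed
          have one: "(\<integral>x. 1 - f x \<partial>q s) = 1 - (\<integral>x. f x \<partial>q s)" if s: "s \<in> {0..T}" for s
          proof -
            interpret prob_space "q s" by (rule qs[OF s])
            have "integrable (q s) f" by (rule intf[OF s contf, of 1]) (simp add: f abs_of_nonneg)
            then show ?thesis by (simp add: prob_space)
          qed
          have oneu: "(\<integral>x. 1 / l - u x \<partial>q 0) = 1 / l - (\<integral>x. u x \<partial>q 0)"
          proof -
            interpret prob_space "q 0" by (rule qs[OF s0])
            have "integrable (q 0) u" by (rule intf[OF s0 smooth_continuous[OF sm_imp_smooth[OF u(1)]] ub])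
            then show ?thesis by (simp add: prob_space)
          qed
          have su: "smooth u" by (rule sm_imp_smooth[OF u(1)])
          have sc: "smooth (\<lambda>x::real^'d. 1 / l)" "smooth (\<lambda>x. -1 * u x)"
            by (intro sm_imp_smooth sm.const sm_cmult u(1))+
          have gu: "gen b a (\<lambda>x. 1 / l - u x) x = - gen b a u x" for x
          proof -
            have "(\<lambda>x. 1 / l - u x) = (\<lambda>x. 1 / l + -1 * u x)" by simp
            moreover have "gen b a (\<lambda>x. 1 / l + -1 * u x) x = gen b a (\<lambda>x. 1 / l) x + gen b a (\<lambda>x. -1 * u x) x"
              by (rule gen_add[OF sc])
            moreover have "gen b a (\<lambda>x. 1 / l) x = 0" by (simp add: gen_def pd_const)
            moreover have "gen b a (\<lambda>x. -1 * u x) x = -1 * gen b a u x" by (rule gen_cmult[OF su])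
            ultimately show ?thesis by simp
          qed
          have "integral {0..T} (\<lambda>s. exp (- (l * s)) * (\<integral>x. 1 - f x \<partial>q s)) \<ge>
              (\<integral>x. 1 / l - u x \<partial>q 0) - (\<integral>x. min (\<delta> * lyap x) Um \<partial>q 0) - e' - exp (- (l * T)) * Um - (e' + \<delta> * Cl) / l"
          proof (rule laplace_lower_bound[OF T q _ _ _ _ _ _ _ Um(1) \<delta>(1) e'(1) _ R(2)])
            show "continuous_on UNIV (\<lambda>x. 1 - f x)" by (intro continuous_intros contf)
            show "0 \<le> 1 - f x" "1 - f x \<le> 1" for x using f(2,3)[of x] by auto
            show "continuous_on {0..T} (\<lambda>s. \<integral>x. 1 - f x \<partial>q s)"
              by (rule continuous_on_eq[OF continuous_on_diff[OF continuous_on_const cont[OF q]]]) (simp add: one)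
            show "sm (\<lambda>x. 1 / l - u x)" by (intro sm_diff sm.const u(1))
            show "\<bar>1 / l - u x\<bar> \<le> Um" for x
            proof -
              have "\<bar>1 / l - u x\<bar> \<le> 1 / l + 2 / l" using ub[of x] l by (simp add: abs_le_iff)
              also have "\<dots> = Um" by (simp add: Um_def add_divide_distrib[symmetric])
              finally show ?thesis .
            qed
            show "\<bar>1 - f x - (l * (1 / l - u x) - gen b a (\<lambda>x. 1 / l - u x) x)\<bar> \<le> e'" if "norm x \<le> R" for x
            proof -
              have "1 - f x - (l * (1 / l - u x) - gen b a (\<lambda>x. 1 / l - u x) x) = - (f x - (l * u x - gen b a u x))"
                unfolding gu using l by (simp add: algebra_simps)
              then show ?thesis using u(2)[OF that] by (simp only: abs_minus_cancel)
            qed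
          qed (use l e' in auto)
          moreover have "integral {0..T} (\<lambda>s. exp (- (l * s)) * (\<integral>x. 1 - f x \<partial>q s)) = (1 - exp (- (l * T))) / l - I q"
          proof -
            have E: "((\<lambda>s. exp (- (l * s))) has_integral (1 - exp (- (l * T))) / l) {0..T}"
            proof -
              have "((\<lambda>s. exp (- (l * s))) has_integral (- exp (- (l * T)) / l) - (- exp (- (l * 0)) / l)) {0..T}"
                by (rule fundamental_theorem_of_calculus)
                  (use T l in \<open>auto intro!: derivative_eq_intros simp: has_real_derivative_iff_has_vector_derivative[symmetric]\<close>)
              then show ?thesis by (simp add: diff_divide_distrib)
            qed
            have "integral {0..T} (\<lambda>s. exp (- (l * s)) * (\<integral>x. 1 - f x \<partial>q s)) =
                integral {0..T} (\<lambda>s. exp (- (l * s)) - exp (- (l * s)) * (\<integral>x. f x \<partial>q s))"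
              by (intro integral_cong) (simp add: one right_diff_distrib)
            also have "\<dots> = integral {0..T} (\<lambda>s. exp (- (l * s))) - I q"
              unfolding I_def by (intro integral_diff integrable_continuous_interval continuous_intros cont q)
            finally show ?thesis using E by (simp add: integral_unique)
          qed
          moreover have "(1 - exp (- (l * T))) / l \<le> 1 / l" using l by (intro divide_right_mono) auto
          ultimately show "I q \<le> J + 4 * e' + 3 * exp (- (l * T))"
            using \<delta>(3) err expUm unfolding oneu unfolding q0 J_def[symmetric] by linarith
        qed
        show ?thesis
          using two_sided[OF fp(1) refl] two_sided[OF fp(2) init[symmetric]] e' by linarith
      qed
      have "\<bar>I m - I m'\<bar> \<le> 6 * exp (- (l * T))" by (rule field_le_epsilon) (rule main)
      then show "\<bar>integral {0..T} (\<lambda>s. exp (- (real n * s)) * \<phi> s)\<bar> \<le> 6 * exp (- (real n * T))"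
        using I_diff by (simp add: l_def)
    qed
    then show "(\<integral>x. f x \<partial>m t) = (\<integral>x. f x \<partial>m' t)" by (simp add: \<phi>_def)
  qed
qed

end

section \<open>Functions that are constant along the process\<close>

text \<open>The constant is the supremum of the levels that \<open>g\<close> exceeds almost
  everywhere. As \<open>g\<close> is real-valued and the space is not a null set, this set of levels
  is nonempty and bounded above.\<close>

lemma AE_constant:
  fixes g :: "real^'d::finite \<Rightarrow> real"
  assumes dich: "\<And>c. (AE x in lborel. g x > c) \<or> (AE x in lborel. g x \<le> c)"
  shows "\<exists>c. AE x in lborel. g x = c"
proof -
  have nontriv: "\<not> (AE x in (lborel :: (real^'d) measure). False)"
  proof
    assume "AE x in (lborel :: (real^'d) measure). False"
    then have "emeasure lborel (UNIV :: (real^'d) set) = 0"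
      by (subst (asm) AE_iff_measurable[of UNIV]) auto
    then show False by simp
  qed
  define S where "S = {c. AE x in lborel. g x > c}"
  have ne: "S \<noteq> {}"
  proof
    assume "S = {}"
    then have "AE x in lborel. g x \<le> - real n" for n using dich[of "- real n"] by (auto simp: S_def)
    then have "AE x in lborel. \<forall>n. g x \<le> - real n" by (simp add: AE_all_countable)
    then have "AE x in (lborel :: (real^'d) measure). False"
    proof eventually_elim
      case (elim x)
      obtain n where "- g x < real n" using reals_Archimedean2 by blast
      then show ?case using elim by (metis less_minus_iff linorder_not_le neg_less_iff_less)
    qed
    then show False using nontriv by blast
  qed
  have bdd: "bdd_above S"
  proof (rule ccontr)
    assume nb: "\<not> bdd_above S"
    have "AE x in lborel. g x > real n" for n
    proof -
      obtain c where c: "c \<in> S" "c > real n" using nb unfolding bdd_above_def by (metis linorder_not_le)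
      from c(1) have "AE x in lborel. g x > c" by (simp add: S_def)
      then show ?thesis by eventually_elim (use c in linarith)
    qed
    then have "AE x in lborel. \<forall>n. g x > real n" by (simp add: AE_all_countable)
    then have "AE x in (lborel :: (real^'d) measure). False"
    proof eventually_elim
      case (elim x)
      obtain n where "g x < real n" using reals_Archimedean2 by blast
      then show ?case using elim by (metis less_asym)
    qed
    then show False using nontriv by blast
  qed
  have Sup: "c \<in> S \<Longrightarrow> c \<le> Sup S" "e > 0 \<Longrightarrow> \<exists>c\<in>S. c > Sup S - e" for c e
    using cSup_upper[OF _ bdd, of c] less_cSup_iff[OF ne bdd, of "Sup S - e"] by auto
  have lo: "AE x in lborel. g x > Sup S - 1 / real (Suc n)" for n
  proof -
    obtain c where c: "c \<in> S" "c > Sup S - 1 / real (Suc n)" using Sup(2)[of "1 / real (Suc n)"] by auto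
    from c(1) have "AE x in lborel. g x > c" by (simp add: S_def)
    then show ?thesis by eventually_elim (use c in linarith)
  qed
  have hi: "AE x in lborel. g x \<le> Sup S + 1 / real (Suc n)" for n
  proof -
    have "Sup S + 1 / real (Suc n) \<notin> S" using Sup(1)[of "Sup S + 1 / real (Suc n)"] by auto
    then show ?thesis using dich by (auto simp: S_def)
  qed
  have "AE x in lborel. \<forall>n. g x > Sup S - 1 / real (Suc n) \<and> g x \<le> Sup S + 1 / real (Suc n)"
    using lo hi by (simp add: AE_all_countable)
  then have "AE x in lborel. g x = Sup S"
  proof eventually_elim
    case (elim x)
    have "g x \<ge> Sup S" by (rule field_le_epsilon) (metis elim less_eq_real_def nat_approx_posE diff_le_eq order_trans add_left_mono)
    moreover have "g x \<le> Sup S" by (rule field_le_epsilon) (metis elim less_eq_real_def nat_approx_posE order_trans add_left_mono)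
    ultimately show ?case by simp
  qed
  then show ?thesis by blast
qed

text \<open>The strictly convex function \<open>sqrt (1 + y\<^sup>2)\<close> has a bounded derivative, which may therefore be
  tested against random variables that are merely integrable.\<close>

lemma sqrt_convex_gap:
  fixes y z :: real
  defines "gap \<equiv> sqrt (1 + y\<^sup>2) - sqrt (1 + z\<^sup>2) - z / sqrt (1 + z\<^sup>2) * (y - z)"
  shows "0 \<le> gap" "gap = 0 \<Longrightarrow> y = z"
proof -
  have pos: "sqrt (1 + z\<^sup>2) > 0" "sqrt (1 + y\<^sup>2) > 0" by (simp_all add: add_pos_nonneg)
  have sq: "sqrt (1 + z\<^sup>2) * sqrt (1 + z\<^sup>2) = 1 + z\<^sup>2" by simp
  define P where "P = sqrt (1 + y\<^sup>2) * sqrt (1 + z\<^sup>2)"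
  \<comment> \<open>The two-square identity: it shows \<open>1 + y * z <= P\<close> and identifies
    the case of equality.\<close>
  have P2: "P\<^sup>2 = (1 + y * z)\<^sup>2 + (y - z)\<^sup>2"
    unfolding P_def power_mult_distrib by (simp add: power2_eq_square algebra_simps)
  have P0: "P > 0" unfolding P_def using pos by simp
  have gap: "gap * sqrt (1 + z\<^sup>2) = P - (1 + y * z)"
  proof -
    have "gap * sqrt (1 + z\<^sup>2) = P - sqrt (1 + z\<^sup>2) * sqrt (1 + z\<^sup>2) - z * (y - z)"
      using pos unfolding gap_def P_def by (simp add: left_diff_distrib)
    then show ?thesis unfolding sq by (simp add: power2_eq_square algebra_simps)
  qed
  have "(1 + y * z)\<^sup>2 \<le> P\<^sup>2" unfolding P2 by simp
  then have "1 + y * z \<le> P" using P0 power2_le_imp_le by (metis less_imp_le)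
  then have "0 \<le> gap * sqrt (1 + z\<^sup>2)" unfolding gap by simp
  then show "0 \<le> gap" using pos by (simp add: zero_le_mult_iff)
  assume "gap = 0"
  then have "P = 1 + y * z" using gap by simp
  then have "(y - z)\<^sup>2 = 0" using P2 by simp
  then show "y = z" by simp
qed

text \<open>The convex gap is nonnegative, and its expectation is 0: the equality of the two
  expectations in \<open>law\<close> cancels the difference of the square roots, and the conditional
  mean property cancels the linear term. The latter has the bounded Borel coefficient
  \<open>\<psi> (g (V \<omega>))\<close>, whereas \<open>eq\<close> is given for smooth
  \<open>f\<close> only.\<close>

lemma (in prob_space) conditional_mean_same_law:
  fixes Y :: "'a \<Rightarrow> real" and V :: "'a \<Rightarrow> real^'d::finite"
  assumes V[measurable]: "V \<in> borel_measurable M" and g[measurable]: "g \<in> borel_measurable borel"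
    and Y: "integrable M Y" and gV: "integrable M (\<lambda>\<omega>. g (V \<omega>))"
    and law: "(\<integral>\<omega>. sqrt (1 + (Y \<omega>)\<^sup>2) \<partial>M) = (\<integral>\<omega>. sqrt (1 + (g (V \<omega>))\<^sup>2) \<partial>M)"
    and eq: "\<And>f. smooth_cs f \<Longrightarrow> (\<integral>\<omega>. f (V \<omega>) * (g (V \<omega>) - Y \<omega>) \<partial>M) = 0"
  shows "AE \<omega> in M. Y \<omega> = g (V \<omega>)"
proof -
  have [measurable]: "Y \<in> borel_measurable M" using Y by auto
  define D where "D \<omega> = g (V \<omega>) - Y \<omega>" for \<omega>
  have D: "integrable M D" unfolding D_def using Y gV by simp
  have [measurable]: "D \<in> borel_measurable M" using D by auto
  \<comment> \<open>Positive and negative part of \<open>D\<close> are pushed forward by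
    \<open>V\<close> to finite measures. They agree on smooth functions, hence are equal, which
    extends \<open>eq\<close> to all bounded Borel functions of \<open>V\<close>.\<close>
  define Np where "Np = distr (density M (\<lambda>\<omega>. ennreal (max 0 (D \<omega>)))) borel V"
  define Nm where "Nm = distr (density M (\<lambda>\<omega>. ennreal (max 0 (- D \<omega>)))) borel V"
  have ip: "integrable M (\<lambda>\<omega>. max 0 (D \<omega>))" "integrable M (\<lambda>\<omega>. max 0 (- D \<omega>))"
    by (intro Bochner_Integration.integrable_bound[OF D]; auto)+
  have fin: "finite_measure (distr (density M (\<lambda>\<omega>. ennreal (h \<omega>))) borel V)"
    if h: "integrable M h" "\<And>\<omega>. 0 \<le> h \<omega>" for h
  proof (rule finite_measureI)
    have [measurable]: "h \<in> borel_measurable M" using h by auto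
    have "emeasure (distr (density M (\<lambda>\<omega>. ennreal (h \<omega>))) borel V) UNIV = (\<integral>\<^sup>+\<omega>. ennreal (h \<omega>) \<partial>M)"
      by (simp add: emeasure_distr emeasure_density cong: nn_integral_cong)
    also have "\<dots> = ennreal (\<integral>\<omega>. h \<omega> \<partial>M)" using h by (simp add: nn_integral_eq_integral)
    finally show "emeasure (distr (density M (\<lambda>\<omega>. ennreal (h \<omega>))) borel V) (space (distr (density M (\<lambda>\<omega>. ennreal (h \<omega>))) borel V)) \<noteq> \<infinity>"
      by simp
  qed
  have int: "(\<integral>x. f x \<partial>Np) - (\<integral>x. f x \<partial>Nm) = (\<integral>\<omega>. f (V \<omega>) * D \<omega> \<partial>M)"
    if f[measurable]: "f \<in> borel_measurable borel" and bd: "\<And>x. \<bar>f x\<bar> \<le> c" for f :: "real^'d \<Rightarrow> real" and c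
  proof -
    have dens: "(\<integral>x. f x \<partial>distr (density M (\<lambda>\<omega>. ennreal (h \<omega>))) borel V) = (\<integral>\<omega>. f (V \<omega>) * h \<omega> \<partial>M)"
      if [measurable]: "h \<in> borel_measurable M" and h0: "\<And>\<omega>. 0 \<le> h \<omega>" for h
      using h0 by (simp add: integral_distr integral_density mult.commute)
    have i: "integrable M (\<lambda>\<omega>. f (V \<omega>) * max 0 (D \<omega>))" "integrable M (\<lambda>\<omega>. f (V \<omega>) * max 0 (- D \<omega>))"
      using ip bd by (auto intro!: integrable_bounded_mult)
    have "(\<integral>x. f x \<partial>Np) = (\<integral>\<omega>. f (V \<omega>) * max 0 (D \<omega>) \<partial>M)" "(\<integral>x. f x \<partial>Nm) = (\<integral>\<omega>. f (V \<omega>) * max 0 (- D \<omega>) \<partial>M)"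
      unfolding Np_def Nm_def by (intro dens; simp)+
    then have "(\<integral>x. f x \<partial>Np) - (\<integral>x. f x \<partial>Nm) = (\<integral>\<omega>. f (V \<omega>) * max 0 (D \<omega>) - f (V \<omega>) * max 0 (- D \<omega>) \<partial>M)"
      using i by simp
    also have "\<dots> = (\<integral>\<omega>. f (V \<omega>) * D \<omega> \<partial>M)"
      by (intro Bochner_Integration.integral_cong) (auto simp: max_def right_diff_distrib[symmetric])
    finally show ?thesis .
  qed
  have N: "Np = Nm"
  proof (rule measure_eqI_smooth_cs)
    show "finite_measure Np" "finite_measure Nm" unfolding Np_def Nm_def by (intro fin ip; simp)+
    show "sets Np = sets borel" "sets Nm = sets borel" by (simp_all add: Np_def Nm_def)
    fix f :: "real^'d \<Rightarrow> real" assume f: "smooth_cs f" "\<And>x. 0 \<le> f x" "\<And>x. f x \<le> 1"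
    have "f \<in> borel_measurable borel"
      using f(1) by (auto simp: smooth_cs_iff intro!: borel_measurable_continuous_onI smooth_continuous)
    then show "(\<integral>x. f x \<partial>Np) = (\<integral>x. f x \<partial>Nm)"
      using int[of f 1] eq[OF f(1)] f by (simp add: D_def abs_of_nonneg)
  qed
  define \<psi> where "\<psi> y = y / sqrt (1 + y\<^sup>2)" for y :: real
  have [measurable]: "\<psi> \<in> borel_measurable borel" unfolding \<psi>_def by measurable
  have \<psi>1: "\<bar>\<psi> y\<bar> \<le> 1" for y
  proof -
    have "\<bar>y\<bar> \<le> sqrt (1 + y\<^sup>2)" by (rule real_le_rsqrt) simp
    moreover have "sqrt (1 + y\<^sup>2) > 0" by (simp add: add_pos_nonneg)
    ultimately show ?thesis by (simp add: \<psi>_def abs_divide)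
  qed
  have \<psi>D: "(\<integral>\<omega>. \<psi> (g (V \<omega>)) * D \<omega> \<partial>M) = 0"
    using int[of "\<lambda>x. \<psi> (g x)" 1] \<psi>1 N by simp
  have i\<psi>: "integrable M (\<lambda>\<omega>. \<psi> (g (V \<omega>)) * D \<omega>)"
    by (rule integrable_bounded_mult[OF D _ \<psi>1]) measurable
  have isq: "integrable M (\<lambda>\<omega>. sqrt (1 + (h \<omega>)\<^sup>2))" if h: "integrable M h" for h
  proof (rule Bochner_Integration.integrable_bound)
    show "integrable M (\<lambda>\<omega>. 1 + \<bar>h \<omega>\<bar>)" using h by simp
    show "(\<lambda>\<omega>. sqrt (1 + (h \<omega>)\<^sup>2)) \<in> borel_measurable M" using h by auto
    show "AE \<omega> in M. norm (sqrt (1 + (h \<omega>)\<^sup>2)) \<le> norm (1 + \<bar>h \<omega>\<bar>)"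
    proof (rule AE_I2)
      fix \<omega>
      have "sqrt (1 + (h \<omega>)\<^sup>2) \<le> 1 + \<bar>h \<omega>\<bar>"
        by (rule real_le_lsqrt) (simp_all add: power2_sum)
      then show "norm (sqrt (1 + (h \<omega>)\<^sup>2)) \<le> norm (1 + \<bar>h \<omega>\<bar>)" by simp
    qed
  qed
  define gap where "gap \<omega> = sqrt (1 + (Y \<omega>)\<^sup>2) - sqrt (1 + (g (V \<omega>))\<^sup>2) - \<psi> (g (V \<omega>)) * (Y \<omega> - g (V \<omega>))" for \<omega>
  have gapD: "gap \<omega> = sqrt (1 + (Y \<omega>)\<^sup>2) - sqrt (1 + (g (V \<omega>))\<^sup>2) + \<psi> (g (V \<omega>)) * D \<omega>" for \<omega>
    by (simp add: gap_def D_def algebra_simps)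
  have igap: "integrable M gap" unfolding gapD[abs_def] using isq[OF Y] isq[OF gV] i\<psi> by simp
  have "(\<integral>\<omega>. gap \<omega> \<partial>M) = 0"
    unfolding gapD using isq[OF Y] isq[OF gV] i\<psi> \<psi>D law by simp
  moreover have "0 \<le> gap \<omega>" for \<omega> unfolding gap_def \<psi>_def by (rule sqrt_convex_gap)
  ultimately have "AE \<omega> in M. gap \<omega> = 0"
    using integral_nonneg_eq_0_iff_AE[OF igap] by simp
  then show ?thesis
  proof eventually_elim
    case (elim \<omega>)
    then show ?case
      using sqrt_convex_gap(2)[of "Y \<omega>" "g (V \<omega>)"] unfolding gap_def \<psi>_def by blast
  qed
qed

lemma (in diffusion_process) tendsto_expectation:
  assumes f: "continuous_on UNIV f" "\<And>x. \<bar>f x\<bar> \<le> c" and V: "integrable M V"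
    and u: "\<And>n. u n \<in> {0..T}" "u \<longlonglongrightarrow> s" and s: "s \<in> {0..T}"
  shows "(\<lambda>n. \<integral>\<omega>. f (X (u n) \<omega>) * V \<omega> \<partial>M) \<longlonglongrightarrow> (\<integral>\<omega>. f (X s \<omega>) * (V \<omega> :: real) \<partial>M)"
proof (rule integral_dominated_convergence[where w = "\<lambda>\<omega>. c * \<bar>V \<omega>\<bar>"])
  have [measurable]: "X s \<in> borel_measurable M" "X (u n) \<in> borel_measurable M" for n
    using X_measurable s u by auto
  have [measurable]: "f \<in> borel_measurable borel" "V \<in> borel_measurable M"
    using f V by (auto intro: borel_measurable_continuous_onI)
  show "(\<lambda>\<omega>. f (X s \<omega>) * V \<omega>) \<in> borel_measurable M"
    "(\<lambda>\<omega>. f (X (u n) \<omega>) * V \<omega>) \<in> borel_measurable M" for n by measurable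
  show "integrable M (\<lambda>\<omega>. c * \<bar>V \<omega>\<bar>)" using V by simp
  show "AE \<omega> in M. norm (f (X (u n) \<omega>) * V \<omega>) \<le> c * \<bar>V \<omega>\<bar>" for n
    using f(2) by (intro AE_I2) (simp add: abs_mult mult_right_mono)
  show "AE \<omega> in M. (\<lambda>n. f (X (u n) \<omega>) * V \<omega>) \<longlonglongrightarrow> f (X s \<omega>) * V \<omega>"
  proof (rule AE_I2)
    fix \<omega> assume "\<omega> \<in> space M"
    then have "(\<lambda>n. X (u n) \<omega>) \<longlonglongrightarrow> X s \<omega>"
      using continuous_on_tendsto_compose[OF paths u(2) s, of \<omega>] u(1) by auto
    then have "(\<lambda>n. f (X (u n) \<omega>)) \<longlonglongrightarrow> f (X s \<omega>)"
      using continuous_on_tendsto_compose[OF f(1)] by auto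
    then show "(\<lambda>n. f (X (u n) \<omega>) * V \<omega>) \<longlonglongrightarrow> f (X s \<omega>) * V \<omega>" by (intro tendsto_intros)
  qed
qed

text \<open>As \<open>X 0\<close> and \<open>X s\<close> lie in \<open>A\<close> simultaneously,
  expectations of \<open>indicator A (X 0 \<omega>) * h (X s \<omega>)\<close> do not depend on
  \<open>s\<close>. In Dynkin's formula the left side is therefore 0, and the time integrand is
  constant.\<close>

lemma (in diffusion_process) invariant_set:
  assumes law: "\<And>s. s \<in> {0..<T} \<Longrightarrow> distr M borel (X s) = P" and A[measurable]: "A \<in> sets borel"
    and inv: "\<And>s. s \<in> {0..<T} \<Longrightarrow> AE \<omega> in M. X 0 \<omega> \<in> A \<longleftrightarrow> X s \<omega> \<in> A"
    and f: "smooth_cs f"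
  shows "(\<integral>x. indicator A x * gen b a f x \<partial>P) = 0"
proof -
  \<comment> \<open>Any positive time below \<open>T\<close> serves: the law and the invariance are
    given on \<open>{0..<T}\<close>.\<close>
  define t where "t = T / 2"
  have t: "t \<in> {0..<T}" "t \<in> {0..T}" "t > 0" using T by (auto simp: t_def)
  have cont: "continuous_on UNIV (gen b a f)"
    using f cont_a cont_b by (intro gen_continuous) (auto simp: smooth_cs_iff)
  have [measurable]: "gen b a f \<in> borel_measurable borel" "f \<in> borel_measurable borel"
    using cont f by (auto intro: borel_measurable_continuous_onI simp: smooth_cs_iff smooth_continuous)
  have [measurable]: "X s \<in> borel_measurable M" if "s \<in> {0..<T}" for s using X_measurable that by auto
  have [measurable]: "X 0 \<in> borel_measurable M" using X_measurable T by auto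
  have eq: "(\<integral>\<omega>. indicator A (X 0 \<omega>) * h (X s \<omega>) \<partial>M) = (\<integral>x. indicator A x * h x \<partial>P)"
    if s: "s \<in> {0..<T}" and [measurable]: "h \<in> borel_measurable borel" for s and h :: "real^'d \<Rightarrow> real"
  proof -
    have [measurable]: "X s \<in> borel_measurable M" using X_measurable s by auto
    have "(\<integral>\<omega>. indicator A (X 0 \<omega>) * h (X s \<omega>) \<partial>M) = (\<integral>\<omega>. indicator A (X s \<omega>) * h (X s \<omega>) \<partial>M)"
    proof (rule integral_cong_AE)
      show "AE \<omega> in M. indicator A (X 0 \<omega>) * h (X s \<omega>) = indicator A (X s \<omega>) * h (X s \<omega>)"
        using inv[OF s] by eventually_elim (simp add: indicator_def)
    qed measurable
    also have "\<dots> = (\<integral>x. indicator A x * h x \<partial>distr M borel (X s))"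
      by (subst integral_distr) auto
    finally show ?thesis unfolding law[OF s] .
  qed
  obtain Cf where Cf: "\<And>x. \<bar>f x\<bar> \<le> Cf" using smooth_cs_bounded[OF f] by blast
  have i: "integrable M (\<lambda>\<omega>. indicator A (X 0 \<omega>) * f (X s \<omega>))" if s: "s \<in> {0..<T}" for s
  proof (rule integrable_const_bound[where B = Cf])
    have [measurable]: "X s \<in> borel_measurable M" using X_measurable s by auto
    show "(\<lambda>\<omega>. indicator A (X 0 \<omega>) * f (X s \<omega>)) \<in> borel_measurable M" by measurable
    show "AE \<omega> in M. norm (indicator A (X 0 \<omega>) * f (X s \<omega>)) \<le> Cf"
      using Cf order_trans[OF abs_ge_zero Cf] by (intro AE_I2) (auto simp: indicator_def)
  qed
  have "(\<integral>\<omega>. indicator A (X 0 \<omega>) * (f (X t \<omega>) - f (X 0 \<omega>)) \<partial>M) =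
      (\<integral>\<omega>. indicator A (X 0 \<omega>) * f (X t \<omega>) \<partial>M) - (\<integral>\<omega>. indicator A (X 0 \<omega>) * f (X 0 \<omega>) \<partial>M)"
    using i[OF t(1)] i[of 0] T by (simp add: right_diff_distrib)
  also have "\<dots> = 0" using eq[OF t(1), of f] eq[of 0 f] T by simp
  finally have "0 = integral {0..t} (\<lambda>r. \<integral>\<omega>. indicator A (X 0 \<omega>) * gen b a f (X r \<omega>) \<partial>M)"
    using dynkin[OF f t(2) A] by simp
  also have "\<dots> = integral {0..t} (\<lambda>r. \<integral>x. indicator A x * gen b a f x \<partial>P)"
    by (intro integral_cong eq) (use t in auto)
  also have "\<dots> = t * (\<integral>x. indicator A x * gen b a f x \<partial>P)" using t by simp
  finally show ?thesis using t by simp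
qed

theorem theorem4p9:
  fixes T :: real
    and b :: "real^'d::finite \<Rightarrow> real^'d"
    and \<sigma> :: "real^'d \<Rightarrow> real^'m::finite^'d"
    and a :: "real^'d \<Rightarrow> real^'d^'d"
    and M :: "'w measure" and X :: "real \<Rightarrow> 'w \<Rightarrow> real^'d"
    and \<mu> :: "real^'d \<Rightarrow> real"
    and \<alpha> lam C :: real and \<eta> :: "real^'d \<Rightarrow> real"
    and bb :: "real \<Rightarrow> real^'d \<Rightarrow> real^'d" and aa :: "real \<Rightarrow> real^'d \<Rightarrow> real^'d^'d"
    and \<mu>h :: "real \<Rightarrow> real^'d \<Rightarrow> real" and \<nu> :: "real^'d \<Rightarrow> real"
    and K :: real and w wt :: "real^'d \<Rightarrow> real"
  assumes T: "T > 0"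
    and a_def: "\<And>x. a x = \<sigma> x ** transpose (\<sigma> x)"
    and sol: "diffusion M X {0..T} b a"
    and init: "distributed M lborel (X 0) (\<lambda>x. ennreal (\<mu> x))"
    and stat: "stationary_density b a \<mu>"
    and reg: "regular_conditions b a \<alpha> lam C \<eta>"
    and bb0: "bb 0 = b" and aa0: "aa 0 = a"
    and pert: "\<exists>\<delta>>0. \<forall>h. \<bar>h\<bar> < \<delta> \<longrightarrow> stationary_density (bb h) (aa h) (\<mu>h h)"
    and mu0: "\<mu>h 0 = \<mu>"
    and nu_int: "integrable lborel \<nu>"
    and nu_lim: "((\<lambda>h. \<integral>x. \<bar>(\<mu>h h x - \<mu> x) / h - \<nu> x\<bar> \<partial>lborel) \<longlongrightarrow> 0) (at 0)"
    and K: "K > 0"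
    and b_lin: "\<And>x. norm (b x) \<le> K * (1 + norm x)"
    and a_quad: "\<And>x. norm (a x) \<le> K * (1 + (norm x)\<^sup>2)"
    and w_def: "\<And>x. w x = \<nu> x / \<mu> x"
    and wt_meas: "wt \<in> borel_measurable borel"
    and wt_L1: "integrable (density lborel (\<lambda>x. ennreal (\<mu> x))) wt"
    and deriv_eq: "\<And>f s t. smooth_cs f \<Longrightarrow> 0 \<le> s \<Longrightarrow> s < t \<Longrightarrow> t \<le> T \<Longrightarrow>
        \<exists>D. ((\<lambda>r. \<integral>\<omega>. f (X t \<omega>) * w (X r \<omega>) \<partial>M) has_real_derivative D) (at s within {0..<t})
          \<and> ((\<lambda>r. \<integral>\<omega>. f (X t \<omega>) * wt (X r \<omega>) \<partial>M) has_real_derivative D) (at s within {0..<t})"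
  shows "\<exists>c. AE x in lborel. w x - wt x = c"
proof -
  let ?P = "density lborel (\<lambda>x. ennreal (\<mu> x))"
  interpret R: regular_diffusion b \<sigma> a \<alpha> lam C \<eta> K
    by (rule regular_diffusion.intro[OF a_def reg K b_lin a_quad])
  have \<mu>: "\<mu> \<in> borel_measurable borel" "\<And>x. 0 \<le> \<mu> x" "integrable lborel \<mu>" "(\<integral>x. \<mu> x \<partial>lborel) = 1"
    using stat unfolding stationary_density_def prob_density_def by auto
  note [measurable] = \<mu>(1)
  have law_borel: "distr N borel V = ?P" if "distributed N lborel V (\<lambda>x. ennreal (\<mu> x))" for N and V :: "'x \<Rightarrow> real^'d"
  proof -
    have "distr N borel V = distr N lborel V" by (rule distr_cong) auto
    also have "\<dots> = ?P" using that by (rule distributed_distr_eq_density)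
    finally show ?thesis .
  qed
  obtain Z :: "(real \<Rightarrow> real^'d) measure" where Z: "diffusion Z (\<lambda>t \<omega>. \<omega> t) {0..} b a"
      "distributed Z lborel (\<lambda>\<omega>. \<omega> 0) (\<lambda>x. ennreal (\<mu> x))"
    using stat unfolding stationary_density_def by blast
  then have Zs: "\<And>t. t \<ge> 0 \<Longrightarrow> distributed Z lborel (\<lambda>\<omega>. \<omega> t) (\<lambda>x. ennreal (\<mu> x))"
    using stat unfolding stationary_density_def by blast
  interpret Z: diffusion_process Z "\<lambda>t \<omega>. \<omega> t" T b a
    by (rule diffusion_processI[OF Z(1) _ T R.cont_a R.cont_b]) auto
  interpret X: diffusion_process M X T b a
    by (rule diffusion_processI[OF sol _ T R.cont_a R.cont_b]) auto
  \<comment> \<open>\<open>stationary_density\<close> speaks of canonical solutions for all times,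
    so it gives the marginals of \<open>Z\<close>. Uniqueness for the Fokker-Planck equation, from
    the common initial law, carries them over to \<open>X\<close>.\<close>
  have law: "distr M borel (X s) = ?P" if s: "s \<in> {0..T}" for s
  proof -
    have "distr M borel (X s) = distr Z borel (\<lambda>\<omega>. \<omega> s)"
      by (rule R.fokker_planck_unique[OF T X.fokker_planck_distr Z.fokker_planck_distr _ s])
        (simp add: law_borel[OF init] law_borel[OF Z(2)])
    also have "\<dots> = ?P" using law_borel[OF Zs] s by simp
    finally show ?thesis .
  qed
  have Xm: "X s \<in> borel_measurable M" if "s \<in> {0..T}" for s by (rule X.X_measurable[OF that])
  define g where "g x = w x - wt x" for x
  have [measurable]: "\<nu> \<in> borel_measurable borel" using nu_int by auto
  have [measurable]: "w \<in> borel_measurable borel" unfolding w_def[abs_def] by measurable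
  note [measurable] = wt_meas
  have [measurable]: "g \<in> borel_measurable borel" unfolding g_def by measurable
  \<comment> \<open>Where \<open>\<mu>\<close> is 0, so is \<open>w\<close>, since division by 0
    gives 0; hence \<open>\<mu> * w\<close> is dominated by \<open>\<nu>\<close> at every
    point.\<close>
  have iw: "integrable ?P w"
  proof -
    have "integrable lborel (\<lambda>x. \<mu> x *\<^sub>R w x)"
      by (rule Bochner_Integration.integrable_bound[OF nu_int]) (auto simp: w_def)
    then show ?thesis by (subst integrable_density) (auto simp: \<mu>(2))
  qed
  have ig: "integrable ?P g" unfolding g_def using iw wt_L1 by simp
  have iX: "integrable M (\<lambda>\<omega>. h (X s \<omega>))"
    if h: "integrable ?P h" "h \<in> borel_measurable borel" and s: "s \<in> {0..T}" for h :: "real^'d \<Rightarrow> real" and s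
    using integrable_distr_eq[OF Xm[OF s] h(2)] h(1) unfolding law[OF s] by simp
  have EX: "(\<integral>\<omega>. h (X s \<omega>) \<partial>M) = (\<integral>x. h x \<partial>?P)"
    if h: "h \<in> borel_measurable borel" and s: "s \<in> {0..T}" for h :: "real^'d \<Rightarrow> real" and s
    using integral_distr[OF Xm[OF s] h] unfolding law[OF s] by simp
  \<comment> \<open>Only for \<open>s < T\<close>, because \<open>X\<close> is observed at later
    times \<open>t\<close> that decrease to \<open>s\<close>.\<close>
  have stay: "AE \<omega> in M. g (X 0 \<omega>) = g (X s \<omega>)" if s: "s \<in> {0..<T}" for s
  proof (rule X.conditional_mean_same_law[OF Xm])
    have s0: "s \<in> {0..T}" "0 \<in> {0..T}" using s by auto
    show "s \<in> {0..T}" by (rule s0)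
    show "integrable M (\<lambda>\<omega>. g (X 0 \<omega>))" "integrable M (\<lambda>\<omega>. g (X s \<omega>))"
      by (intro iX ig s0; measurable)+
    show "(\<integral>\<omega>. sqrt (1 + (g (X 0 \<omega>))\<^sup>2) \<partial>M) = (\<integral>\<omega>. sqrt (1 + (g (X s \<omega>))\<^sup>2) \<partial>M)"
      using EX[of "\<lambda>x. sqrt (1 + (g x)\<^sup>2)"] s0 by simp
    fix f :: "real^'d \<Rightarrow> real" assume f: "smooth_cs f"
    obtain Cf where Cf: "\<And>x. \<bar>f x\<bar> \<le> Cf" using smooth_cs_bounded[OF f] by blast
    have cf: "continuous_on UNIV f" using f by (simp add: smooth_cs_iff smooth_continuous)
    have [measurable]: "f \<in> borel_measurable borel" by (rule borel_measurable_continuous_onI[OF cf])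
    have ifh: "integrable M (\<lambda>\<omega>. f (X t \<omega>) * h (X r \<omega>))"
      if "integrable ?P h" "h \<in> borel_measurable borel" "t \<in> {0..T}" "r \<in> {0..T}" for h t r
      by (rule integrable_bounded_mult[OF iX[OF that(1,2,4)] measurable_compose[OF Xm[OF that(3)]] Cf]) measurable
    \<comment> \<open>With equal derivatives for \<open>w\<close> and \<open>wt\<close>, the
      expectation with \<open>g\<close> is constant in the earlier time on \<open>{0..<t}\<close>,
      an interval containing both 0 and \<open>s\<close>.\<close>
    have const: "(\<integral>\<omega>. f (X t \<omega>) * g (X s \<omega>) \<partial>M) = (\<integral>\<omega>. f (X t \<omega>) * g (X 0 \<omega>) \<partial>M)" if t: "s < t" "t \<le> T" for t
    proof -
      have tT: "t \<in> {0..T}" using t s by auto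
      have split: "(\<integral>\<omega>. f (X t \<omega>) * w (X r \<omega>) \<partial>M) - (\<integral>\<omega>. f (X t \<omega>) * wt (X r \<omega>) \<partial>M) = (\<integral>\<omega>. f (X t \<omega>) * g (X r \<omega>) \<partial>M)"
        if r: "r \<in> {0..<t}" for r
      proof -
        have "r \<in> {0..T}" using r t by auto
        then show ?thesis
          using ifh[OF iw _ tT, of r] ifh[OF wt_L1 _ tT, of r] by (simp add: g_def right_diff_distrib)
      qed
      have "((\<lambda>r. \<integral>\<omega>. f (X t \<omega>) * g (X r \<omega>) \<partial>M) has_real_derivative 0) (at r within {0..<t})" if r: "r \<in> {0..<t}" for r
      proof -
        obtain D where D: "((\<lambda>r. \<integral>\<omega>. f (X t \<omega>) * w (X r \<omega>) \<partial>M) has_real_derivative D) (at r within {0..<t})"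
          "((\<lambda>r. \<integral>\<omega>. f (X t \<omega>) * wt (X r \<omega>) \<partial>M) has_real_derivative D) (at r within {0..<t})"
          using deriv_eq[OF f, of r t] r t by auto
        from DERIV_diff[OF this]
        have "((\<lambda>r. (\<integral>\<omega>. f (X t \<omega>) * w (X r \<omega>) \<partial>M) - (\<integral>\<omega>. f (X t \<omega>) * wt (X r \<omega>) \<partial>M)) has_real_derivative 0) (at r within {0..<t})"
          by simp
        then show ?thesis
          by (rule has_field_derivative_transform_within[OF _ zero_less_one r]) (simp add: split)
      qed
      then obtain c where "\<And>r. r \<in> {0..<t} \<Longrightarrow> (\<integral>\<omega>. f (X t \<omega>) * g (X r \<omega>) \<partial>M) = c"
        using has_field_derivative_zero_constant[of "{0..<t}" "\<lambda>r. \<integral>\<omega>. f (X t \<omega>) * g (X r \<omega>) \<partial>M"] by auto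
      then show ?thesis using s t by simp
    qed
    define u where "u n = s + (T - s) / real (Suc n)" for n
    have u: "s < u n" "u n \<le> T" for n
    proof -
      show "s < u n" using s by (simp add: u_def)
      have "(T - s) / real (Suc n) \<le> (T - s) / 1" using s by (intro divide_left_mono) auto
      then show "u n \<le> T" by (simp add: u_def)
    qed
    have u01: "u n \<in> {0..T}" for n using u[of n] s by auto
    have "(\<lambda>n. (T - s) / real (Suc n)) \<longlonglongrightarrow> 0" using LIMSEQ_Suc[OF lim_const_over_n[of "T - s"]] .
    then have ul: "u \<longlonglongrightarrow> s" unfolding u_def using tendsto_add[OF tendsto_const[of s]] by fastforce
    have igX: "integrable M (\<lambda>\<omega>. g (X r \<omega>))" if "r \<in> {0..T}" for r by (intro iX ig that) measurable
    have "(\<integral>\<omega>. f (X s \<omega>) * g (X s \<omega>) \<partial>M) = (\<integral>\<omega>. f (X s \<omega>) * g (X 0 \<omega>) \<partial>M)"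
    proof (rule LIMSEQ_unique)
      show "(\<lambda>n. \<integral>\<omega>. f (X (u n) \<omega>) * g (X s \<omega>) \<partial>M) \<longlonglongrightarrow> (\<integral>\<omega>. f (X s \<omega>) * g (X s \<omega>) \<partial>M)"
        by (rule X.tendsto_expectation[OF cf Cf igX[OF s0(1)] u01 ul s0(1)])
      show "(\<lambda>n. \<integral>\<omega>. f (X (u n) \<omega>) * g (X s \<omega>) \<partial>M) \<longlonglongrightarrow> (\<integral>\<omega>. f (X s \<omega>) * g (X 0 \<omega>) \<partial>M)"
        unfolding const[OF u] by (rule X.tendsto_expectation[OF cf Cf igX[OF s0(2)] u01 ul s0(1)])
    qed
    then show "(\<integral>\<omega>. f (X s \<omega>) * (g (X s \<omega>) - g (X 0 \<omega>)) \<partial>M) = 0"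
      using ifh[OF ig _ s0(1) s0(1)] ifh[OF ig _ s0(1) s0(2)] by (simp add: right_diff_distrib)
  qed measurable
  have dich: "(AE x in lborel. indicator A x * \<mu> x = 0) \<or> (AE x in lborel. indicator A x * \<mu> x > 0)"
    if A[measurable]: "A \<in> sets borel" and inv: "\<And>s. s \<in> {0..<T} \<Longrightarrow> AE \<omega> in M. X 0 \<omega> \<in> A \<longleftrightarrow> X s \<omega> \<in> A" for A
  proof (rule global_dichotomy[OF R.local_elliptic])
    show "integrable lborel (\<lambda>x. indicator A x * \<mu> x)"
      by (rule integrable_bounded_mult[OF \<mu>(3), where C = 1]) (auto simp: indicator_def)
    show "0 \<le> indicator A x * \<mu> x" for x using \<mu>(2) by simp
    fix v :: "real^'d \<Rightarrow> real" assume v: "smooth_cs v"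
    have [measurable]: "gen b a v \<in> borel_measurable borel"
      using v by (intro borel_measurable_continuous_onI gen_continuous R.cont_a R.cont_b) (simp add: smooth_cs_iff)
    have "0 = (\<integral>x. indicator A x * gen b a v x \<partial>?P)"
      by (rule X.invariant_set[OF law A inv v, symmetric]) auto
    also have "\<dots> = (\<integral>x. gen b a v x * (indicator A x * \<mu> x) \<partial>lborel)"
      by (subst integral_density) (auto simp: \<mu>(2) mult_ac)
    finally show "(\<integral>x. gen b a v x * (indicator A x * \<mu> x) \<partial>lborel) = 0" by simp
  qed
  \<comment> \<open>The alternative for the whole space; total mass 1 rules out the first case.
    Positivity of \<open>\<mu>\<close> is what turns the alternative for
    \<open>indicator A x * \<mu> x\<close> into one for the level set itself.\<close>
  have \<mu>_pos: "AE x in lborel. \<mu> x > 0"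
  proof -
    have "\<not> (AE x in lborel. \<mu> x = 0)"
    proof
      assume "AE x in lborel. \<mu> x = 0"
      then have "(\<integral>x. \<mu> x \<partial>lborel) = 0" by (rule integral_eq_zero_AE)
      then show False using \<mu>(4) by simp
    qed
    then show ?thesis using dich[of UNIV] by simp
  qed
  have "\<exists>c. AE x in lborel. g x = c"
  proof (rule AE_constant)
    fix c :: real
    define A where "A = {x. g x > c}"
    have A: "A \<in> sets borel" unfolding A_def by measurable
    have "(AE x in lborel. indicator A x * \<mu> x = 0) \<or> (AE x in lborel. indicator A x * \<mu> x > 0)"
    proof (rule dich[OF A])
      show "AE \<omega> in M. X 0 \<omega> \<in> A \<longleftrightarrow> X s \<omega> \<in> A" if "s \<in> {0..<T}" for s
        using stay[OF that] by eventually_elim (simp add: A_def)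
    qed
    then show "(AE x in lborel. g x > c) \<or> (AE x in lborel. g x \<le> c)"
    proof
      assume "AE x in lborel. indicator A x * \<mu> x = 0"
      with \<mu>_pos have "AE x in lborel. g x \<le> c"
        by eventually_elim (auto simp: A_def indicator_def split: if_splits)
      then show ?thesis ..
    next
      assume "AE x in lborel. indicator A x * \<mu> x > 0"
      then have "AE x in lborel. g x > c"
      proof eventually_elim
        case (elim x)
        then have "x \<in> A" by (cases "x \<in> A") simp_all
        then show ?case by (simp add: A_def)
      qed
      then show ?thesis ..
    qed
  qed
  then show ?thesis by (simp add: g_def)
qed

end
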